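(* Let $d\ge1$ and let $\Omega\subset\mathbb{R}^d$ be an open bounded set with Lipschitz continuous boundary. Let $\{s_n\}_{n\in\mathbb{N}}\subset(0,1)$ be such that $s_n\to0^+$ as $n\to+\infty$. Let $u^0_0\in L^2(\Omega)$ and let $\{u^n_0\}_{n\in\mathbb{N}}\subset L^2(\Omega)$ be such that $u^n_0\in\mathcal{H}^{s_n}_0(\Omega)$, $S:=\sup_{n\in\mathbb{N}}s_nF^{s_n}(u^n_0)<+\infty$ and $u^n_0\to u^0_0$ in $L^2(\Omega)$. Then, for every $n\in\mathbb{N}$ there exists a unique solution $u^n\in H^1([0,+\infty);L^2(\Omega))$ to $$u_t(t)=-s_n(-\Delta)^{s_n}u(t)\quad\text{for a.e. }t\in[0,+\infty),\qquad u(0)=u^n_0,$$ and such a solution satisfies $(-\Delta)^{s_n}u^n(t)\in L^2(\Omega)$ for a.e. $t\ge0$. Moreover, for every $T>0$, $u^n\rightharpoonup u^0$ weakly in $H^1([0,T];L^2(\Omega))$ as $n\to+\infty$, where $u^0\in H^1([0,T];L^2(\Omega))$ is the unique solution to $$u_t(t)=-d\omega_d\,u(t)\quad\text{for a.e. }t\in(0,T),\qquad u(0)=u^0_0.$$ Furthermore, if $\lim_{n\to+\infty}s_nF^{s_n}(u^n_0)=F^0(u^0_0)$, then $u^n\to u^0$ strongly in $H^1([0,T];L^2(\Omega))$ for every $T>0$, and for every $t\ge0$ $$\|u^n(t)-u^0(t)\|_{L^2(\Omega)}\to0\qquad\text{and}\qquad s_nF^{s_n}(u^n(t))\to F^0(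u^0(t)).$$
   Context: For measurable $u:\Omega\to\mathbb{R}$, $\tilde u$ denotes its extension by $0$ to $\mathbb{R}^d$; $\omega_d$ is the Lebesgue measure of the unit ball of $\mathbb{R}^d$. For $s\in(0,1)$, $[v]_s^2:=\int_{\mathbb{R}^d}\int_{\mathbb{R}^d}\frac{|v(x)-v(y)|^2}{|x-y|^{d+2s}}\,dy\,dx$, $F^s:L^2(\Omega)\to[0,+\infty]$ is $F^s(u):=\frac12[\tilde u]_s^2$, and $F^0(u):=\frac{d\omega_d}{2}\|u\|^2_{L^2(\Omega)}$. $\mathcal{H}^s_0(\Omega)$ is the completion of $C^\infty_c(\Omega)$ with respect to $[\cdot]_s$; it coincides with $\{u\in L^2(\Omega):[\tilde u]_s<+\infty\}$. For $\psi\in C^\infty_c(\mathbb{R}^d)$, $(-\Delta)^s\psi(x):=\int_{\mathbb{R}^d}\frac{2\psi(x)-\psi(x+z)-\psi(x-z)}{|z|^{d+2s}}\,dz$ (no normalizing constant). For $u\in\mathcal{H}^s_0(\Omega)$, $(-\Delta)^su$ is defined by duality: $\langle(-\Delta)^su,\varphi\rangle:=\langle u,(-\Delta)^s\tilde\varphi\rangle$ for all $\varphi\in C^\infty_c(\Omega)$, with $\langle\cdot,\cdot\rangle$ the $L^2$ scalar product; $(-\Delta)^su\in L^2(\Omega)$ means that this functional is represented by an $L^2(\Omega)$ function. $H^1(I;L^2(\Omega))$ is the Bochner–Sobolev space on the time interval $I$ (functions identified with their continuous representatives), and $u_t$ is the time derivative. A solution of the fractional Cauchy problem is understood to satisfy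 $u(t)\in\mathcal{H}^{s_n}_0(\Omega)$ for a.e. $t$, with the equation holding in duality with $C^\infty_c(\Omega)$, i.e. for a.e. $t$ one has $\langle u_t(t),\varphi\rangle=-s_n\langle u(t),(-\Delta)^{s_n}\tilde\varphi\rangle$ for all $\varphi\in C^\infty_c(\Omega)$. *)

theory Defs
  imports "HOL-Analysis.Analysis"
begin

section \<open>The Hilbert space of square-integrable functions\<close>

text \<open>
  The type \<open>'a L2\<close> consists of the square-integrable Borel functions on the
  Euclidean space \<open>'a\<close> modulo equality almost everywhere. It is made a separable real Hilbert
  space, so that the Bochner integral of the library applies to functions with values in it.
\<close>

definition sq_integrable :: "('a::euclidean_space \<Rightarrow> real) \<Rightarrow> bool" where
  "sq_integrable f \<longleftrightarrow> f \<in> borel_measurable borel \<and> integrable lborel (\<lambda>x. (f x)\<^sup>2)"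

definition L2_rel :: "('a::euclidean_space \<Rightarrow> real) \<Rightarrow> ('a \<Rightarrow> real) \<Rightarrow> bool" where
  "L2_rel f g \<longleftrightarrow> sq_integrable f \<and> sq_integrable g \<and> (AE x in lborel. f x = g x)"

lemma sq_integrable_mult:
  assumes "sq_integrable f" "sq_integrable g"
  shows "integrable lborel (\<lambda>x. f x * g x)"
proof (rule Bochner_Integration.integrable_bound)
  show "integrable lborel (\<lambda>x. (f x)\<^sup>2 + (g x)\<^sup>2)"
    using assms by (auto simp: sq_integrable_def)
  show "(\<lambda>x. f x * g x) \<in> borel_measurable lborel"
    using assms by (auto simp: sq_integrable_def)
  show "AE x in lborel. norm (f x * g x) \<le> norm ((f x)\<^sup>2 + (g x)\<^sup>2)"
  proof (rule AE_I2)
    fix x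
    have "2 * (\<bar>f x\<bar> * \<bar>g x\<bar>) \<le> (f x)\<^sup>2 + (g x)\<^sup>2"
      using sum_squares_bound[of "\<bar>f x\<bar>" "\<bar>g x\<bar>"] by simp
    moreover have "0 \<le> \<bar>f x\<bar> * \<bar>g x\<bar>" by simp
    ultimately have "\<bar>f x\<bar> * \<bar>g x\<bar> \<le> (f x)\<^sup>2 + (g x)\<^sup>2" by linarith
    then show "norm (f x * g x) \<le> norm ((f x)\<^sup>2 + (g x)\<^sup>2)"
      by (simp add: abs_mult)
  qed
qed

lemma sq_integrable_zero: "sq_integrable (\<lambda>_. 0)"
  by (simp add: sq_integrable_def)

lemma sq_integrable_add:
  assumes "sq_integrable f" "sq_integrable g"
  shows "sq_integrable (\<lambda>x. f x + g x)"
  using assms sq_integrable_mult[OF assms]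
  by (auto simp: sq_integrable_def power2_sum mult.assoc)

lemma sq_integrable_scale:
  assumes "sq_integrable f"
  shows "sq_integrable (\<lambda>x. c * f x)"
  using assms by (auto simp: sq_integrable_def power_mult_distrib)

lemma sq_integrable_minus:
  assumes "sq_integrable f"
  shows "sq_integrable (\<lambda>x. - f x)"
  using assms by (auto simp: sq_integrable_def)

lemma sq_integrable_diff:
  assumes "sq_integrable f" "sq_integrable g"
  shows "sq_integrable (\<lambda>x. f x - g x)"
  using sq_integrable_add[OF assms(1) sq_integrable_minus[OF assms(2)]] by simp

quotient_type (overloaded) 'a L2 = "'a::euclidean_space \<Rightarrow> real" / partial: L2_rel
proof (rule part_equivpI)
  show "\<exists>f. L2_rel f (f :: 'a \<Rightarrow> real)"
    by (rule exI[of _ "\<lambda>_. 0"]) (simp add: L2_rel_def sq_integrable_zero)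
  show "symp (L2_rel :: ('a \<Rightarrow> real) \<Rightarrow> _)"
    by (auto simp: symp_def L2_rel_def elim: eventually_mono)
  show "transp (L2_rel :: ('a \<Rightarrow> real) \<Rightarrow> _)"
  proof (rule transpI)
    fix f g h :: "'a \<Rightarrow> real"
    assume "L2_rel f g" "L2_rel g h"
    then show "L2_rel f h"
      unfolding L2_rel_def by (auto elim: eventually_elim2)
  qed
qed

lemma L2_rel_rep: "L2_rel (rep_L2 u) (rep_L2 u)"
  by (rule Quotient_rep_reflp[OF Quotient_L2])

lemma sq_integrable_rep_L2: "sq_integrable (rep_L2 u)"
  using L2_rel_rep[of u] by (simp add: L2_rel_def)

lemma abs_rep_L2: "abs_L2 (rep_L2 u) = u"
  by (rule Quotient_abs_rep[OF Quotient_L2])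

lemma rep_abs_L2:
  assumes "sq_integrable f"
  shows "AE x in lborel. rep_L2 (abs_L2 f) x = f x"
  using rep_abs_rsp_left[OF Quotient3_L2, of f f] assms by (simp add: L2_rel_def)

instantiation L2 :: (euclidean_space) real_vector
begin

lift_definition zero_L2 :: "'a L2" is "\<lambda>_. 0"
  by (simp add: L2_rel_def sq_integrable_zero)

lift_definition plus_L2 :: "'a L2 \<Rightarrow> 'a L2 \<Rightarrow> 'a L2" is "\<lambda>f g x. f x + g x"
  by (auto simp: L2_rel_def sq_integrable_add)

lift_definition uminus_L2 :: "'a L2 \<Rightarrow> 'a L2" is "\<lambda>f x. - f x"
  by (auto simp: L2_rel_def sq_integrable_minus)

lift_definition minus_L2 :: "'a L2 \<Rightarrow> 'a L2 \<Rightarrow> 'a L2" is "\<lambda>f g x. f x - g x"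
  by (auto simp: L2_rel_def sq_integrable_diff)

lift_definition scaleR_L2 :: "real \<Rightarrow> 'a L2 \<Rightarrow> 'a L2" is "\<lambda>c f x. c * f x"
  by (auto simp: L2_rel_def sq_integrable_scale)

instance
  by standard
    (transfer; auto simp: L2_rel_def algebra_simps
      intro!: sq_integrable_add sq_integrable_scale sq_integrable_minus sq_integrable_diff
        sq_integrable_zero)+

end

instantiation L2 :: (euclidean_space) real_inner
begin

lift_definition inner_L2 :: "'a L2 \<Rightarrow> 'a L2 \<Rightarrow> real" is "\<lambda>f g. LINT x|lborel. f x * g x"
  by (rule integral_cong_AE) (auto simp: L2_rel_def sq_integrable_def)

definition norm_L2 :: "'a L2 \<Rightarrow> real" where "norm_L2 u = sqrt (inner u u)"
definition dist_L2 :: "'a L2 \<Rightarrow> 'a L2 \<Rightarrow> real" where "dist_L2 u v = norm (u - v)"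
definition sgn_L2 :: "'a L2 \<Rightarrow> 'a L2" where "sgn_L2 u = inverse (norm u) *\<^sub>R u"
definition uniformity_L2 :: "('a L2 \<times> 'a L2) filter" where
  "uniformity_L2 = (INF e\<in>{0 <..}. principal {(x, y). dist x y < e})"
definition open_L2 :: "'a L2 set \<Rightarrow> bool" where
  "open_L2 U \<longleftrightarrow> (\<forall>x\<in>U. eventually (\<lambda>(x', y). x' = x \<longrightarrow> y \<in> U) uniformity)"

instance
proof
  fix u v w :: "'a L2" and c :: real
  show "inner u v = inner v u"
    by transfer (simp add: mult.commute)
  show "inner (u + v) w = inner u w + inner v w"
    by transfer (simp add: L2_rel_def distrib_right sq_integrable_mult)
  show "inner (c *\<^sub>R u) v = c * inner u v"
    by transfer (simp add: mult.assoc)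
  show "0 \<le> inner u u"
    by transfer simp
  show "inner u u = 0 \<longleftrightarrow> u = 0"
  proof transfer
    fix f :: "'a \<Rightarrow> real" assume f: "L2_rel f f"
    then have "(LINT x|lborel. f x * f x) = 0 \<longleftrightarrow> (AE x in lborel. f x * f x = 0)"
      by (intro integral_nonneg_eq_0_iff_AE) (auto simp: L2_rel_def sq_integrable_mult)
    with f show "(LINT x|lborel. f x * f x) = 0 \<longleftrightarrow> L2_rel f (\<lambda>_. 0)"
      by (simp add: L2_rel_def sq_integrable_zero)
  qed
qed (simp_all add: norm_L2_def dist_L2_def sgn_L2_def uniformity_L2_def open_L2_def)

end

lemma norm_abs_L2:
  assumes "sq_integrable f"
  shows "(norm (abs_L2 f))\<^sup>2 = (LINT x|lborel. (f x)\<^sup>2)"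
proof -
  have "inner (abs_L2 f) (abs_L2 f) = (LINT x|lborel. f x * f x)"
    using assms by (intro inner_L2.abs_eq) (simp_all add: eq_onp_def L2_rel_def)
  then show ?thesis
    by (simp only: power2_norm_eq_inner) (simp add: power2_eq_square)
qed

lemma abs_L2_diff:
  assumes "sq_integrable f" "sq_integrable g"
  shows "abs_L2 f - abs_L2 g = abs_L2 (\<lambda>x. f x - g x)"
  using assms by (intro minus_L2.abs_eq) (simp_all add: eq_onp_def L2_rel_def)

lemma abs_L2_add:
  assumes "sq_integrable f" "sq_integrable g"
  shows "abs_L2 f + abs_L2 g = abs_L2 (\<lambda>x. f x + g x)"
  using assms by (intro plus_L2.abs_eq) (simp_all add: eq_onp_def L2_rel_def)

lemma abs_L2_scale:
  assumes "sq_integrable f"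
  shows "c *\<^sub>R abs_L2 f = abs_L2 (\<lambda>x. c * f x)"
  using assms by (intro scaleR_L2.abs_eq) (simp_all add: eq_onp_def L2_rel_def)

lemma abs_L2_zero: "(0 :: 'a::euclidean_space L2) = abs_L2 (\<lambda>_. 0)"
  by (rule zero_L2.abs_eq)

lemma nn_integral_sq_L2:
  assumes "sq_integrable f"
  shows "(\<integral>\<^sup>+x. ennreal ((f x)\<^sup>2) \<partial>lborel) = ennreal ((norm (abs_L2 f))\<^sup>2)"
  unfolding norm_abs_L2[OF assms]
  by (rule nn_integral_eq_integral) (use assms in \<open>auto simp: sq_integrable_def\<close>)

lemma dist_abs_L2:
  assumes "sq_integrable f" "sq_integrable g"
  shows "(dist (abs_L2 f) (abs_L2 g))\<^sup>2 = (LINT x|lborel. (f x - g x)\<^sup>2)"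
  by (simp add: dist_norm abs_L2_diff[OF assms] norm_abs_L2 sq_integrable_diff assms)

subsection \<open>Completeness\<close>

lemma L2_fast_Cauchy_convergent:
  fixes f :: "nat \<Rightarrow> 'a::euclidean_space \<Rightarrow> real"
  assumes f: "\<And>n. sq_integrable (f n)"
    and fast: "\<And>n. dist (abs_L2 (f (Suc n))) (abs_L2 (f n)) \<le> (1/4)^n"
    and Cauchy: "Cauchy (\<lambda>n. abs_L2 (f n))"
  shows "convergent (\<lambda>n. abs_L2 (f n))"
proof -
  have [measurable]: "f n \<in> borel_measurable borel" for n
    using f[of n] by (simp add: sq_integrable_def)
  define h where "h n x = f (Suc n) x - f n x" for n x
  have [measurable]: "h n \<in> borel_measurable borel" for n
    unfolding h_def by measurable
  have hsq: "sq_integrable (h n)" for n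
    unfolding h_def by (intro sq_integrable_diff f)
  have hnorm: "(\<integral>\<^sup>+x. ennreal (4^n * (h n x)\<^sup>2) \<partial>lborel) \<le> ennreal ((1/4)^n)" for n
  proof -
    have "norm (abs_L2 (h n)) \<le> (1/4)^n"
      using fast[of n] by (simp add: dist_norm abs_L2_diff f h_def[abs_def])
    then have "(norm (abs_L2 (h n)))\<^sup>2 \<le> ((1/4)^n)\<^sup>2"
      by (intro power_mono) auto
    then have *: "4^n * (norm (abs_L2 (h n)))\<^sup>2 \<le> 4^n * ((1/4)^n)\<^sup>2"
      by (intro mult_left_mono) auto
    have "(4::real)^n * ((1/4)^n)\<^sup>2 = (1/4)^n"
      by (simp add: power2_eq_square flip: power_mult_distrib)
    with * have **: "4^n * (norm (abs_L2 (h n)))\<^sup>2 \<le> (1/4)^n"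
      by simp
    have "(\<integral>\<^sup>+x. ennreal (4^n * (h n x)\<^sup>2) \<partial>lborel)
        = ennreal (4^n) * (\<integral>\<^sup>+x. ennreal ((h n x)\<^sup>2) \<partial>lborel)"
      by (simp add: ennreal_mult nn_integral_cmult)
    also have "\<dots> = ennreal (4^n * (norm (abs_L2 (h n)))\<^sup>2)"
      by (simp add: nn_integral_sq_L2[OF hsq] ennreal_mult)
    also have "\<dots> \<le> ennreal ((1/4)^n)"
      using ** by (rule ennreal_leI)
    finally show ?thesis .
  qed
  have "(\<integral>\<^sup>+x. (\<Sum>n. ennreal (4^n * (h n x)\<^sup>2)) \<partial>lborel)
      = (\<Sum>n. \<integral>\<^sup>+x. ennreal (4^n * (h n x)\<^sup>2) \<partial>lborel)"
    by (rule nn_integral_suminf) simp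
  also have "\<dots> \<le> (\<Sum>n. ennreal ((1/4)^n))"
    by (intro suminf_le hnorm) auto
  also have "\<dots> < \<infinity>"
    by (subst suminf_ennreal2) (auto intro!: summable_geometric)
  finally have "AE x in lborel. (\<Sum>n. ennreal (4^n * (h n x)\<^sup>2)) \<noteq> \<infinity>"
    by (intro nn_integral_PInf_AE) auto
  then have AEconv: "AE x in lborel. convergent (\<lambda>n. f n x)"
  proof (rule eventually_mono)
    fix x assume fin: "(\<Sum>n. ennreal (4^n * (h n x)\<^sup>2)) \<noteq> \<infinity>"
    have sm: "summable (\<lambda>n. 4^n * (h n x)\<^sup>2)"
      by (rule summable_suminf_not_top) (use fin in auto)
    then obtain M where M: "\<And>n. 4^n * (h n x)\<^sup>2 \<le> M" "M \<ge> 0"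
    proof -
      assume *: "\<And>M. (\<And>n. 4^n * (h n x)\<^sup>2 \<le> M) \<Longrightarrow> 0 \<le> M \<Longrightarrow> thesis"
      have "4^n * (h n x)\<^sup>2 \<le> (\<Sum>n. 4^n * (h n x)\<^sup>2)" for n
        using sum_le_suminf[OF sm, of "{n}"] by auto
      moreover have "0 \<le> (\<Sum>n. 4^n * (h n x)\<^sup>2)"
        by (intro suminf_nonneg sm) auto
      ultimately show thesis by (rule *)
    qed
    have "summable (\<lambda>n. h n x)"
    proof (rule summable_comparison_test')
      show "summable (\<lambda>n. sqrt M * (1/2)^n)"
        by (intro summable_mult summable_geometric) auto
      fix n
      have "(2^n * \<bar>h n x\<bar>)\<^sup>2 \<le> M"
      proof -
        have "((2::real)^n)\<^sup>2 = 4^n"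
          by (simp add: power2_eq_square flip: power_mult_distrib)
        with M(1)[of n] show ?thesis by (simp add: power_mult_distrib)
      qed
      then have "2^n * \<bar>h n x\<bar> \<le> sqrt M"
        by (rule real_le_rsqrt)
      then show "norm (h n x) \<le> sqrt M * (1/2)^n"
        by (simp add: field_simps power_divide)
    qed
    then have "convergent (\<lambda>n. f 0 x + (\<Sum>i<n. h i x))"
      by (intro convergent_add convergent_const)
        (simp add: summable_iff_convergent)
    moreover have "f 0 x + (\<Sum>i<n. h i x) = f n x" for n
      by (induction n) (auto simp: h_def)
    ultimately show "convergent (\<lambda>n. f n x)" by simp
  qed
  define g where "g x = lim (\<lambda>n. f n x)" for x
  have [measurable]: "g \<in> borel_measurable borel"
    unfolding g_def by (rule borel_measurable_lim_metric) simp
  have AElim: "AE x in lborel. (\<lambda>n. f n x) \<longlonglongrightarrow> g x"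
    using AEconv by eventually_elim (simp add: g_def convergent_LIMSEQ_iff)
  have bound: "(\<integral>\<^sup>+x. ennreal ((g x - f n x)\<^sup>2) \<partial>lborel) \<le> ennreal (e\<^sup>2)"
    if e: "\<And>m. m \<ge> N \<Longrightarrow> dist (abs_L2 (f m)) (abs_L2 (f n)) \<le> e" and "e \<ge> 0" for n N e
  proof -
    have "(\<integral>\<^sup>+x. ennreal ((g x - f n x)\<^sup>2) \<partial>lborel)
        = (\<integral>\<^sup>+x. liminf (\<lambda>m. ennreal ((f m x - f n x)\<^sup>2)) \<partial>lborel)"
    proof (rule nn_integral_cong_AE)
      show "AE x in lborel. ennreal ((g x - f n x)\<^sup>2) = liminf (\<lambda>m. ennreal ((f m x - f n x)\<^sup>2))"
        using AElim
      proof eventually_elim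
        case (elim x)
        then have "(\<lambda>m. ennreal ((f m x - f n x)\<^sup>2)) \<longlonglongrightarrow> ennreal ((g x - f n x)\<^sup>2)"
          by (intro tendsto_ennrealI tendsto_intros)
        then show ?case
          by (intro lim_imp_Liminf[symmetric]) auto
      qed
    qed
    also have "\<dots> \<le> liminf (\<lambda>m. \<integral>\<^sup>+x. ennreal ((f m x - f n x)\<^sup>2) \<partial>lborel)"
      by (rule nn_integral_liminf) simp
    also have "\<dots> \<le> ennreal (e\<^sup>2)"
    proof -
      have "(\<integral>\<^sup>+x. ennreal ((f m x - f n x)\<^sup>2) \<partial>lborel) \<le> ennreal (e\<^sup>2)" if "m \<ge> N" for m
      proof -
        have "(\<integral>\<^sup>+x. ennreal ((f m x - f n x)\<^sup>2) \<partial>lborel)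
          = ennreal ((norm (abs_L2 (\<lambda>x. f m x - f n x)))\<^sup>2)"
          by (rule nn_integral_sq_L2) (intro sq_integrable_diff f)
        also have "\<dots> \<le> ennreal (e\<^sup>2)"
          using e[OF that] by (intro ennreal_leI power_mono) (auto simp: dist_norm abs_L2_diff f)
        finally show ?thesis .
      qed
      then have "eventually (\<lambda>m. (\<integral>\<^sup>+x. ennreal ((f m x - f n x)\<^sup>2) \<partial>lborel) \<le> ennreal (e\<^sup>2))
          sequentially"
        by (auto simp: eventually_sequentially)
      then have "limsup (\<lambda>m. \<integral>\<^sup>+x. ennreal ((f m x - f n x)\<^sup>2) \<partial>lborel) \<le> ennreal (e\<^sup>2)"
        by (rule Limsup_bounded)
      with Liminf_le_Limsup[OF sequentially_bot] show ?thesis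
        by (rule order_trans)
    qed
    finally show ?thesis .
  qed
  have diff_sq: "sq_integrable (\<lambda>x. g x - f n x) \<and> dist (abs_L2 g) (abs_L2 (f n)) \<le> e"
    if e: "\<And>m. m \<ge> N \<Longrightarrow> dist (abs_L2 (f m)) (abs_L2 (f n)) \<le> e" and "e \<ge> 0" for n N e
  proof -
    have b: "(\<integral>\<^sup>+x. ennreal ((g x - f n x)\<^sup>2) \<partial>lborel) \<le> ennreal (e\<^sup>2)"
      by (rule bound[of N n e]) (use that in auto)
    have "integrable lborel (\<lambda>x. (g x - f n x)\<^sup>2)"
      by (rule integrableI_nonneg) (auto intro: le_less_trans[OF b])
    then have s: "sq_integrable (\<lambda>x. g x - f n x)"
      by (simp add: sq_integrable_def)
    then have "sq_integrable (\<lambda>x. (g x - f n x) + f n x)"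
      by (intro sq_integrable_add f)
    then have gs: "sq_integrable g" by simp
    have "ennreal ((norm (abs_L2 (\<lambda>x. g x - f n x)))\<^sup>2) \<le> ennreal (e\<^sup>2)"
      using b nn_integral_sq_L2[OF s] by simp
    then have "(norm (abs_L2 (\<lambda>x. g x - f n x)))\<^sup>2 \<le> e\<^sup>2"
      by (simp add: ennreal_le_iff)
    then have "norm (abs_L2 (\<lambda>x. g x - f n x)) \<le> e"
      using \<open>e \<ge> 0\<close> by (rule power2_le_imp_le)
    with s show ?thesis
      by (simp add: dist_norm abs_L2_diff gs f)
  qed
  have "(\<lambda>n. abs_L2 (f n)) \<longlonglongrightarrow> abs_L2 g"
  proof (rule metric_LIMSEQ_I)
    fix r :: real assume "r > 0"
    then obtain N where N: "\<And>m n. m \<ge> N \<Longrightarrow> n \<ge> N \<Longrightarrow> dist (abs_L2 (f m)) (abs_L2 (f n)) < r/2"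
      using Cauchy half_gt_zero unfolding Cauchy_def by meson
    have "dist (abs_L2 (f n)) (abs_L2 g) < r" if "n \<ge> N" for n
    proof -
      have "dist (abs_L2 g) (abs_L2 (f n)) \<le> r/2"
        using diff_sq[of N n "r/2"] N that \<open>r > 0\<close> by (auto intro: less_imp_le)
      with \<open>r > 0\<close> show ?thesis by (simp add: dist_commute)
    qed
    then show "\<exists>N. \<forall>n\<ge>N. dist (abs_L2 (f n)) (abs_L2 g) < r" by blast
  qed
  then show ?thesis by (rule convergentI)
qed

instance L2 :: (euclidean_space) complete_space
proof
  fix X :: "nat \<Rightarrow> 'a L2"
  assume X: "Cauchy X"
  have "\<exists>N. \<forall>m\<ge>N. \<forall>n\<ge>N. dist (X m) (X n) < (1/4)^k" for k :: nat
    using X unfolding Cauchy_def by (meson zero_less_power zero_less_divide_1_iff zero_less_numeral)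
  then obtain N where N: "\<And>k m n. m \<ge> N k \<Longrightarrow> n \<ge> N k \<Longrightarrow> dist (X m) (X n) < (1/4)^k"
    by metis
  define r where "r k = (\<Sum>i\<le>k. N i) + k" for k
  have r: "strict_mono r"
    by (auto simp: strict_mono_Suc_iff r_def)
  have rN: "r k \<ge> N k" for k
    using member_le_sum[of k "{..k}" N] by (simp add: r_def)
  have "convergent (\<lambda>k. abs_L2 (rep_L2 (X (r k))))"
  proof (rule L2_fast_Cauchy_convergent)
    fix k
    show "sq_integrable (rep_L2 (X (r k)))"
      by (rule sq_integrable_rep_L2)
    have "r (Suc k) \<ge> r k" using r by (simp add: strict_mono_less_eq)
    with rN[of k] have "dist (X (r (Suc k))) (X (r k)) < (1/4)^k"
      by (intro N) auto
    then show "dist (abs_L2 (rep_L2 (X (r (Suc k))))) (abs_L2 (rep_L2 (X (r k)))) \<le> (1/4)^k"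
      by (simp add: abs_rep_L2)
  next
    show "Cauchy (\<lambda>k. abs_L2 (rep_L2 (X (r k))))"
      using Cauchy_subseq_Cauchy[OF X r] by (simp add: abs_rep_L2 o_def)
  qed
  then obtain l where l: "(X \<circ> r) \<longlonglongrightarrow> l"
    by (auto simp: abs_rep_L2 convergent_def o_def)
  have "X \<longlonglongrightarrow> l"
  proof (rule metric_LIMSEQ_I)
    fix e :: real assume "e > 0"
    then have e2: "e/2 > 0" by simp
    obtain M where M: "\<And>m n. m \<ge> M \<Longrightarrow> n \<ge> M \<Longrightarrow> dist (X m) (X n) < e/2"
      using X e2 unfolding Cauchy_def by meson
    obtain K where K: "\<And>k. k \<ge> K \<Longrightarrow> dist (X (r k)) l < e/2"
      using metric_LIMSEQ_D[OF l e2] by auto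
    have "dist (X n) l < e" if "n \<ge> M" for n
    proof -
      have "r (max M K) \<ge> M"
        using seq_suble[OF r, of "max M K"] by simp
      then have "dist (X n) (X (r (max M K))) < e/2"
        using that by (intro M)
      moreover have "dist (X (r (max M K))) l < e/2"
        by (rule K) simp
      ultimately show ?thesis
        using dist_triangle[of "X n" l "X (r (max M K))"] by linarith
    qed
    then show "\<exists>N. \<forall>n\<ge>N. dist (X n) l < e" by blast
  qed
  then show "convergent X" by (rule convergentI)
qed

instance L2 :: (euclidean_space) banach ..

subsection \<open>Separability\<close>

lemma countable_dense_imp_countable_subbasis:
  fixes D :: "'a::metric_space set"
  assumes "countable D" and dense: "closure D = UNIV"
  shows "\<exists>B::'a set set. countable B \<and> open = generate_topology B"
proof -
  define B where "B = (\<lambda>(d, n). ball d (1 / real (Suc n))) ` (D \<times> (UNIV::nat set))"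
  have "topological_basis B"
  proof (rule topological_basisI)
    show "open U" if "U \<in> B" for U
      using that by (auto simp: B_def)
    fix U and x :: 'a assume "open U" "x \<in> U"
    then obtain e where e: "e > 0" "ball x e \<subseteq> U"
      by (meson openE)
    obtain n where n: "1 / real (Suc n) < e / 2"
      using e(1) nat_approx_posE half_gt_zero by metis
    have "x \<in> closure D" using dense by simp
    then obtain d where d: "d \<in> D" "dist d x < 1 / real (Suc n)"
      unfolding closure_approachable by (metis of_nat_0_less_iff zero_less_Suc zero_less_divide_1_iff)
    have "ball d (1 / real (Suc n)) \<subseteq> ball x e"
    proof
      fix y assume "y \<in> ball d (1 / real (Suc n))"
      then have "dist d y < 1 / real (Suc n)" by simp
      with d(2) n dist_triangle[of x y d] show "y \<in> ball x e"
        by (simp add: dist_commute)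
    qed
    with d e show "\<exists>B'\<in>B. x \<in> B' \<and> B' \<subseteq> U"
      by (intro bexI[of _ "ball d (1 / real (Suc n))"]) (auto simp: B_def)
  qed
  moreover have "countable B"
    unfolding B_def using assms(1) by (intro countable_image countable_SIGMA) auto
  ultimately show ?thesis
    using topological_basis_imp_subbasis by blast
qed

lemma countable_rational_span_dense:
  fixes C :: "'a::real_normed_vector set"
  assumes C: "countable C"
  obtains D where "countable D" "C \<subseteq> closure D"
    "\<And>x y. x \<in> closure D \<Longrightarrow> y \<in> closure D \<Longrightarrow> x + y \<in> closure D"
    "\<And>c x. x \<in> closure D \<Longrightarrow> c *\<^sub>R x \<in> closure D"
proof -
  define val where "val = (\<lambda>ps :: (rat \<times> 'a) list. \<Sum>(q, x)\<leftarrow>ps. of_rat q *\<^sub>R x)"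
  define D where "D = val ` lists (UNIV \<times> C)"
  have cD: "countable D"
    unfolding D_def using C by (intro countable_image countable_lists countable_SIGMA) auto
  have CD: "C \<subseteq> D"
  proof
    fix x assume "x \<in> C"
    then have "val [(1, x)] \<in> D" unfolding D_def by (intro imageI) auto
    then show "x \<in> D" by (simp add: val_def)
  qed
  have addD: "x + y \<in> D" if xy: "x \<in> D" "y \<in> D" for x y
  proof -
    obtain ps qs where "ps \<in> lists (UNIV \<times> C)" "qs \<in> lists (UNIV \<times> C)" "x = val ps" "y = val qs"
      using xy unfolding D_def by blast
    then have "val (ps @ qs) = x + y" "ps @ qs \<in> lists (UNIV \<times> C)"
      by (auto simp: val_def)
    then show ?thesis unfolding D_def by (metis imageI)
  qed
  have scaleD: "of_rat q *\<^sub>R x \<in> D" if x: "x \<in> D" for x q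
  proof -
    obtain ps where ps: "ps \<in> lists (UNIV \<times> C)" "x = val ps"
      using x unfolding D_def by blast
    have "val (map (\<lambda>(r, y). (q * r, y)) ps) = of_rat q *\<^sub>R val ps"
      by (induction ps) (auto simp: val_def scaleR_add_right of_rat_mult)
    moreover have "val (map (\<lambda>(r, y). (q * r, y)) ps) \<in> D"
      unfolding D_def using ps(1) by (intro imageI) (auto simp: lists_eq_set)
    ultimately show ?thesis using ps by simp
  qed
  have add: "x + y \<in> closure D" if "x \<in> closure D" "y \<in> closure D" for x y
  proof -
    obtain f g where f: "\<And>n. f n \<in> D" "f \<longlonglongrightarrow> x" and g: "\<And>n. g n \<in> D" "g \<longlonglongrightarrow> y"
      using \<open>x \<in> closure D\<close> \<open>y \<in> closure D\<close> unfolding closure_sequential by blast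
    have "(\<lambda>n. f n + g n) \<longlonglongrightarrow> x + y"
      using f g by (intro tendsto_add)
    with f g addD show ?thesis
      unfolding closure_sequential by (intro exI[of _ "\<lambda>n. f n + g n"]) auto
  qed
  have scale: "c *\<^sub>R x \<in> closure D" if x: "x \<in> closure D" for c x
  proof -
    obtain f where f: "\<And>n. f n \<in> D" "f \<longlonglongrightarrow> x"
      using x unfolding closure_sequential by blast
    have "\<exists>q::rat. c < of_rat q \<and> of_rat q < c + 1 / real (Suc n)" for n
      by (rule of_rat_dense) simp
    then obtain q :: "nat \<Rightarrow> rat" where
      q: "\<And>n. c < of_rat (q n)" "\<And>n. of_rat (q n) < c + 1 / real (Suc n)" by metis
    have "(\<lambda>n. c + 1 / real (Suc n)) \<longlonglongrightarrow> c + 0"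
      by (intro tendsto_add tendsto_const LIMSEQ_Suc lim_1_over_n)
    then have "(\<lambda>n. of_rat (q n) :: real) \<longlonglongrightarrow> c"
      by (intro tendsto_sandwich[of "\<lambda>_. c" "\<lambda>n. of_rat (q n)" sequentially "\<lambda>n. c + 1 / real (Suc n)"])
        (auto intro!: always_eventually less_imp_le q simp del: of_nat_Suc)
    then have "(\<lambda>n. of_rat (q n) *\<^sub>R f n) \<longlonglongrightarrow> c *\<^sub>R x"
      using f by (intro tendsto_scaleR)
    with f scaleD show ?thesis
      unfolding closure_sequential by (intro exI[of _ "\<lambda>n. of_rat (q n) *\<^sub>R f n"]) auto
  qed
  show thesis
    using that[of D] cD CD closure_subset add scale by blast
qed

lemma sq_integrable_indicator:
  fixes A :: "'a::euclidean_space set"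
  assumes "A \<in> sets borel"
  shows "sq_integrable (indicator (A \<inter> ball 0 r))"
proof -
  have "emeasure lborel (A \<inter> ball 0 r) \<le> emeasure lborel (ball (0::'a) r)"
    by (rule emeasure_mono) auto
  also have "\<dots> < \<infinity>"
    by (rule emeasure_bounded_finite) simp
  finally have "integrable lborel (indicator (A \<inter> ball 0 r) :: 'a \<Rightarrow> real)"
    using assms by (simp add: integrable_indicator_iff)
  moreover have "(\<lambda>x::'a. (indicator (A \<inter> ball 0 r) x)\<^sup>2) = (indicator (A \<inter> ball 0 r) :: 'a \<Rightarrow> real)"
    by (auto simp: indicator_def)
  ultimately show ?thesis
    using assms by (simp add: sq_integrable_def)
qed

lemma L2_dominated_convergence:
  fixes f :: "nat \<Rightarrow> 'a::euclidean_space \<Rightarrow> real"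
  assumes f: "\<And>n. sq_integrable (f n)" and g: "sq_integrable g" and w: "sq_integrable w"
    and lim: "\<And>x. (\<lambda>n. f n x) \<longlonglongrightarrow> g x" and le: "\<And>n x. \<bar>f n x - g x\<bar> \<le> w x"
  shows "(\<lambda>n. abs_L2 (f n)) \<longlonglongrightarrow> abs_L2 g"
proof -
  have [measurable]: "f n \<in> borel_measurable borel" "g \<in> borel_measurable borel" for n
    using f[of n] g by (auto simp: sq_integrable_def)
  have "(\<lambda>n. LINT x|lborel. (f n x - g x)\<^sup>2) \<longlonglongrightarrow> (LINT x|(lborel::'a measure). 0)"
  proof (rule integral_dominated_convergence)
    show "integrable lborel (\<lambda>x. (w x)\<^sup>2)"
      using w by (simp add: sq_integrable_def)
    show "AE x in lborel. (\<lambda>n. (f n x - g x)\<^sup>2) \<longlonglongrightarrow> 0"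
    proof (rule AE_I2)
      fix x
      have "(\<lambda>n. (f n x - g x)\<^sup>2) \<longlonglongrightarrow> (g x - g x)\<^sup>2"
        by (intro tendsto_intros lim)
      then show "(\<lambda>n. (f n x - g x)\<^sup>2) \<longlonglongrightarrow> 0" by simp
    qed
    show "AE x in lborel. norm ((f n x - g x)\<^sup>2) \<le> (w x)\<^sup>2" for n
      using le by (auto intro!: AE_I2 simp: abs_le_square_iff[symmetric] intro: order_trans[OF _ abs_ge_self])
  qed auto
  then have "(\<lambda>n. (dist (abs_L2 (f n)) (abs_L2 g))\<^sup>2) \<longlonglongrightarrow> 0"
    by (simp add: dist_abs_L2 f g)
  then have "(\<lambda>n. sqrt ((dist (abs_L2 (f n)) (abs_L2 g))\<^sup>2)) \<longlonglongrightarrow> sqrt 0"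
    by (intro tendsto_real_sqrt)
  then show ?thesis
    by (simp add: tendsto_dist_iff[of "\<lambda>n. abs_L2 (f n)"])
qed

instance L2 :: (euclidean_space) second_countable_topology
proof
  obtain \<B> :: "'a set set" where \<B>: "countable \<B>" "topological_basis \<B>"
    using ex_countable_basis by blast
  define \<G> where "\<G> = Inter ` {F. finite F \<and> F \<subseteq> \<B>}"
  have cG: "countable \<G>"
    unfolding \<G>_def using \<B>(1) by (intro countable_image countable_Collect_finite_subset)
  have Gopen: "open G" if "G \<in> \<G>" for G
    using that topological_basis_open[OF \<B>(2)] by (auto simp: \<G>_def intro!: open_Inter)
  have GInt: "Int_stable \<G>"
  proof (rule Int_stableI)
    fix A B assume "A \<in> \<G>" "B \<in> \<G>"
    then obtain F H where "finite F" "F \<subseteq> \<B>" "A = \<Inter>F" "finite H" "H \<subseteq> \<B>" "B = \<Inter>H"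
      by (auto simp: \<G>_def)
    then show "A \<inter> B \<in> \<G>"
      unfolding \<G>_def by (intro image_eqI[of _ _ "F \<union> H"]) auto
  qed
  have GUNIV: "UNIV \<in> \<G>"
    unfolding \<G>_def by (intro image_eqI[of _ _ "{}"]) auto
  have BG: "\<B> \<subseteq> \<G>"
  proof
    fix A assume "A \<in> \<B>" then show "A \<in> \<G>"
      unfolding \<G>_def by (intro image_eqI[of _ _ "{A}"]) auto
  qed
  have borelG: "sigma_sets UNIV \<G> = sets (borel :: 'a measure)"
  proof (rule antisym)
    show "sigma_sets UNIV \<G> \<subseteq> sets (borel :: 'a measure)"
      using Gopen sets.sigma_sets_subset[of \<G> "borel :: 'a measure"] by (simp add: subset_iff)
    have "sets (borel :: 'a measure) = sigma_sets UNIV \<B>"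
      by (simp add: borel_eq_countable_basis[OF \<B>])
    also have "\<dots> \<subseteq> sigma_sets UNIV \<G>"
      by (rule sigma_sets_mono') (rule BG)
    finally show "sets (borel :: 'a measure) \<subseteq> sigma_sets UNIV \<G>" .
  qed
  define ind :: "'a set \<Rightarrow> nat \<Rightarrow> 'a L2" where
    "ind A n = abs_L2 (indicator (A \<inter> ball 0 (real n)))" for A n
  define C where "C = (\<lambda>(A, n). ind A n) ` (\<G> \<times> (UNIV::nat set))"
  have "countable C"
    unfolding C_def using cG by (intro countable_image countable_SIGMA) auto
  then obtain D where D: "countable D" "C \<subseteq> closure D"
    "\<And>x y. x \<in> closure D \<Longrightarrow> y \<in> closure D \<Longrightarrow> x + y \<in> closure D"
    "\<And>c x. x \<in> closure D \<Longrightarrow> c *\<^sub>R x \<in> closure D"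
    using countable_rational_span_dense by blast
  have Dlim: "l \<in> closure D" if "X \<longlonglongrightarrow> l" "\<And>n. X n \<in> closure D" for X l
    using closed_sequentially[OF closed_closure, of X D l] that by blast
  have Ddiff: "x - y \<in> closure D" if "x \<in> closure D" "y \<in> closure D" for x y
    using D(3)[OF that(1) D(4)[OF that(2), of "-1"]] by simp
  have ind0: "ind {} n = 0" for n
    by (simp add: ind_def abs_L2_zero indicator_def[abs_def])
  have zeroD: "0 \<in> closure D"
    using D(4)[of "ind UNIV 0" 0] D(2) GUNIV by (auto simp: C_def)
  have sumD: "finite I \<Longrightarrow> (\<And>i. i \<in> I \<Longrightarrow> F i \<in> closure D) \<Longrightarrow> sum F I \<in> closure D"
    for F :: "real \<Rightarrow> 'a L2" and I
    by (induction I rule: finite_induct) (auto simp: zeroD D(3))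
  have indD: "ind A n \<in> closure D" if "A \<in> sets borel" for A n
  proof -
    have "\<G> \<subseteq> Pow UNIV" "A \<in> sigma_sets UNIV \<G>" using that borelG by simp_all
    with GInt show ?thesis
    proof (induction rule: sigma_sets_induct_disjoint)
      case (basic A)
      then show ?case using D(2) by (auto simp: C_def)
    next
      case empty
      show ?case using zeroD by (simp add: ind0)
    next
      case (compl A)
      then have A: "A \<in> sets borel" by (simp add: borelG)
      have "ind (UNIV - A) n = ind UNIV n - ind A n"
      proof -
        have "(indicator ((UNIV - A) \<inter> ball 0 (real n)) :: 'a \<Rightarrow> real)
            = (\<lambda>x. indicator (UNIV \<inter> ball 0 (real n)) x - indicator (A \<inter> ball 0 (real n)) x)"
          by (auto simp: indicator_def)
        then show ?thesis
          by (simp only: ind_def abs_L2_diff sq_integrable_indicator A sets.top space_borel)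
            (subst abs_L2_diff; (intro sq_integrable_indicator A refl)?; simp)
      qed
      moreover have "ind UNIV n \<in> closure D" using D(2) GUNIV by (auto simp: C_def)
      ultimately show ?case using compl by (simp add: Ddiff)
    next
      case (union A)
      have A: "A i \<in> sets borel" for i using union by (auto simp: borelG)
      have part: "ind (\<Union>i<k. A i) n \<in> closure D" for k
      proof (induction k)
        case 0
        show ?case using zeroD by (simp add: ind0)
      next
        case (Suc k)
        have disj: "A k \<inter> (\<Union>i<k. A i) = {}"
        proof -
          have "A k \<inter> A i = {}" if "i < k" for i
            using union(1) that by (intro disjoint_family_onD[where I = UNIV]) auto
          then show ?thesis by blast
        qed
        have "(indicator ((\<Union>i<Suc k. A i) \<inter> ball 0 (real n)) :: 'a \<Rightarrow> real)
            = (\<lambda>x. indicator ((\<Union>i<k. A i) \<inter> ball 0 (real n)) x + indicator (A k \<inter> ball 0 (real n)) x)"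
        proof
          fix x
          show "(indicator ((\<Union>i<Suc k. A i) \<inter> ball 0 (real n)) x :: real)
            = indicator ((\<Union>i<k. A i) \<inter> ball 0 (real n)) x + indicator (A k \<inter> ball 0 (real n)) x"
            using disj by (cases "x \<in> A k"; cases "x \<in> (\<Union>i<k. A i)"; cases "x \<in> ball 0 (real n)")
              (simp_all add: indicator_def lessThan_Suc set_eq_iff)
        qed
        then have "ind (\<Union>i<Suc k. A i) n = ind (\<Union>i<k. A i) n + ind (A k) n"
          unfolding ind_def
          by (subst abs_L2_add) (auto intro!: sq_integrable_indicator A arg_cong[of _ _ abs_L2])
        then show ?case using Suc union(3)[of k] by (simp add: D(3))
      qed
      have "(\<lambda>k. ind (\<Union>i<k. A i) n) \<longlonglongrightarrow> ind (\<Union>i. A i) n"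
        unfolding ind_def
      proof (rule L2_dominated_convergence)
        show "sq_integrable (indicator ((\<Union>i<k. A i) \<inter> ball 0 (real n)))" for k
          using A by (intro sq_integrable_indicator) auto
        show "sq_integrable (indicator ((\<Union>i. A i) \<inter> ball 0 (real n)))"
          using A by (intro sq_integrable_indicator) auto
        show "sq_integrable (indicator (UNIV \<inter> ball (0::'a) (real n)))"
          by (intro sq_integrable_indicator) auto
        show "(\<lambda>k. indicator ((\<Union>i<k. A i) \<inter> ball 0 (real n)) x)
            \<longlonglongrightarrow> (indicator ((\<Union>i. A i) \<inter> ball 0 (real n)) x :: real)" for x
        proof (cases "x \<in> (\<Union>i. A i)")
          case True
          then obtain j where "x \<in> A j" by blast
          then have "indicator ((\<Union>i<k. A i) \<inter> ball 0 (real n)) x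
              = (indicator ((\<Union>i. A i) \<inter> ball 0 (real n)) x :: real)" if "k \<ge> Suc j" for k
            using that by (auto simp: indicator_def)
          then show ?thesis
            by (intro tendsto_eventually) (auto simp: eventually_sequentially)
        next
          case False
          then show ?thesis by (intro tendsto_eventually always_eventually) (auto simp: indicator_def)
        qed
        show "\<bar>indicator ((\<Union>i<k. A i) \<inter> ball 0 (real n)) x
            - indicator ((\<Union>i. A i) \<inter> ball 0 (real n)) x\<bar>
            \<le> (indicator (UNIV \<inter> ball (0::'a) (real n)) x :: real)" for k x
          by (auto simp: indicator_def)
      qed
      then show ?case by (rule Dlim) (rule part)
    qed
  qed
  have "u \<in> closure D" for u
  proof -
    define f where "f = rep_L2 u"
    have f: "sq_integrable f" by (simp add: f_def sq_integrable_rep_L2)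
    then have "f \<in> borel_measurable borel" by (simp add: sq_integrable_def)
    then obtain s where s: "\<And>i. simple_function borel (s i)"
      "\<And>x. (\<lambda>i. s i x) \<longlonglongrightarrow> f x" "\<And>i x. dist (s i x) 0 \<le> 2 * dist (f x) 0"
      using borel_measurable_implies_sequence_metric[of f borel 0] by auto
    define t where "t i x = s i x * indicator (ball 0 (real i)) x" for i and x :: 'a
    have rep: "t i = (\<lambda>x. \<Sum>y\<in>range (s i). y * indicator (s i -` {y} \<inter> ball 0 (real i)) x)" for i
    proof
      fix x
      have fin: "finite (range (s i))" using s(1)[of i] by (simp add: simple_function_def)
      have "(\<Sum>y\<in>range (s i). y * indicator (s i -` {y} \<inter> ball 0 (real i)) x)
          = (\<Sum>y\<in>range (s i). if y = s i x then y * indicator (ball 0 (real i)) x else 0)"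
        by (intro sum.cong) (auto simp: indicator_def)
      also have "\<dots> = t i x" using fin by (simp add: t_def)
      finally show "t i x = (\<Sum>y\<in>range (s i). y * indicator (s i -` {y} \<inter> ball 0 (real i)) x)" ..
    qed
    have meas: "s i -` {y} \<in> sets borel" for i y
      using measurable_sets[OF borel_measurable_simple_function[OF s(1)[of i]], of "{y}"] by simp
    define g where "g i y x = y * (indicator (s i -` {y} \<inter> ball 0 (real i)) x :: real)" for i y x
    have gsq: "sq_integrable (g i y)" for i y
      unfolding g_def by (intro sq_integrable_scale sq_integrable_indicator meas)
    have gabs: "abs_L2 (g i y) = y *\<^sub>R ind (s i -` {y}) i" for i y
      unfolding g_def ind_def by (simp only: abs_L2_scale sq_integrable_indicator meas)
    have fsum: "finite I \<Longrightarrow> sq_integrable (\<lambda>x. \<Sum>y\<in>I. g i y x) \<and>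
      abs_L2 (\<lambda>x. \<Sum>y\<in>I. g i y x) = (\<Sum>y\<in>I. y *\<^sub>R ind (s i -` {y}) i)" for I i
    proof (induction I rule: finite_induct)
      case empty
      show ?case by (simp add: sq_integrable_zero abs_L2_zero)
    next
      case (insert y I)
      then show ?case
        by (simp add: sq_integrable_add gsq abs_L2_add[symmetric] gabs)
    qed
    have tsq: "sq_integrable (t i)" and tD: "abs_L2 (t i) \<in> closure D" for i
    proof -
      have fin: "finite (range (s i))" using s(1)[of i] by (simp add: simple_function_def)
      show "sq_integrable (t i)" using fsum[OF fin] by (simp add: rep g_def)
      have "abs_L2 (t i) = (\<Sum>y\<in>range (s i). y *\<^sub>R ind (s i -` {y}) i)"
        using fsum[OF fin] by (simp add: rep g_def)
      also have "\<dots> \<in> closure D"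
        using fin by (intro sumD D(4) indD meas)
      finally show "abs_L2 (t i) \<in> closure D" .
    qed
    have "(\<lambda>i. abs_L2 (t i)) \<longlonglongrightarrow> abs_L2 f"
    proof (rule L2_dominated_convergence[OF tsq f])
      have "sq_integrable (\<lambda>x. \<bar>f x\<bar>)" using f by (auto simp: sq_integrable_def)
      then show "sq_integrable (\<lambda>x. 3 * \<bar>f x\<bar>)" by (rule sq_integrable_scale)
      show "(\<lambda>i. t i x) \<longlonglongrightarrow> f x" for x
      proof -
        obtain N where N: "norm x < real N" using reals_Archimedean2 by blast
        then have "eventually (\<lambda>i. s i x = t i x) sequentially"
          unfolding eventually_sequentially
          by (intro exI[of _ N]) (auto simp: t_def indicator_def)
        then show ?thesis using s(2)[of x] tendsto_cong by fast
      qed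
      show "\<bar>t i x - f x\<bar> \<le> 3 * \<bar>f x\<bar>" for i x
        using s(3)[of i x] by (auto simp: t_def indicator_def)
    qed
    then have "abs_L2 f \<in> closure D" by (rule Dlim) (rule tD)
    then show ?thesis by (simp add: f_def abs_rep_L2)
  qed
  then have "closure D = UNIV" by blast
  then show "\<exists>B::'a L2 set set. countable B \<and> open = generate_topology B"
    using countable_dense_imp_countable_subbasis[OF D(1)] by blast
qed

section \<open>Domains and test functions\<close>

text \<open>Up to the choice of an orthonormal frame with last vector \<open>e\<close>, the set lies locally
  strictly above the graph of a Lipschitz function on the hyperplane orthogonal to \<open>e\<close>.
  Since \<open>U\<close> is open, the part of the frontier in \<open>U\<close> is then the graph itself.\<close>

definition lipschitz_boundary :: "'a::euclidean_space set \<Rightarrow> bool" where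
  "lipschitz_boundary \<Omega> \<longleftrightarrow>
    (\<forall>p\<in>frontier \<Omega>. \<exists>U e g L. open U \<and> p \<in> U \<and> norm e = 1 \<and>
      L-lipschitz_on {y. y \<bullet> e = 0} (g :: 'a \<Rightarrow> real) \<and>
      \<Omega> \<inter> U = {x \<in> U. g (x - (x \<bullet> e) *\<^sub>R e) < x \<bullet> e})"

primrec Ck :: "nat \<Rightarrow> ('a::euclidean_space \<Rightarrow> real) \<Rightarrow> bool" where
  "Ck 0 f \<longleftrightarrow> continuous_on UNIV f"
| "Ck (Suc k) f \<longleftrightarrow> f differentiable_on UNIV \<and>
    (\<forall>b\<in>Basis. Ck k (\<lambda>x. frechet_derivative f (at x) b))"

text \<open>The functions of \<open>C\<^sup>\<infinity>\<close> with compact support in \<open>\<Omega>\<close>, already extended by zero to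
  the whole space.\<close>

definition Cc_infty :: "'a::euclidean_space set \<Rightarrow> ('a \<Rightarrow> real) set" where
  "Cc_infty \<Omega> = {\<phi>. (\<forall>k. Ck k \<phi>) \<and> compact (closure {x. \<phi> x \<noteq> 0}) \<and> closure {x. \<phi> x \<noteq> 0} \<subseteq> \<Omega>}"

text \<open>A function on \<open>\<Omega>\<close> is identified with its extension by zero.\<close>

definition L2_on :: "'a::euclidean_space set \<Rightarrow> 'a L2 set" where
  "L2_on \<Omega> = {u. AE x in lborel. x \<notin> \<Omega> \<longrightarrow> rep_L2 u x = 0}"

definition L2_pairing :: "'a::euclidean_space set \<Rightarrow> 'a L2 \<Rightarrow> ('a \<Rightarrow> real) \<Rightarrow> real" where
  "L2_pairing \<Omega> u g = (LINT x:\<Omega>|lborel. rep_L2 u x * g x)"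

section \<open>The fractional energies and the fractional Laplacian\<close>

text \<open>The value of the integrands below at the singularity is irrelevant (it is \<open>0\<close>, as
  \<open>x / 0 = 0\<close>).\<close>

definition gagliardo_sq :: "real \<Rightarrow> ('a::euclidean_space \<Rightarrow> real) \<Rightarrow> ennreal" where
  "gagliardo_sq s v =
    (\<integral>\<^sup>+x. \<integral>\<^sup>+y. ennreal (\<bar>v x - v y\<bar>\<^sup>2 / norm (x - y) powr (real DIM('a) + 2 * s)) \<partial>lborel \<partial>lborel)"

definition frac_energy :: "real \<Rightarrow> 'a::euclidean_space L2 \<Rightarrow> ennreal" where
  "frac_energy s u = ennreal (1/2) * gagliardo_sq s (rep_L2 u)"

definition dim_omega :: "'a::euclidean_space itself \<Rightarrow> real" where
  "dim_omega _ = real DIM('a) * measure lborel (ball (0::'a) 1)"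

definition zero_energy :: "'a::euclidean_space L2 \<Rightarrow> real" where
  "zero_energy u = dim_omega TYPE('a) / 2 * (norm u)\<^sup>2"

text \<open>The completion of \<open>Cc_infty \<Omega>\<close> with respect to \<open>[\<cdot>]\<^sub>s\<close>, realized inside \<open>L\<^sup>2(\<Omega>)\<close>:
  for bounded \<open>\<Omega>\<close> the fractional Poincare inequality makes \<open>[\<cdot>]\<^sub>s\<close>-Cauchy sequences
  converge in \<open>L\<^sup>2(\<Omega>)\<close>, so that the elements of the completion are the
  \<open>L\<^sup>2\<close> functions below.\<close>

definition H0s :: "real \<Rightarrow> 'a::euclidean_space set \<Rightarrow> 'a L2 set" where
  "H0s s \<Omega> = {u \<in> L2_on \<Omega>. \<exists>\<phi>. (\<forall>k. \<phi> k \<in> Cc_infty \<Omega>) \<and>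
    (\<lambda>k::nat. gagliardo_sq s (\<lambda>x. \<phi> k x - rep_L2 u x)) \<longlonglongrightarrow> 0}"

definition frac_laplacian :: "real \<Rightarrow> ('a::euclidean_space \<Rightarrow> real) \<Rightarrow> 'a \<Rightarrow> real" where
  "frac_laplacian s \<psi> x =
    (LINT z|lborel. (2 * \<psi> x - \<psi> (x + z) - \<psi> (x - z)) / norm z powr (real DIM('a) + 2 * s))"

definition frac_laplacian_dual ::
    "'a::euclidean_space set \<Rightarrow> real \<Rightarrow> 'a L2 \<Rightarrow> ('a \<Rightarrow> real) \<Rightarrow> real" where
  "frac_laplacian_dual \<Omega> s u \<phi> = L2_pairing \<Omega> u (frac_laplacian s \<phi>)"

definition frac_laplacian_in_L2 :: "'a::euclidean_space set \<Rightarrow> real \<Rightarrow> 'a L2 \<Rightarrow> bool" where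
  "frac_laplacian_in_L2 \<Omega> s u \<longleftrightarrow> u \<in> H0s s \<Omega> \<and>
    (\<exists>f\<in>L2_on \<Omega>. \<forall>\<phi>\<in>Cc_infty \<Omega>. frac_laplacian_dual \<Omega> s u \<phi> = L2_pairing \<Omega> f \<phi>)"

section \<open>Bochner--Sobolev spaces\<close>

text \<open>Functions on the interval \<open>I\<close> with values in a closed subspace \<open>X\<close> of a separable
  Hilbert space; values outside \<open>I\<close> play no role. By separability, Borel measurability is
  strong measurability. Members of \<open>H1_time I X\<close> are the continuous representatives.\<close>

definition L2_time ::
    "real set \<Rightarrow> 'b::{real_inner, banach, second_countable_topology} set \<Rightarrow> (real \<Rightarrow> 'b) set" where
  "L2_time I X = {v. set_borel_measurable lborel I v \<and> (AE t in lborel. t \<in> I \<longrightarrow> v t \<in> X) \<and>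
    set_integrable lborel I (\<lambda>t. (norm (v t))\<^sup>2)}"

definition weak_deriv ::
    "real set \<Rightarrow> (real \<Rightarrow> 'b::{real_inner, banach, second_countable_topology}) \<Rightarrow> (real \<Rightarrow> 'b) \<Rightarrow> bool" where
  "weak_deriv I u v \<longleftrightarrow> (\<forall>\<eta>\<in>Cc_infty (interior I).
    (LINT t:I|lborel. deriv \<eta> t *\<^sub>R u t) = - (LINT t:I|lborel. \<eta> t *\<^sub>R v t))"

definition H1_time ::
    "real set \<Rightarrow> 'b::{real_inner, banach, second_countable_topology} set \<Rightarrow> (real \<Rightarrow> 'b) set" where
  "H1_time I X = {u \<in> L2_time I X. continuous_on I u \<and> (\<forall>t\<in>I. u t \<in> X) \<and>
    (\<exists>v\<in>L2_time I X. weak_deriv I u v)}"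

text \<open>On an interval \<open>I\<close>, the weak derivative of a member of \<open>H1_time I X\<close> is unique up to
  null sets, so the choice of a representative below is immaterial.\<close>

definition time_deriv ::
    "real set \<Rightarrow> 'b::{real_inner, banach, second_countable_topology} set \<Rightarrow> (real \<Rightarrow> 'b) \<Rightarrow> real \<Rightarrow> 'b" where
  "time_deriv I X u = (SOME v. v \<in> L2_time I X \<and> weak_deriv I u v)"

definition H1_inner ::
    "real set \<Rightarrow> 'b::{real_inner, banach, second_countable_topology} set \<Rightarrow> (real \<Rightarrow> 'b) \<Rightarrow> (real \<Rightarrow> 'b) \<Rightarrow> real" where
  "H1_inner I X u w = (LINT t:I|lborel. u t \<bullet> w t) +
    (LINT t:I|lborel. time_deriv I X u t \<bullet> time_deriv I X w t)"

definition H1_norm ::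
    "real set \<Rightarrow> 'b::{real_inner, banach, second_countable_topology} set \<Rightarrow> (real \<Rightarrow> 'b) \<Rightarrow> real" where
  "H1_norm I X u = sqrt (H1_inner I X u u)"

text \<open>Weak convergence in the Hilbert space \<open>H\<^sup>1(I; X)\<close>, tested with the scalar product.\<close>

definition H1_weak_lim ::
    "real set \<Rightarrow> 'b::{real_inner, banach, second_countable_topology} set \<Rightarrow>
     (nat \<Rightarrow> real \<Rightarrow> 'b) \<Rightarrow> (real \<Rightarrow> 'b) \<Rightarrow> bool" where
  "H1_weak_lim I X f g \<longleftrightarrow> (\<forall>n. f n \<in> H1_time I X) \<and> g \<in> H1_time I X \<and>
    (\<forall>w\<in>H1_time I X. (\<lambda>n. H1_inner I X (f n) w) \<longlonglongrightarrow> H1_inner I X g w)"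

definition H1_strong_lim ::
    "real set \<Rightarrow> 'b::{real_inner, banach, second_countable_topology} set \<Rightarrow>
     (nat \<Rightarrow> real \<Rightarrow> 'b) \<Rightarrow> (real \<Rightarrow> 'b) \<Rightarrow> bool" where
  "H1_strong_lim I X f g \<longleftrightarrow> (\<forall>n. f n \<in> H1_time I X) \<and> g \<in> H1_time I X \<and>
    (\<lambda>n. H1_norm I X (\<lambda>t. f n t - g t)) \<longlonglongrightarrow> 0"

section \<open>The Cauchy problems\<close>

definition solves_frac_cauchy ::
    "'a::euclidean_space set \<Rightarrow> real \<Rightarrow> 'a L2 \<Rightarrow> (real \<Rightarrow> 'a L2) \<Rightarrow> bool" where
  "solves_frac_cauchy \<Omega> s u0 u \<longleftrightarrow> u \<in> H1_time {0..} (L2_on \<Omega>) \<and> u 0 = u0 \<and>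
    (AE t in lborel. t \<in> {0..} \<longrightarrow> u t \<in> H0s s \<Omega> \<and>
      (\<forall>\<phi>\<in>Cc_infty \<Omega>. L2_pairing \<Omega> (time_deriv {0..} (L2_on \<Omega>) u t) \<phi>
        = - s * frac_laplacian_dual \<Omega> s (u t) \<phi>))"

definition solves_limit_cauchy ::
    "'a::euclidean_space set \<Rightarrow> real \<Rightarrow> 'a L2 \<Rightarrow> (real \<Rightarrow> 'a L2) \<Rightarrow> bool" where
  "solves_limit_cauchy \<Omega> T u0 u \<longleftrightarrow> u \<in> H1_time {0..T} (L2_on \<Omega>) \<and> u 0 = u0 \<and>
    (AE t in lborel. t \<in> {0<..<T} \<longrightarrow>
      time_deriv {0..T} (L2_on \<Omega>) u t = - dim_omega TYPE('a) *\<^sub>R u t)"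

end

theory Submission imports Defs "HOL-Computational_Algebra.Polynomial" begin

text \<open>
  Put \<open>T u (x, y) = \<surd>s (u(x) - u(y)) / |x - y|\<^bsup>d/2 + s\<^esup>\<close>. Then \<open>T\<close> is a closed operator into
  \<open>L\<^sup>2\<close> of the product space with \<open>s F\<^sup>s(u) = \<parallel>T u\<parallel>\<^sup>2 / 2\<close>, and the fractional Cauchy problem is
  the weak form \<open>\<langle>u\<^sub>t, y\<rangle> = - \<langle>T u, T y\<rangle>\<close> of its gradient flow. The Yosida approximations of
  \<open>T\<^sup>*T\<close> are bounded, and the moments \<open>\<langle>(T\<^sup>*T)\<^sup>j u, u\<rangle>\<close>, which decrease along the flow, give solutions
  with bounds on speed and acceleration at times \<open>t > 0\<close> that depend only on \<open>t\<close> and on the initial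
  energy, hence are uniform in \<open>n\<close>.

  For a test function \<open>\<phi>\<close> the functions \<open>s (-\<Delta>)\<^sup>s \<phi>\<close> converge to \<open>d \<omega>\<^sub>d \<phi>\<close> in \<open>L\<^sup>2\<close>. Comparing
  \<open>u\<^sub>n\<close> with \<open>e\<^bsup>-d \<omega>\<^sub>d t\<^esup> \<phi>\<close>, with \<open>\<phi>\<close> close to the initial datum, yields \<open>u\<^sub>n(t) \<rightarrow> u(t)\<close> for each
  \<open>t\<close>, and the uniform Taylor bounds turn this into convergence of the velocities for \<open>t > 0\<close>. As
  the energy is \<open>-\<langle>u\<^sub>t, u\<rangle> / 2\<close>, it converges as well. Weak \<open>H\<^sup>1\<close> convergence follows from the
  uniform \<open>H\<^sup>1\<close> bound; if the initial energies converge, the energy inequality excludes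
  concentration of the velocities at \<open>t = 0\<close> and the convergence is strong.
\<close>

section \<open>Flows of bounded symmetric operators\<close>

text \<open>The form domains \<open>H0s (s n) \<Omega>\<close> change with \<open>n\<close>, and as
  \<open>s n\<close> tends to 0 the seminorm bounds carry no more compactness than an
  \<open>L2\<close> bound. The comparison with explicit paths is possible because test functions
  belong to all these domains. The rate \<open>dim_omega\<close> is \<open>s\<close> times twice the
  kernel mass outside the unit ball; the factor 2 is the coefficient of \<open>\<phi> x\<close> in
  the second difference. Moments of all integer orders, odd ones included, stand in for spectral
  calculus, so neither square roots nor adjoints are constructed. Every bound depends only on
  \<open>norm (T x)\<close>, which the scaling by \<open>s\<close> keeps finite, but the bounds on
  speed and acceleration blow up at \<open>t = 0\<close>. Hence velocities are controlled for
  \<open>t > 0\<close>, and integrals over \<open>[0, T]\<close> are split at a small time.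
  Solutions are only weakly differentiable and solve the equation for almost every time, so
  uniqueness needs a fundamental theorem of calculus for weak derivatives and a contraction estimate
  that avoids the product rule.\<close>

lemma bounded_linear_funpow:
  fixes B :: "'b::real_normed_vector \<Rightarrow> 'b"
  assumes "bounded_linear B"
  shows "bounded_linear (B ^^ n)"
proof (induction n)
  case (Suc n)
  then show ?case using bounded_linear_compose[OF assms Suc] by (simp add: o_def)
qed (simp add: id_def bounded_linear_ident)

text \<open>The solution is the exponential series of \<open>- t B\<close> applied to
  \<open>x\<close>. Differentiating a term gives \<open>- B\<close> of the preceding term, and the
  Weierstrass test on bounded sets of times justifies termwise differentiation.\<close>

lemma linear_flow_exists:
  fixes B :: "'b::banach \<Rightarrow> 'b"
  assumes B: "bounded_linear B"
  obtains u where "u 0 = x" "\<And>t. (u has_vector_derivative - B (u t)) (at t)"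
proof -
  interpret B: bounded_linear B by (rule B)
  obtain K where K: "K > 0" "\<And>y. norm (B y) \<le> norm y * K"
    using B.pos_bounded by blast
  define c where "c n t = (-t) ^ n / fact n" for n and t :: real
  have c0: "c 0 t = 1" for t by (simp add: c_def)
  have cd: "(c n has_real_derivative (if n = 0 then 0 else - c (n - 1) t)) (at t within S)" for n t S
  proof (cases n)
    case (Suc m)
    have "(c (Suc m) has_real_derivative (real (Suc m) * (-t) ^ m * (-1)) / fact (Suc m)) (at t within S)"
      unfolding c_def
      by (rule DERIV_cdivide, rule DERIV_cong[OF DERIV_power[OF DERIV_minus[OF DERIV_ident]]]) simp
    also have "(real (Suc m) * (-t) ^ m * (-1)) / fact (Suc m) = - c m t"
      by (simp add: c_def fact_Suc del: of_nat_Suc)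
    finally show ?thesis by (simp add: Suc)
  qed (simp add: c0[abs_def])
  define f where "f n t = c n t *\<^sub>R (B ^^ n) x" for n t
  define f' where "f' n t = (if n = 0 then 0 else - c (n - 1) t *\<^sub>R (B ^^ n) x)" for n t
  have pow: "norm ((B ^^ n) x) \<le> K ^ n * norm x" for n
  proof (induction n)
    case (Suc n)
    have "norm ((B ^^ Suc n) x) \<le> norm ((B ^^ n) x) * K" using K(2) by simp
    also have "\<dots> \<le> K ^ n * norm x * K" using Suc K(1) by (intro mult_right_mono) auto
    finally show ?case by (simp add: mult_ac)
  qed simp
  have cb: "\<bar>c n t\<bar> \<le> R ^ n / fact n" if "\<bar>t\<bar> \<le> R" for n t R
    using that by (auto simp: c_def power_abs intro!: divide_right_mono power_mono)
  have fsum: "summable (\<lambda>n. f n t)" for t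
  proof (rule summable_comparison_test')
    show "summable (\<lambda>n. norm x * ((\<bar>t\<bar> * K) ^ n / fact n))"
      using summable_exp[of "\<bar>t\<bar> * K"] by (intro summable_mult) (simp add: field_simps)
    fix n
    have "norm (f n t) = \<bar>c n t\<bar> * norm ((B ^^ n) x)" by (simp add: f_def)
    also have "\<dots> \<le> (\<bar>t\<bar> ^ n / fact n) * (K ^ n * norm x)"
      by (intro mult_mono cb pow) auto
    finally show "norm (f n t) \<le> norm x * ((\<bar>t\<bar> * K) ^ n / fact n)"
      by (simp add: power_mult_distrib mult_ac)
  qed
  define u where "u t = (\<Sum>n. f n t)" for t
  have f'sum: "(\<lambda>n. f' n t) sums (- B (u t))" for t
  proof -
    have "(\<lambda>n. f n t) sums u t" unfolding u_def using fsum by (rule summable_sums)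
    then have "(\<lambda>n. - B (f n t)) sums (- B (u t))" by (intro sums_minus B.sums)
    also have "(\<lambda>n. - B (f n t)) = (\<lambda>n. f' (Suc n) t)"
      by (auto simp: f_def f'_def B.scaleR)
    finally have "(\<lambda>n. f' n t) sums (- B (u t) + f' 0 t)" by (rule sums_Suc)
    then show ?thesis by (simp add: f'_def)
  qed
  have der: "(u has_vector_derivative - B (u t)) (at t)" for t
  proof -
    \<comment> \<open>The majorants grow with the time, so uniform convergence is available on
      bounded sets only; this ball is chosen to contain both \<open>t\<close> and 0.\<close>
    define R where "R = \<bar>t\<bar> + 1"
    define M where "M n = (if n = 0 then 0 else (R ^ (n-1) / fact (n-1)) * (K ^ n * norm x))" for n
    have "summable (\<lambda>n. M (Suc n))"
    proof -
      have "summable (\<lambda>n. K * norm x * ((R * K) ^ n / fact n))"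
        using summable_exp[of "R * K"] by (intro summable_mult) (simp add: field_simps)
      also have "(\<lambda>n. K * norm x * ((R * K) ^ n / fact n)) = (\<lambda>n. M (Suc n))"
        by (auto simp: M_def power_mult_distrib mult_ac)
      finally show ?thesis .
    qed
    then have M: "summable M" by (simp add: summable_Suc_iff)
    have "uniform_limit (ball 0 R) (\<lambda>n t. \<Sum>i<n. f' i t) (\<lambda>t. \<Sum>i. f' i t) sequentially"
    proof (rule Weierstrass_m_test[OF _ M])
      fix n and s :: real assume "s \<in> ball 0 R"
      then have s: "\<bar>s\<bar> \<le> R" by simp
      show "norm (f' n s) \<le> M n"
      proof (cases "n = 0")
        case False
        then have "norm (f' n s) = \<bar>c (n-1) s\<bar> * norm ((B ^^ n) x)" by (simp add: f'_def)
        also have "\<dots> \<le> (R ^ (n-1) / fact (n-1)) * (K ^ n * norm x)"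
          using s by (intro mult_mono cb pow) (auto simp: R_def)
        finally show ?thesis using False by (simp add: M_def)
      qed (simp add: f'_def M_def)
    qed
    then have ul: "uniform_limit (ball 0 R) (\<lambda>n t. \<Sum>i<n. f' i t) (\<lambda>t. - B (u t)) sequentially"
      using f'sum by (simp add: sums_iff)
    have "\<exists>g. \<forall>s\<in>ball 0 R. (\<lambda>n. f n s) sums g s \<and>
        (g has_derivative (\<lambda>h. h *\<^sub>R (- B (u s)))) (at s within ball 0 R)"
    proof (rule has_derivative_series[where f' = "\<lambda>n s h. h *\<^sub>R f' n s" and x = 0])
      fix n and s :: real
      have "(f n has_vector_derivative (if n = 0 then 0 else - c (n - 1) s) *\<^sub>R (B ^^ n) x) (at s within ball 0 R)"
        unfolding f_def by (rule has_vector_derivative_eq_rhs[OF has_vector_derivative_scaleR[OF cd has_vector_derivative_const]]) simp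
      then show "(f n has_derivative (\<lambda>h. h *\<^sub>R f' n s)) (at s within ball 0 R)"
        by (auto simp: has_vector_derivative_def f'_def split: if_splits)
    next
      fix e :: real assume "e > 0"
      from uniform_limitD[OF ul this]
      show "\<forall>\<^sub>F n in sequentially. \<forall>s\<in>ball 0 R. \<forall>h. norm ((\<Sum>i<n. h *\<^sub>R f' i s) - h *\<^sub>R (- B (u s))) \<le> e * norm h"
      proof eventually_elim
        case (elim n)
        show ?case
        proof (intro ballI allI)
          fix s h :: real assume "s \<in> ball 0 R"
          with elim have *: "norm ((\<Sum>i<n. f' i s) - (- B (u s))) \<le> e"
            by (force simp: dist_norm)
          have "(\<Sum>i<n. h *\<^sub>R f' i s) - h *\<^sub>R (- B (u s)) = h *\<^sub>R ((\<Sum>i<n. f' i s) - (- B (u s)))"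
            by (simp add: scaleR_right_diff_distrib scaleR_sum_right scaleR_right_distrib)
          then have "norm ((\<Sum>i<n. h *\<^sub>R f' i s) - h *\<^sub>R (- B (u s))) = \<bar>h\<bar> * norm ((\<Sum>i<n. f' i s) - (- B (u s)))"
            by simp
          also have "\<dots> \<le> \<bar>h\<bar> * e" by (intro mult_left_mono *) auto
          finally show "norm ((\<Sum>i<n. h *\<^sub>R f' i s) - h *\<^sub>R (- B (u s))) \<le> e * norm h"
            by (simp add: mult.commute)
        qed
      qed
    next
      show "(\<lambda>n. f n 0) sums u 0" unfolding u_def using fsum by (rule summable_sums)
    qed (auto simp: R_def)
    then obtain g where g: "\<And>s. s \<in> ball 0 R \<Longrightarrow> (\<lambda>n. f n s) sums g s"
       "\<And>s. s \<in> ball 0 R \<Longrightarrow> (g has_derivative (\<lambda>h. h *\<^sub>R (- B (u s)))) (at s within ball 0 R)" by blast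
    have t: "t \<in> ball 0 R" by (simp add: R_def)
    have gu: "g s = u s" if "s \<in> ball 0 R" for s
      using g(1)[OF that] by (simp add: u_def sums_iff)
    have "(u has_derivative (\<lambda>h. h *\<^sub>R (- B (u t)))) (at t within ball 0 R)"
      by (rule has_derivative_transform[OF t _ g(2)[OF t]]) (simp add: gu)
    then show ?thesis
      using t by (simp add: has_vector_derivative_def at_within_open[OF t])
  qed
  have "u 0 = x"
  proof -
    have "f n 0 = (if n = 0 then x else 0)" for n by (auto simp: f_def c_def)
    then show ?thesis by (simp add: u_def sums_unique[OF sums_single, symmetric])
  qed
  then show thesis using der that by blast
qed

text \<open>Moving one factor \<open>B\<close> to the other side turns order \<open>n + 2\<close> at
  \<open>x\<close> into order \<open>n\<close> at \<open>B x\<close>. The induction therefore goes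
  in steps of two, and odd orders are reduced to the nonnegativity of \<open>B\<close>
  itself.\<close>

lemma symmetric_funpow_nonneg:
  fixes B :: "'b::real_inner \<Rightarrow> 'b"
  assumes sym: "\<And>x y. B x \<bullet> y = x \<bullet> B y" and nonneg: "\<And>x. 0 \<le> B x \<bullet> x"
  shows "0 \<le> (B ^^ j) x \<bullet> x"
proof (induction j arbitrary: x rule: induct_nat_012)
  case (ge2 n)
  have "(B ^^ Suc (Suc n)) x \<bullet> x = B ((B ^^ n) (B x)) \<bullet> x"
    by (simp only: funpow_simps_right(2) o_apply funpow_swap1)
  also have "\<dots> = (B ^^ n) (B x) \<bullet> B x" by (rule sym)
  finally have "(B ^^ Suc (Suc n)) x \<bullet> x = (B ^^ n) (B x) \<bullet> B x" .
  with ge2(1)[of "B x"] show ?case by simp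
qed (simp_all add: nonneg)

text \<open>The segment may run in either direction, so that increments of both signs are covered by
  one statement.\<close>

lemma norm_diff_le_of_derivative_bound:
  fixes f :: "real \<Rightarrow> 'b::real_inner"
  assumes "\<And>q. q \<in> closed_segment a b \<Longrightarrow> (f has_vector_derivative f' q) (at q)"
    and "\<And>q. q \<in> closed_segment a b \<Longrightarrow> norm (f' q) \<le> M"
  shows "norm (f b - f a) \<le> \<bar>b - a\<bar> * M"
proof -
  have "norm (f b - f a) \<le> M * norm (b - a)"
  proof (rule differentiable_bound[of "closed_segment a b" f "\<lambda>q h. h *\<^sub>R f' q"])
    show "onorm (\<lambda>h. h *\<^sub>R f' q) \<le> M" if "q \<in> closed_segment a b" for q
      using assms(2)[OF that] norm_ge_zero[of "f' q"]
      by (intro onorm_bound) (auto intro!: mult_left_mono simp: mult.commute[of M] simp del: norm_ge_zero)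
  qed (use assms(1) in \<open>auto simp: has_vector_derivative_def intro: has_derivative_at_withinI\<close>)
  then show ?thesis by (simp add: mult.commute)
qed

section \<open>Moments along the flow of a bounded symmetric operator\<close>

locale symmetric_flow =
  fixes B :: "'b::{real_inner, banach} \<Rightarrow> 'b" and u :: "real \<Rightarrow> 'b"
  assumes bounded_linear: "bounded_linear B"
    and symmetric: "\<And>x y. B x \<bullet> y = x \<bullet> B y"
    and nonneg: "\<And>x. 0 \<le> B x \<bullet> x"
    and flow: "\<And>t. (u has_vector_derivative - B (u t)) (at t)"
begin

text \<open>Formally the squared norm of \<open>B^(j/2) (u t)\<close>, written without fractional
  powers.\<close>

definition moment :: "nat \<Rightarrow> real \<Rightarrow> real" where
  "moment j t = (B ^^ j) (u t) \<bullet> u t"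

lemma funpow_flow: "((\<lambda>t. (B ^^ j) (u t)) has_vector_derivative - (B ^^ Suc j) (u t)) (at t)"
proof -
  interpret Bj: bounded_linear "B ^^ j"
    by (rule bounded_linear_funpow[OF bounded_linear])
  show ?thesis
    using Bj.has_vector_derivative[OF flow] by (simp add: linear_neg[OF Bj.linear_axioms] funpow_swap1)
qed

lemma moment_nonneg: "0 \<le> moment j t"
  unfolding moment_def by (intro symmetric_funpow_nonneg symmetric nonneg)

lemma funpow_symmetric: "(B ^^ j) x \<bullet> y = x \<bullet> (B ^^ j) y"
  by (induction j arbitrary: x) (simp_all add: symmetric funpow_swap1)

text \<open>Symmetry merges the two terms of the product rule. Each moment is thus dissipated at
  twice the rate of the next one, which is nonnegative, so the whole hierarchy is
  nonincreasing.\<close>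

lemma moment_deriv: "(moment j has_real_derivative - 2 * moment (Suc j) t) (at t)"
proof -
  have "((\<lambda>t. (B ^^ j) (u t) \<bullet> u t) has_derivative
    (\<lambda>h. (B ^^ j) (u t) \<bullet> (h *\<^sub>R (- B (u t))) + (h *\<^sub>R (- (B ^^ Suc j) (u t))) \<bullet> u t)) (at t)"
    using flow funpow_flow unfolding has_vector_derivative_def by (intro has_derivative_inner) auto
  also have "(B ^^ j) (u t) \<bullet> B (u t) = (B ^^ Suc j) (u t) \<bullet> u t"
    by (simp add: symmetric)
  then have "(\<lambda>h. (B ^^ j) (u t) \<bullet> (h *\<^sub>R (- B (u t))) + (h *\<^sub>R (- (B ^^ Suc j) (u t))) \<bullet> u t)
      = (*) (- 2 * moment (Suc j) t)"
    by (simp add: moment_def fun_eq_iff)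
  finally show ?thesis
    by (simp only: has_field_derivative_def moment_def[of j, abs_def])
qed

lemma moment_antimono: "r \<le> t \<Longrightarrow> moment j t \<le> moment j r"
  by (rule DERIV_nonpos_imp_nonincreasing[of r t])
    (auto intro!: exI[of _ "- 2 * moment (Suc j) _"] moment_deriv moment_nonneg)

text \<open>The mean value theorem finds a time \<open>z\<close> in \<open>(a, t)\<close> at which
  twice the next moment equals the mean rate of loss; monotonicity carries the bound from
  \<open>z\<close> to \<open>t\<close>. This is parabolic smoothing in quantitative form: one factor
  \<open>1 / (t - a)\<close> buys one power of \<open>B\<close>.\<close>

lemma moment_Suc_bound:
  assumes "a < t"
  shows "moment (Suc j) t \<le> moment j a / (2 * (t - a))"
proof -
  obtain z where z: "a < z" "z < t" "moment j t - moment j a = (t - a) * (- 2 * moment (Suc j) z)"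
    using MVT2[OF assms, of "moment j" "\<lambda>t. - 2 * moment (Suc j) t"] moment_deriv by auto
  have "2 * (t - a) * moment (Suc j) t \<le> 2 * (t - a) * moment (Suc j) z"
    using moment_antimono[of z t] z assms by (intro mult_left_mono) auto
  also have "\<dots> \<le> moment j a"
    using z(3) moment_nonneg[of j t] by (simp add: algebra_simps)
  finally show ?thesis using assms by (simp add: field_simps)
qed

lemma moment_two: "moment 2 t = (norm (B (u t)))\<^sup>2"
  using symmetric[of "B (u t)" "u t"] by (simp add: moment_def numeral_2_eq_2 dot_square_norm)

lemma moment_four: "moment 4 t = (norm (B (B (u t))))\<^sup>2"
  using funpow_symmetric[of 2 "B (B (u t))" "u t"]
  by (simp add: moment_def eval_nat_numeral dot_square_norm del: inner_real_def)

lemma velocity_bound: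
  assumes "0 < t"
  shows "(norm (B (u t)))\<^sup>2 \<le> moment 1 0 / (2 * t)"
  using moment_Suc_bound[OF assms, of 1] moment_two by (simp add: numeral_2_eq_2)

text \<open>Three successive moment bounds, one on each third of \<open>[0, t]\<close>.\<close>

lemma acceleration_bound:
  assumes "0 < t"
  shows "(norm (B (B (u t))))\<^sup>2 \<le> (3 / (2 * t)) ^ 3 * moment 1 0"
proof -
  have "moment 2 (t / 3) \<le> (3 / (2 * t)) * moment 1 0"
    using moment_Suc_bound[of 0 "t / 3" 1] assms by (simp add: numeral_2_eq_2 field_simps)
  moreover have "moment 3 (2 * t / 3) \<le> (3 / (2 * t)) * moment 2 (t / 3)"
    using moment_Suc_bound[of "t / 3" "2 * t / 3" 2] assms by (simp add: eval_nat_numeral field_simps)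
  moreover have "moment 4 t \<le> (3 / (2 * t)) * moment 3 (2 * t / 3)"
    using moment_Suc_bound[of "2 * t / 3" t 3] assms by (simp add: eval_nat_numeral field_simps)
  moreover have "0 \<le> 3 / (2 * t)" using assms by simp
  ultimately have "moment 4 t \<le> (3 / (2 * t)) * ((3 / (2 * t)) * ((3 / (2 * t)) * moment 1 0))"
    by (meson mult_left_mono order_trans)
  then show ?thesis by (simp add: moment_four power3_eq_cube mult.assoc)
qed

text \<open>The second derivative of the flow is \<open>B (B (u r))\<close>. The mean value
  inequality is applied twice, to the velocity and then to the remainder, hence no factor
  \<open>1 / 2\<close>.\<close>

lemma taylor_bound:
  assumes "0 < t" "\<bar>h\<bar> \<le> t / 2"
  shows "norm (u (t + h) - u t - h *\<^sub>R (- B (u t))) \<le> h\<^sup>2 * sqrt (27 * moment 1 0 / t ^ 3)"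
proof -
  \<comment> \<open>All times involved are at least \<open>t / 2\<close>, and
    \<open>(3 / (2 * r)) ^ 3\<close> at \<open>r = t / 2\<close> is
    \<open>27 / t ^ 3\<close>.\<close>
  define M where "M = sqrt (27 * moment 1 0 / t ^ 3)"
  have M0: "0 \<le> M" using moment_nonneg assms by (simp add: M_def)
  have acc: "norm (B (B (u r))) \<le> M" if "t / 2 \<le> r" for r
  proof -
    have "(norm (B (B (u r))))\<^sup>2 \<le> moment 4 (t / 2)"
      using moment_antimono[OF that, of 4] by (simp add: moment_four)
    also have "\<dots> \<le> (3 / t) ^ 3 * moment 1 0"
      using acceleration_bound[of "t / 2"] assms by (simp add: moment_four)
    also have "\<dots> = 27 * moment 1 0 / t ^ 3" by (simp add: power3_eq_cube)
    finally show ?thesis unfolding M_def by (rule real_le_rsqrt)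
  qed
  define S where "S = closed_segment t (t + h)"
  have S: "r \<in> S \<Longrightarrow> t / 2 \<le> r \<and> \<bar>r - t\<bar> \<le> \<bar>h\<bar>" for r
    using assms unfolding S_def closed_segment_eq_real_ivl by (auto split: if_splits)
  have vel: "norm (- B (u r) - - B (u t)) \<le> \<bar>h\<bar> * M" if "r \<in> S" for r
  proof -
    have "norm (- B (u r) - - B (u t)) \<le> \<bar>r - t\<bar> * M"
    proof (rule norm_diff_le_of_derivative_bound)
      show "((\<lambda>t. - B (u t)) has_vector_derivative B (B (u q))) (at q)" for q
        using has_vector_derivative_minus[OF funpow_flow[of 1 q]] by simp
      show "norm (B (B (u q))) \<le> M" if "q \<in> closed_segment t r" for q
        using that S[of q] \<open>r \<in> S\<close> subset_closed_segment[of t r t "t + h"]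
        by (intro acc) (auto simp: S_def)
    qed
    also have "\<dots> \<le> \<bar>h\<bar> * M" using S[OF that] M0 by (intro mult_right_mono) auto
    finally show ?thesis .
  qed
  have "norm ((u (t + h) - (t + h) *\<^sub>R (- B (u t))) - (u t - t *\<^sub>R (- B (u t)))) \<le> \<bar>(t + h) - t\<bar> * (\<bar>h\<bar> * M)"
  proof (rule norm_diff_le_of_derivative_bound)
    show "((\<lambda>r. u r - r *\<^sub>R (- B (u t))) has_vector_derivative - B (u q) - - B (u t)) (at q)" for q
      by (auto intro!: derivative_eq_intros flow)
    show "norm (- B (u q) - - B (u t)) \<le> \<bar>h\<bar> * M" if "q \<in> closed_segment t (t + h)" for q
      using that by (intro vel) (simp add: S_def)
  qed
  then show ?thesis
    by (simp add: M_def power2_eq_square algebra_simps)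
qed

text \<open>The squared speed is \<open>moment 2\<close>, which is the derivative of
  \<open>- moment 1 / 2\<close>.\<close>

lemma velocity_nn_integral:
  assumes "0 \<le> t"
  shows "(\<integral>\<^sup>+r. ennreal ((norm (B (u r)))\<^sup>2) * indicator {0..t} r \<partial>lborel)
    = ennreal ((moment 1 0 - moment 1 t) / 2)"
proof -
  have cont: "continuous_on UNIV (\<lambda>t. B (u t))"
    using funpow_flow[of 1] by (intro continuous_at_imp_continuous_on ballI has_vector_derivative_continuous) auto
  have "(\<integral>\<^sup>+r. ennreal ((norm (B (u r)))\<^sup>2) * indicator {0..t} r \<partial>lborel)
    = ennreal (- moment 1 t / 2 - (- moment 1 0 / 2))"
  proof (rule nn_integral_FTC_Icc)
    show "(\<lambda>r. (norm (B (u r)))\<^sup>2) \<in> borel_measurable borel"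
      by (intro borel_measurable_continuous_onI continuous_intros cont)
    show "((\<lambda>t. - moment 1 t / 2) has_real_derivative (norm (B (u r)))\<^sup>2) (at r)" for r
      using DERIV_cdivide[OF DERIV_minus[OF moment_deriv[of 1 r]], of 2] moment_two[of r]
      by (simp add: numeral_2_eq_2)
  qed (use assms in auto)
  then show ?thesis by (simp add: field_simps)
qed

end

section \<open>Gradient flows of closed operators\<close>

text \<open>\<open>T\<close> is a total function, but its laws hold on the domain \<open>V\<close>
  only. Closedness is what makes minimising sequences converge inside the domain; the adjoint enters
  only through the weak form \<open>T x \<bullet> T y\<close>.\<close>

locale closed_operator =
  fixes V :: "'b::{real_inner, banach} set" and T :: "'b \<Rightarrow> 'c::{real_inner, banach}"
  assumes zero_in: "0 \<in> V"
    and add_in: "x \<in> V \<Longrightarrow> y \<in> V \<Longrightarrow> x + y \<in> V"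
    and scale_in: "x \<in> V \<Longrightarrow> c *\<^sub>R x \<in> V"
    and T_add: "x \<in> V \<Longrightarrow> y \<in> V \<Longrightarrow> T (x + y) = T x + T y"
    and T_scale: "x \<in> V \<Longrightarrow> T (c *\<^sub>R x) = c *\<^sub>R T x"
    and closed_graph: "(\<And>k::nat. X k \<in> V) \<Longrightarrow> X \<longlonglongrightarrow> x \<Longrightarrow> (\<lambda>k. T (X k)) \<longlonglongrightarrow> z \<Longrightarrow> x \<in> V \<and> T x = z"
begin

lemma minus_in: "x \<in> V \<Longrightarrow> - x \<in> V"
  using scale_in[of x "-1"] by simp

lemma T_minus: "x \<in> V \<Longrightarrow> T (- x) = - T x"
  using T_scale[of x "-1"] by simp

lemma diff_in: "x \<in> V \<Longrightarrow> y \<in> V \<Longrightarrow> x - y \<in> V"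
  using add_in[of x "- y"] minus_in[of y] by simp

lemma T_diff: "x \<in> V \<Longrightarrow> y \<in> V \<Longrightarrow> T (x - y) = T x - T y"
  using T_add[of x "- y"] T_minus[of y] minus_in[of y] by simp

lemma limit_in:
  assumes X: "\<And>k::nat. X k \<in> V" "X \<longlonglongrightarrow> x" and C: "Cauchy (\<lambda>k. T (X k))"
  shows "x \<in> V" "(\<lambda>k. T (X k)) \<longlonglongrightarrow> T x"
proof -
  obtain y where y: "(\<lambda>k. T (X k)) \<longlonglongrightarrow> y"
    using C by (auto simp: Cauchy_convergent_iff convergent_def)
  with closed_graph[OF X y] show "x \<in> V" "(\<lambda>k. T (X k)) \<longlonglongrightarrow> T x" by auto
qed

text \<open>The resolvent is found by minimising \<open>\<lambda>v. \<parallel>v - f\<parallel>\<^sup>2 + l \<parallel>T v\<parallel>\<^sup>2\<close>; minimising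
  sequences are Cauchy by the parallelogram law.\<close>

lemma resolvent_exists:
  assumes l: "0 < l"
  shows "\<exists>v\<in>V. \<forall>y\<in>V. v \<bullet> y + l * (T v \<bullet> T y) = f \<bullet> y"
proof -
  define G where "G v = (norm (v - f))\<^sup>2 + l * (norm (T v))\<^sup>2" for v
  define m where "m = Inf (G ` V)"
  have G0: "0 \<le> G v" for v using l by (simp add: G_def)
  have bdd: "bdd_below (G ` V)" by (rule bdd_belowI[of _ 0]) (use G0 in auto)
  have mle: "m \<le> G v" if "v \<in> V" for v
    unfolding m_def by (rule cINF_lower[OF bdd that])
  have "\<exists>v\<in>V. G v < m + 1 / real (Suc k)" for k
    using cInf_lessD[of "G ` V" "m + 1 / real (Suc k)"] zero_in by (auto simp: m_def[symmetric])
  then obtain X where X: "\<And>k. X k \<in> V" "\<And>k. G (X k) < m + 1 / real (Suc k)" by metis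
  \<comment> \<open>The midpoint of \<open>a\<close> and \<open>b\<close> competes in the
    minimisation, so the parallelogram law, applied to both squares, bounds the distance by the
    excesses of \<open>G a\<close> and \<open>G b\<close> over \<open>m\<close>.\<close>
  have par: "(norm (a - b))\<^sup>2 + l * (norm (T a - T b))\<^sup>2 \<le> 2 * (G a - m) + 2 * (G b - m)"
    if ab: "a \<in> V" "b \<in> V" for a b
  proof -
    define N1 where "N1 = (norm ((1/2) *\<^sub>R ((a - f) + (b - f))))\<^sup>2"
    define N2 where "N2 = (norm ((1/2) *\<^sub>R (T a + T b)))\<^sup>2"
    have "(1/2) *\<^sub>R (a + b) - f = (1/2) *\<^sub>R ((a - f) + (b - f))"
      by (simp add: algebra_simps flip: scaleR_add_left)
    then have "G ((1/2) *\<^sub>R (a + b)) = N1 + l * N2"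
      using ab by (simp add: G_def N1_def N2_def T_scale T_add add_in)
    moreover have "m \<le> G ((1/2) *\<^sub>R (a + b))" using ab by (intro mle scale_in add_in)
    ultimately have "4 * m \<le> 4 * N1 + l * (4 * N2)" by simp
    moreover have pl: "4 * (norm ((1/2) *\<^sub>R (p + q)))\<^sup>2 = 2 * (norm p)\<^sup>2 + 2 * (norm q)\<^sup>2 - (norm (p - q))\<^sup>2"
      for p q :: "'d::real_inner"
      by (simp add: power2_norm_eq_inner inner_add_left inner_add_right inner_diff_left inner_diff_right inner_commute power_mult_distrib power_divide)
    note pl[of "a - f" "b - f", folded N1_def] arg_cong[OF pl[of "T a" "T b", folded N2_def], of "(*) l"]
    ultimately show ?thesis by (simp add: G_def algebra_simps)
  qed
  have conv0: "(\<lambda>k. 1 / real (Suc k)) \<longlonglongrightarrow> 0" by (rule LIMSEQ_Suc[OF lim_1_over_n])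
  have small: "(norm (X i - X j))\<^sup>2 + l * (norm (T (X i) - T (X j)))\<^sup>2 \<le> 4 / real (Suc n)"
    if "n \<le> i" "n \<le> j" for i j n
  proof -
    have "1 / real (Suc i) \<le> 1 / real (Suc n)" "1 / real (Suc j) \<le> 1 / real (Suc n)"
      using that by (auto intro!: divide_left_mono)
    then show ?thesis
      using par[of "X i" "X j"] X(1)[of i] X(1)[of j] X(2)[of i] X(2)[of j] by simp
  qed
  have "Cauchy X"
  proof (rule CauchyI)
    fix e :: real assume "0 < e"
    then obtain n where n: "4 / real (Suc n) < e\<^sup>2"
      using reals_Archimedean[of "e\<^sup>2 / 4"] by (auto simp: field_simps)
    have "norm (X i - X j) < e" if "n \<le> i" "n \<le> j" for i j
    proof -
      have "(norm (X i - X j))\<^sup>2 \<le> 4 / real (Suc n)"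
        using small[OF that] l by (smt (verit) mult_nonneg_nonneg zero_le_power2)
      with n \<open>0 < e\<close> show ?thesis by (intro power2_less_imp_less[of _ e]) auto
    qed
    then show "\<exists>M. \<forall>m\<ge>M. \<forall>n\<ge>M. norm (X m - X n) < e" by blast
  qed
  then obtain v where v: "X \<longlonglongrightarrow> v" by (auto simp: Cauchy_convergent_iff convergent_def)
  have "Cauchy (\<lambda>k. T (X k))"
  proof (rule CauchyI)
    fix e :: real assume "0 < e"
    then obtain n where n: "4 / real (Suc n) < l * e\<^sup>2"
      using reals_Archimedean[of "l * e\<^sup>2 / 4"] l by (auto simp: field_simps)
    have "norm (T (X i) - T (X j)) < e" if "n \<le> i" "n \<le> j" for i j
    proof -
      have "l * (norm (T (X i) - T (X j)))\<^sup>2 < l * e\<^sup>2"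
        using small[OF that] n by (smt (verit) zero_le_power2)
      with l \<open>0 < e\<close> show ?thesis by (intro power2_less_imp_less[of _ e]) auto
    qed
    then show "\<exists>M. \<forall>m\<ge>M. \<forall>n\<ge>M. norm (T (X m) - T (X n)) < e" by blast
  qed
  note vV = limit_in[OF X(1) v this]
  have Gv: "G v \<le> m"
  proof (rule LIMSEQ_le)
    show "(\<lambda>k. G (X k)) \<longlonglongrightarrow> G v" unfolding G_def by (intro tendsto_intros v vV)
    show "(\<lambda>k. m + 1 / real (Suc k)) \<longlonglongrightarrow> m" using tendsto_add[OF tendsto_const conv0, of m] by simp
    show "\<exists>N. \<forall>n\<ge>N. G (X n) \<le> m + 1 / real (Suc n)" using X(2) by (auto intro: less_imp_le)
  qed
  have "v \<bullet> y + l * (T v \<bullet> T y) = f \<bullet> y" if y: "y \<in> V" for y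
  proof -
    define b where "b = (v - f) \<bullet> y + l * (T v \<bullet> T y)"
    define c where "c = (norm y)\<^sup>2 + l * (norm (T y))\<^sup>2"
    have c0: "0 \<le> c" using l by (simp add: c_def)
    have norm_add_sq: "(norm (p + q))\<^sup>2 = (norm p)\<^sup>2 + 2 * (p \<bullet> q) + (norm q)\<^sup>2" for p q :: "'d::real_inner"
      by (simp add: power2_norm_eq_inner inner_add_left inner_add_right inner_commute)
    have quad: "0 \<le> 2 * t * b + t\<^sup>2 * c" for t
    proof -
      have "G v \<le> G (v + t *\<^sub>R y)" using Gv mle[of "v + t *\<^sub>R y"] vV(1) y by (simp add: add_in scale_in)
      also have "G (v + t *\<^sub>R y) = (norm ((v - f) + t *\<^sub>R y))\<^sup>2 + l * (norm (T v + t *\<^sub>R T y))\<^sup>2"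
        using vV(1) y by (simp add: G_def T_add T_scale scale_in diff_add_eq)
      also have "\<dots> = G v + (2 * t * b + t\<^sup>2 * c)"
        unfolding norm_add_sq by (simp add: G_def b_def c_def power_mult_distrib algebra_simps)
      finally show ?thesis by simp
    qed
    have "b = 0"
    proof (rule ccontr)
      assume "b \<noteq> 0"
      \<comment> \<open>A nonzero first variation \<open>b\<close> is refuted by the step
        \<open>- q\<close> in the direction \<open>y\<close>, for which the quadratic equals
        \<open>- (q^2 * (c + 2))\<close>. The summand 1 keeps the denominator positive.\<close>
      define q where "q = b / (c + 1)"
      have b: "b = q * (c + 1)" using c0 by (simp add: q_def)
      have "0 \<le> 2 * (- q) * b + (- q)\<^sup>2 * c" by (rule quad)
      also have "\<dots> = - (q\<^sup>2 * (c + 2))" by (simp add: b algebra_simps power2_eq_square)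
      also have "\<dots> < 0" using \<open>b \<noteq> 0\<close> c0 by (simp add: b)
      finally show False by simp
    qed
    then show ?thesis by (simp add: b_def inner_diff_left)
  qed
  with vV(1) show ?thesis by blast
qed

lemma zero_if_resolvent_equation:
  assumes "0 < l" "w \<in> V" "\<And>y. y \<in> V \<Longrightarrow> w \<bullet> y + l * (T w \<bullet> T y) = 0"
  shows "w = 0"
proof -
  have "(norm w)\<^sup>2 + l * (norm (T w))\<^sup>2 = 0"
    using assms(3)[OF assms(2)] by (simp add: power2_norm_eq_inner)
  then show ?thesis
    using assms(1) by (smt (verit) mult_nonneg_nonneg zero_le_power2 zero_eq_power2 norm_eq_zero)
qed

end

section \<open>Resolvents and Yosida approximations\<close>

locale yosida = closed_operator V T for V :: "'b::{real_inner, banach} set"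
    and T :: "'b \<Rightarrow> 'c::{real_inner, banach}" +
  fixes l :: real assumes l_pos: "0 < l"
begin

text \<open>The resolvent \<open>(I + l T^*T)^(-1)\<close> in weak form, tested on the domain of
  \<open>T\<close>.\<close>

definition J :: "'b \<Rightarrow> 'b" where
  "J f = (SOME v. v \<in> V \<and> (\<forall>y\<in>V. v \<bullet> y + l * (T v \<bullet> T y) = f \<bullet> y))"

text \<open>The Yosida approximation of \<open>T^*T\<close>: bounded, symmetric, and weakly equal to
  \<open>T^*T J\<close> by \<open>B_eq\<close>.\<close>

definition B :: "'b \<Rightarrow> 'b" where "B f = (1 / l) *\<^sub>R (f - J f)"

lemma J_in: "J f \<in> V" and J_eq: "y \<in> V \<Longrightarrow> J f \<bullet> y + l * (T (J f) \<bullet> T y) = f \<bullet> y"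
proof -
  have "\<exists>v. v \<in> V \<and> (\<forall>y\<in>V. v \<bullet> y + l * (T v \<bullet> T y) = f \<bullet> y)"
    using resolvent_exists[OF l_pos, of f] by blast
  from someI_ex[OF this] show "J f \<in> V" "y \<in> V \<Longrightarrow> J f \<bullet> y + l * (T (J f) \<bullet> T y) = f \<bullet> y"
    by (auto simp: J_def)
qed

lemma J_unique:
  assumes "v \<in> V" "\<And>y. y \<in> V \<Longrightarrow> v \<bullet> y + l * (T v \<bullet> T y) = f \<bullet> y"
  shows "v = J f"
proof -
  have "v - J f = 0"
    by (rule zero_if_resolvent_equation[OF l_pos])
      (use assms J_in J_eq[of _ f] in \<open>auto simp: diff_in T_diff inner_diff_left right_diff_distrib algebra_simps\<close>)
  then show ?thesis by simp
qed

lemma J_add: "J (f + g) = J f + J g"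
proof (rule J_unique[symmetric])
  fix y assume y: "y \<in> V"
  show "(J f + J g) \<bullet> y + l * (T (J f + J g) \<bullet> T y) = (f + g) \<bullet> y"
    using J_eq[OF y, of f] J_eq[OF y, of g] by (simp add: T_add J_in inner_add_left algebra_simps)
qed (simp add: add_in J_in)

lemma J_scale: "J (c *\<^sub>R f) = c *\<^sub>R J f"
proof (rule J_unique[symmetric])
  fix y assume y: "y \<in> V"
  show "(c *\<^sub>R J f) \<bullet> y + l * (T (c *\<^sub>R J f) \<bullet> T y) = (c *\<^sub>R f) \<bullet> y"
    using arg_cong[OF J_eq[OF y, of f], of "(*) c"] by (simp add: T_scale J_in algebra_simps)
qed (simp add: scale_in J_in)

lemma J_symmetric: "J f \<bullet> g = f \<bullet> J g"
  using J_eq[OF J_in[of g], of f] J_eq[OF J_in[of f], of g] by (simp add: inner_commute)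

lemma J_inner_self: "J f \<bullet> f = (norm (J f))\<^sup>2 + l * (norm (T (J f)))\<^sup>2"
  using J_eq[OF J_in[of f], of f] by (simp add: power2_norm_eq_inner inner_commute)

lemma norm_J: "norm (J f) \<le> norm f"
proof -
  have "(norm (J f))\<^sup>2 \<le> J f \<bullet> f" using l_pos by (simp add: J_inner_self)
  also have "\<dots> \<le> norm (J f) * norm f" by (rule norm_cauchy_schwarz)
  finally have "norm (J f) * norm (J f) \<le> norm (J f) * norm f" by (simp add: power2_eq_square)
  then show ?thesis by (cases "norm (J f) = 0") auto
qed

lemma J_plus_B: "J f + l *\<^sub>R B f = f"
  using l_pos by (simp add: B_def)

lemma B_eq:
  assumes "y \<in> V"
  shows "B f \<bullet> y = T (J f) \<bullet> T y"
  using J_eq[OF assms, of f] l_pos by (simp add: B_def inner_diff_left field_simps)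

lemma B_inner_self: "B f \<bullet> f = (norm (T (J f)))\<^sup>2 + l * (norm (B f))\<^sup>2"
proof -
  have "B f \<bullet> f = B f \<bullet> (J f + l *\<^sub>R B f)" by (simp only: J_plus_B)
  then show ?thesis using B_eq[OF J_in[of f], of f] by (simp add: inner_add_right power2_norm_eq_inner)
qed

text \<open>The form of the approximation stays below the original one for every \<open>l\<close>:
  Cauchy-Schwarz first bounds \<open>T (J x)\<close> by \<open>T x\<close>. This is how the initial
  energy enters all later bounds independently of \<open>l\<close>.\<close>

lemma B_inner_self_le:
  assumes "x \<in> V"
  shows "B x \<bullet> x \<le> (norm (T x))\<^sup>2"
proof -
  have eq: "B x \<bullet> x = T (J x) \<bullet> T x" by (rule B_eq[OF assms])
  then have le: "B x \<bullet> x \<le> norm (T (J x)) * norm (T x)" by (simp add: norm_cauchy_schwarz)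
  have "norm (T (J x)) * norm (T (J x)) \<le> B x \<bullet> x" using l_pos by (simp add: B_inner_self power2_eq_square)
  with le have "norm (T (J x)) * norm (T (J x)) \<le> norm (T (J x)) * norm (T x)" by linarith
  then have "norm (T (J x)) \<le> norm (T x)" by (cases "norm (T (J x)) = 0") auto
  then have "norm (T (J x)) * norm (T x) \<le> norm (T x) * norm (T x)" by (intro mult_right_mono) auto
  with le show ?thesis by (simp add: power2_eq_square)
qed

lemma bounded_linear_B: "bounded_linear B"
proof (rule bounded_linear_intro[where K = "2 / l"])
  show "B (f + g) = B f + B g" for f g by (simp add: B_def J_add algebra_simps)
  show "B (c *\<^sub>R f) = c *\<^sub>R B f" for c f by (simp add: B_def J_scale algebra_simps)
  show "norm (B f) \<le> norm f * (2 / l)" for f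
  proof -
    have "norm (f - J f) \<le> 2 * norm f" using norm_triangle_ineq4[of f "J f"] norm_J[of f] by simp
    moreover have "norm (B f) = norm (f - J f) / l" using l_pos by (simp add: B_def)
    ultimately show ?thesis using l_pos by (simp add: field_simps)
  qed
qed

lemma B_symmetric: "B f \<bullet> g = f \<bullet> B g"
  using J_symmetric[of f g] by (simp add: B_def inner_diff_left inner_diff_right)

lemma B_nonneg: "0 \<le> B f \<bullet> f"
  using l_pos by (simp add: B_inner_self)

end

text \<open>Splitting \<open>u - w\<close> into a difference of resolvents and
  \<open>l B u - m B w\<close> leaves a monotone term, nonnegative squares and the cross term
  \<open>(l + m) * (p \<bullet> q)\<close>. Adding the first moments with weight
  \<open>(l + m) / 2\<close> to the squared distance supplies exactly the dissipation that absorbs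
  the cross term, and their initial values give the bound.\<close>

lemma yosida_flow_dist:
  fixes T :: "'b::{real_inner, banach} \<Rightarrow> 'c::{real_inner, banach}"
  assumes "yosida V T l" "yosida V T m"
    and u: "symmetric_flow (yosida.B V T l) u" and w: "symmetric_flow (yosida.B V T m) w"
    and init: "u 0 = x" "w 0 = x" "x \<in> V" and t: "0 \<le> t"
  shows "(norm (u t - w t))\<^sup>2 \<le> (l + m) * (norm (T x))\<^sup>2"
proof -
  interpret l: yosida V T l by fact
  interpret m: yosida V T m by fact
  interpret u: symmetric_flow l.B u by fact
  interpret w: symmetric_flow m.B w by fact
  define D where "D t = (norm (u t - w t))\<^sup>2" for t
  define F where "F t = D t + (l + m) / 2 * (u.moment 1 t + w.moment 1 t)" for t
  have D_deriv: "(D has_real_derivative - 2 * ((l.B (u t) - m.B (w t)) \<bullet> (u t - w t))) (at t)" for t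
  proof -
    have d: "((\<lambda>t. u t - w t) has_derivative (\<lambda>h. h *\<^sub>R (- l.B (u t) - - m.B (w t)))) (at t)"
      using has_vector_derivative_diff[OF u.flow w.flow] by (simp add: has_vector_derivative_def)
    have "((\<lambda>t. (u t - w t) \<bullet> (u t - w t)) has_derivative
        (\<lambda>h. (u t - w t) \<bullet> (h *\<^sub>R (- l.B (u t) - - m.B (w t))) + (h *\<^sub>R (- l.B (u t) - - m.B (w t))) \<bullet> (u t - w t))) (at t)"
      by (rule has_derivative_inner[OF d d])
    moreover have "(\<lambda>h. (u t - w t) \<bullet> (h *\<^sub>R (- l.B (u t) - - m.B (w t))) + (h *\<^sub>R (- l.B (u t) - - m.B (w t))) \<bullet> (u t - w t))
      = (*) (- 2 * ((l.B (u t) - m.B (w t)) \<bullet> (u t - w t)))"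
      by (simp add: fun_eq_iff inner_commute algebra_simps inner_diff_left inner_diff_right)
    ultimately show ?thesis
      by (simp add: has_field_derivative_def D_def[abs_def] power2_norm_eq_inner)
  qed
  have F_deriv: "(F has_real_derivative - 2 * ((l.B (u t) - m.B (w t)) \<bullet> (u t - w t))
      + (l + m) / 2 * (- 2 * (norm (l.B (u t)))\<^sup>2 + - 2 * (norm (m.B (w t)))\<^sup>2)) (at t)" for t
    unfolding F_def using u.moment_deriv[of 1 t] w.moment_deriv[of 1 t] u.moment_two[of t] w.moment_two[of t]
    by (intro DERIV_add D_deriv DERIV_cmult) (auto simp: numeral_2_eq_2)
  have "F t \<le> F 0"
  proof (rule DERIV_nonpos_imp_nonincreasing[OF t], intro exI conjI)
    fix t
    show "(F has_real_derivative - 2 * ((l.B (u t) - m.B (w t)) \<bullet> (u t - w t))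
      + (l + m) / 2 * (- 2 * (norm (l.B (u t)))\<^sup>2 + - 2 * (norm (m.B (w t)))\<^sup>2)) (at t)" by (rule F_deriv)
    define p q where "p = l.B (u t)" and "q = m.B (w t)"
    define a b where "a = l.J (u t)" and "b = m.J (w t)"
    have ab: "a \<in> V" "b \<in> V" by (simp_all add: a_def b_def l.J_in m.J_in)
    have "u t - w t = (a - b) + (l *\<^sub>R p - m *\<^sub>R q)"
      using l.J_plus_B[of "u t"] m.J_plus_B[of "w t"] by (simp add: a_def b_def p_def q_def algebra_simps)
    then have "(p - q) \<bullet> (u t - w t) = (p - q) \<bullet> (a - b) + (p - q) \<bullet> (l *\<^sub>R p - m *\<^sub>R q)"
      by (simp add: inner_add_right)
    moreover have "(p - q) \<bullet> (a - b) = (norm (T a - T b))\<^sup>2"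
      using l.B_eq[OF l.diff_in[OF ab], of "u t"] m.B_eq[OF l.diff_in[OF ab], of "w t"] ab
      by (simp add: p_def q_def inner_diff_left a_def[symmetric] b_def[symmetric] l.T_diff power2_norm_eq_inner)
    moreover have "(p - q) \<bullet> (l *\<^sub>R p - m *\<^sub>R q) = l * (norm p)\<^sup>2 + m * (norm q)\<^sup>2 - (l + m) * (p \<bullet> q)"
      by (simp add: inner_diff_left inner_diff_right power2_norm_eq_inner inner_commute algebra_simps)
    moreover have "(l + m) * (p \<bullet> q) \<le> (l + m) * ((norm p)\<^sup>2 + (norm q)\<^sup>2) / 2"
      unfolding times_divide_eq_right[symmetric]
    proof (rule mult_left_mono)
      have "0 \<le> (norm (p - q))\<^sup>2" by simp
      then show "p \<bullet> q \<le> ((norm p)\<^sup>2 + (norm q)\<^sup>2) / 2"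
        by (simp add: power2_norm_eq_inner inner_diff_left inner_diff_right inner_commute)
    qed (use l.l_pos m.l_pos in simp)
    moreover have "0 \<le> l * (norm p)\<^sup>2" "0 \<le> m * (norm q)\<^sup>2" "0 \<le> (norm (T a - T b))\<^sup>2"
      using l.l_pos m.l_pos by auto
    moreover have "(l + m) / 2 * (- 2 * (norm p)\<^sup>2 + - 2 * (norm q)\<^sup>2) = - ((l + m) * ((norm p)\<^sup>2 + (norm q)\<^sup>2))"
      by (simp add: field_simps)
    ultimately show "- 2 * ((l.B (u t) - m.B (w t)) \<bullet> (u t - w t))
      + (l + m) / 2 * (- 2 * (norm (l.B (u t)))\<^sup>2 + - 2 * (norm (m.B (w t)))\<^sup>2) \<le> 0"
      unfolding p_def[symmetric] q_def[symmetric] by linarith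
  qed
  also have "F 0 \<le> (l + m) / 2 * ((norm (T x))\<^sup>2 + (norm (T x))\<^sup>2)"
    unfolding F_def D_def using l.l_pos m.l_pos init l.B_inner_self_le[of x] m.B_inner_self_le[of x]
    by (simp add: u.moment_def w.moment_def)
  also have "\<dots> = (l + m) * (norm (T x))\<^sup>2" by (simp add: field_simps)
  moreover have "0 \<le> (l + m) / 2 * (u.moment 1 t + w.moment 1 t)"
    using u.moment_nonneg[of 1 t] w.moment_nonneg[of 1 t] l.l_pos m.l_pos
    by (intro mult_nonneg_nonneg) auto
  ultimately show ?thesis unfolding F_def D_def by linarith
qed

text \<open>A common quadratic remainder says that \<open>p k\<close> differs from the difference
  quotient of \<open>U k\<close> by at most \<open>h * M\<close>. For fixed \<open>h\<close> the
  quotients converge, so the \<open>p k\<close> are Cauchy. The lemma serves both for the Yosida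
  parameter and for the index of the fractional exponents.\<close>

lemma taylor_velocity_convergent:
  fixes U :: "nat \<Rightarrow> real \<Rightarrow> 'b::banach"
  assumes lim: "\<And>r. 0 < r \<Longrightarrow> (\<lambda>k. U k r) \<longlonglongrightarrow> u r" and t: "0 < t"
    and taylor: "\<And>k h. \<bar>h\<bar> \<le> t / 2 \<Longrightarrow> norm (U k (t + h) - U k t - h *\<^sub>R p k) \<le> h\<^sup>2 * M"
  shows "convergent p"
proof -
  have "Cauchy p"
  proof (rule metric_CauchyI)
    fix e :: real assume e: "0 < e"
    have M: "0 \<le> M"
    proof -
      have "0 \<le> (t / 2)\<^sup>2 * M" using taylor[of "t / 2" 0] t by (intro order_trans[OF norm_ge_zero]) auto
      then show ?thesis using t by (simp add: zero_le_mult_iff)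
    qed
    \<comment> \<open>Two remainders occur, each at most \<open>h * M\<close> after division by
      \<open>h\<close>; the second entry of the minimum keeps their sum below
      \<open>e / 2\<close>.\<close>
    define h where "h = min (t / 2) (e / (4 * (M + 1)))"
    have h: "0 < h" "h \<le> t / 2" using t e M by (simp add: h_def) (simp only: h_def min.cobounded1)
    have hM: "2 * h * M < e / 2 \<or> M = 0"
    proof (cases "M = 0")
      case False
      have "h \<le> e / (4 * (M + 1))" by (simp add: h_def)
      then have "h * (M + 1) \<le> e / 4" using M by (simp add: field_simps)
      then show ?thesis using h by (simp add: algebra_simps)
    qed simp
    then have hM: "2 * h * M < e / 2" using e by auto
    have "convergent (\<lambda>k. U k (t + h) - U k t)"
      using lim[of "t + h"] lim[of t] t h by (auto intro!: convergentI tendsto_diff)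
    then have "Cauchy (\<lambda>k. U k (t + h) - U k t)" by (rule convergent_Cauchy)
    moreover have "0 < h * (e / 2)" using h e by simp
    ultimately obtain N where N: "\<And>i j. N \<le> i \<Longrightarrow> N \<le> j \<Longrightarrow>
        dist (U i (t + h) - U i t) (U j (t + h) - U j t) < h * (e / 2)"
      unfolding Cauchy_def by blast
    have "dist (p i) (p j) < e" if ij: "N \<le> i" "N \<le> j" for i j
    proof -
      define a b where "a = U i (t + h) - U i t" and "b = U j (t + h) - U j t"
      have "norm (a - h *\<^sub>R p i) \<le> h\<^sup>2 * M" "norm (b - h *\<^sub>R p j) \<le> h\<^sup>2 * M"
        using taylor[of h i] taylor[of h j] h by (auto simp: a_def b_def)
      moreover have "norm (a - b) < h * (e / 2)" using N[OF ij] by (simp add: dist_norm a_def b_def)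
      moreover have "norm (h *\<^sub>R (p i - p j)) \<le> norm (a - b) + norm (a - h *\<^sub>R p i) + norm (b - h *\<^sub>R p j)"
      proof -
        have "h *\<^sub>R (p i - p j) = (a - b) - (a - h *\<^sub>R p i) + (b - h *\<^sub>R p j)"
          by (simp add: algebra_simps)
        then show ?thesis
          using norm_triangle_ineq[of "(a - b) - (a - h *\<^sub>R p i)" "b - h *\<^sub>R p j"]
            norm_triangle_ineq4[of "a - b" "a - h *\<^sub>R p i"] by simp
      qed
      moreover have "norm (h *\<^sub>R (p i - p j)) = h * norm (p i - p j)" using h(1) by simp
      ultimately have "h * norm (p i - p j) < h * (e / 2) + 2 * (h\<^sup>2 * M)" by linarith
      also have "\<dots> = h * (e / 2 + 2 * h * M)" by (simp add: power2_eq_square algebra_simps)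
      also have "\<dots> \<le> h * e" using hM h(1) by (intro mult_left_mono) auto
      finally show ?thesis using h(1) by (simp add: dist_norm)
    qed
    then show "\<exists>M. \<forall>m\<ge>M. \<forall>n\<ge>M. dist (p m) (p n) < e" by blast
  qed
  then show ?thesis by (simp add: Cauchy_convergent_iff)
qed

lemma taylor_has_vector_derivative:
  fixes u :: "real \<Rightarrow> 'b::real_normed_vector"
  assumes t: "0 < t"
    and taylor: "\<And>h. \<bar>h\<bar> \<le> t / 2 \<Longrightarrow> norm (u (t + h) - u t - h *\<^sub>R v) \<le> h\<^sup>2 * M"
  shows "(u has_vector_derivative v) (at t)"
proof -
  have "((\<lambda>h. norm (u (t + h) - u t - h *\<^sub>R v) / norm h) \<longlongrightarrow> 0) (at 0)"
  proof (rule tendsto_sandwich[of "\<lambda>_. 0" _ _ "\<lambda>h. \<bar>h\<bar> * M"])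
    show "\<forall>\<^sub>F h in at 0. norm (u (t + h) - u t - h *\<^sub>R v) / norm h \<le> \<bar>h\<bar> * M"
      unfolding eventually_at
    proof (intro exI[of _ "t / 2"] conjI ballI impI)
      fix h :: real assume "h \<noteq> 0 \<and> dist h 0 < t / 2"
      then have "norm (u (t + h) - u t - h *\<^sub>R v) \<le> h\<^sup>2 * M" "h \<noteq> 0" by (auto intro!: taylor)
      then show "norm (u (t + h) - u t - h *\<^sub>R v) / norm h \<le> \<bar>h\<bar> * M"
        by (simp add: divide_le_eq power2_eq_square mult_ac flip: abs_mult)
    qed (use t in auto)
    have "((\<lambda>h::real. \<bar>h\<bar> * M) \<longlongrightarrow> \<bar>0\<bar> * M) (at 0)" by (intro tendsto_intros)
    then show "((\<lambda>h::real. \<bar>h\<bar> * M) \<longlongrightarrow> 0) (at 0)" by simp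
  qed auto
  then show ?thesis
    by (simp add: has_vector_derivative_def has_derivative_at bounded_linear_scaleR_left)
qed

section \<open>Existence of the gradient flow\<close>

context closed_operator
begin

text \<open>The Yosida flows converge uniformly in time by the distance estimate, their velocities
  pointwise by the Taylor bounds. The resolvents of the states have the same limit as the states,
  and closedness then yields the equation. Assertions on the velocity exclude \<open>t = 0\<close>,
  where the bounds blow up; the energy relation is an inequality because Fatou's lemma is used in
  the limit.\<close>

theorem gradient_flow_exists:
  assumes x: "x \<in> V"
  obtains u v where "u 0 = x" "continuous_on {0..} u" "\<And>t. 0 \<le> t \<Longrightarrow> u t \<in> V"
    "\<And>t y. 0 < t \<Longrightarrow> y \<in> V \<Longrightarrow> v t \<bullet> y = - (T (u t) \<bullet> T y)"
    "\<And>t h. 0 < t \<Longrightarrow> \<bar>h\<bar> \<le> t / 2 \<Longrightarrow>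
      norm (u (t + h) - u t - h *\<^sub>R v t) \<le> h\<^sup>2 * sqrt (27 * (norm (T x))\<^sup>2 / t ^ 3)"
    "\<And>t. 0 < t \<Longrightarrow> (norm (v t))\<^sup>2 \<le> (norm (T x))\<^sup>2 / (2 * t)"
    "\<And>t. 0 < t \<Longrightarrow> (\<integral>\<^sup>+r. ennreal ((norm (v r))\<^sup>2) * indicator {0<..t} r \<partial>lborel)
      + ennreal ((norm (T (u t)))\<^sup>2 / 2) \<le> ennreal ((norm (T x))\<^sup>2 / 2)"
proof -
  define E where "E = (norm (T x))\<^sup>2"
  define l where "l k = 1 / real (Suc k)" for k
  have l_pos: "0 < l k" for k by (simp add: l_def)
  have l_lim: "l \<longlonglongrightarrow> 0" unfolding l_def by (rule LIMSEQ_Suc[OF lim_1_over_n])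
  have yos: "yosida V T (l k)" for k by unfold_locales (rule l_pos)
  define B where "B k = yosida.B V T (l k)" for k
  define J where "J k = yosida.J V T (l k)" for k
  have "\<exists>u. u 0 = x \<and> (\<forall>t. (u has_vector_derivative - B k (u t)) (at t))" for k
    using linear_flow_exists[OF yosida.bounded_linear_B[OF yos[of k]], of x] unfolding B_def by metis
  then obtain U where U0: "\<And>k. U k 0 = x"
    and U: "\<And>k t. (U k has_vector_derivative - B k (U k t)) (at t)" by metis
  have flow: "symmetric_flow (B k) (U k)" for k
    using yosida.bounded_linear_B[OF yos] yosida.B_symmetric[OF yos] yosida.B_nonneg[OF yos] U
    by (simp add: symmetric_flow_def B_def)
  define m where "m k t = B k (U k t) \<bullet> U k t" for k t
  have m: "m k t = symmetric_flow.moment (B k) (U k) 1 t" for k t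
    by (simp add: m_def symmetric_flow.moment_def[OF flow])
  have m0: "m k 0 \<le> E" for k
    using yosida.B_inner_self_le[OF yos x] by (simp add: m_def B_def U0 E_def)
  have dist: "(norm (U i t - U j t))\<^sup>2 \<le> (l i + l j) * E" if "0 \<le> t" for i j t
    unfolding E_def
    by (rule yosida_flow_dist[OF yos yos flow[unfolded B_def] flow[unfolded B_def] U0 U0 x that])
  have unif: "uniformly_Cauchy_on {0..} U"
  proof (rule uniformly_Cauchy_onI)
    fix e :: real assume e: "0 < e"
    obtain N where N: "inverse (real (Suc N)) < e\<^sup>2 / (2 * (E + 1))"
      using reals_Archimedean[of "e\<^sup>2 / (2 * (E + 1))"] e by (auto simp: E_def add_nonneg_pos)
    have "dist (U i t) (U j t) < e" if "t \<in> {0..}" "N \<le> i" "N \<le> j" for t i j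
    proof -
      have "l i \<le> l N" "l j \<le> l N" using that by (auto simp: l_def intro!: divide_left_mono)
      then have "(l i + l j) * E \<le> (2 * l N) * (E + 1)"
        using l_pos[of i] l_pos[of j] by (intro mult_mono) (auto simp: E_def)
      also have "\<dots> < e\<^sup>2"
      proof -
        have "0 < E + 1" by (simp add: E_def add_nonneg_pos)
        then show ?thesis using N by (simp add: l_def field_simps)
      qed
      finally have "(norm (U i t - U j t))\<^sup>2 < e\<^sup>2" using dist[of t i j] that by simp
      then show ?thesis using e by (simp add: dist_norm power2_less_imp_less)
    qed
    then show "\<exists>M. \<forall>t\<in>{0..}. \<forall>m\<ge>M. \<forall>n\<ge>M. dist (U m t) (U n t) < e" by blast
  qed
  then obtain u where ul: "uniform_limit {0..} U u sequentially"
    using Cauchy_uniformly_convergent uniformly_convergent_on_def by blast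
  have Ulim: "(\<lambda>k. U k t) \<longlonglongrightarrow> u t" if "0 \<le> t" for t
    using tendsto_uniform_limitI[OF ul] that by simp
  have cont: "continuous_on {0..} u"
  proof (rule uniform_limit_theorem[OF _ ul])
    show "\<forall>\<^sub>F k in sequentially. continuous_on {0..} (U k)"
      using U has_vector_derivative_continuous
      by (intro always_eventually allI continuous_at_imp_continuous_on ballI) blast
  qed simp
  have taylor: "norm (U k (t + h) - U k t - h *\<^sub>R (- B k (U k t))) \<le> h\<^sup>2 * sqrt (27 * E / t ^ 3)"
    if "0 < t" "\<bar>h\<bar> \<le> t / 2" for k t h
  proof -
    have "norm (U k (t + h) - U k t - h *\<^sub>R (- B k (U k t))) \<le> h\<^sup>2 * sqrt (27 * m k 0 / t ^ 3)"
      unfolding m by (rule symmetric_flow.taylor_bound[OF flow that])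
    also have "\<dots> \<le> h\<^sup>2 * sqrt (27 * E / t ^ 3)"
      using that m0 by (intro mult_left_mono real_sqrt_le_mono divide_right_mono) auto
    finally show ?thesis .
  qed
  define v where "v t = lim (\<lambda>k. - B k (U k t))" for t
  have vlim: "(\<lambda>k. - B k (U k t)) \<longlonglongrightarrow> v t" if "0 < t" for t
    using taylor_velocity_convergent[of U u t, OF Ulim that taylor[OF that]]
    by (simp add: v_def convergent_LIMSEQ_iff)
  have Blim: "(\<lambda>k. B k (U k t)) \<longlonglongrightarrow> - v t" if "0 < t" for t
    using tendsto_minus[OF vlim[OF that]] by simp
  have Jin: "J k (U k t) \<in> V" for k t by (simp add: J_def yosida.J_in[OF yos])
  have Jlim: "(\<lambda>k. J k (U k t)) \<longlonglongrightarrow> u t" if "0 < t" for t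
  proof -
    have "(\<lambda>k. U k t - l k *\<^sub>R B k (U k t)) \<longlonglongrightarrow> u t - 0 *\<^sub>R (- v t)"
      using that by (intro tendsto_intros Ulim l_lim Blim) auto
    moreover have "U k t - l k *\<^sub>R B k (U k t) = J k (U k t)" for k
      using yosida.J_plus_B[OF yos[of k], of "U k t"] by (simp add: J_def B_def algebra_simps)
    ultimately show ?thesis by simp
  qed
  have TJ: "B k f \<bullet> y = T (J k f) \<bullet> T y" if "y \<in> V" for k f y
    unfolding B_def J_def by (rule yosida.B_eq[OF yos that])
  \<comment> \<open>The squared distance of the images equals the inner product of the difference of
    velocities with the difference of resolvents, and both differences become small.\<close>
  have TJCauchy: "Cauchy (\<lambda>k. T (J k (U k t)))" if t: "0 < t" for t
  proof (rule metric_CauchyI)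
    fix e :: real assume e: "0 < e"
    obtain N1 where N1: "\<And>i j. N1 \<le> i \<Longrightarrow> N1 \<le> j \<Longrightarrow> dist (B i (U i t)) (B j (U j t)) < e"
      using LIMSEQ_imp_Cauchy[OF Blim[OF t]] e unfolding Cauchy_def by blast
    obtain N2 where N2: "\<And>i j. N2 \<le> i \<Longrightarrow> N2 \<le> j \<Longrightarrow> dist (J i (U i t)) (J j (U j t)) < e"
      using LIMSEQ_imp_Cauchy[OF Jlim[OF t]] e unfolding Cauchy_def by blast
    have "dist (T (J i (U i t))) (T (J j (U j t))) < e" if "max N1 N2 \<le> i" "max N1 N2 \<le> j" for i j
    proof -
      define a b where "a = J i (U i t)" and "b = J j (U j t)"
      have ab: "a \<in> V" "b \<in> V" by (simp_all add: a_def b_def Jin)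
      have "(norm (T a - T b))\<^sup>2 = (B i (U i t) - B j (U j t)) \<bullet> (a - b)"
        using TJ[OF diff_in[OF ab], of i "U i t"] TJ[OF diff_in[OF ab], of j "U j t"] ab
        by (simp add: inner_diff_left a_def[symmetric] b_def[symmetric] T_diff power2_norm_eq_inner)
      also have "\<dots> \<le> norm (B i (U i t) - B j (U j t)) * norm (a - b)" by (rule norm_cauchy_schwarz)
      also have "\<dots> < e * e"
        using N1[of i j] N2[of i j] that by (intro mult_strict_mono') (auto simp: a_def b_def dist_norm)
      finally have "norm (T a - T b) < e"
        using e by (intro power2_less_imp_less[of _ e]) (auto simp: power2_eq_square)
      then show ?thesis by (simp add: a_def b_def dist_norm)
    qed
    then show "\<exists>M. \<forall>m\<ge>M. \<forall>n\<ge>M. dist (T (J m (U m t))) (T (J n (U n t))) < e" by blast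
  qed
  have uV: "u t \<in> V" "(\<lambda>k. T (J k (U k t))) \<longlonglongrightarrow> T (u t)" if "0 < t" for t
    using limit_in[OF Jin Jlim[OF that] TJCauchy[OF that]] by auto
  have u0: "u 0 = x" using Ulim[of 0] by (simp add: U0 LIMSEQ_const_iff)
  have eq: "v t \<bullet> y = - (T (u t) \<bullet> T y)" if "0 < t" "y \<in> V" for t y
  proof (rule LIMSEQ_unique)
    show "(\<lambda>k. - B k (U k t) \<bullet> y) \<longlonglongrightarrow> v t \<bullet> y" by (intro tendsto_intros vlim that)
    have "(\<lambda>k. - (T (J k (U k t)) \<bullet> T y)) \<longlonglongrightarrow> - (T (u t) \<bullet> T y)"
      by (intro tendsto_intros uV that)
    then show "(\<lambda>k. - B k (U k t) \<bullet> y) \<longlonglongrightarrow> - (T (u t) \<bullet> T y)" by (simp add: TJ that)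
  qed
  show thesis
  proof (rule that[of u v])
    show "u 0 = x" by (rule u0)
    show "continuous_on {0..} u" by (rule cont)
    show "u t \<in> V" if "0 \<le> t" for t using uV(1)[of t] u0 x that by (cases "t = 0") auto
    show "v t \<bullet> y = - (T (u t) \<bullet> T y)" if "0 < t" "y \<in> V" for t y by (rule eq[OF that])
    show "norm (u (t + h) - u t - h *\<^sub>R v t) \<le> h\<^sup>2 * sqrt (27 * (norm (T x))\<^sup>2 / t ^ 3)"
      if "0 < t" "\<bar>h\<bar> \<le> t / 2" for t h
    proof (rule LIMSEQ_le_const2)
      show "(\<lambda>k. norm (U k (t + h) - U k t - h *\<^sub>R (- B k (U k t)))) \<longlonglongrightarrow> norm (u (t + h) - u t - h *\<^sub>R v t)"
        using that by (intro tendsto_intros Ulim vlim) auto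
    qed (use taylor[OF that] E_def in auto)
    show "(norm (v t))\<^sup>2 \<le> (norm (T x))\<^sup>2 / (2 * t)" if "0 < t" for t
    proof (rule LIMSEQ_le_const2)
      show "(\<lambda>k. (norm (- B k (U k t)))\<^sup>2) \<longlonglongrightarrow> (norm (v t))\<^sup>2" by (intro tendsto_intros vlim that)
      have "(norm (- B k (U k t)))\<^sup>2 \<le> E / (2 * t)" for k
        using symmetric_flow.velocity_bound[OF flow that, of k] divide_right_mono[OF m0[of k], of "2 * t"] that
        by (simp add: m)
      then show "\<exists>N. \<forall>n\<ge>N. (norm (- B n (U n t)))\<^sup>2 \<le> (norm (T x))\<^sup>2 / (2 * t)" by (simp add: E_def)
    qed
    show "(\<integral>\<^sup>+r. ennreal ((norm (v r))\<^sup>2) * indicator {0<..t} r \<partial>lborel)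
      + ennreal ((norm (T (u t)))\<^sup>2 / 2) \<le> ennreal ((norm (T x))\<^sup>2 / 2)" if t: "0 < t" for t
    proof -
      define e where "e = (norm (T (u t)))\<^sup>2"
      \<comment> \<open>Tested with \<open>u t\<close> itself, the equation identifies the limit of
        the first moments as the squared norm of \<open>T (u t)\<close>.\<close>
      have mlim: "(\<lambda>k. m k t) \<longlonglongrightarrow> e"
      proof -
        have "(\<lambda>k. m k t) \<longlonglongrightarrow> - v t \<bullet> u t"
          unfolding m_def using t by (intro tendsto_intros Blim Ulim) auto
        also have "- v t \<bullet> u t = e"
          using eq[OF t uV(1)[OF t]] by (simp add: e_def power2_norm_eq_inner t)
        finally show ?thesis .
      qed
      have "m k t \<le> E" for k
        using symmetric_flow.moment_antimono[OF flow, of 0 t k 1] m0[of k] t by (simp add: m)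
      then have eE: "e \<le> E" by (intro LIMSEQ_le_const2[OF mlim]) auto
      have meas: "(\<lambda>r. B k (U k r)) \<in> borel_measurable borel" for k
        using symmetric_flow.funpow_flow[OF flow, of 1 k] has_vector_derivative_continuous
        by (intro borel_measurable_continuous_onI continuous_at_imp_continuous_on ballI) fastforce
      have "(\<integral>\<^sup>+r. ennreal ((norm (v r))\<^sup>2) * indicator {0<..t} r \<partial>lborel)
        \<le> (\<integral>\<^sup>+r. liminf (\<lambda>k. ennreal ((norm (B k (U k r)))\<^sup>2) * indicator {0..t} r) \<partial>lborel)"
      \<comment> \<open>Pointwise convergence of the velocities is known for positive times only,
        and the half-open interval leaves out time 0.\<close>
      proof (rule nn_integral_mono)
        fix r
        show "ennreal ((norm (v r))\<^sup>2) * indicator {0<..t} r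
          \<le> liminf (\<lambda>k. ennreal ((norm (B k (U k r)))\<^sup>2) * indicator {0..t} r)"
        proof (cases "r \<in> {0<..t}")
          case True
          have "(\<lambda>k. ennreal ((norm (B k (U k r)))\<^sup>2)) \<longlonglongrightarrow> ennreal ((norm (- v r))\<^sup>2)"
            using True by (intro tendsto_ennrealI tendsto_intros Blim) auto
          then have "liminf (\<lambda>k. ennreal ((norm (B k (U k r)))\<^sup>2)) = ennreal ((norm (- v r))\<^sup>2)"
            by (rule lim_imp_Liminf[OF sequentially_bot])
          then show ?thesis using True by simp
        qed simp
      qed
      also have "\<dots> \<le> liminf (\<lambda>k. \<integral>\<^sup>+r. ennreal ((norm (B k (U k r)))\<^sup>2) * indicator {0..t} r \<partial>lborel)"
        by (rule nn_integral_liminf) (use meas in measurable)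
      also have "\<dots> = liminf (\<lambda>k. ennreal ((m k 0 - m k t) / 2))"
        using symmetric_flow.velocity_nn_integral[OF flow, of t] t by (simp add: m)
      also have "\<dots> \<le> liminf (\<lambda>k. ennreal ((E - m k t) / 2))"
        using m0 by (intro Liminf_mono always_eventually allI ennreal_leI) auto
      also have "\<dots> = ennreal ((E - e) / 2)"
        by (intro lim_imp_Liminf tendsto_ennrealI tendsto_intros mlim) auto
      finally have "(\<integral>\<^sup>+r. ennreal ((norm (v r))\<^sup>2) * indicator {0<..t} r \<partial>lborel) + ennreal (e / 2)
        \<le> ennreal ((E - e) / 2) + ennreal (e / 2)" by (rule add_right_mono)
      also have "\<dots> = ennreal (E / 2)"
        using eE by (subst ennreal_plus[symmetric]) (auto simp: e_def field_simps)
      finally show ?thesis by (simp add: e_def E_def)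
    qed
  qed
qed

end

section \<open>Test functions and weak time derivatives\<close>

lemma Ck_SucI:
  fixes f :: "'a::euclidean_space \<Rightarrow> real"
  assumes "\<And>x. (f has_derivative f' x) (at x)" "\<And>b. b \<in> Basis \<Longrightarrow> Ck k (\<lambda>x. f' x b)"
  shows "Ck (Suc k) f"
proof -
  have "frechet_derivative f (at x) = f' x" for x
    using frechet_derivative_at[OF assms(1)[of x]] by simp
  then show ?thesis
    using assms by (auto simp: differentiable_on_def differentiable_def intro: has_derivative_at_withinI)
qed

lemma Ck_SucD:
  fixes f :: "'a::euclidean_space \<Rightarrow> real"
  assumes "Ck (Suc k) f"
  shows "(f has_derivative frechet_derivative f (at x)) (at x)" "b \<in> Basis \<Longrightarrow> Ck k (\<lambda>x. frechet_derivative f (at x) b)"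
  using assms by (auto simp: differentiable_on_def frechet_derivative_works[symmetric])

lemma Ck_add:
  fixes f g :: "'a::euclidean_space \<Rightarrow> real"
  shows "Ck k f \<Longrightarrow> Ck k g \<Longrightarrow> Ck k (\<lambda>x. f x + g x)"
proof (induction k arbitrary: f g)
  case (Suc k)
  show ?case
    by (rule Ck_SucI[OF has_derivative_add[OF Ck_SucD(1)[OF Suc.prems(1)] Ck_SucD(1)[OF Suc.prems(2)]]])
      (rule Suc.IH[OF Ck_SucD(2)[OF Suc.prems(1)] Ck_SucD(2)[OF Suc.prems(2)]])
qed (simp add: continuous_on_add)

lemma Ck_scale:
  fixes f :: "'a::euclidean_space \<Rightarrow> real"
  shows "Ck k f \<Longrightarrow> Ck k (\<lambda>x. c * f x)"
proof (induction k arbitrary: f)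
  case (Suc k)
  show ?case
    by (rule Ck_SucI[OF has_derivative_mult_right[OF Ck_SucD(1)[OF Suc.prems]]])
      (rule Suc.IH[OF Ck_SucD(2)[OF Suc.prems]])
qed (simp add: continuous_on_mult_const continuous_on_mult)

lemma Ck_real_SucI:
  fixes f :: "real \<Rightarrow> real"
  assumes "\<And>x. (f has_real_derivative f' x) (at x)" "Ck k f'"
  shows "Ck (Suc k) f"
  using assms by (intro Ck_SucI[of f "\<lambda>x h. f' x * h"]) (auto simp: has_field_derivative_def)

lemma Ck_real_SucE:
  fixes f :: "real \<Rightarrow> real"
  assumes "Ck (Suc k) f"
  shows "(f has_real_derivative deriv f x) (at x)" "Ck k (deriv f)"
proof -
  have d: "f differentiable at x" for x using assms by (auto simp: differentiable_on_def)
  then show *: "(f has_real_derivative deriv f x) (at x)" for x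
    by (simp add: DERIV_deriv_iff_real_differentiable)
  have "frechet_derivative f (at x) 1 = deriv f x" for x
    using frechet_derivative_at[OF *[of x, unfolded has_field_derivative_def]]
    by (metis mult.right_neutral)
  then show "Ck k (deriv f)" using assms by simp
qed

lemma Ck_Suc_imp_Ck:
  fixes f :: "real \<Rightarrow> real"
  shows "Ck (Suc k) f \<Longrightarrow> Ck k f"
proof (induction k arbitrary: f)
  case 0
  show ?case using Ck_real_SucE(1)[OF 0] by (auto intro!: continuous_at_imp_continuous_on DERIV_isCont)
next
  case (Suc k)
  show ?case
    by (rule Ck_real_SucI[OF Ck_real_SucE(1)[OF Suc.prems] Suc.IH[OF Ck_real_SucE(2)[OF Suc.prems]]])
qed

lemma Ck_real_const: "Ck k (\<lambda>_::real. c :: real)"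
proof (induction k arbitrary: c)
  case (Suc k)
  then show ?case by (intro Ck_real_SucI[of _ "\<lambda>_. 0"]) auto
qed simp

lemma Ck_real_mult:
  fixes f g :: "real \<Rightarrow> real"
  shows "Ck k f \<Longrightarrow> Ck k g \<Longrightarrow> Ck k (\<lambda>x. f x * g x)"
proof (induction k arbitrary: f g)
  case 0
  then show ?case by (simp add: continuous_intros)
next
  case (Suc k)
  show ?case
    by (rule Ck_real_SucI[OF DERIV_mult[OF Ck_real_SucE(1)[OF Suc.prems(1)] Ck_real_SucE(1)[OF Suc.prems(2)]]])
      (rule Ck_add[OF Suc.IH[OF Ck_real_SucE(2)[OF Suc.prems(1)] Ck_Suc_imp_Ck[OF Suc.prems(2)]]
        Suc.IH[OF Ck_real_SucE(2)[OF Suc.prems(2)] Ck_Suc_imp_Ck[OF Suc.prems(1)]]])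
qed

lemma Ck_real_affine:
  fixes f :: "real \<Rightarrow> real"
  shows "Ck k f \<Longrightarrow> Ck k (\<lambda>x. f (a * x + b))"
proof (induction k arbitrary: f)
  case 0
  then show ?case by (auto intro!: continuous_on_compose2[of UNIV f] continuous_on_add continuous_on_mult)
next
  case (Suc k)
  have "((\<lambda>x. f (a * x + b)) has_real_derivative deriv f (a * x + b) * a) (at x)" for x
    by (rule DERIV_chain2[OF Ck_real_SucE(1)[OF Suc.prems]]) (auto intro!: derivative_eq_intros)
  then show ?case
    by (rule Ck_real_SucI[OF _ Ck_real_mult[OF Suc.IH[OF Ck_real_SucE(2)[OF Suc.prems]] Ck_real_const]])
qed

text \<open>The functions \<open>p (1 / x) * exp (- 1 / x)\<close>, extended by 0, are closed under
  differentiation: the new polynomial is \<open>X^2 (p - p')\<close>. One differentiability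
  statement for all \<open>p\<close>, the origin included, therefore gives every order.\<close>

lemma Ck_exp_inverse:
  "Ck k (\<lambda>x::real. if 0 < x then poly p (1 / x) * exp (- 1 / x) else 0)"
proof -
  define g where "g p x = (if 0 < x then poly p (1 / x) * exp (- 1 / x) else 0)" for p :: "real poly" and x :: real
  define q where "q p = [:0, 0, 1:] * (p - pderiv p)" for p :: "real poly"
  have pos: "(g p has_real_derivative g (q p) x) (at x)" if "0 < x" for p x
  proof -
    have "((\<lambda>x. poly p (1 / x) * exp (- 1 / x)) has_real_derivative g (q p) x) (at x)"
    proof -
      have inv: "((\<lambda>x. 1 / x) has_real_derivative - (1 / x\<^sup>2)) (at x)"
        using DERIV_inverse[of x UNIV] that by (simp add: inverse_eq_divide power2_eq_square power_one_over)
      have "((\<lambda>x. poly p (1 / x)) has_real_derivative poly (pderiv p) (1 / x) * - (1 / x\<^sup>2)) (at x)"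
        by (rule DERIV_chain2[OF poly_DERIV inv])
      moreover have "((\<lambda>x. exp (- 1 / x)) has_real_derivative exp (- 1 / x) * (1 / x\<^sup>2)) (at x)"
        using DERIV_chain2[OF DERIV_exp DERIV_minus[OF inv]] by simp
      ultimately have "((\<lambda>x. poly p (1 / x) * exp (- 1 / x)) has_real_derivative
          poly (pderiv p) (1 / x) * - (1 / x\<^sup>2) * exp (- 1 / x) + exp (- 1 / x) * (1 / x\<^sup>2) * poly p (1 / x)) (at x)"
        by (rule DERIV_mult)
      also have "poly (pderiv p) (1 / x) * - (1 / x\<^sup>2) * exp (- 1 / x) + exp (- 1 / x) * (1 / x\<^sup>2) * poly p (1 / x)
          = g (q p) x"
        using that by (simp add: g_def q_def power2_eq_square left_diff_distrib right_diff_distrib mult_ac)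
      finally show ?thesis .
    qed
    then show ?thesis
      by (rule has_field_derivative_transform_within_open[where S = "{0<..}"])
        (use that in \<open>auto simp: g_def\<close>)
  qed
  have neg: "(g p has_real_derivative g (q p) x) (at x)" if "x < 0" for p x
  proof -
    have "((\<lambda>x. 0) has_real_derivative g (q p) x) (at x)" using that by (simp add: g_def)
    then show ?thesis
      by (rule has_field_derivative_transform_within_open[where S = "{..<0}"])
        (use that in \<open>auto simp: g_def\<close>)
  qed
  have lim: "((\<lambda>y. poly p y * exp (- y)) \<longlongrightarrow> 0) at_top" for p :: "real poly"
  proof -
    have "((\<lambda>y. \<Sum>i\<le>degree p. coeff p i * (y ^ i / exp y)) \<longlongrightarrow> (\<Sum>i\<le>degree p. coeff p i * 0)) at_top"
      by (intro tendsto_sum tendsto_mult tendsto_const tendsto_power_div_exp_0)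
    moreover have "(\<Sum>i\<le>degree p. coeff p i * (y ^ i / exp y)) = poly p y * exp (- y)" for y
      by (simp add: poly_altdef exp_minus sum_distrib_right divide_inverse mult.assoc)
    ultimately show ?thesis by simp
  qed
  have zero: "(g p has_real_derivative g (q p) 0) (at 0)" for p
  proof -
    have r: "((\<lambda>h. g p h / h) \<longlongrightarrow> 0) (at_right 0)"
    proof -
      \<comment> \<open>Dividing by \<open>h\<close> multiplies the polynomial by its variable,
        hence \<open>pCons 0 p\<close>; the exponential still dominates.\<close>
      have "((\<lambda>h. poly (pCons 0 p) (inverse h) * exp (- inverse h)) \<longlongrightarrow> 0) (at_right 0)"
        by (rule filterlim_compose[OF lim filterlim_inverse_at_top_right])
      then show ?thesis
        by (rule Lim_transform_eventually)
          (auto simp: eventually_at_right_field g_def field_simps intro!: exI[of _ 1])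
    qed
    have l: "((\<lambda>h. g p h / h) \<longlongrightarrow> 0) (at_left 0)"
      by (rule Lim_transform_eventually[of "\<lambda>_. 0"])
        (auto simp: eventually_at_left_field g_def intro!: exI[of _ "-1"])
    from l r have "((\<lambda>h. g p h / h) \<longlongrightarrow> 0) (at 0)" by (simp add: filterlim_split_at)
    then show ?thesis by (simp add: DERIV_def g_def)
  qed
  have der: "(g p has_real_derivative g (q p) x) (at x)" for p x
    using pos neg zero by (cases x "0::real" rule: linorder_cases) auto
  have "Ck k (g p)" for p
  proof (induction k arbitrary: p)
    case 0
    show ?case using der by (auto intro!: continuous_at_imp_continuous_on DERIV_isCont)
  next
    case (Suc k)
    show ?case by (rule Ck_real_SucI[OF der Suc.IH])
  qed
  then show ?thesis by (simp add: g_def[abs_def])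
qed

text \<open>The product of \<open>e x\<close> and \<open>e (1 - x)\<close> is a smooth bump on the
  unit interval, and \<open>\<Theta>\<close> is its normalised primitive. The pair provides smooth
  cutoffs whose derivatives are one-sided mollifiers.\<close>

lemma smooth_step_exists:
  obtains \<theta> \<Theta> :: "real \<Rightarrow> real" where
    "\<And>k. Ck k \<theta>" "\<And>x. (\<Theta> has_real_derivative \<theta> x) (at x)" "\<And>x. 0 \<le> \<theta> x"
    "\<And>x. x \<notin> {0<..<1} \<Longrightarrow> \<theta> x = 0" "\<And>x. x \<le> 0 \<Longrightarrow> \<Theta> x = 0" "\<And>x. 1 \<le> x \<Longrightarrow> \<Theta> x = 1"
    "\<And>x. 0 \<le> \<Theta> x \<and> \<Theta> x \<le> 1"
proof -
  define e where "e x = (if 0 < x then poly 1 (1 / x) * exp (- 1 / x) else 0)" for x :: real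
  have Ce: "Ck k e" for k unfolding e_def[abs_def] by (rule Ck_exp_inverse)
  define b where "b x = e x * e (1 - x)" for x
  have Cb: "Ck k b" for k
    using Ck_real_mult[OF Ce[of k] Ck_real_affine[OF Ce[of k], of "-1" 1]] by (simp add: b_def[abs_def])
  have b0: "0 \<le> b x" for x by (simp add: b_def e_def)
  have bout: "b x = 0" if "x \<notin> {0<..<1}" for x using that by (auto simp: b_def e_def)
  have bpos: "0 < b (1/2)" by (simp add: b_def e_def)
  have cont: "continuous_on S b" for S using Cb[of 0] by (auto intro: continuous_on_subset)
  \<comment> \<open>The lower limit lies strictly to the left of the support, so that every
    \<open>x \<ge> 0\<close> is an interior point of the interval on which the primitive is
    differentiated.\<close>
  define P where "P x = integral {-1..x} b" for x
  have P0: "P x = 0" if "x \<le> 0" for x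
  proof -
    have "P x = integral {-1..x} (\<lambda>_. 0)" unfolding P_def by (rule integral_cong) (use that bout in auto)
    then show ?thesis by simp
  qed
  have Pd: "(P has_real_derivative b x) (at x)" for x
  proof (cases "x < 0")
    case True
    have "((\<lambda>_. 0) has_real_derivative b x) (at x)" using True bout by simp
    then show ?thesis
      by (rule has_field_derivative_transform_within_open[where S = "{..<0}"])
        (use True P0 in auto)
  next
    case False
    have "(P has_real_derivative b x) (at x within {-1..x+1})"
      unfolding P_def by (rule integral_has_real_derivative[OF cont]) (use False in auto)
    then show ?thesis using False at_within_interior[of x "{-1..x+1}"] by (simp add: interior_cbox[where 'a=real, simplified])
  qed
  have mono: "P x \<le> P y" if "x \<le> y" for x y
    by (rule DERIV_nonneg_imp_nondecreasing[OF that]) (use Pd b0 in auto)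
  have P1: "P x = P 1" if "1 \<le> x" for x
  proof (cases "x = 1")
    case False
    with that have "1 < x" by simp
    then obtain z where "1 < z" "P x - P 1 = (x - 1) * b z"
      using MVT2[of 1 x P b] Pd by auto
    then show ?thesis using bout[of z] by simp
  qed simp
  \<comment> \<open>Otherwise the monotone function \<open>P\<close> vanishes on the unit interval,
    although its derivative at \<open>1 / 2\<close> is positive.\<close>
  have pos: "0 < P 1"
  proof (rule ccontr)
    assume "\<not> 0 < P 1"
    then have "P y = 0" if "y \<in> {0<..<1}" for y
      using mono[of 0 y] mono[of y 1] P0[of 0] that by simp
    then have "(P has_real_derivative 0) (at (1/2))"
      by (intro has_field_derivative_transform_within_open[OF DERIV_const[of 0], where S = "{0<..<1}"]) auto
    then show False using Pd[of "1/2"] bpos DERIV_unique by fastforce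
  qed
  show thesis
  proof (rule that[of "\<lambda>x. b x * (1 / P 1)" "\<lambda>x. P x / P 1"])
    show "Ck k (\<lambda>x. b x * (1 / P 1))" for k by (intro Ck_real_mult Cb Ck_real_const)
    show "((\<lambda>x. P x / P 1) has_real_derivative b x * (1 / P 1)) (at x)" for x
      using DERIV_cdivide[OF Pd[of x], of "P 1"] by simp
    show "0 \<le> P x / P 1 \<and> P x / P 1 \<le> 1" for x
    proof -
      have "0 \<le> P x" using mono[of "min x 0" x] P0[of "min x 0"] by simp
      moreover have "P x \<le> P 1" using mono[of x 1] P1[of x] by (cases "x \<le> 1") linarith+
      ultimately show ?thesis using pos by simp
    qed
    show "P x / P 1 = 1" if "1 \<le> x" for x using P1[OF that] pos by simp
  qed (use b0 bout P0 pos in auto)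
qed

lemma Cc_infty_realI:
  fixes \<eta> :: "real \<Rightarrow> real"
  assumes "\<And>k. Ck k \<eta>" "\<And>x. x \<notin> {a..b} \<Longrightarrow> \<eta> x = 0" "{a..b} \<subseteq> U"
  shows "\<eta> \<in> Cc_infty U"
proof -
  have "{x. \<eta> x \<noteq> 0} \<subseteq> {a..b}" using assms(2) by blast
  then have *: "closure {x. \<eta> x \<noteq> 0} \<subseteq> {a..b}" by (rule closure_minimal) simp
  then have "compact (closure {x. \<eta> x \<noteq> 0})"
    by (meson bounded_closed_interval bounded_subset closed_closure compact_eq_bounded_closed)
  with assms * show ?thesis by (auto simp: Cc_infty_def)
qed

lemma Cc_infty_realD:
  fixes \<eta> :: "real \<Rightarrow> real"
  assumes "\<eta> \<in> Cc_infty U"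
  obtains K N M where "compact K" "K \<subseteq> U" "\<And>x. x \<notin> K \<Longrightarrow> \<eta> x = 0" "\<And>x. x \<notin> K \<Longrightarrow> deriv \<eta> x = 0"
    "\<And>x. (\<eta> has_real_derivative deriv \<eta> x) (at x)" "continuous_on UNIV \<eta>" "continuous_on UNIV (deriv \<eta>)"
    "\<And>x. x \<notin> {-N..N} \<Longrightarrow> \<eta> x = 0" "\<And>x. x \<notin> {-N..N} \<Longrightarrow> deriv \<eta> x = 0"
    "\<And>x. \<bar>\<eta> x\<bar> \<le> M" "\<And>x. \<bar>deriv \<eta> x\<bar> \<le> M" "K \<subseteq> {-N..N}"
proof -
  define K where "K = closure {x. \<eta> x \<noteq> 0}"
  have K: "compact K" "K \<subseteq> U" and Ck: "\<And>k. Ck k \<eta>" using assms by (auto simp: Cc_infty_def K_def)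
  have out: "\<eta> x = 0" if "x \<notin> K" for x using that closure_subset[of "{x. \<eta> x \<noteq> 0}"] by (auto simp: K_def)
  have der: "(\<eta> has_real_derivative deriv \<eta> x) (at x)" for x by (rule Ck_real_SucE(1)[OF Ck])
  have cont: "continuous_on UNIV \<eta>" "continuous_on UNIV (deriv \<eta>)"
    using Ck[of 0] Ck_real_SucE(2)[OF Ck, of 0] by simp_all
  have dout: "deriv \<eta> x = 0" if "x \<notin> K" for x
  proof -
    have "(\<eta> has_real_derivative 0) (at x)"
      by (rule has_field_derivative_transform_within_open[OF DERIV_const[of 0], where S = "- K"])
        (use that out K compact_imp_closed in auto)
    then show ?thesis by (rule DERIV_imp_deriv)
  qed
  obtain N where N: "\<And>x. x \<in> K \<Longrightarrow> \<bar>x\<bar> \<le> N"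
    using compact_imp_bounded[OF K(1)] by (auto simp: bounded_iff)
  obtain M1 where M1: "\<And>x. x \<in> K \<Longrightarrow> \<bar>\<eta> x\<bar> \<le> M1"
    using compact_imp_bounded[OF compact_continuous_image[OF continuous_on_subset[OF cont(1)] K(1)]] by (auto simp: bounded_iff)
  obtain M2 where M2: "\<And>x. x \<in> K \<Longrightarrow> \<bar>deriv \<eta> x\<bar> \<le> M2"
    using compact_imp_bounded[OF compact_continuous_image[OF continuous_on_subset[OF cont(2)] K(1)]] by (auto simp: bounded_iff)
  have NK: "x \<notin> K" if "x \<notin> {-N..N}" for x using N[of x] that by (auto simp: abs_le_iff)
  have b: "\<bar>\<eta> x\<bar> \<le> \<bar>M1\<bar> + \<bar>M2\<bar>" "\<bar>deriv \<eta> x\<bar> \<le> \<bar>M1\<bar> + \<bar>M2\<bar>" for x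
    using M1[of x] M2[of x] out[of x] dout[of x] by (cases "x \<in> K"; simp)+
  show thesis
    by (rule that[OF K out dout der cont, of N "\<bar>M1\<bar> + \<bar>M2\<bar>"]) (use NK b out dout in blast)+
qed

section \<open>Square-integrable paths and the fundamental theorem for weak derivatives\<close>

lemma L2_timeD:
  assumes "g \<in> L2_time I X"
  shows "(\<lambda>t. indicator I t *\<^sub>R g t) \<in> borel_measurable borel" "set_integrable lborel I (\<lambda>t. (norm (g t))\<^sup>2)"
    "AE t in lborel. t \<in> I \<longrightarrow> g t \<in> X"
  using assms by (auto simp: L2_time_def set_borel_measurable_def)

text \<open>A bounded factor that vanishes outside a bounded interval turns square integrability
  into integrability, through \<open>norm \<le> 1 + norm^2\<close>. The interval \<open>I\<close>
  itself may be unbounded.\<close>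

lemma L2_time_integrable_test:
  assumes g: "g \<in> L2_time I X" and \<eta>: "\<eta> \<in> borel_measurable borel" "\<And>x. \<bar>\<eta> x\<bar> \<le> M" "\<And>x. x \<notin> {a..b} \<Longrightarrow> \<eta> x = 0"
  shows "set_integrable lborel I (\<lambda>t. \<eta> t *\<^sub>R g t)"
  unfolding set_integrable_def
proof (rule Bochner_Integration.integrable_bound)
  show "integrable lborel (\<lambda>t. M * (indicator {a..b} t + indicator I t * (norm (g t))\<^sup>2))"
    using L2_timeD(2)[OF g] by (intro integrable_mult_right Bochner_Integration.integrable_add)
      (auto simp: set_integrable_def emeasure_lborel_Icc_eq)
  have "(\<lambda>t. \<eta> t *\<^sub>R (indicator I t *\<^sub>R g t)) \<in> borel_measurable borel"
    by (intro borel_measurable_scaleR \<eta> L2_timeD(1)[OF g])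
  then show "(\<lambda>t. indicator I t *\<^sub>R \<eta> t *\<^sub>R g t) \<in> borel_measurable lborel"
    by (simp add: mult.commute)
  show "AE t in lborel. norm (indicator I t *\<^sub>R \<eta> t *\<^sub>R g t)
      \<le> norm (M * (indicator {a..b} t + indicator I t * (norm (g t))\<^sup>2))"
  proof (rule AE_I2)
    fix t
    have M: "0 \<le> M" using \<eta>(2)[of t] by linarith
    have n: "norm (g t) \<le> 1 + (norm (g t))\<^sup>2"
    proof -
      have "0 \<le> (norm (g t) - 1/2)\<^sup>2" by simp
      then show ?thesis unfolding power2_diff by (simp add: power_one_over)
    qed
    have "\<bar>\<eta> t\<bar> * norm (g t) \<le> M * (indicator {a..b} t + (norm (g t))\<^sup>2)"
    proof (cases "t \<in> {a..b}")
      case True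
      have "\<bar>\<eta> t\<bar> * norm (g t) \<le> M * (1 + (norm (g t))\<^sup>2)" using n \<eta>(2) M by (intro mult_mono) auto
      then show ?thesis using True by simp
    qed (use \<eta>(3) M in auto)
    then show "norm (indicator I t *\<^sub>R \<eta> t *\<^sub>R g t)
      \<le> norm (M * (indicator {a..b} t + indicator I t * (norm (g t))\<^sup>2))"
      using M by (auto simp: indicator_def)
  qed
qed

lemma L2_time_integrable_Ioc:
  assumes g: "g \<in> L2_time I X" and sub: "{a<..b} \<subseteq> I"
  shows "set_integrable lborel {a<..b} g"
proof -
  have "set_integrable lborel I (\<lambda>t. (indicator {a<..b} t :: real) *\<^sub>R g t)"
    by (rule L2_time_integrable_test[OF g, where M = 1 and a = a and b = b]) (auto simp: indicator_def)
  moreover have "(\<lambda>t. indicator I t *\<^sub>R (indicator {a<..b} t :: real) *\<^sub>R g t) = (\<lambda>t. indicator {a<..b} t *\<^sub>R g t)"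
    using sub by (auto simp: indicator_def fun_eq_iff)
  ultimately show ?thesis by (simp add: set_integrable_def del: scaleR_scaleR)
qed

text \<open>Substituting \<open>x = r + y / n\<close> freezes the bump and lets dominated
  convergence act on \<open>U\<close>. The bump sits to the right of \<open>r\<close>, so continuity
  on \<open>[r, b]\<close> is what is used.\<close>

lemma mollifier_tendsto:
  fixes U :: "real \<Rightarrow> 'b::{banach, second_countable_topology}"
  assumes \<theta>: "continuous_on UNIV \<theta>" "\<And>x. (\<Theta> has_real_derivative \<theta> x) (at x)" "\<And>x. 0 \<le> \<theta> x" "\<And>x. x \<notin> {0<..<1} \<Longrightarrow> \<theta> x = 0"
    "\<Theta> 0 = 0" "\<Theta> 1 = 1"
    and U: "U \<in> borel_measurable borel" "continuous_on {r..b} U" "r < b"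
  shows "(\<lambda>n. LINT x|lborel. (real n * \<theta> (real n * (x - r))) *\<^sub>R U x) \<longlonglongrightarrow> U r"
proof -
  obtain M where M: "\<And>x. x \<in> {r..b} \<Longrightarrow> norm (U x) \<le> M"
    using compact_imp_bounded[OF compact_continuous_image[OF U(2)]] unfolding bounded_iff by (metis compact_Icc imageI)
  obtain N where N: "1 / (b - r) < real N" using reals_Archimedean2 by blast
  have \<theta>_int: "has_bochner_integral lborel (\<lambda>y. \<theta> y * indicator {0..1} y) (\<Theta> 1 - \<Theta> 0)"
    by (rule has_bochner_integral_FTC_Icc_nonneg) (use \<theta> borel_measurable_continuous_onI in auto)
  moreover have ind: "\<theta> y * indicator {0..1} y = \<theta> y" for y
    using \<theta>(4)[of y] by (cases "y \<in> {0<..<1}") (auto simp: indicator_def)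
  ultimately have \<theta>I: "has_bochner_integral lborel \<theta> 1" using \<theta> by simp
  have Ub: "norm (U (r + y / real n)) \<le> M" if "n \<ge> N" "0 < y" "y < 1" for n y
  proof (rule M)
    have n: "1 / (b - r) < real n" using N that by linarith
    moreover have "0 < 1 / (b - r)" using U by simp
    ultimately have "0 < real n" by linarith
    have "y / real n < 1 / real n" using that \<open>0 < real n\<close> by (simp add: divide_strict_right_mono)
    moreover have "1 / real n < b - r" using n U \<open>0 < real n\<close> by (simp add: field_simps)
    moreover have "0 < y / real n" using that \<open>0 < real n\<close> by simp
    ultimately show "r + y / real n \<in> {r..b}" by simp
  qed
  \<comment> \<open>The offset \<open>Suc N\<close> makes all denominators positive and keeps all
    sample points inside \<open>[r, b]\<close>.\<close>
  have "(\<lambda>n. LINT y|lborel. \<theta> y *\<^sub>R U (r + y / real (n + Suc N))) \<longlonglongrightarrow> (LINT y|lborel. \<theta> y *\<^sub>R U r)"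
  proof (rule integral_dominated_convergence)
    have [measurable]: "\<theta> \<in> borel_measurable borel" "U \<in> borel_measurable borel"
      using \<theta>(1) U(1) by (auto intro: borel_measurable_continuous_onI)
    show "(\<lambda>y. \<theta> y *\<^sub>R U r) \<in> borel_measurable lborel" by measurable
    show "(\<lambda>y. \<theta> y *\<^sub>R U (r + y / real (n + Suc N))) \<in> borel_measurable lborel" for n by measurable
    show "integrable lborel (\<lambda>y. \<theta> y * M)" using \<theta>I by (auto simp: has_bochner_integral_iff)
    show "AE y in lborel. (\<lambda>n. \<theta> y *\<^sub>R U (r + y / real (n + Suc N))) \<longlonglongrightarrow> \<theta> y *\<^sub>R U r"
    proof (rule AE_I2)
      fix y
      show "(\<lambda>n. \<theta> y *\<^sub>R U (r + y / real (n + Suc N))) \<longlonglongrightarrow> \<theta> y *\<^sub>R U r"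
      proof (cases "y \<in> {0<..<1}")
        case True
        have l0: "(\<lambda>n. r + y / real (n + Suc N)) \<longlonglongrightarrow> r + 0"
          by (intro tendsto_intros LIMSEQ_ignore_initial_segment[OF lim_const_over_n])
        have mem: "r + y / real (n + Suc N) \<in> {r..b}" for n
        proof -
          have "1 / (b - r) < real (n + Suc N)" using N by simp
          moreover have "0 < real (n + Suc N)" by simp
          ultimately have "1 / real (n + Suc N) < b - r" using U(3) by (simp add: field_simps)
          moreover have "y / real (n + Suc N) < 1 / real (n + Suc N)" using True by (simp add: divide_strict_right_mono)
          moreover have "0 < y / real (n + Suc N)" using True by simp
          ultimately show ?thesis unfolding atLeastAtMost_iff by linarith
        qed
        have "(\<lambda>n. U (r + y / real (n + Suc N))) \<longlonglongrightarrow> U r"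
          by (rule continuous_on_tendsto_compose[OF U(2)]) (use l0 mem U(3) in auto)
        then show ?thesis by (intro tendsto_intros)
      qed (use \<theta>(4) in auto)
    qed
    show "AE y in lborel. norm (\<theta> y *\<^sub>R U (r + y / real (n + Suc N))) \<le> \<theta> y * M" for n
    proof (rule AE_I2)
      fix y show "norm (\<theta> y *\<^sub>R U (r + y / real (n + Suc N))) \<le> \<theta> y * M"
        using Ub[of "n + Suc N" y] \<theta>(3)[of y] \<theta>(4)[of y] by (cases "y \<in> {0<..<1}") (auto intro: mult_left_mono)
    qed
  qed
  also have "(LINT y|lborel. \<theta> y *\<^sub>R U r) = U r"
    using \<theta>I by (simp add: has_bochner_integral_iff)
  finally have lim: "(\<lambda>n. LINT y|lborel. \<theta> y *\<^sub>R U (r + y / real (n + Suc N))) \<longlonglongrightarrow> U r" .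
  have "(LINT x|lborel. (real n * \<theta> (real n * (x - r))) *\<^sub>R U x) = (LINT y|lborel. \<theta> y *\<^sub>R U (r + y / real n))"
    if "0 < n" for n
  proof -
    have "(LINT x|lborel. (real n * \<theta> (real n * (x - r))) *\<^sub>R U x)
        = (1 / real n) *\<^sub>R (LINT y|lborel. (real n * \<theta> y) *\<^sub>R U (r + y / real n))"
      using lborel_integral_real_affine[of "1 / real n" "\<lambda>x. (real n * \<theta> (real n * (x - r))) *\<^sub>R U x" r] that
      by simp
    also have "\<dots> = (1 / real n) *\<^sub>R (real n *\<^sub>R (LINT y|lborel. \<theta> y *\<^sub>R U (r + y / real n)))"
      by (simp flip: integral_scaleR_right)
    finally show ?thesis using that by simp
  qed
  then have "(\<lambda>n. LINT x|lborel. (real (n + Suc N) * \<theta> (real (n + Suc N) * (x - r))) *\<^sub>R U x) \<longlonglongrightarrow> U r"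
    using lim by (simp del: of_nat_add of_nat_Suc)
  then show ?thesis by (rule LIMSEQ_offset)
qed

text \<open>The test functions \<open>\<eta> n\<close> are smooth approximations of the indicator of
  \<open>(r, t]\<close>, and their derivatives are differences of mollifiers at \<open>r\<close> and
  at \<open>t\<close>. The gap between \<open>t\<close> and \<open>b\<close> leaves room for the
  flank on which \<open>\<eta> n\<close> descends to 0.\<close>

lemma weak_deriv_FTC:
  fixes u v :: "real \<Rightarrow> 'b::{real_inner, banach, second_countable_topology}"
  assumes wd: "weak_deriv I u v" and u: "u \<in> L2_time I X" "continuous_on I u" and v: "v \<in> L2_time I X"
    and sub: "{r..b} \<subseteq> interior I" and rt: "r \<le> t" "t < b"
  shows "(LINT x:{r<..t}|lborel. v x) = u t - u r"
proof -
  obtain \<theta> \<Theta> :: "real \<Rightarrow> real" where \<theta>: "\<And>k. Ck k \<theta>" "\<And>x. (\<Theta> has_real_derivative \<theta> x) (at x)" "\<And>x. 0 \<le> \<theta> x"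
    "\<And>x. x \<notin> {0<..<1} \<Longrightarrow> \<theta> x = 0" "\<And>x. x \<le> 0 \<Longrightarrow> \<Theta> x = 0" "\<And>x. 1 \<le> x \<Longrightarrow> \<Theta> x = 1"
    "\<And>x. 0 \<le> \<Theta> x \<and> \<Theta> x \<le> 1" using smooth_step_exists by blast
  have C\<Theta>: "Ck k \<Theta>" for k by (rule Ck_Suc_imp_Ck[OF Ck_real_SucI[OF \<theta>(2,1)]])
  have I: "{r..b} \<subseteq> I" using sub interior_subset by blast
  define U where "U x = indicator I x *\<^sub>R u x" for x
  define W where "W x = indicator I x *\<^sub>R v x" for x
  have Um: "U \<in> borel_measurable borel" and Wm: "W \<in> borel_measurable borel"
    using L2_timeD(1)[OF u(1)] L2_timeD(1)[OF v] by (simp_all add: U_def[abs_def] W_def[abs_def])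
  have Uc: "continuous_on S U" if "S \<subseteq> I" for S
    using continuous_on_subset[OF u(2) that]
    by (rule continuous_on_cong[THEN iffD1, rotated -1]) (use that in \<open>auto simp: U_def\<close>)
  have contTheta: "continuous_on UNIV \<theta>" "continuous_on UNIV \<Theta>" using \<theta>(1)[of 0] C\<Theta>[of 0] by auto
  define \<eta> where "\<eta> n x = \<Theta> (real n * (x - r)) - \<Theta> (real n * (x - t))" for n x
  have \<eta>_der: "deriv (\<eta> n) x = real n * \<theta> (real n * (x - r)) - real n * \<theta> (real n * (x - t))" for n x
  proof (rule DERIV_imp_deriv)
    have "((\<lambda>x. \<Theta> (real n * (x - c))) has_real_derivative \<theta> (real n * (x - c)) * real n) (at x)" for c
      by (rule DERIV_chain2[OF \<theta>(2)]) (auto intro!: derivative_eq_intros)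
    from DERIV_diff[OF this[of r] this[of t]]
    show "(\<eta> n has_real_derivative real n * \<theta> (real n * (x - r)) - real n * \<theta> (real n * (x - t))) (at x)"
      by (simp add: \<eta>_def[abs_def] mult.commute)
  qed
  obtain N where N: "1 / (b - t) < real N" using reals_Archimedean2 by blast
  have Npos: "0 < real N" using N rt by (smt (verit) zero_less_divide_1_iff)
  have \<eta>_out: "\<eta> n x = 0" if "N \<le> n" "x \<notin> {r..b}" for n x
  proof -
    have n: "0 < real n" "1 / (b - t) < real n" using that(1) Npos N by auto
    show ?thesis
    proof (cases "x < r")
      case True
      then have "real n * (x - r) \<le> 0" "real n * (x - t) \<le> 0" using n rt by (auto simp: mult_le_0_iff)
      then show ?thesis by (simp add: \<eta>_def \<theta>(5))
    next
      case False
      then have x: "b < x" using that by auto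
      have "1 < real n * (b - t)" using n rt by (simp add: field_simps)
      also have "\<dots> \<le> real n * (x - t)" using n x by (intro mult_left_mono) auto
      also have "\<dots> \<le> real n * (x - r)" using n rt by (intro mult_left_mono) auto
      ultimately show ?thesis by (simp add: \<eta>_def \<theta>(6))
    qed
  qed
  have \<eta>C: "Ck k (\<eta> n)" for k n
  proof -
    have "\<eta> n = (\<lambda>x. \<Theta> (real n * x + (- real n * r)) + (-1) * \<Theta> (real n * x + (- real n * t)))"
      by (auto simp: \<eta>_def algebra_simps)
    then show ?thesis
      by (simp only:) (rule Ck_add[OF Ck_real_affine[OF C\<Theta>] Ck_real_mult[OF Ck_real_const Ck_real_affine[OF C\<Theta>]]])
  qed
  have weak: "(LINT x|lborel. deriv (\<eta> n) x *\<^sub>R U x) = - (LINT x|lborel. \<eta> n x *\<^sub>R W x)" if "N \<le> n" for n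
  proof -
    have "\<eta> n \<in> Cc_infty (interior I)"
      by (rule Cc_infty_realI[OF \<eta>C \<eta>_out[OF that] sub])
    then have "(LINT t:I|lborel. deriv (\<eta> n) t *\<^sub>R u t) = - (LINT t:I|lborel. \<eta> n t *\<^sub>R v t)"
      using wd by (simp add: weak_deriv_def)
    then show ?thesis
      unfolding set_lebesgue_integral_def U_def W_def by (simp add: mult.commute)
  qed
  have moll_int: "integrable lborel (\<lambda>x. (real n * \<theta> (real n * (x - c))) *\<^sub>R U x)" if c: "r \<le> c" "c \<le> t" and n: "N \<le> n" for n c
  proof -
    have n0: "0 < real n" "1 / (b - t) < real n" using n Npos N by auto
    obtain M where M: "\<And>x. \<bar>real n * \<theta> (real n * (x - c))\<bar> \<le> M"
    proof -
      obtain B where B: "\<And>x. x \<in> {0..1} \<Longrightarrow> norm (\<theta> x) \<le> B"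
        using compact_imp_bounded[OF compact_continuous_image[OF continuous_on_subset[OF contTheta(1)]], of "{0..1}"]
        unfolding bounded_iff by (metis UNIV_I compact_Icc imageI subsetI)
      have "\<bar>\<theta> y\<bar> \<le> B" for y using B[of y] B[of 0] \<theta>(4)[of y] \<theta>(4)[of 0] by (cases "y \<in> {0<..<1}") auto
      then show thesis by (intro that[of "real n * B"]) (auto simp: abs_mult intro: mult_left_mono)
    qed
    have "set_integrable lborel I (\<lambda>x. (real n * \<theta> (real n * (x - c))) *\<^sub>R u x)"
    proof (rule L2_time_integrable_test[OF u(1) _ M])
      show "(\<lambda>x. real n * \<theta> (real n * (x - c))) \<in> borel_measurable borel"
        using borel_measurable_continuous_onI[OF contTheta(1)] by measurable
      show "real n * \<theta> (real n * (x - c)) = 0" if "x \<notin> {c..c+1/real n}" for x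
      proof -
        have "real n * (x - c) \<notin> {0<..<1}" using that n0 by (auto simp: field_simps zero_less_mult_iff)
        then show ?thesis using \<theta>(4) by simp
      qed
    qed
    then show ?thesis by (simp add: set_integrable_def U_def mult_ac)
  qed
  have "(\<lambda>n. (LINT x|lborel. (real n * \<theta> (real n * (x - r))) *\<^sub>R U x) - (LINT x|lborel. (real n * \<theta> (real n * (x - t))) *\<^sub>R U x)) \<longlonglongrightarrow> U r - U t"
  proof (intro tendsto_diff)
    show "(\<lambda>n. LINT x|lborel. (real n * \<theta> (real n * (x - r))) *\<^sub>R U x) \<longlonglongrightarrow> U r"
      by (rule mollifier_tendsto[OF contTheta(1) \<theta>(2,3,4) _ _ Um Uc]) (use \<theta>(5,6) I rt in auto)
    show "(\<lambda>n. LINT x|lborel. (real n * \<theta> (real n * (x - t))) *\<^sub>R U x) \<longlonglongrightarrow> U t"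
      by (rule mollifier_tendsto[OF contTheta(1) \<theta>(2,3,4) _ _ Um Uc, of t b]) (use \<theta>(5,6) I rt in auto)
  qed
  moreover have "\<forall>\<^sub>F n in sequentially. (LINT x|lborel. (real n * \<theta> (real n * (x - r))) *\<^sub>R U x) - (LINT x|lborel. (real n * \<theta> (real n * (x - t))) *\<^sub>R U x)
      = - (LINT x|lborel. \<eta> n x *\<^sub>R W x)"
    using eventually_ge_at_top[of N]
  proof eventually_elim
    case (elim n)
    then show ?case
      using weak[OF elim] moll_int[of r n] moll_int[of t n] rt
      by (simp add: \<eta>_der scaleR_left_diff_distrib)
  qed
  ultimately have l1: "(\<lambda>n. - (LINT x|lborel. \<eta> n x *\<^sub>R W x)) \<longlonglongrightarrow> U r - U t"
    by (rule Lim_transform_eventually)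
  have "(\<lambda>n. LINT x|lborel. \<eta> (n + N) x *\<^sub>R W x) \<longlonglongrightarrow> (LINT x|lborel. indicator {r<..t} x *\<^sub>R W x)"
  \<comment> \<open>Starting at \<open>r - 1\<close> ensures that the half-open interval contains
    the point \<open>r\<close>, outside of \<open>[r, b]\<close> all \<open>\<eta> n\<close> in
    question vanish.\<close>
  proof (rule integral_dominated_convergence[where w = "\<lambda>x. norm (indicator {r - 1<..b} x *\<^sub>R W x)"])
    have [measurable]: "W \<in> borel_measurable borel" "\<eta> n \<in> borel_measurable borel" for n
      using Wm \<eta>C[of 0 n] by (auto intro: borel_measurable_continuous_onI)
    show "(\<lambda>x. \<eta> (n + N) x *\<^sub>R W x) \<in> borel_measurable lborel" for n by measurable
    show "(\<lambda>x. indicat_real {r<..t} x *\<^sub>R W x) \<in> borel_measurable lborel" by measurable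
    have "set_integrable lborel I (\<lambda>x. (indicator {r - 1<..b} x :: real) *\<^sub>R v x)"
      by (rule L2_time_integrable_test[OF v, where M = 1 and a = "r - 1" and b = b]) (auto simp: indicator_def)
    then show "integrable lborel (\<lambda>x. norm (indicat_real {r - 1<..b} x *\<^sub>R W x))"
      by (intro integrable_norm) (simp add: set_integrable_def W_def mult.commute)
    show "AE x in lborel. (\<lambda>n. \<eta> (n + N) x *\<^sub>R W x) \<longlonglongrightarrow> indicat_real {r<..t} x *\<^sub>R W x"
    proof (rule AE_I2)
      fix x
      have \<Theta>lim: "(\<lambda>n. \<Theta> (real (n + N) * (x - c))) \<longlonglongrightarrow> indicator {c<..} x" for c
      proof (cases "c < x")
        case True
        obtain n0 where n0: "1 / (x - c) < real n0" using reals_Archimedean2 by blast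
        have "\<Theta> (real (n + N) * (x - c)) = 1" if "n0 \<le> n" for n
        proof (rule \<theta>(6))
          have "1 / (x - c) < real (n + N)" using n0 that by simp
          then show "1 \<le> real (n + N) * (x - c)" using True by (simp add: divide_less_eq)
        qed
        then show ?thesis using True by (intro tendsto_eventually) (auto simp: eventually_sequentially)
      next
        case False
        then have "\<Theta> (real (n + N) * (x - c)) = 0" for n by (intro \<theta>(5)) (auto simp: mult_le_0_iff)
        then show ?thesis using False by simp
      qed
      have "(\<lambda>n. \<eta> (n + N) x) \<longlonglongrightarrow> indicator {r<..} x - indicator {t<..} x"
        unfolding \<eta>_def by (intro tendsto_diff \<Theta>lim)
      also have "indicator {r<..} x - indicator {t<..} x = (indicator {r<..t} x :: real)"
        using rt by (auto simp: indicator_def)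
      finally show "(\<lambda>n. \<eta> (n + N) x *\<^sub>R W x) \<longlonglongrightarrow> indicat_real {r<..t} x *\<^sub>R W x" by (intro tendsto_intros)
    qed
    show "AE x in lborel. norm (\<eta> (n + N) x *\<^sub>R W x) \<le> norm (indicat_real {r - 1<..b} x *\<^sub>R W x)" for n
    proof (rule AE_I2)
      fix x
      have "\<bar>\<eta> (n + N) x\<bar> \<le> indicator {r - 1<..b} x"
        using \<eta>_out[of "n + N" x] \<theta>(7)[of "real (n + N) * (x - r)"] \<theta>(7)[of "real (n + N) * (x - t)"]
        by (cases "x \<in> {r..b}") (auto simp: \<eta>_def indicator_def abs_le_iff)
      then show "norm (\<eta> (n + N) x *\<^sub>R W x) \<le> norm (indicat_real {r - 1<..b} x *\<^sub>R W x)"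
        by (auto intro!: mult_right_mono)
    qed
  qed
  then have "(\<lambda>n. - (LINT x|lborel. \<eta> n x *\<^sub>R W x)) \<longlonglongrightarrow> - (LINT x|lborel. indicator {r<..t} x *\<^sub>R W x)"
    by (rule tendsto_minus[OF LIMSEQ_offset])
  from LIMSEQ_unique[OF l1 this] have "- (U t - U r) = - (LINT x|lborel. indicator {r<..t} x *\<^sub>R W x)"
    by simp
  then have "U t - U r = (LINT x|lborel. indicator {r<..t} x *\<^sub>R W x)" by (simp only: neg_equal_iff_equal)
  also have "(\<lambda>x. indicator {r<..t} x *\<^sub>R W x) = (\<lambda>x. indicator {r<..t} x *\<^sub>R v x)"
    using I rt by (auto simp: W_def indicator_def fun_eq_iff)
  finally show ?thesis
    using I rt by (simp add: U_def set_lebesgue_integral_def indicator_def subset_iff)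
qed

text \<open>Half-open intervals form an intersection-stable generator of the Borel sets, so the
  integrals vanish over all Borel sets by a Dynkin argument. The total integral, needed for
  complements, is a limit over growing intervals.\<close>

lemma AE_zero_if_Ioc_integrals_zero:
  fixes f :: "real \<Rightarrow> 'b::{banach, second_countable_topology}"
  assumes f: "integrable lborel f" and zero: "\<And>r t. r \<le> t \<Longrightarrow> (LINT x:{r<..t}|lborel. f x) = 0"
  shows "AE x in lborel. f x = 0"
proof (rule sigma_finite_measure.density_zero[OF sigma_finite_lborel f])
  have si: "set_integrable lborel A f" if "A \<in> sets borel" for A
    using that f by (simp add: set_integrable_def integrable_mult_indicator)
  have Iz: "(LINT x:{r<..t}|lborel. f x) = 0" for r t
  proof (cases "r \<le> t")
    case False
    then have "{r<..t} = {}" by auto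
    then show ?thesis by (simp add: set_lebesgue_integral_def)
  qed (rule zero)
  have total: "(LINT x|lborel. f x) = 0"
  proof (rule LIMSEQ_unique)
    show "(\<lambda>n. LINT x|lborel. indicator {- real n<..real n} x *\<^sub>R f x) \<longlonglongrightarrow> (LINT x|lborel. f x)"
    proof (rule integral_dominated_convergence[where w = "\<lambda>x. norm (f x)"])
      show "AE x in lborel. (\<lambda>n. indicator {- real n<..real n} x *\<^sub>R f x) \<longlonglongrightarrow> f x"
      proof (rule AE_I2)
        fix x
        obtain N where N: "\<bar>x\<bar> < real N" using reals_Archimedean2 by blast
        have "indicator {- real n<..real n} x *\<^sub>R f x = f x" if "N \<le> n" for n
          using N that by (auto simp: indicator_def)
        then show "(\<lambda>n. indicator {- real n<..real n} x *\<^sub>R f x) \<longlonglongrightarrow> f x"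
          by (intro tendsto_eventually) (auto simp: eventually_sequentially)
      qed
    qed (use f in \<open>auto simp: indicator_def\<close>)
    show "(\<lambda>n. LINT x|lborel. indicator {- real n<..real n} x *\<^sub>R f x) \<longlonglongrightarrow> 0"
      using Iz by (simp add: set_lebesgue_integral_def)
  qed
  fix A assume "A \<in> sets (lborel :: real measure)"
  moreover have borel: "sigma_sets UNIV (range (\<lambda>(a, b). {a <.. b::real})) = sets borel"
  proof -
    have "sets borel = sets (sigma UNIV (range (\<lambda>(a, b). {a <.. b::real})))"
      by (rule arg_cong[OF borel_sigma_sets_Ioc])
    also have "\<dots> = sigma_sets UNIV (range (\<lambda>(a, b). {a <.. b::real}))" by (rule sets_measure_of) simp
    finally show ?thesis ..
  qed
  ultimately have A: "A \<in> sigma_sets UNIV (range (\<lambda>(a, b). {a <.. b::real}))" by simp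
  have "Int_stable (range (\<lambda>(a, b). {a <.. b::real}))"
  proof (rule Int_stableI)
    fix A B assume "A \<in> range (\<lambda>(a, b). {a <.. b::real})" "B \<in> range (\<lambda>(a, b). {a <.. b::real})"
    then obtain a b c d where "A = {a<..b}" "B = {c<..d}" by auto
    then show "A \<inter> B \<in> range (\<lambda>(a, b). {a <.. b::real})"
      by (intro image_eqI[of _ _ "(max a c, min b d)"]) auto
  qed
  from this subset_UNIV[THEN Pow_mono, THEN subset_trans[OF subset_Pow_Union]] A
  show "(LINT x:A|lborel. f x) = 0"
  proof (induction rule: sigma_sets_induct_disjoint)
    case (basic A)
    then show ?case using Iz by auto
  next
    case empty
    show ?case by (simp add: set_lebesgue_integral_def)
  next
    case (compl A)
    then have A: "A \<in> sets borel" by (simp add: borel)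
    have "(LINT x|lborel. f x) = (LINT x:A|lborel. f x) + (LINT x:UNIV - A|lborel. f x)"
      using set_integral_Un[of A "UNIV - A" lborel f] si A by (simp add: set_lebesgue_integral_def Un_absorb1)
    then show ?case using compl total by simp
  next
    case (union A)
    have A: "A i \<in> sets borel" for i using union(2) by (auto simp: borel)
    have "(LINT x:(\<Union>i. A i)|lborel. f x) = (\<Sum>i. LINT x:A i|lborel. f x)"
    proof (rule lebesgue_integral_countable_add)
      show "A i \<inter> A j = {}" if "i \<noteq> j" for i j
        using union(1) that by (auto simp: disjoint_family_on_def)
      show "set_integrable lborel (\<Union>i. A i) f" using A by (intro si) auto
    qed (use A in auto)
    then show ?case using union(3) by simp
  qed
qed

text \<open>By the fundamental theorem both candidates have equal integrals over all half-open
  subintervals of a compact piece of the interior. Restricting to rational endpoints makes the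
  exceptional null sets countable in number.\<close>

lemma weak_deriv_unique:
  fixes u v1 v2 :: "real \<Rightarrow> 'b::{real_inner, banach, second_countable_topology}"
  assumes wd: "weak_deriv I u v1" "weak_deriv I u v2" and u: "u \<in> L2_time I X" "continuous_on I u"
    and v: "v1 \<in> L2_time I X" "v2 \<in> L2_time I X"
  shows "AE t in lborel. t \<in> interior I \<longrightarrow> v1 t = v2 t"
proof -
  have *: "AE t in lborel. t \<in> {a<..m} \<longrightarrow> v1 t = v2 t" if sub: "{a..b} \<subseteq> interior I" and "m < b" for a m b
  proof -
    define f where "f t = indicator {a<..m} t *\<^sub>R (v1 t - v2 t)" for t
    have sub': "{a<..m} \<subseteq> I" using sub \<open>m < b\<close> interior_subset by fastforce
    have i: "integrable lborel (\<lambda>t. indicator {a<..m} t *\<^sub>R v1 t)" "integrable lborel (\<lambda>t. indicator {a<..m} t *\<^sub>R v2 t)"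
      using L2_time_integrable_Ioc[OF v(1) sub'] L2_time_integrable_Ioc[OF v(2) sub'] by (auto simp: set_integrable_def)
    have f: "integrable lborel f" unfolding f_def scaleR_right_diff_distrib by (intro Bochner_Integration.integrable_diff i)
    have "AE x in lborel. f x = 0"
    proof (rule AE_zero_if_Ioc_integrals_zero[OF f])
      fix r t :: real assume "r \<le> t"
      show "(LINT x:{r<..t}|lborel. f x) = 0"
      proof (cases "max r a \<le> min t m")
        case True
        let ?r = "max r a" and ?t = "min t m"
        have sb: "{?r<..?t} \<subseteq> I" using sub' by auto
        have "(LINT x:{r<..t}|lborel. f x) = (LINT x:{?r<..?t}|lborel. v1 x - v2 x)"
          unfolding set_lebesgue_integral_def f_def
          by (rule Bochner_Integration.integral_cong) (auto simp: indicator_def)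
        also have "\<dots> = (LINT x:{?r<..?t}|lborel. v1 x) - (LINT x:{?r<..?t}|lborel. v2 x)"
          by (intro set_integral_diff L2_time_integrable_Ioc[OF v(1) sb] L2_time_integrable_Ioc[OF v(2) sb])
        also have "(LINT x:{?r<..?t}|lborel. v1 x) = u ?t - u ?r"
          by (rule weak_deriv_FTC[OF wd(1) u v(1), of _ b]) (use sub True \<open>m < b\<close> in auto)
        also have "(LINT x:{?r<..?t}|lborel. v2 x) = u ?t - u ?r"
          by (rule weak_deriv_FTC[OF wd(2) u v(2), of _ b]) (use sub True \<open>m < b\<close> in auto)
        finally show ?thesis by simp
      next
        case False
        then have "(\<lambda>x. indicator {r<..t} x *\<^sub>R f x) = (\<lambda>_. 0)" by (auto simp: f_def indicator_def fun_eq_iff)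
        then show ?thesis by (simp only: set_lebesgue_integral_def) simp
      qed
    qed
    then show ?thesis by eventually_elim (auto simp: f_def)
  qed
  have "AE t in lborel. \<forall>a\<in>\<rat>. \<forall>m\<in>\<rat>. \<forall>b\<in>\<rat>. {a..b} \<subseteq> interior I \<and> m < b \<longrightarrow> t \<in> {a<..m} \<longrightarrow> v1 t = v2 t"
    using * by (intro AE_ball_countable[THEN iffD2] countable_rat ballI AE_impI) auto
  then show ?thesis
  proof eventually_elim
    case (elim t)
    show ?case
    proof
      assume "t \<in> interior I"
      then obtain e where e: "0 < e" "ball t e \<subseteq> interior I" using open_contains_ball[of "interior I"] by auto
      obtain a where a: "a \<in> \<rat>" "t - e < a" "a < t" using Rats_dense_in_real[of "t - e" t] e by auto
      obtain m where m: "m \<in> \<rat>" "t < m" "m < t + e" using Rats_dense_in_real[of t "t + e"] e by auto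
      obtain b where b: "b \<in> \<rat>" "m < b" "b < t + e" using Rats_dense_in_real[of m "t + e"] m by auto
      have "{a..b} \<subseteq> ball t e" using a b by (auto simp: dist_real_def)
      with e have "{a..b} \<subseteq> interior I" by blast
      with elim a(1) m(1) b(1,2) have "t \<in> {a<..m} \<longrightarrow> v1 t = v2 t" by blast
      then show "v1 t = v2 t" using a m by simp
    qed
  qed
qed

lemma integrable_continuous_vanishing:
  fixes f :: "real \<Rightarrow> 'b::{banach, second_countable_topology}"
  assumes "continuous_on UNIV f" "\<And>x. x \<notin> {-N..N} \<Longrightarrow> f x = 0"
  shows "integrable lborel f"
proof -
  have "integrable lborel (\<lambda>x. indicator {-N..N} x *\<^sub>R f x)"
    by (rule borel_integrable_compact) (auto intro: continuous_on_subset[OF assms(1)])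
  also have "(\<lambda>x. indicator {-N..N} x *\<^sub>R f x) = f"
    using assms(2) by (auto simp: indicator_def fun_eq_iff)
  finally show ?thesis .
qed

text \<open>Outside the interior nothing is known of \<open>u\<close>, so the products with the test
  function are extended by 0 off its compact support and seen to be continuous on the line. Pairing
  with a fixed vector reduces the claim to the real fundamental theorem.\<close>

lemma deriv_imp_weak_deriv:
  fixes u v :: "real \<Rightarrow> 'b::{real_inner, banach, second_countable_topology}"
  assumes der: "\<And>t. t \<in> interior I \<Longrightarrow> (u has_vector_derivative v t) (at t)"
    and cont: "continuous_on (interior I) v"
  shows "weak_deriv I u v"
  unfolding weak_deriv_def
proof
  fix \<eta> assume "\<eta> \<in> Cc_infty (interior I)"
  then obtain K N M where K: "compact K" "K \<subseteq> interior I" and out: "\<And>x. x \<notin> K \<Longrightarrow> \<eta> x = 0" "\<And>x. x \<notin> K \<Longrightarrow> deriv \<eta> x = 0"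
    and \<eta>: "\<And>x. (\<eta> has_real_derivative deriv \<eta> x) (at x)" "continuous_on UNIV \<eta>" "continuous_on UNIV (deriv \<eta>)"
    and N: "K \<subseteq> {-N..N}" by (rule Cc_infty_realD) blast
  have oK: "open (- K)" using K by (simp add: compact_imp_closed open_Compl)
  have cover: "- K \<union> interior I = UNIV" using K by auto
  have cu: "continuous_on (interior I) u"
    using der by (intro continuous_at_imp_continuous_on ballI has_vector_derivative_continuous) blast
  have ext: "continuous_on UNIV (\<lambda>t. h t *\<^sub>R w t)"
    if "\<And>x. x \<notin> K \<Longrightarrow> h x = 0" "continuous_on UNIV h" "continuous_on (interior I) w"
    for h :: "real \<Rightarrow> real" and w :: "real \<Rightarrow> 'b"
    unfolding cover[symmetric]
  proof (rule continuous_on_open_Un[OF oK open_interior])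
    show "continuous_on (- K) (\<lambda>t. h t *\<^sub>R w t)"
      by (rule continuous_on_cong[THEN iffD1, OF refl _ continuous_on_const[of _ 0]]) (use that in auto)
    show "continuous_on (interior I) (\<lambda>t. h t *\<^sub>R w t)"
      by (intro continuous_intros that continuous_on_subset[OF that(2)]) auto
  qed
  have c: "continuous_on UNIV (\<lambda>t. deriv \<eta> t *\<^sub>R u t)" "continuous_on UNIV (\<lambda>t. \<eta> t *\<^sub>R v t)"
    by (rule ext[OF out(2) \<eta>(3) cu] ext[OF out(1) \<eta>(2) cont]; assumption)+
  have outN: "\<eta> x = 0" "deriv \<eta> x = 0" if "x \<notin> {-N..N}" for x
    using out[of x] N that by blast+
  have "integrable lborel (\<lambda>t. deriv \<eta> t *\<^sub>R u t)"
    by (rule integrable_continuous_vanishing[OF c(1), of N]) (metis outN scaleR_zero_left)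
  moreover have "integrable lborel (\<lambda>t. \<eta> t *\<^sub>R v t)"
    by (rule integrable_continuous_vanishing[OF c(2), of N]) (metis outN scaleR_zero_left)
  ultimately have i: "integrable lborel (\<lambda>t. deriv \<eta> t *\<^sub>R u t)" "integrable lborel (\<lambda>t. \<eta> t *\<^sub>R v t)" .
  have "(LINT t|lborel. deriv \<eta> t *\<^sub>R u t + \<eta> t *\<^sub>R v t) \<bullet> y = 0" for y
  proof -
    define F where "F t = (\<eta> t *\<^sub>R u t) \<bullet> y" for t
    define G where "G t = (deriv \<eta> t *\<^sub>R u t + \<eta> t *\<^sub>R v t) \<bullet> y" for t
    have FG: "(F has_real_derivative G t) (at t)" for t
    proof (cases "t \<in> K")
      case True
      then have "(u has_vector_derivative v t) (at t)" using K by (intro der) auto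
      from has_vector_derivative_scaleR[OF \<eta>(1) this]
      have "((\<lambda>t. \<eta> t *\<^sub>R u t) has_vector_derivative (\<eta> t *\<^sub>R v t + deriv \<eta> t *\<^sub>R u t)) (at t)" .
      from bounded_linear.has_vector_derivative[OF bounded_linear_inner_left this, of y]
      show ?thesis by (simp add: F_def[abs_def] G_def has_real_derivative_iff_has_vector_derivative add.commute)
    next
      case False
      have "(F has_real_derivative 0) (at t)"
        by (rule has_field_derivative_transform_within_open[OF DERIV_const[of 0] oK]) (use False out in \<open>auto simp: F_def\<close>)
      then show ?thesis using False out by (simp add: G_def)
    qed
    have Gc: "continuous_on UNIV G" unfolding G_def by (intro continuous_intros c)
    have "(LINT t|lborel. G t * indicator {-\<bar>N\<bar>-1..\<bar>N\<bar>+1} t) = F (\<bar>N\<bar>+1) - F (-\<bar>N\<bar>-1)"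
      by (rule integral_FTC_Icc_real) (use FG Gc in \<open>auto simp: continuous_on_eq_continuous_at\<close>)
    also have "\<dots> = 0"
    proof -
      have "\<eta> (\<bar>N\<bar> + 1) = 0" "\<eta> (- \<bar>N\<bar> - 1) = 0" by (rule outN(1), auto)+
      then show ?thesis by (simp add: F_def)
    qed
    also have "(\<lambda>t. G t * indicator {-\<bar>N\<bar>-1..\<bar>N\<bar>+1} t) = G"
    proof
      fix t show "G t * indicator {-\<bar>N\<bar>-1..\<bar>N\<bar>+1} t = G t"
        using N out[of t] by (cases "t \<in> K") (auto simp: G_def indicator_def subset_iff)
    qed
    finally show ?thesis
      using i by (simp add: G_def[abs_def])
  qed
  then have "(LINT t|lborel. deriv \<eta> t *\<^sub>R u t + \<eta> t *\<^sub>R v t) = 0"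
    by (metis inner_eq_zero_iff)
  then have "(LINT t|lborel. deriv \<eta> t *\<^sub>R u t) = - (LINT t|lborel. \<eta> t *\<^sub>R v t)"
    using i by (simp add: eq_neg_iff_add_eq_0)
  moreover have "indicator I t *\<^sub>R (\<eta> t *\<^sub>R w t) = \<eta> t *\<^sub>R w t" "indicator I t *\<^sub>R (deriv \<eta> t *\<^sub>R w t) = deriv \<eta> t *\<^sub>R w t"
    for t and w :: "real \<Rightarrow> 'b"
    using out[of t] K interior_subset[of I] by (cases "t \<in> K"; auto simp: indicator_def)+
  ultimately show "(LINT t:I|lborel. deriv \<eta> t *\<^sub>R u t) = - (LINT t:I|lborel. \<eta> t *\<^sub>R v t)"
    by (simp add: set_lebesgue_integral_def del: scaleR_scaleR)
qed

section \<open>Contraction for weakly differentiable dissipative paths\<close>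

lemma antimono_if_locally_antimono:
  fixes g :: "real \<Rightarrow> real"
  assumes "a \<le> b" "0 < \<delta>" and loc: "\<And>r t. a \<le> r \<Longrightarrow> r \<le> t \<Longrightarrow> t \<le> b \<Longrightarrow> t - r < \<delta> \<Longrightarrow> g t \<le> g r"
  shows "g b \<le> g a"
proof -
  obtain n where n: "(b - a) / \<delta> < real n" using reals_Archimedean2 by blast
  have n0: "0 < real n" using n assms(1,2) by (smt (verit) divide_nonneg_pos)
  define d where "d = (b - a) / real n"
  have d: "0 \<le> d" "d < \<delta>" "real n * d = b - a" using n n0 assms(1,2) by (auto simp: d_def field_simps)
  have "i \<le> n \<Longrightarrow> g (a + real i * d) \<le> g a" for i
  proof (induction i)
    case (Suc i)
    have "real (Suc i) * d \<le> real n * d" using Suc.prems d by (intro mult_right_mono) auto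
    then have "g (a + real (Suc i) * d) \<le> g (a + real i * d)"
      using d by (intro loc) (auto simp: algebra_simps)
    then show ?case using Suc by simp
  qed simp
  from this[of n] d show ?thesis by simp
qed

text \<open>The squared norm is handled without a product rule: its increment is the integral of
  \<open>v x\<close> against \<open>z t + z r\<close>, and by uniform continuity this sum is within
  \<open>2 * e\<close> of twice \<open>z x\<close> on short intervals. The error is
  \<open>2 * e\<close> times the integral of \<open>norm (v x)\<close>, with \<open>e\<close>
  arbitrary.\<close>

lemma weak_dissipative_interior:
  fixes z v :: "real \<Rightarrow> 'b::{real_inner, banach, second_countable_topology}"
  assumes wd: "weak_deriv I z v" and z: "z \<in> L2_time I X" "continuous_on I z" and v: "v \<in> L2_time I X"
    and diss: "AE t in lborel. t \<in> I \<longrightarrow> v t \<bullet> z t \<le> 0"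
    and sub: "{a..b'} \<subseteq> interior I" and ab: "a \<le> b" "b < b'"
  shows "norm (z b) \<le> norm (z a)"
proof -
  have I: "{a..b'} \<subseteq> I" using sub interior_subset by blast
  have zc: "continuous_on {a..b} z" by (rule continuous_on_subset[OF z(2)]) (use I ab in auto)
  have vi: "set_integrable lborel {r<..t} v" if "a \<le> r" "t \<le> b" for r t
    by (rule L2_time_integrable_Ioc[OF v]) (use I that ab in auto)
  have ni: "set_integrable lborel {r<..t} (\<lambda>x. norm (v x))" if "a \<le> r" "t \<le> b" for r t
    using integrable_norm[OF vi[OF that, unfolded set_integrable_def]] by (simp add: set_integrable_def)
  define C where "C = (LINT x:{a<..b}|lborel. norm (v x))"
  have C0: "0 \<le> C" by (simp add: C_def set_lebesgue_integral_def integral_nonneg_AE)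
  have main: "(norm (z b))\<^sup>2 \<le> (norm (z a))\<^sup>2 + 2 * e * C" if e: "0 < e" for e
  proof -
    obtain \<delta> where \<delta>: "0 < \<delta>" "\<And>x y. x \<in> {a..b} \<Longrightarrow> y \<in> {a..b} \<Longrightarrow> dist y x < \<delta> \<Longrightarrow> dist (z y) (z x) < e"
      using compact_uniformly_continuous[OF zc] e by (auto simp: uniformly_continuous_on_def)
    define g where "g t = (norm (z t))\<^sup>2 - 2 * e * (LINT x:{a<..t}|lborel. norm (v x))" for t
    have "g b \<le> g a"
    proof (rule antimono_if_locally_antimono[OF ab(1) \<delta>(1)])
      fix r t assume rt: "a \<le> r" "r \<le> t" "t \<le> b" "t - r < \<delta>"
      have "(norm (z t))\<^sup>2 - (norm (z r))\<^sup>2 = (z t - z r) \<bullet> (z t + z r)"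
        by (simp add: power2_norm_eq_inner inner_diff_left inner_add_right inner_commute[of "z r" "z t"])
      also have "z t - z r = (LINT x:{r<..t}|lborel. v x)"
        by (rule weak_deriv_FTC[OF wd z v, of r b', symmetric]) (use rt sub ab in auto)
      also have "\<dots> \<bullet> (z t + z r) = (LINT x|lborel. (indicator {r<..t} x *\<^sub>R v x) \<bullet> (z t + z r))"
        unfolding set_lebesgue_integral_def
        using vi[of r t] rt by (intro integral_inner_left[symmetric]) (simp add: set_integrable_def)
      also have "\<dots> \<le> (LINT x|lborel. 2 * e * (indicator {r<..t} x *\<^sub>R norm (v x)))"
      proof (rule integral_mono_AE)
        show "integrable lborel (\<lambda>x. (indicator {r<..t} x *\<^sub>R v x) \<bullet> (z t + z r))"
          using vi[of r t] rt by (intro integrable_inner_left) (simp add: set_integrable_def)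
        show "integrable lborel (\<lambda>x. 2 * e * (indicator {r<..t} x *\<^sub>R norm (v x)))"
          using ni[of r t] rt by (intro integrable_mult_right) (simp add: set_integrable_def)
        show "AE x in lborel. (indicator {r<..t} x *\<^sub>R v x) \<bullet> (z t + z r) \<le> 2 * e * (indicator {r<..t} x *\<^sub>R norm (v x))"
          using diss
        proof eventually_elim
          case (elim x)
          show ?case
          proof (cases "x \<in> {r<..t}")
            case True
            have "dist (z t) (z x) < e" "dist (z r) (z x) < e"
              using True rt by (auto intro!: \<delta>(2) simp: dist_real_def)
            then have "norm ((z t - z x) + (z r - z x)) \<le> 2 * e"
              using norm_triangle_ineq[of "z t - z x" "z r - z x"] by (simp add: dist_norm)
            then have "norm (v x) * norm ((z t - z x) + (z r - z x)) \<le> norm (v x) * (2 * e)"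
              by (intro mult_left_mono) auto
            then have "v x \<bullet> ((z t - z x) + (z r - z x)) \<le> norm (v x) * (2 * e)"
              using norm_cauchy_schwarz[of "v x" "(z t - z x) + (z r - z x)"] by linarith
            moreover have "v x \<bullet> z x \<le> 0" using elim True I rt ab by (auto simp: subset_iff)
            ultimately have "v x \<bullet> (z t + z r) \<le> 2 * e * norm (v x)"
              by (simp add: inner_add_right inner_diff_right mult.commute)
            then show ?thesis using True by simp
          qed simp
        qed
      qed
      also have "\<dots> = 2 * e * (LINT x:{r<..t}|lborel. norm (v x))"
        by (simp add: set_lebesgue_integral_def)
      also have "(LINT x:{r<..t}|lborel. norm (v x)) = (LINT x:{a<..t}|lborel. norm (v x)) - (LINT x:{a<..r}|lborel. norm (v x))"
      proof -
        have "{a<..t} = {a<..r} \<union> {r<..t}" "{a<..r} \<inter> {r<..t} = {}" using rt by auto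
        then show ?thesis
          using set_integral_Un[of "{a<..r}" "{r<..t}" lborel "\<lambda>x. norm (v x)"] ni rt by simp
      qed
      finally show "g t \<le> g r" by (simp add: g_def right_diff_distrib)
    qed
    then show ?thesis by (simp add: g_def C_def set_lebesgue_integral_def)
  qed
  have "(norm (z b))\<^sup>2 \<le> (norm (z a))\<^sup>2"
  proof (rule field_le_epsilon)
    fix e :: real assume "0 < e"
    \<comment> \<open>Rescaled in this way the error term is at most \<open>e\<close>; the summand 1
      covers \<open>C = 0\<close>.\<close>
    then have "0 < e / (2 * (C + 1))" using C0 by simp
    note main[OF this]
    also have "2 * (e / (2 * (C + 1))) * C = e * (C / (C + 1))" using C0 by (simp add: divide_simps)
    finally have "(norm (z b))\<^sup>2 \<le> (norm (z a))\<^sup>2 + e * (C / (C + 1))" .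
    also have "e * (C / (C + 1)) \<le> e * 1" using C0 \<open>0 < e\<close> by (intro mult_left_mono) auto
    finally show "(norm (z b))\<^sup>2 \<le> (norm (z a))\<^sup>2 + e" by simp
  qed
  then show ?thesis by (rule power2_le_imp_le) simp
qed

text \<open>Weak derivatives are tested in the interior only. The endpoints are reached by
  continuity, along \<open>t / (n + 2)\<close> on the left and \<open>T * (1 - 1 / (n + 2))\<close>
  on the right.\<close>

lemma weak_dissipative:
  fixes z v :: "real \<Rightarrow> 'b::{real_inner, banach, second_countable_topology}"
  assumes wd: "weak_deriv I z v" and z: "z \<in> L2_time I X" "continuous_on I z" and v: "v \<in> L2_time I X"
    and diss: "AE t in lborel. t \<in> I \<longrightarrow> v t \<bullet> z t \<le> 0"
    and I: "{0<..<T} \<subseteq> interior I" "{0..T} \<subseteq> I" and t: "0 \<le> t" "t \<le> T"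
  shows "norm (z t) \<le> norm (z 0)"
proof -
  have zc: "continuous_on {0..T} z" using z(2) I(2) by (rule continuous_on_subset)
  have int: "norm (z t) \<le> norm (z 0)" if t: "0 < t" "t < T" for t
  proof -
    have "norm (z t) \<le> norm (z (t / real (n + 2)))" for n
    proof (rule weak_dissipative_interior[OF wd z v diss])
      have "0 < t / real (n + 2)" using t by simp
      moreover have "(t + T) / 2 < T" using t by simp
      ultimately have "{t / real (n + 2)..(t + T) / 2} \<subseteq> {0<..<T}"
        by (meson atLeastAtMost_iff greaterThanLessThan_iff less_le_trans le_less_trans subsetI)
      then show "{t / real (n + 2)..(t + T) / 2} \<subseteq> interior I" using I(1) by blast
      show "t / real (n + 2) \<le> t" using t by (simp add: divide_le_eq)
    qed (use t in auto)
    moreover have "(\<lambda>n. norm (z (t / real (n + 2)))) \<longlonglongrightarrow> norm (z 0)"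
    proof (intro tendsto_norm continuous_on_tendsto_compose[OF zc])
      show "(\<lambda>n. t / real (n + 2)) \<longlonglongrightarrow> 0" by (rule LIMSEQ_ignore_initial_segment[OF lim_const_over_n])
      show "\<forall>\<^sub>F n in sequentially. t / real (n + 2) \<in> {0..T}"
        using t by (intro always_eventually allI) (auto simp: divide_le_eq intro: order_trans[of t T "T * _"])
    qed (use t in auto)
    ultimately show ?thesis by (intro LIMSEQ_le_const) auto
  qed
  show ?thesis
  proof (cases "t = 0 \<or> t < T")
    case True
    then show ?thesis using int[of t] t by (cases "t = 0") auto
  next
    case False
    then have t: "t = T" "0 < T" using assms(8,9) by auto
    have "norm (z (T * (1 - 1 / real (n + 2)))) \<le> norm (z 0)" for n
      using t by (intro int) (auto simp: mult_less_cancel_left1)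
    moreover have "(\<lambda>n. norm (z (T * (1 - 1 / real (n + 2))))) \<longlonglongrightarrow> norm (z T)"
    proof (intro tendsto_norm continuous_on_tendsto_compose[OF zc])
      have "(\<lambda>n. T * (1 - 1 / real (n + 2))) \<longlonglongrightarrow> T * (1 - 0)"
        by (intro tendsto_intros LIMSEQ_ignore_initial_segment[OF lim_1_over_n])
      then show "(\<lambda>n. T * (1 - 1 / real (n + 2))) \<longlonglongrightarrow> T" by simp
      show "\<forall>\<^sub>F n in sequentially. T * (1 - 1 / real (n + 2)) \<in> {0..T}"
        using t by (intro always_eventually allI) (auto simp: mult_le_cancel_left1)
    qed (use t in auto)
    ultimately show ?thesis unfolding t(1) by (intro LIMSEQ_le_const2) auto
  qed
qed

lemma norm_diff_sq_le: "(norm (a - b))\<^sup>2 \<le> 2 * (norm a)\<^sup>2 + 2 * (norm (b :: 'b::real_inner))\<^sup>2"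
proof -
  have "0 \<le> (norm (a + b))\<^sup>2" by simp
  then show ?thesis
    by (simp add: power2_norm_eq_inner inner_add_left inner_add_right inner_diff_left inner_diff_right inner_commute)
qed

section \<open>Differences of paths and the chosen time derivative\<close>

lemma L2_time_diff:
  assumes f: "f \<in> L2_time I X" and g: "g \<in> L2_time I X" and X: "\<And>x y. x \<in> X \<Longrightarrow> y \<in> X \<Longrightarrow> x - y \<in> X"
  shows "(\<lambda>t. f t - g t) \<in> L2_time I X"
proof -
  have m: "(\<lambda>t. indicator I t *\<^sub>R (f t - g t)) \<in> borel_measurable borel"
    using borel_measurable_diff[OF L2_timeD(1)[OF f] L2_timeD(1)[OF g]] by (simp add: scaleR_right_diff_distrib)
  have "integrable lborel (\<lambda>t. indicator I t *\<^sub>R (norm (f t - g t))\<^sup>2)"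
  proof (rule Bochner_Integration.integrable_bound)
    show "integrable lborel (\<lambda>t. 2 * (indicator I t *\<^sub>R (norm (f t))\<^sup>2) + 2 * (indicator I t *\<^sub>R (norm (g t))\<^sup>2))"
      using L2_timeD(2)[OF f] L2_timeD(2)[OF g] by (auto simp: set_integrable_def)
    have "(\<lambda>t. (norm (indicator I t *\<^sub>R (f t - g t)))\<^sup>2) \<in> borel_measurable borel"
      using m by measurable
    also have "(\<lambda>t. (norm (indicator I t *\<^sub>R (f t - g t)))\<^sup>2) = (\<lambda>t. indicator I t *\<^sub>R (norm (f t - g t))\<^sup>2)"
      by (auto simp: indicator_def)
    finally show "(\<lambda>t. indicator I t *\<^sub>R (norm (f t - g t))\<^sup>2) \<in> borel_measurable lborel" by simp
    show "AE t in lborel. norm (indicator I t *\<^sub>R (norm (f t - g t))\<^sup>2)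
        \<le> norm (2 * (indicator I t *\<^sub>R (norm (f t))\<^sup>2) + 2 * (indicator I t *\<^sub>R (norm (g t))\<^sup>2))"
      using norm_diff_sq_le by (intro AE_I2) (auto simp: indicator_def)
  qed
  moreover have "AE t in lborel. t \<in> I \<longrightarrow> f t - g t \<in> X"
    using L2_timeD(3)[OF f] L2_timeD(3)[OF g] by eventually_elim (auto intro: X)
  ultimately show ?thesis
    using m by (simp add: L2_time_def set_integrable_def set_borel_measurable_def)
qed

lemma weak_deriv_diff:
  fixes u v :: "real \<Rightarrow> 'b::{real_inner, banach, second_countable_topology}"
  assumes "weak_deriv I u v" "weak_deriv I u' v'"
    and L: "u \<in> L2_time I X" "v \<in> L2_time I X" "u' \<in> L2_time I X" "v' \<in> L2_time I X"
  shows "weak_deriv I (\<lambda>t. u t - u' t) (\<lambda>t. v t - v' t)"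
  unfolding weak_deriv_def
proof
  fix \<eta> assume \<eta>: "\<eta> \<in> Cc_infty (interior I)"
  then obtain N M where *: "continuous_on UNIV \<eta>" "continuous_on UNIV (deriv \<eta>)"
    "\<And>x. x \<notin> {-N..N} \<Longrightarrow> \<eta> x = 0" "\<And>x. x \<notin> {-N..N} \<Longrightarrow> deriv \<eta> x = 0" "\<And>x. \<bar>\<eta> x\<bar> \<le> M" "\<And>x. \<bar>deriv \<eta> x\<bar> \<le> M"
    by (rule Cc_infty_realD) blast
  have i: "set_integrable lborel I (\<lambda>t. \<eta> t *\<^sub>R w t)" "set_integrable lborel I (\<lambda>t. deriv \<eta> t *\<^sub>R w t)"
    if "w \<in> L2_time I X" for w :: "real \<Rightarrow> 'b"
    using * by (auto intro!: L2_time_integrable_test[OF that, of _ M "-N" N] borel_measurable_continuous_onI)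
  show "(LINT t:I|lborel. deriv \<eta> t *\<^sub>R (u t - u' t)) = - (LINT t:I|lborel. \<eta> t *\<^sub>R (v t - v' t))"
    using assms(1,2) \<eta> unfolding weak_deriv_def scaleR_right_diff_distrib
    by (subst (1 2) set_integral_diff) (auto intro!: i L)
qed

lemma time_derivD:
  assumes "u \<in> H1_time I X"
  shows "time_deriv I X u \<in> L2_time I X" "weak_deriv I u (time_deriv I X u)"
proof -
  have "\<exists>v. v \<in> L2_time I X \<and> weak_deriv I u v" using assms by (auto simp: H1_time_def)
  from someI_ex[OF this] show "time_deriv I X u \<in> L2_time I X" "weak_deriv I u (time_deriv I X u)"
    by (simp_all add: time_deriv_def)
qed

text \<open>\<open>time_deriv\<close> is a choice of representative; uniqueness up to null sets
  allows it to be replaced by any known weak derivative.\<close>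

lemma time_deriv_AE:
  assumes u: "u \<in> H1_time I X" and v: "v \<in> L2_time I X" "weak_deriv I u v"
    and I: "AE t in lborel. t \<in> I \<longrightarrow> t \<in> interior I"
  shows "AE t in lborel. t \<in> I \<longrightarrow> time_deriv I X u t = v t"
proof -
  have "AE t in lborel. t \<in> interior I \<longrightarrow> time_deriv I X u t = v t"
    by (rule weak_deriv_unique[OF time_derivD(2)[OF u] v(2) _ _ time_derivD(1)[OF u] v(1)])
      (use u in \<open>auto simp: H1_time_def\<close>)
  with I show ?thesis by eventually_elim auto
qed

lemma AE_Icc_interior: "AE t in lborel. t \<in> {0..T} \<longrightarrow> t \<in> interior {0..T::real}"
  using AE_lborel_singleton[of 0] AE_lborel_singleton[of T]
  by eventually_elim (auto simp: interior_cbox[where 'a=real, simplified])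

lemma AE_atLeast_interior: "AE t in lborel. t \<in> {0..} \<longrightarrow> t \<in> interior {0::real..}"
  using AE_lborel_singleton[of 0] by eventually_elim auto

section \<open>The fractional kernel\<close>

lemma nn_integral_powr_tail:
  assumes "0 < p" "0 < r"
  shows "(\<integral>\<^sup>+\<rho>. ennreal (p * \<rho> powr (- p - 1)) * indicator {r..} \<rho> \<partial>lborel) = ennreal (1 / r powr p)"
proof (rule nn_integral_has_integral_lebesgue')
  have "((\<lambda>\<rho>. p * \<rho> powr (- p - 1)) has_integral (p * (- (r powr (- p - 1 + 1)) / (- p - 1 + 1)))) {r..}"
    by (rule has_integral_mult_right[OF has_integral_powr_to_inf]) (use assms in auto)
  then show "((\<lambda>\<rho>. p * \<rho> powr (- p - 1)) has_integral (1 / r powr p)) {r..}"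
    using assms by (simp add: powr_minus_divide)
qed (use assms in auto)

text \<open>Polar coordinates in layer-cake form: \<open>1 / norm z powr p\<close> is the integral
  of \<open>p * \<rho> powr (- p - 1)\<close> over \<open>\<rho> \<ge> norm z\<close>, and
  exchanging the integrals leaves integrals of \<open>f\<close> over balls.\<close>

lemma nn_integral_norm_powr:
  fixes f :: "'a::euclidean_space \<Rightarrow> ennreal"
  assumes [measurable]: "f \<in> borel_measurable borel" and p: "0 < p"
  shows "(\<integral>\<^sup>+z. f z * ennreal (1 / norm z powr p) \<partial>lborel)
    = (\<integral>\<^sup>+\<rho>. ennreal (p * \<rho> powr (- p - 1)) * indicator {0<..} \<rho> *
        (\<integral>\<^sup>+z. f z * indicator (cball 0 \<rho>) z \<partial>lborel) \<partial>lborel)"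
proof -
  have "(\<integral>\<^sup>+z. f z * ennreal (1 / norm z powr p) \<partial>lborel)
    = (\<integral>\<^sup>+z. (\<integral>\<^sup>+\<rho>. f z * (ennreal (p * \<rho> powr (- p - 1)) * indicator {0<..} \<rho> * indicator (cball 0 \<rho>) z) \<partial>lborel) \<partial>lborel)"
  proof (rule nn_integral_cong_AE)
    show "AE z in lborel. f z * ennreal (1 / norm z powr p) =
      (\<integral>\<^sup>+\<rho>. f z * (ennreal (p * \<rho> powr (- p - 1)) * indicator {0<..} \<rho> * indicator (cball 0 \<rho>) z) \<partial>lborel)"
      using AE_lborel_singleton[of 0]
    proof eventually_elim
      case (elim z)
      have "(\<integral>\<^sup>+\<rho>. ennreal (p * \<rho> powr (- p - 1)) * indicator {0<..} \<rho> * indicator (cball 0 \<rho>) z \<partial>lborel)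
        = (\<integral>\<^sup>+\<rho>. ennreal (p * \<rho> powr (- p - 1)) * indicator {norm z..} \<rho> \<partial>lborel)"
        by (rule nn_integral_cong) (use elim in \<open>auto simp: indicator_def intro: less_le_trans[of 0 "norm z"]\<close>)
      also have "\<dots> = ennreal (1 / norm z powr p)" using elim p by (intro nn_integral_powr_tail) auto
      moreover have "(\<lambda>\<rho>. ennreal (p * \<rho> powr (- p - 1)) * indicator {0<..} \<rho> * indicator (cball 0 \<rho>) z) \<in> borel_measurable lborel"
        by (simp add: indicator_def[of "cball _ _"] mem_cball)
      ultimately show ?case by (subst nn_integral_cmult) auto
    qed
  qed
  also have "\<dots> = (\<integral>\<^sup>+\<rho>. (\<integral>\<^sup>+z. f z * (ennreal (p * \<rho> powr (- p - 1)) * indicator {0<..} \<rho> * indicator (cball 0 \<rho>) z) \<partial>lborel) \<partial>lborel)"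
    by (rule lborel_pair.Fubini'[symmetric]) (simp add: indicator_def[of "cball _ _"] mem_cball)
  also have "\<dots> = (\<integral>\<^sup>+\<rho>. ennreal (p * \<rho> powr (- p - 1)) * indicator {0<..} \<rho> *
        (\<integral>\<^sup>+z. f z * indicator (cball 0 \<rho>) z \<partial>lborel) \<partial>lborel)"
  proof (rule nn_integral_cong)
    fix \<rho>
    have [measurable]: "cball (0::'a) \<rho> \<in> sets borel" by simp
    show "(\<integral>\<^sup>+z. f z * (ennreal (p * \<rho> powr (- p - 1)) * indicator {0<..} \<rho> * indicator (cball 0 \<rho>) z) \<partial>lborel)
      = ennreal (p * \<rho> powr (- p - 1)) * indicator {0<..} \<rho> * (\<integral>\<^sup>+z. f z * indicator (cball 0 \<rho>) z \<partial>lborel)"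
      by (subst nn_integral_cmult[symmetric]) (measurable, simp add: mult_ac)
  qed
  finally show ?thesis .
qed

lemma dim_omega_pos: "0 < dim_omega TYPE('a::euclidean_space)"
  by (simp add: dim_omega_def content_ball_pos)

lemma emeasure_cball_dim_omega:
  fixes r :: real
  assumes "0 \<le> r"
  shows "emeasure lborel (cball (0::'a::euclidean_space) r) = ennreal (dim_omega TYPE('a) / DIM('a) * r ^ DIM('a))"
proof -
  have "emeasure lborel (cball (0::'a) r) = ennreal (measure lborel (cball (0::'a) r))"
    by (rule emeasure_eq_ennreal_measure) (use emeasure_bounded_finite[of "cball (0::'a) r"] in auto)
  also have "measure lborel (cball (0::'a) r) = dim_omega TYPE('a) / DIM('a) * r ^ DIM('a)"
    using assms by (simp add: content_cball content_ball dim_omega_def)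
  finally show ?thesis .
qed

text \<open>Volumes of shells inserted into the layer formula give the area \<open>dim_omega\<close>
  of the unit sphere times the integral of \<open>\<rho> powr (- 1 - 2 * s)\<close> from
  \<open>R\<close> on. The resulting pole \<open>1 / s\<close> is what the scaling of the energy
  cancels.\<close>

lemma kernel_outer:
  fixes R s :: real
  assumes "0 < R" "0 < s"
  shows "(\<integral>\<^sup>+(z::'a::euclidean_space). indicator {z. R \<le> norm z} z * ennreal (1 / norm z powr (DIM('a) + 2 * s)) \<partial>lborel)
    = ennreal (dim_omega TYPE('a) / (2 * s * R powr (2 * s)))"
proof -
  define d \<omega> p where "d = real DIM('a)" and "\<omega> = dim_omega TYPE('a) / DIM('a)" and "p = d + 2 * s"
  have d: "0 < d" by (simp add: d_def)
  have \<omega>: "0 < \<omega>" using dim_omega_pos[where 'a = 'a] by (simp add: \<omega>_def)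
  have p: "0 < p" using d assms by (simp add: p_def)
  have vol: "(\<integral>\<^sup>+(z::'a). indicator {z. R \<le> norm z} z * indicator (cball 0 \<rho>) z \<partial>lborel)
      = ennreal (\<omega> * (\<rho> powr d - R powr d)) * indicator {R..} \<rho>" if "0 < \<rho>" for \<rho>
  proof (cases "R \<le> \<rho>")
    case True
    have "(\<integral>\<^sup>+(z::'a). indicator {z. R \<le> norm z} z * indicator (cball 0 \<rho>) z \<partial>lborel)
        = (\<integral>\<^sup>+(z::'a). indicator (cball 0 \<rho> - cball 0 R) z \<partial>lborel)"
    proof (rule nn_integral_cong_AE)
      have "sphere (0::'a) R \<in> null_sets lborel"
        using negligible_sphere[of "0::'a" R] by (simp add: negligible_iff_null_sets null_sets_completion_iff)
      then have "AE z in lborel. z \<notin> sphere (0::'a) R" by (rule AE_not_in)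
      then show "AE z::'a in lborel. indicator {z. R \<le> norm z} z * indicator (cball 0 \<rho>) z = (indicator (cball 0 \<rho> - cball 0 R) z :: ennreal)"
        by eventually_elim (auto simp: indicator_def)
    qed
    also have "\<dots> = emeasure lborel (cball 0 \<rho> - cball (0::'a) R)" by (subst nn_integral_indicator) auto
    also have "\<dots> = emeasure lborel (cball (0::'a) \<rho>) - emeasure lborel (cball (0::'a) R)"
      by (rule emeasure_Diff) (use True assms emeasure_bounded_finite[of "cball (0::'a) R"] in auto)
    also have "\<dots> = ennreal (\<omega> * \<rho> ^ DIM('a) - \<omega> * R ^ DIM('a))"
      using True assms \<omega> by (simp add: emeasure_cball_dim_omega \<omega>_def ennreal_minus dim_omega_pos less_imp_le)
    also have "\<omega> * \<rho> ^ DIM('a) - \<omega> * R ^ DIM('a) = \<omega> * (\<rho> powr d - R powr d)"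
      using True assms by (simp add: d_def powr_realpow right_diff_distrib)
    finally show ?thesis using True by simp
  next
    case False
    then have "(\<lambda>z::'a. indicator {z. R \<le> norm z} z * indicator (cball 0 \<rho>) z) = (\<lambda>_. 0::ennreal)"
      by (auto simp: indicator_def)
    with False show ?thesis by (simp only:) simp
  qed
  have "(\<integral>\<^sup>+(z::'a). indicator {z. R \<le> norm z} z * ennreal (1 / norm z powr p) \<partial>lborel)
    = (\<integral>\<^sup>+\<rho>. ennreal (p * \<rho> powr (- p - 1)) * indicator {0<..} \<rho> *
        (\<integral>\<^sup>+(z::'a). indicator {z. R \<le> norm z} z * indicator (cball 0 \<rho>) z \<partial>lborel) \<partial>lborel)"
    by (rule nn_integral_norm_powr) (use p in auto)
  also have "\<dots> = (\<integral>\<^sup>+\<rho>. ennreal (\<omega> * p * \<rho> powr (- 2 * s - 1) - \<omega> * R powr d * (p * \<rho> powr (- p - 1))) * indicator {R..} \<rho> \<partial>lborel)"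
  proof (rule nn_integral_cong)
    fix \<rho> :: real
    show "ennreal (p * \<rho> powr (- p - 1)) * indicator {0<..} \<rho> * (\<integral>\<^sup>+(z::'a). indicator {z. R \<le> norm z} z * indicator (cball 0 \<rho>) z \<partial>lborel)
      = ennreal (\<omega> * p * \<rho> powr (- 2 * s - 1) - \<omega> * R powr d * (p * \<rho> powr (- p - 1))) * indicator {R..} \<rho>"
    proof (cases "R \<le> \<rho>")
      case True
      have "\<rho> powr (- p - 1) * \<rho> powr d = \<rho> powr (- 2 * s - 1)"
        by (simp add: p_def flip: powr_add)
      then have "p * \<rho> powr (- p - 1) * (\<omega> * (\<rho> powr d - R powr d)) =
          \<omega> * p * \<rho> powr (- 2 * s - 1) - \<omega> * R powr d * (p * \<rho> powr (- p - 1))"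
        by (simp add: algebra_simps)
      then show ?thesis using True assms vol[of \<rho>] p by (simp flip: ennreal_mult')
    next
      case False
      then show ?thesis using vol[of \<rho>] by (cases "0 < \<rho>") auto
    qed
  qed
  also have "\<dots> = ennreal (\<omega> * p * (R powr (- 2 * s) / (2 * s)) - \<omega> * R powr d * (1 / R powr p))"
  proof (rule nn_integral_has_integral_lebesgue')
    have 1: "((\<lambda>\<rho>. \<rho> powr (- 2 * s - 1)) has_integral (R powr (- 2 * s) / (2 * s))) {R..}"
      using has_integral_powr_to_inf[of "- 2 * s - 1" R] assms by simp
    have 2: "((\<lambda>\<rho>. p * \<rho> powr (- p - 1)) has_integral (1 / R powr p)) {R..}"
      using has_integral_mult_right[OF has_integral_powr_to_inf[of "- p - 1" R], of p] assms p
      by (simp add: powr_minus_divide)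
    show "((\<lambda>\<rho>. \<omega> * p * \<rho> powr (- 2 * s - 1) - \<omega> * R powr d * (p * \<rho> powr (- p - 1))) has_integral
      (\<omega> * p * (R powr (- 2 * s) / (2 * s)) - \<omega> * R powr d * (1 / R powr p))) {R..}"
      by (intro has_integral_diff has_integral_mult_right 1 2)
    fix \<rho> assume "\<rho> \<in> {R..}"
    then have \<rho>: "R \<le> \<rho>" by simp
    have "R powr d * \<rho> powr (- p - 1) \<le> \<rho> powr d * \<rho> powr (- p - 1)"
      using \<rho> assms d by (intro mult_right_mono powr_mono2) auto
    also have "\<dots> = \<rho> powr (- 2 * s - 1)" by (simp add: p_def flip: powr_add)
    finally have "(\<omega> * p) * (R powr d * \<rho> powr (- p - 1)) \<le> (\<omega> * p) * \<rho> powr (- 2 * s - 1)"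
      using \<omega> p by (intro mult_left_mono) auto
    then show "0 \<le> \<omega> * p * \<rho> powr (- 2 * s - 1) - \<omega> * R powr d * (p * \<rho> powr (- p - 1))"
      by (simp add: mult_ac)
  qed
  \<comment> \<open>As \<open>p = d + 2 * s\<close>, the second term removes exactly the part
    \<open>2 * s / (2 * s)\<close> of \<open>p / (2 * s)\<close>, leaving
    \<open>d / (2 * s)\<close>.\<close>
  also have "\<omega> * p * (R powr (- 2 * s) / (2 * s)) - \<omega> * R powr d * (1 / R powr p) = \<omega> * d / (2 * s * R powr (2 * s))"
  proof -
    define X Y where "X = R powr (2 * s)" and "Y = R powr d"
    have "R powr p = Y * X" "R powr (- 2 * s) = 1 / X" "0 < X" "0 < Y"
      using assms by (simp_all add: p_def X_def Y_def powr_add powr_minus_divide flip: minus_mult_left)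
    then show ?thesis unfolding X_def[symmetric] Y_def[symmetric]
      using assms by (simp add: p_def add_divide_distrib ring_distribs)
  qed
  also have "\<omega> * d = dim_omega TYPE('a)" by (simp add: \<omega>_def d_def)
  finally show ?thesis by (simp add: p_def d_def)
qed

text \<open>Over a ball of radius \<open>\<rho>\<close> the integrand is bounded by
  \<open>m^2\<close> on the ball of radius \<open>m = min \<rho> 1\<close>. Up to the volume factor,
  radii below and above 1 contribute \<open>p / (2 - 2 * s)\<close> and 1, with \<open>p\<close> the
  exponent of the kernel, so the bound does not degenerate as \<open>s\<close> tends to 0.\<close>

lemma kernel_inner:
  fixes s :: real
  assumes "0 < s" "s < 1"
  shows "(\<integral>\<^sup>+(z::'a::euclidean_space). (ennreal ((norm z)\<^sup>2) * indicator {z. norm z < 1} z) * ennreal (1 / norm z powr (DIM('a) + 2 * s)) \<partial>lborel)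
    \<le> ennreal (dim_omega TYPE('a) / DIM('a) * ((DIM('a) + 2 * s) / (2 - 2 * s) + 1))"
proof -
  define d \<omega> p where "d = real DIM('a)" and "\<omega> = dim_omega TYPE('a) / DIM('a)" and "p = d + 2 * s"
  have d: "0 < d" by (simp add: d_def)
  have \<omega>: "0 < \<omega>" using dim_omega_pos[where 'a = 'a] by (simp add: \<omega>_def)
  have p: "0 < p" using d assms by (simp add: p_def)
  have vol: "(\<integral>\<^sup>+(z::'a). (ennreal ((norm z)\<^sup>2) * indicator {z. norm z < 1} z) * indicator (cball 0 \<rho>) z \<partial>lborel)
      \<le> ennreal (\<omega> * (min \<rho> 1 powr (2 + d)))" if "0 < \<rho>" for \<rho>
  proof -
    define m where "m = min \<rho> 1"
    have m: "0 < m" using that by (simp add: m_def)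
    have "(\<integral>\<^sup>+(z::'a). (ennreal ((norm z)\<^sup>2) * indicator {z. norm z < 1} z) * indicator (cball 0 \<rho>) z \<partial>lborel)
      \<le> (\<integral>\<^sup>+(z::'a). ennreal (m\<^sup>2) * indicator (cball 0 m) z \<partial>lborel)"
    proof (rule nn_integral_mono)
      fix z :: 'a
      show "(ennreal ((norm z)\<^sup>2) * indicator {z. norm z < 1} z) * indicator (cball 0 \<rho>) z \<le> ennreal (m\<^sup>2) * indicator (cball 0 m) z"
        by (cases "norm z < 1 \<and> norm z \<le> \<rho>") (auto simp: m_def indicator_def intro!: ennreal_leI power_mono)
    qed
    also have "\<dots> = ennreal (m\<^sup>2) * emeasure lborel (cball (0::'a) m)" by (rule nn_integral_cmult_indicator) simp
    also have "\<dots> = ennreal (\<omega> * m powr (2 + d))"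
      using m \<omega> by (simp add: emeasure_cball_dim_omega \<omega>_def d_def powr_add powr_realpow mult_ac flip: ennreal_mult')
    finally show ?thesis by (simp add: m_def)
  qed
  have "(\<integral>\<^sup>+(z::'a). (ennreal ((norm z)\<^sup>2) * indicator {z. norm z < 1} z) * ennreal (1 / norm z powr p) \<partial>lborel)
    = (\<integral>\<^sup>+\<rho>. ennreal (p * \<rho> powr (- p - 1)) * indicator {0<..} \<rho> *
        (\<integral>\<^sup>+(z::'a). (ennreal ((norm z)\<^sup>2) * indicator {z. norm z < 1} z) * indicator (cball 0 \<rho>) z \<partial>lborel) \<partial>lborel)"
    by (rule nn_integral_norm_powr) (use p in auto)
  also have "\<dots> \<le> (\<integral>\<^sup>+\<rho>. ennreal (\<omega> * p * \<rho> powr (1 - 2 * s)) * indicator {0..1} \<rho> + ennreal \<omega> * (ennreal (p * \<rho> powr (- p - 1)) * indicator {1..} \<rho>) \<partial>lborel)"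
  proof (rule nn_integral_mono)
    fix \<rho> :: real
    show "ennreal (p * \<rho> powr (- p - 1)) * indicator {0<..} \<rho> * (\<integral>\<^sup>+(z::'a). (ennreal ((norm z)\<^sup>2) * indicator {z. norm z < 1} z) * indicator (cball 0 \<rho>) z \<partial>lborel)
      \<le> ennreal (\<omega> * p * \<rho> powr (1 - 2 * s)) * indicator {0..1} \<rho> + ennreal \<omega> * (ennreal (p * \<rho> powr (- p - 1)) * indicator {1..} \<rho>)"
    proof (cases "0 < \<rho>")
      case True
      have "ennreal (p * \<rho> powr (- p - 1)) * indicator {0<..} \<rho> * (\<integral>\<^sup>+(z::'a). (ennreal ((norm z)\<^sup>2) * indicator {z. norm z < 1} z) * indicator (cball 0 \<rho>) z \<partial>lborel)
        \<le> ennreal (p * \<rho> powr (- p - 1)) * indicator {0<..} \<rho> * ennreal (\<omega> * (min \<rho> 1 powr (2 + d)))"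
        by (intro mult_left_mono vol True) auto
      also have "\<dots> = ennreal (p * \<rho> powr (- p - 1) * (\<omega> * (min \<rho> 1 powr (2 + d))))"
        using True p by (simp add: ennreal_mult')
      also have "\<dots> \<le> ennreal (\<omega> * p * \<rho> powr (1 - 2 * s)) * indicator {0..1} \<rho> + ennreal \<omega> * (ennreal (p * \<rho> powr (- p - 1)) * indicator {1..} \<rho>)"
      proof (cases "\<rho> \<le> 1")
        case True
        have "\<rho> powr (- p - 1) * \<rho> powr (2 + d) = \<rho> powr (1 - 2 * s)"
          by (simp add: p_def algebra_simps flip: powr_add)
        then have "p * \<rho> powr (- p - 1) * (\<omega> * (min \<rho> 1 powr (2 + d))) = \<omega> * p * \<rho> powr (1 - 2 * s)"
          using True by (simp add: min_def mult_ac)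
        then show ?thesis using True \<open>0 < \<rho>\<close> by (simp only:) (simp add: add_increasing2)
      next
        case False
        then show ?thesis using \<omega> p by (simp add: mult_ac flip: ennreal_mult')
      qed
      finally show ?thesis .
    qed simp
  qed
  also have "\<dots> = (\<integral>\<^sup>+\<rho>. ennreal (\<omega> * p * \<rho> powr (1 - 2 * s)) * indicator {0..1} \<rho> \<partial>lborel) + ennreal \<omega> * (\<integral>\<^sup>+\<rho>. (ennreal (p * \<rho> powr (- p - 1)) * indicator {1..} \<rho>) \<partial>lborel)"
    by (subst nn_integral_add) (auto simp: nn_integral_cmult)
  also have "(\<integral>\<^sup>+\<rho>. (ennreal (p * \<rho> powr (- p - 1)) * indicator {1..} \<rho>) \<partial>lborel) = ennreal (1 / 1 powr p)"
    by (rule nn_integral_powr_tail) (use p in auto)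
  also have "(\<integral>\<^sup>+\<rho>. ennreal (\<omega> * p * \<rho> powr (1 - 2 * s)) * indicator {0..1} \<rho> \<partial>lborel) = ennreal (\<omega> * p * (1 / (2 - 2 * s)))"
  proof (rule nn_integral_has_integral_lebesgue')
    have "((\<lambda>\<rho>. \<rho> powr (1 - 2 * s)) has_integral (1 powr (1 - 2 * s + 1) / (1 - 2 * s + 1))) {0..1}"
      by (rule has_integral_powr_from_0) (use assms in auto)
    then show "((\<lambda>\<rho>. \<omega> * p * \<rho> powr (1 - 2 * s)) has_integral (\<omega> * p * (1 / (2 - 2 * s)))) {0..1}"
      by (intro has_integral_mult_right) (simp add: algebra_simps)
  qed (use \<omega> p in auto)
  also have "ennreal (\<omega> * p * (1 / (2 - 2 * s))) + ennreal \<omega> * ennreal (1 / 1 powr p) = ennreal (\<omega> * (p / (2 - 2 * s) + 1))"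
    using \<omega> p assms by (simp add: algebra_simps flip: ennreal_plus)
  finally show ?thesis by (simp add: p_def d_def \<omega>_def)
qed

section \<open>Test functions and bounds on their differences\<close>

lemma Cc_infty_add:
  fixes f g :: "'a::euclidean_space \<Rightarrow> real"
  assumes "f \<in> Cc_infty \<Omega>" "g \<in> Cc_infty \<Omega>"
  shows "(\<lambda>x. f x + g x) \<in> Cc_infty \<Omega>"
proof -
  have "closure {x. f x + g x \<noteq> 0} \<subseteq> closure ({x. f x \<noteq> 0} \<union> {x. g x \<noteq> 0})" by (rule closure_mono) auto
  then have sub: "closure {x. f x + g x \<noteq> 0} \<subseteq> closure {x. f x \<noteq> 0} \<union> closure {x. g x \<noteq> 0}" by simp
  moreover have "compact (closure {x. f x \<noteq> 0} \<union> closure {x. g x \<noteq> 0})"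
    using assms by (auto simp: Cc_infty_def intro: compact_Un)
  ultimately have "compact (closure {x. f x + g x \<noteq> 0})"
    using closed_Int_compact[OF closed_closure, of "closure {x. f x \<noteq> 0} \<union> closure {x. g x \<noteq> 0}" "{x. f x + g x \<noteq> 0}"]
    by (simp only: Int_absorb2)
  then show ?thesis using assms sub by (auto simp: Cc_infty_def intro: Ck_add)
qed

lemma Cc_infty_scale:
  fixes f :: "'a::euclidean_space \<Rightarrow> real"
  assumes "f \<in> Cc_infty \<Omega>"
  shows "(\<lambda>x. c * f x) \<in> Cc_infty \<Omega>"
proof (cases "c = 0")
  case True
  have "Ck k (\<lambda>x::'a. 0 * f x)" for k using assms by (intro Ck_scale) (simp add: Cc_infty_def)
  with True show ?thesis by (simp add: Cc_infty_def)
next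
  case False
  then show ?thesis using assms by (auto simp: Cc_infty_def intro: Ck_scale)
qed

lemma frechet_derivative_vanishing:
  fixes f :: "'a::euclidean_space \<Rightarrow> real"
  assumes K: "compact K" "\<And>x. x \<notin> K \<Longrightarrow> f x = 0" and x: "x \<notin> K"
  shows "frechet_derivative f (at x) b = 0"
proof -
  have "(f has_derivative (\<lambda>_. 0)) (at x)"
    by (rule has_derivative_transform_within_open[OF has_derivative_const[of 0], where s = "- K"])
      (use assms compact_imp_closed in auto)
  then show ?thesis using frechet_derivative_at by metis
qed

lemma bounded_if_vanishing:
  fixes f :: "'a::euclidean_space \<Rightarrow> real"
  assumes K: "compact K" "\<And>x. x \<notin> K \<Longrightarrow> f x = 0" and f: "continuous_on UNIV f"
  obtains M where "0 \<le> M" "\<And>x. \<bar>f x\<bar> \<le> M"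
proof -
  obtain M where M: "\<And>x. x \<in> K \<Longrightarrow> \<bar>f x\<bar> \<le> M"
    using compact_imp_bounded[OF compact_continuous_image[OF continuous_on_subset[OF f] K(1)]]
    unfolding bounded_iff by auto
  have "\<bar>f x\<bar> \<le> \<bar>M\<bar>" for x using M[of x] K(2)[of x] by (cases "x \<in> K") auto
  then show thesis by (intro that[of "\<bar>M\<bar>"]) auto
qed

lemma derivative_eq_sum_Basis:
  fixes f :: "'a::euclidean_space \<Rightarrow> real"
  assumes "(f has_derivative f') (at x)"
  shows "f' h = (\<Sum>b\<in>Basis. (h \<bullet> b) * f' b)"
proof -
  interpret bounded_linear f' using assms by (rule has_derivative_bounded_linear)
  have "f' h = f' (\<Sum>b\<in>Basis. (h \<bullet> b) *\<^sub>R b)" by (simp add: euclidean_representation)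
  then show ?thesis by (simp add: sum scaleR)
qed

lemma lipschitz_if_vanishing:
  fixes f :: "'a::euclidean_space \<Rightarrow> real"
  assumes K: "compact K" "\<And>x. x \<notin> K \<Longrightarrow> f x = 0" and f: "Ck (Suc k) f" "\<And>b. b \<in> Basis \<Longrightarrow> continuous_on UNIV (\<lambda>x. frechet_derivative f (at x) b)"
  obtains L where "0 \<le> L" "\<And>x y. \<bar>f x - f y\<bar> \<le> L * norm (x - y)"
proof -
  have "\<exists>M. 0 \<le> M \<and> (\<forall>x. \<bar>frechet_derivative f (at x) b\<bar> \<le> M)" if "b \<in> Basis" for b
    using bounded_if_vanishing[OF K(1) frechet_derivative_vanishing[OF K] f(2)[OF that]] by metis
  then obtain M where M: "\<And>b. b \<in> Basis \<Longrightarrow> 0 \<le> M b" "\<And>b x. b \<in> Basis \<Longrightarrow> \<bar>frechet_derivative f (at x) b\<bar> \<le> M b"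
    by metis
  show thesis
  proof (rule that[of "\<Sum>b\<in>Basis. M b"])
    show "0 \<le> (\<Sum>b\<in>Basis. M b)" using M by (intro sum_nonneg) auto
    fix x y
    have "norm (f x - f y) \<le> (\<Sum>b\<in>Basis. M b) * norm (x - y)"
    proof (rule differentiable_bound[OF convex_UNIV])
      show "(f has_derivative frechet_derivative f (at x)) (at x within UNIV)" for x by (rule Ck_SucD(1)[OF f(1)])
      show "onorm (frechet_derivative f (at x)) \<le> (\<Sum>b\<in>Basis. M b)" for x
      proof (rule onorm_bound)
        show "0 \<le> (\<Sum>b\<in>Basis. M b)" using M by (intro sum_nonneg) auto
        fix h
        have "\<bar>frechet_derivative f (at x) h\<bar> \<le> (\<Sum>b\<in>Basis. \<bar>(h \<bullet> b) * frechet_derivative f (at x) b\<bar>)"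
          unfolding derivative_eq_sum_Basis[OF Ck_SucD(1)[OF f(1)], of x h] by (rule sum_abs)
        also have "\<dots> \<le> (\<Sum>b\<in>Basis. norm h * M b)"
          unfolding abs_mult by (intro sum_mono mult_mono Basis_le_norm M) auto
        finally show "norm (frechet_derivative f (at x) h) \<le> (\<Sum>b\<in>Basis. M b) * norm h"
          by (simp add: sum_distrib_left mult.commute)
      qed
    qed auto
    then show "\<bar>f x - f y\<bar> \<le> (\<Sum>b\<in>Basis. M b) * norm (x - y)" by simp
  qed
qed

text \<open>The function \<open>f (x + t z) + f (x - t z)\<close> of \<open>t\<close> has as
  derivative a difference of directional derivatives at points \<open>2 t z\<close> apart, and the
  partial derivatives are Lipschitz. The symmetric difference is thus quadratic in \<open>z\<close>,
  hence integrable against the kernel near 0 for \<open>s < 1\<close>.\<close>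

lemma second_difference_bound:
  fixes f :: "'a::euclidean_space \<Rightarrow> real"
  assumes K: "compact K" "\<And>x. x \<notin> K \<Longrightarrow> f x = 0" and f: "\<And>k. Ck k f"
  obtains C where "0 \<le> C" "\<And>x z. \<bar>2 * f x - f (x + z) - f (x - z)\<bar> \<le> C * (norm z)\<^sup>2"
proof -
  define g where "g b x = frechet_derivative f (at x) b" for b x
  have gC: "Ck k (g b)" if "b \<in> Basis" for b k unfolding g_def by (rule Ck_SucD(2)[OF f that])
  have "\<exists>L. 0 \<le> L \<and> (\<forall>x y. \<bar>g b x - g b y\<bar> \<le> L * norm (x - y))" if "b \<in> Basis" for b
  proof -
    have "g b x = 0" if "x \<notin> K" for x unfolding g_def by (rule frechet_derivative_vanishing[OF K that])
    moreover have "continuous_on UNIV (\<lambda>x. frechet_derivative (g b) (at x) c)" if "c \<in> Basis" for c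
      using Ck_SucD(2)[OF gC[OF \<open>b \<in> Basis\<close>, of "Suc 0"] that] by simp
    ultimately show ?thesis
      using lipschitz_if_vanishing[OF K(1) _ gC[OF that, of "Suc 0"]] by metis
  qed
  then obtain L where L: "\<And>b. b \<in> Basis \<Longrightarrow> 0 \<le> L b" "\<And>b x y. b \<in> Basis \<Longrightarrow> \<bar>g b x - g b y\<bar> \<le> L b * norm (x - y)"
    by metis
  show thesis
  proof (rule that[of "\<Sum>b\<in>Basis. 2 * L b"])
    show "0 \<le> (\<Sum>b\<in>Basis. 2 * L b)" using L by (intro sum_nonneg) auto
    fix x z
    define h where "h t = f (x + t *\<^sub>R z) + f (x - t *\<^sub>R z)" for t :: real
    have "norm (h 1 - h 0) \<le> \<bar>1 - 0\<bar> * ((\<Sum>b\<in>Basis. 2 * L b) * (norm z)\<^sup>2)"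
    proof (rule norm_diff_le_of_derivative_bound)
      fix t :: real assume "t \<in> closed_segment 0 1"
      then have t: "0 \<le> t" "t \<le> 1" by (auto simp: closed_segment_eq_real_ivl)
      define h' where "h' = frechet_derivative f (at (x + t *\<^sub>R z)) z - frechet_derivative f (at (x - t *\<^sub>R z)) z"
      have d1: "((\<lambda>t. f (x + t *\<^sub>R z)) has_derivative (\<lambda>s. frechet_derivative f (at (x + t *\<^sub>R z)) (s *\<^sub>R z))) (at t)"
        by (rule has_derivative_compose[of "\<lambda>t. x + t *\<^sub>R z" "\<lambda>s. s *\<^sub>R z" t UNIV f, OF _ Ck_SucD(1)[OF f]])
          (auto intro!: derivative_eq_intros)
      have d2: "((\<lambda>t. f (x - t *\<^sub>R z)) has_derivative (\<lambda>s. frechet_derivative f (at (x - t *\<^sub>R z)) (- (s *\<^sub>R z)))) (at t)"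
        by (rule has_derivative_compose[of "\<lambda>t. x - t *\<^sub>R z" "\<lambda>s. - (s *\<^sub>R z)" t UNIV f, OF _ Ck_SucD(1)[OF f]])
          (auto intro!: derivative_eq_intros)
      have lin: "linear (frechet_derivative f (at y))" for y
        using has_derivative_linear[OF Ck_SucD(1)[OF f]] .
      show "(h has_vector_derivative h') (at t)"
        using has_derivative_add[OF d1 d2]
        by (simp add: h_def[abs_def] h'_def has_vector_derivative_def linear_neg[OF lin] linear_scale[OF lin] right_diff_distrib)
      have "\<bar>h'\<bar> = \<bar>\<Sum>b\<in>Basis. (z \<bullet> b) * (g b (x + t *\<^sub>R z) - g b (x - t *\<^sub>R z))\<bar>"
        unfolding h'_def derivative_eq_sum_Basis[OF Ck_SucD(1)[OF f], of _ z] g_def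
        by (simp add: right_diff_distrib sum_subtractf)
      also have "\<dots> \<le> (\<Sum>b\<in>Basis. \<bar>(z \<bullet> b) * (g b (x + t *\<^sub>R z) - g b (x - t *\<^sub>R z))\<bar>)" by (rule sum_abs)
      also have "\<dots> \<le> (\<Sum>b\<in>Basis. norm z * (L b * (2 * norm z)))"
        unfolding abs_mult
      proof (intro sum_mono mult_mono Basis_le_norm)
        fix b :: 'a assume b: "b \<in> Basis"
        have "(x + t *\<^sub>R z) - (x - t *\<^sub>R z) = (2 * t) *\<^sub>R z" by (simp add: algebra_simps flip: scaleR_add_left)
        then have "\<bar>g b (x + t *\<^sub>R z) - g b (x - t *\<^sub>R z)\<bar> \<le> L b * norm ((2 * t) *\<^sub>R z)"
          using L(2)[OF b, of "x + t *\<^sub>R z" "x - t *\<^sub>R z"] by simp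
        also have "\<dots> \<le> L b * (2 * norm z)"
          using t L(1)[OF b] mult_right_mono[of t 1 "norm z"] by (intro mult_left_mono) auto
        finally show "\<bar>g b (x + t *\<^sub>R z) - g b (x - t *\<^sub>R z)\<bar> \<le> L b * (2 * norm z)" .
      qed auto
      finally show "norm h' \<le> (\<Sum>b\<in>Basis. 2 * L b) * (norm z)\<^sup>2"
        by (simp add: sum_distrib_left sum_distrib_right power2_eq_square mult_ac)
    qed
    then show "\<bar>2 * f x - f (x + z) - f (x - z)\<bar> \<le> (\<Sum>b\<in>Basis. 2 * L b) * (norm z)\<^sup>2"
      by (simp add: h_def)
  qed
qed

lemma Cc_inftyD:
  fixes \<phi> :: "'a::euclidean_space \<Rightarrow> real"
  assumes "\<phi> \<in> Cc_infty \<Omega>"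
  obtains K M L C where "compact K" "K \<subseteq> \<Omega>" "\<And>x. x \<notin> K \<Longrightarrow> \<phi> x = 0" "continuous_on UNIV \<phi>"
    "0 \<le> M" "\<And>x. \<bar>\<phi> x\<bar> \<le> M" "0 \<le> L" "\<And>x y. \<bar>\<phi> x - \<phi> y\<bar> \<le> L * norm (x - y)"
    "0 \<le> C" "\<And>x z. \<bar>2 * \<phi> x - \<phi> (x + z) - \<phi> (x - z)\<bar> \<le> C * (norm z)\<^sup>2"
proof -
  define K where "K = closure {x. \<phi> x \<noteq> 0}"
  have K: "compact K" "K \<subseteq> \<Omega>" and Ck: "\<And>k. Ck k \<phi>" using assms by (auto simp: Cc_infty_def K_def)
  have out: "\<phi> x = 0" if "x \<notin> K" for x using that closure_subset[of "{x. \<phi> x \<noteq> 0}"] by (auto simp: K_def)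
  have cont: "continuous_on UNIV \<phi>" using Ck[of 0] by simp
  obtain M where M: "0 \<le> M" "\<And>x. \<bar>\<phi> x\<bar> \<le> M" using bounded_if_vanishing[OF K(1) out cont] by blast
  have "continuous_on UNIV (\<lambda>x. frechet_derivative \<phi> (at x) b)" if "b \<in> Basis" for b
    using Ck_SucD(2)[OF Ck that, of 0] by simp
  then obtain L where L: "0 \<le> L" "\<And>x y. \<bar>\<phi> x - \<phi> y\<bar> \<le> L * norm (x - y)"
    using lipschitz_if_vanishing[OF K(1) out Ck] by blast
  obtain C where C: "0 \<le> C" "\<And>x z. \<bar>2 * \<phi> x - \<phi> (x + z) - \<phi> (x - z)\<bar> \<le> C * (norm z)\<^sup>2"
    using second_difference_bound[OF K(1) out Ck] by blast
  show thesis by (rule that[OF K out cont M L C])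
qed

lemma Cc_infty_integrable:
  fixes \<phi> :: "'a::euclidean_space \<Rightarrow> real"
  assumes "\<phi> \<in> Cc_infty \<Omega>"
  shows "\<phi> \<in> borel_measurable borel" "integrable lborel \<phi>" "sq_integrable \<phi>"
proof -
  obtain K M where K: "compact K" "\<And>x. x \<notin> K \<Longrightarrow> \<phi> x = 0" and c: "continuous_on UNIV \<phi>"
    using Cc_inftyD[OF assms] by metis
  show m: "\<phi> \<in> borel_measurable borel" using c by (rule borel_measurable_continuous_onI)
  have i: "integrable lborel f" if "continuous_on UNIV f" "\<And>x. x \<notin> K \<Longrightarrow> f x = 0" for f :: "'a \<Rightarrow> real"
  proof -
    have "integrable lborel (\<lambda>x. indicator K x *\<^sub>R f x)"
      by (rule borel_integrable_compact[OF K(1) continuous_on_subset[OF that(1)]]) auto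
    also have "(\<lambda>x. indicator K x *\<^sub>R f x) = f" using that(2) by (auto simp: indicator_def fun_eq_iff)
    finally show ?thesis .
  qed
  show "integrable lborel \<phi>" by (rule i[OF c K(2)])
  show "sq_integrable \<phi>"
    using m i[of "\<lambda>x. (\<phi> x)\<^sup>2"] c K(2) by (auto simp: sq_integrable_def intro!: continuous_on_power)
qed

section \<open>The kernel and finiteness of integrals against it\<close>

definition frac_kernel :: "real \<Rightarrow> 'a::euclidean_space \<Rightarrow> real" where
  "frac_kernel s z = 1 / norm z powr (real DIM('a) + 2 * s)"

lemma frac_kernel_nonneg [simp]: "0 \<le> frac_kernel s z"
  by (simp add: frac_kernel_def)

lemma frac_kernel_measurable [measurable]: "frac_kernel s \<in> borel_measurable borel"
  unfolding frac_kernel_def[abs_def] by measurable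

lemma frac_kernel_minus: "frac_kernel s (- z) = frac_kernel s z"
  by (simp add: frac_kernel_def)

lemma frac_kernel_le_1:
  assumes "1 \<le> norm z" "0 < s"
  shows "frac_kernel s z \<le> 1"
  using assms ge_one_powr_ge_zero[of "norm z" "real DIM('a) + 2 * s"]
  by (simp add: frac_kernel_def divide_le_eq_1)

text \<open>Inside the unit ball the quadratic bound tames the singularity, outside it boundedness
  suffices because the tail is integrable. Squared first differences and absolute second differences
  of test functions both satisfy the two bounds.\<close>

lemma frac_kernel_integral_bound:
  fixes g :: "'a::euclidean_space \<Rightarrow> real"
  assumes [measurable]: "g \<in> borel_measurable borel" and s: "0 < s" "s < 1"
    and g: "\<And>z. 0 \<le> g z" "\<And>z. g z \<le> A * (norm z)\<^sup>2" "\<And>z. g z \<le> M" and A: "0 \<le> A"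
  shows "(\<integral>\<^sup>+z. ennreal (g z * frac_kernel s z) \<partial>lborel)
    \<le> ennreal (A * (dim_omega TYPE('a) / DIM('a) * ((real DIM('a) + 2 * s) / (2 - 2 * s) + 1)) + M * (dim_omega TYPE('a) / (2 * s)))"
proof -
  have M: "0 \<le> M" using g(1,3)[of 0] by linarith
  note dp = dim_omega_pos[where 'a = 'a]
  have "(\<integral>\<^sup>+z. ennreal (g z * frac_kernel s z) \<partial>lborel)
    \<le> (\<integral>\<^sup>+(z::'a). ennreal A * ((ennreal ((norm z)\<^sup>2) * indicator {z. norm z < 1} z) * ennreal (frac_kernel s z))
      + ennreal M * (indicator {z. 1 \<le> norm z} z * ennreal (frac_kernel s z)) \<partial>lborel)"
  proof (rule nn_integral_mono)
    fix z :: 'a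
    show "ennreal (g z * frac_kernel s z)
      \<le> ennreal A * ((ennreal ((norm z)\<^sup>2) * indicator {z. norm z < 1} z) * ennreal (frac_kernel s z))
      + ennreal M * (indicator {z. 1 \<le> norm z} z * ennreal (frac_kernel s z))"
    proof (cases "norm z < 1")
      case True
      have "ennreal (g z * frac_kernel s z) \<le> ennreal (A * (norm z)\<^sup>2 * frac_kernel s z)"
        by (intro ennreal_leI mult_right_mono g) auto
      then show ?thesis using True A by (simp add: ennreal_mult mult.assoc)
    next
      case False
      have "ennreal (g z * frac_kernel s z) \<le> ennreal (M * frac_kernel s z)"
        by (intro ennreal_leI mult_right_mono g) auto
      then show ?thesis using False M by (simp add: ennreal_mult)
    qed
  qed
  also have "\<dots> = ennreal A * (\<integral>\<^sup>+(z::'a). (ennreal ((norm z)\<^sup>2) * indicator {z. norm z < 1} z) * ennreal (frac_kernel s z) \<partial>lborel)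
      + ennreal M * (\<integral>\<^sup>+(z::'a). indicator {z. 1 \<le> norm z} z * ennreal (frac_kernel s z) \<partial>lborel)"
    by (subst nn_integral_add) (auto simp: nn_integral_cmult)
  also have "\<dots> \<le> ennreal A * ennreal (dim_omega TYPE('a) / DIM('a) * ((real DIM('a) + 2 * s) / (2 - 2 * s) + 1))
      + ennreal M * ennreal (dim_omega TYPE('a) / (2 * s * 1 powr (2 * s)))"
    using kernel_outer[of 1 s, where 'a = 'a] kernel_inner[OF s, where 'a = 'a] s
    by (intro add_mono mult_left_mono) (auto simp: frac_kernel_def)
  also have "\<dots> = ennreal (A * (dim_omega TYPE('a) / DIM('a) * ((real DIM('a) + 2 * s) / (2 - 2 * s) + 1)) + M * (dim_omega TYPE('a) / (2 * s)))"
  proof -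
    have "0 \<le> dim_omega TYPE('a) / DIM('a) * ((real DIM('a) + 2 * s) / (2 - 2 * s) + 1)" "0 \<le> dim_omega TYPE('a) / (2 * s)"
      using s dp by simp_all
    then show ?thesis using A M by (simp only: powr_one_eq_one mult_1_right ennreal_mult[symmetric] ennreal_plus[symmetric] mult_nonneg_nonneg)
  qed
  finally show ?thesis .
qed

lemma nn_integral_lborel_plus:
  fixes f :: "'a::euclidean_space \<Rightarrow> ennreal"
  assumes [measurable]: "f \<in> borel_measurable borel"
  shows "(\<integral>\<^sup>+z. f (c + z) \<partial>lborel) = (\<integral>\<^sup>+z. f z \<partial>lborel)"
proof -
  have "(\<integral>\<^sup>+z. f z \<partial>lborel) = (\<integral>\<^sup>+z. f z \<partial>distr lborel borel ((+) c))" by (simp add: lborel_distr_plus)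
  also have "\<dots> = (\<integral>\<^sup>+z. f (c + z) \<partial>lborel)" by (rule nn_integral_distr) auto
  finally show ?thesis ..
qed

lemma lborel_integral_plus:
  fixes f :: "'a::euclidean_space \<Rightarrow> real"
  assumes [measurable]: "f \<in> borel_measurable borel"
  shows "(LINT z|lborel. f (c + z)) = (LINT z|lborel. f z)" "integrable lborel (\<lambda>z. f (c + z)) \<longleftrightarrow> integrable lborel f"
proof -
  have "(LINT z|lborel. f z) = (LINT z|distr lborel borel ((+) c). f z)" by (simp add: lborel_distr_plus)
  also have "\<dots> = (LINT z|lborel. f (c + z))" by (rule integral_distr) auto
  finally show "(LINT z|lborel. f (c + z)) = (LINT z|lborel. f z)" ..
  have "integrable lborel f \<longleftrightarrow> integrable (distr lborel borel ((+) c)) f" by (simp add: lborel_distr_plus)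
  also have "\<dots> \<longleftrightarrow> integrable lborel (\<lambda>z. f (c + z))" by (rule integrable_distr_eq) auto
  finally show "integrable lborel (\<lambda>z. f (c + z)) \<longleftrightarrow> integrable lborel f" ..
qed

lemma gagliardo_sq_eq:
  fixes f :: "'a::euclidean_space \<Rightarrow> real"
  assumes [measurable]: "f \<in> borel_measurable borel"
  shows "gagliardo_sq s f = (\<integral>\<^sup>+x. \<integral>\<^sup>+z. ennreal ((f x - f (x + z))\<^sup>2 * frac_kernel s z) \<partial>lborel \<partial>lborel)"
  unfolding gagliardo_sq_def
proof (rule nn_integral_cong)
  fix x :: 'a
  show "(\<integral>\<^sup>+y. ennreal (\<bar>f x - f y\<bar>\<^sup>2 / norm (x - y) powr (real DIM('a) + 2 * s)) \<partial>lborel)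
    = (\<integral>\<^sup>+z. ennreal ((f x - f (x + z))\<^sup>2 * frac_kernel s z) \<partial>lborel)"
    by (subst nn_integral_lborel_plus[symmetric, of _ x]) (auto simp: frac_kernel_def)
qed

text \<open>After the exchange of integrals, the difference for fixed \<open>z\<close> lives on the
  support \<open>K\<close> and a translate of it, of total measure at most twice that of
  \<open>K\<close>. What remains is a kernel integral of a Lipschitz bound near 0 and a sup bound
  far away.\<close>

lemma gagliardo_sq_test_finite:
  fixes \<phi> :: "'a::euclidean_space \<Rightarrow> real"
  assumes \<phi>: "\<phi> \<in> Cc_infty \<Omega>" and s: "0 < s" "s < 1"
  shows "gagliardo_sq s \<phi> < \<infinity>"
proof -
  obtain K M L where K: "compact K" "\<And>x. x \<notin> K \<Longrightarrow> \<phi> x = 0" and M: "0 \<le> M" "\<And>x. \<bar>\<phi> x\<bar> \<le> M"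
    and L: "0 \<le> L" "\<And>x y. \<bar>\<phi> x - \<phi> y\<bar> \<le> L * norm (x - y)" using Cc_inftyD[OF \<phi>] by metis
  have [measurable]: "\<phi> \<in> borel_measurable borel" by (rule Cc_infty_integrable(1)[OF \<phi>])
  have [measurable]: "K \<in> sets borel" using compact_imp_closed[OF K(1)] by simp
  define g where "g z = min (L\<^sup>2 * (norm z)\<^sup>2) (4 * M\<^sup>2)" for z :: 'a
  have gm [measurable]: "g \<in> borel_measurable borel" unfolding g_def by measurable
  have g0: "0 \<le> g z" for z by (simp add: g_def)
  have eg: "emeasure lborel K < \<infinity>" using K emeasure_bounded_finite compact_imp_bounded by blast
  have diff: "ennreal ((\<phi> x - \<phi> (x + z))\<^sup>2) \<le> ennreal (g z) * (indicator K x + indicator K (x + z))" for x z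
  proof (cases "x \<in> K \<or> x + z \<in> K")
    case True
    have "\<bar>\<phi> x - \<phi> (x + z)\<bar> \<le> L * norm z" using L(2)[of x "x + z"] by simp
    then have "\<bar>\<phi> x - \<phi> (x + z)\<bar>\<^sup>2 \<le> (L * norm z)\<^sup>2" by (intro power_mono) auto
    then have 1: "(\<phi> x - \<phi> (x + z))\<^sup>2 \<le> L\<^sup>2 * (norm z)\<^sup>2" by (simp add: power_mult_distrib)
    have "\<bar>\<phi> x - \<phi> (x + z)\<bar> \<le> 2 * M" using M(2)[of x] M(2)[of "x + z"] by linarith
    then have "\<bar>\<phi> x - \<phi> (x + z)\<bar>\<^sup>2 \<le> (2 * M)\<^sup>2" by (intro power_mono) auto
    then have "(\<phi> x - \<phi> (x + z))\<^sup>2 \<le> g z" using 1 by (simp add: g_def power_mult_distrib)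
    then have "ennreal ((\<phi> x - \<phi> (x + z))\<^sup>2) \<le> ennreal (g z) * 1" by (simp add: ennreal_leI)
    also have "\<dots> \<le> ennreal (g z) * (indicator K x + indicator K (x + z))"
      using True by (intro mult_left_mono) (auto simp: indicator_def)
    finally show ?thesis .
  qed (use K in auto)
  have "gagliardo_sq s \<phi> = (\<integral>\<^sup>+z. \<integral>\<^sup>+x. ennreal ((\<phi> x - \<phi> (x + z))\<^sup>2 * frac_kernel s z) \<partial>lborel \<partial>lborel)"
    unfolding gagliardo_sq_eq[OF \<open>\<phi> \<in> borel_measurable borel\<close>] by (rule lborel_pair.Fubini'[symmetric]) measurable
  also have "\<dots> \<le> (\<integral>\<^sup>+z. \<integral>\<^sup>+x. ennreal (g z * frac_kernel s z) * (indicator K x + indicator K (x + z)) \<partial>lborel \<partial>lborel)"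
  proof (intro nn_integral_mono)
    fix x z
    show "ennreal ((\<phi> x - \<phi> (x + z))\<^sup>2 * frac_kernel s z) \<le> ennreal (g z * frac_kernel s z) * (indicator K x + indicator K (x + z))"
      using mult_right_mono[OF diff[of x z], of "ennreal (frac_kernel s z)"] g0[of z] by (simp add: ennreal_mult mult_ac)
  qed
  also have "\<dots> = (\<integral>\<^sup>+z. ennreal (g z * frac_kernel s z) * (2 * emeasure lborel K) \<partial>lborel)"
  proof (rule nn_integral_cong)
    fix z
    have "(\<integral>\<^sup>+x. indicator K (x + z) \<partial>lborel) = emeasure lborel K"
      using nn_integral_lborel_plus[of "indicator K" z] by (simp add: add.commute)
    then show "(\<integral>\<^sup>+x. ennreal (g z * frac_kernel s z) * (indicator K x + indicator K (x + z)) \<partial>lborel)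
      = ennreal (g z * frac_kernel s z) * (2 * emeasure lborel K)"
      by (subst nn_integral_cmult) (auto simp: nn_integral_add mult_2)
  qed
  also have "\<dots> = (\<integral>\<^sup>+z. ennreal (g z * frac_kernel s z) \<partial>lborel) * (2 * emeasure lborel K)"
    by (rule nn_integral_multc) measurable
  also have "\<dots> < \<infinity>"
  proof -
    have "(\<integral>\<^sup>+z. ennreal (g z * frac_kernel s z) \<partial>lborel) < \<infinity>"
      using frac_kernel_integral_bound[OF gm s g0, of "L\<^sup>2" "4 * M\<^sup>2"] by (auto simp: g_def less_top[symmetric] top_unique)
    then show ?thesis using eg by (simp add: ennreal_mult_less_top ennreal_mult_eq_top_iff less_top)
  qed
  finally show ?thesis .
qed

section \<open>The Gagliardo form as a closed operator\<close>

definition frac_diff :: "real \<Rightarrow> ('a::euclidean_space \<Rightarrow> real) \<Rightarrow> 'a \<times> 'a \<Rightarrow> real" where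
  "frac_diff s f = (\<lambda>(x, y). sqrt s * (f x - f y) / norm (x - y) powr ((real DIM('a) + 2 * s) / 2))"

lemma frac_diff_measurable:
  assumes [measurable]: "f \<in> borel_measurable borel"
  shows "frac_diff s f \<in> borel_measurable borel"
proof -
  have "frac_diff s f \<in> borel_measurable (borel \<Otimes>\<^sub>M borel)" unfolding frac_diff_def by measurable
  then show ?thesis by (simp add: borel_prod)
qed

lemma frac_diff_sq:
  fixes f :: "'a::euclidean_space \<Rightarrow> real"
  assumes "0 \<le> s"
  shows "(frac_diff s f (x, y))\<^sup>2 = s * ((f x - f y)\<^sup>2 * frac_kernel s (x - y))"
proof -
  have "(r powr (p / 2))\<^sup>2 = r powr p" if "0 \<le> r" for r p :: real
    using that by (simp add: power2_eq_square flip: powr_add)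
  then show ?thesis
    using assms by (simp add: frac_diff_def frac_kernel_def power_divide power_mult_distrib)
qed

lemma nn_integral_lborel_prod:
  fixes f :: "'a::euclidean_space \<times> 'a \<Rightarrow> ennreal"
  assumes "f \<in> borel_measurable borel"
  shows "(\<integral>\<^sup>+p. f p \<partial>lborel) = (\<integral>\<^sup>+x. \<integral>\<^sup>+y. f (x, y) \<partial>lborel \<partial>lborel)"
proof -
  have "f \<in> borel_measurable (lborel \<Otimes>\<^sub>M lborel)" using assms by (simp add: lborel_prod)
  from lborel.nn_integral_fst[OF this] show ?thesis by (simp add: lborel_prod)
qed

lemma nn_integral_frac_diff_sq:
  fixes f :: "'a::euclidean_space \<Rightarrow> real"
  assumes [measurable]: "f \<in> borel_measurable borel" and s: "0 \<le> s"
  shows "(\<integral>\<^sup>+p. ennreal ((frac_diff s f p)\<^sup>2) \<partial>lborel) = ennreal s * gagliardo_sq s f"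
proof -
  have "(\<integral>\<^sup>+p. ennreal ((frac_diff s f p)\<^sup>2) \<partial>lborel)
    = (\<integral>\<^sup>+x. \<integral>\<^sup>+y. ennreal ((frac_diff s f (x, y))\<^sup>2) \<partial>lborel \<partial>lborel)"
    using frac_diff_measurable[OF assms(1), of s] by (intro nn_integral_lborel_prod) measurable
  also have "\<dots> = (\<integral>\<^sup>+x. \<integral>\<^sup>+y. ennreal s * ennreal (\<bar>f x - f y\<bar>\<^sup>2 / norm (x - y) powr (real DIM('a) + 2 * s)) \<partial>lborel \<partial>lborel)"
    by (intro nn_integral_cong) (simp add: frac_diff_sq s frac_kernel_def flip: ennreal_mult)
  also have "\<dots> = ennreal s * gagliardo_sq s f"
    by (simp add: gagliardo_sq_def nn_integral_cmult)
  finally show ?thesis .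
qed

lemma sq_integrable_frac_diff_iff:
  fixes f :: "'a::euclidean_space \<Rightarrow> real"
  assumes f: "f \<in> borel_measurable borel" and s: "0 < s"
  shows "sq_integrable (frac_diff s f) \<longleftrightarrow> gagliardo_sq s f < \<infinity>"
proof -
  have m: "(\<lambda>p. (frac_diff s f p)\<^sup>2) \<in> borel_measurable borel"
    using frac_diff_measurable[OF f, of s] by measurable
  then have "sq_integrable (frac_diff s f) \<longleftrightarrow> (\<integral>\<^sup>+p. ennreal ((frac_diff s f p)\<^sup>2) \<partial>lborel) < \<infinity>"
    using frac_diff_measurable[OF f, of s] by (simp add: sq_integrable_def integrable_iff_bounded)
  also have "\<dots> \<longleftrightarrow> ennreal s * gagliardo_sq s f < \<infinity>"
    using s by (simp add: nn_integral_frac_diff_sq[OF f])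
  also have "\<dots> \<longleftrightarrow> gagliardo_sq s f < \<infinity>"
    using s by (auto simp: ennreal_mult_less_top)
  finally show ?thesis .
qed

lemma gagliardo_sq_cong_AE:
  fixes f g :: "'a::euclidean_space \<Rightarrow> real"
  assumes ae: "AE x in lborel. f x = g x"
  shows "gagliardo_sq s f = gagliardo_sq s g"
  unfolding gagliardo_sq_def
proof (rule nn_integral_cong_AE, use ae in eventually_elim)
  case (elim x)
  show ?case by (rule nn_integral_cong_AE, use ae in eventually_elim) (simp add: elim)
qed

lemma frac_diff_add: "frac_diff s (\<lambda>x. f x + g x) = (\<lambda>p. frac_diff s f p + frac_diff s g p)"
  by (auto simp: frac_diff_def algebra_simps add_divide_distrib diff_divide_distrib)

lemma frac_diff_diff: "frac_diff s (\<lambda>x. f x - g x) = (\<lambda>p. frac_diff s f p - frac_diff s g p)"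
  by (auto simp: frac_diff_def algebra_simps add_divide_distrib diff_divide_distrib)

lemma frac_diff_scale: "frac_diff s (\<lambda>x. c * f x) = (\<lambda>p. c * frac_diff s f p)"
  by (auto simp: frac_diff_def algebra_simps add_divide_distrib diff_divide_distrib)

text \<open>\<open>abs_L2\<close> is informative for square-integrable arguments only, so the value
  is meaningful on \<open>frac_dom s\<close> only.\<close>

definition frac_op :: "real \<Rightarrow> 'a::euclidean_space L2 \<Rightarrow> ('a \<times> 'a) L2" where
  "frac_op s u = abs_L2 (frac_diff s (rep_L2 u))"

definition frac_dom :: "real \<Rightarrow> 'a::euclidean_space L2 set" where
  "frac_dom s = {u. gagliardo_sq s (rep_L2 u) < \<infinity>}"

section \<open>Independence of representatives, linearity and closedness\<close>

lemma rep_L2_measurable [measurable]: "rep_L2 u \<in> borel_measurable borel"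
  using sq_integrable_rep_L2[of u] by (simp add: sq_integrable_def)

lemma abs_L2_eqI:
  assumes "sq_integrable f" "sq_integrable g" "AE x in lborel. f x = g x"
  shows "abs_L2 f = abs_L2 g"
proof -
  have "norm (abs_L2 f - abs_L2 g) = 0"
  proof -
    have "(norm (abs_L2 f - abs_L2 g))\<^sup>2 = (LINT x|lborel. (f x - g x)\<^sup>2)"
      by (simp add: abs_L2_diff assms norm_abs_L2 sq_integrable_diff)
    also have "\<dots> = (LINT x|(lborel::'a measure). 0)"
      by (rule integral_cong_AE) (use assms in \<open>auto simp: sq_integrable_def elim: eventually_mono\<close>)
    finally show ?thesis by simp
  qed
  then show ?thesis by simp
qed

lemma inner_abs_L2:
  assumes "sq_integrable f" "sq_integrable g"
  shows "abs_L2 f \<bullet> abs_L2 g = (LINT x|lborel. f x * g x)"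
  using assms by (intro inner_L2.abs_eq) (simp_all add: eq_onp_def L2_rel_def)

lemma rep_L2_add: "AE x in lborel. rep_L2 (u + v) x = rep_L2 u x + rep_L2 v x"
proof -
  have "u + v = abs_L2 (\<lambda>x. rep_L2 u x + rep_L2 v x)"
    using abs_L2_add[OF sq_integrable_rep_L2[of u] sq_integrable_rep_L2[of v]] by (simp add: abs_rep_L2)
  then show ?thesis using rep_abs_L2[OF sq_integrable_add[OF sq_integrable_rep_L2[of u] sq_integrable_rep_L2[of v]]] by simp
qed

lemma rep_L2_diff: "AE x in lborel. rep_L2 (u - v) x = rep_L2 u x - rep_L2 v x"
proof -
  have "u - v = abs_L2 (\<lambda>x. rep_L2 u x - rep_L2 v x)"
    using abs_L2_diff[OF sq_integrable_rep_L2[of u] sq_integrable_rep_L2[of v]] by (simp add: abs_rep_L2)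
  then show ?thesis using rep_abs_L2[OF sq_integrable_diff[OF sq_integrable_rep_L2[of u] sq_integrable_rep_L2[of v]]] by simp
qed

lemma rep_L2_scale: "AE x in lborel. rep_L2 (c *\<^sub>R u) x = c * rep_L2 u x"
proof -
  have "c *\<^sub>R u = abs_L2 (\<lambda>x. c * rep_L2 u x)"
    using abs_L2_scale[OF sq_integrable_rep_L2[of u]] by (simp add: abs_rep_L2)
  then show ?thesis using rep_abs_L2[OF sq_integrable_scale[OF sq_integrable_rep_L2[of u]]] by simp
qed

lemma rep_L2_zero: "AE x in lborel. rep_L2 0 x = 0"
  unfolding abs_L2_zero by (rule rep_abs_L2) (rule sq_integrable_zero)

lemma gagliardo_sq_zero: "gagliardo_sq s (\<lambda>_. 0) = 0"
  by (simp add: gagliardo_sq_def)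

text \<open>\<open>rep_L2 u\<close> is an arbitrary representative. Since the seminorm of a function
  that vanishes almost everywhere is 0, any explicit representative \<open>g\<close> may be used in
  its place.\<close>

lemma frac_op_abs:
  fixes g :: "'a::euclidean_space \<Rightarrow> real"
  assumes s: "0 < s" and g: "sq_integrable g" "gagliardo_sq s g < \<infinity>" and ae: "AE x in lborel. rep_L2 u x = g x"
  shows "u \<in> frac_dom s" "frac_op s u = abs_L2 (frac_diff s g)"
proof -
  have gm: "g \<in> borel_measurable borel" using g by (simp add: sq_integrable_def)
  have eq: "gagliardo_sq s (rep_L2 u) = gagliardo_sq s g" by (rule gagliardo_sq_cong_AE[OF ae])
  then show "u \<in> frac_dom s" using g by (simp add: frac_dom_def)
  have i: "sq_integrable (frac_diff s (rep_L2 u))" "sq_integrable (frac_diff s g)"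
    using eq g s gm by (simp_all add: sq_integrable_frac_diff_iff)
  define h where "h x = rep_L2 u x - g x" for x
  have hm: "h \<in> borel_measurable borel" using gm unfolding h_def by measurable
  have "gagliardo_sq s h = gagliardo_sq s (\<lambda>_::'a. 0)"
    by (rule gagliardo_sq_cong_AE) (use ae in \<open>auto simp: h_def elim: eventually_mono\<close>)
  then have "(\<integral>\<^sup>+p. ennreal ((frac_diff s h p)\<^sup>2) \<partial>lborel) = 0"
    using s by (simp add: nn_integral_frac_diff_sq[OF hm] gagliardo_sq_zero)
  moreover have "frac_diff s h = (\<lambda>p. frac_diff s (rep_L2 u) p - frac_diff s g p)"
    unfolding h_def by (rule frac_diff_diff)
  ultimately have "ennreal ((norm (abs_L2 (frac_diff s (rep_L2 u)) - abs_L2 (frac_diff s g)))\<^sup>2) = 0"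
    using nn_integral_sq_L2[OF sq_integrable_diff[OF i]] abs_L2_diff[OF i] by simp
  then show "frac_op s u = abs_L2 (frac_diff s g)" by (simp add: frac_op_def)
qed

lemma frac_dom_sq_integrable:
  assumes "0 < s" "u \<in> frac_dom s"
  shows "sq_integrable (frac_diff s (rep_L2 u))"
  using assms by (simp add: frac_dom_def sq_integrable_frac_diff_iff)

lemma norm_frac_op:
  assumes "0 < s" "u \<in> frac_dom s"
  shows "ennreal ((norm (frac_op s u))\<^sup>2) = ennreal s * gagliardo_sq s (rep_L2 u)"
  unfolding frac_op_def nn_integral_sq_L2[OF frac_dom_sq_integrable[OF assms], symmetric]
  using assms by (simp add: nn_integral_frac_diff_sq)

lemma frac_energy_eq:
  assumes "0 < s" "u \<in> frac_dom s"
  shows "ennreal s * frac_energy s u = ennreal ((norm (frac_op s u))\<^sup>2 / 2)"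
proof -
  have "ennreal s * frac_energy s u = ennreal (1/2) * (ennreal s * gagliardo_sq s (rep_L2 u))"
    by (simp add: frac_energy_def mult_ac)
  also have "\<dots> = ennreal ((norm (frac_op s u))\<^sup>2 / 2)"
    unfolding norm_frac_op[OF assms, symmetric] by (subst ennreal_mult[symmetric]) auto
  finally show ?thesis .
qed

lemma frac_op_linear:
  assumes s: "0 < s" and u: "u \<in> frac_dom s" and v: "v \<in> frac_dom s"
  shows "u + v \<in> frac_dom s" "frac_op s (u + v) = frac_op s u + frac_op s v"
    "c *\<^sub>R u \<in> frac_dom s" "frac_op s (c *\<^sub>R u) = c *\<^sub>R frac_op s u"
    "u - v \<in> frac_dom s" "frac_op s (u - v) = frac_op s u - frac_op s v"
proof -
  note iu = frac_dom_sq_integrable[OF s u] and iv = frac_dom_sq_integrable[OF s v]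
  note ru = sq_integrable_rep_L2[of u] and rv = sq_integrable_rep_L2[of v]
  have "sq_integrable (frac_diff s (\<lambda>x. rep_L2 u x + rep_L2 v x))"
    unfolding frac_diff_add by (rule sq_integrable_add[OF iu iv])
  then have "gagliardo_sq s (\<lambda>x. rep_L2 u x + rep_L2 v x) < \<infinity>" using s by (subst (asm) sq_integrable_frac_diff_iff) auto
  from frac_op_abs[OF s sq_integrable_add[OF ru rv] this rep_L2_add]
  show "u + v \<in> frac_dom s" "frac_op s (u + v) = frac_op s u + frac_op s v"
    by (simp_all add: frac_diff_add frac_op_def abs_L2_add[OF iu iv])
  have "sq_integrable (frac_diff s (\<lambda>x. rep_L2 u x - rep_L2 v x))"
    unfolding frac_diff_diff by (rule sq_integrable_diff[OF iu iv])
  then have "gagliardo_sq s (\<lambda>x. rep_L2 u x - rep_L2 v x) < \<infinity>" using s by (subst (asm) sq_integrable_frac_diff_iff) auto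
  from frac_op_abs[OF s sq_integrable_diff[OF ru rv] this rep_L2_diff]
  show "u - v \<in> frac_dom s" "frac_op s (u - v) = frac_op s u - frac_op s v"
    by (simp_all add: frac_diff_diff frac_op_def abs_L2_diff[OF iu iv])
  have "sq_integrable (frac_diff s (\<lambda>x. c * rep_L2 u x))"
    unfolding frac_diff_scale by (rule sq_integrable_scale[OF iu])
  then have "gagliardo_sq s (\<lambda>x. c * rep_L2 u x) < \<infinity>" using s by (subst (asm) sq_integrable_frac_diff_iff) auto
  from frac_op_abs[OF s sq_integrable_scale[OF ru] this rep_L2_scale]
  show "c *\<^sub>R u \<in> frac_dom s" "frac_op s (c *\<^sub>R u) = c *\<^sub>R frac_op s u"
    by (simp_all add: frac_diff_scale frac_op_def abs_L2_scale[OF iu])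
qed

lemma frac_op_test:
  assumes "0 < s" "s < 1" "\<phi> \<in> Cc_infty \<Omega>"
  shows "abs_L2 \<phi> \<in> frac_dom s" "frac_op s (abs_L2 \<phi>) = abs_L2 (frac_diff s \<phi>)" "sq_integrable (frac_diff s \<phi>)"
proof -
  note \<phi> = Cc_infty_integrable[OF assms(3)] and fin = gagliardo_sq_test_finite[OF assms(3,1,2)]
  show "abs_L2 \<phi> \<in> frac_dom s" "frac_op s (abs_L2 \<phi>) = abs_L2 (frac_diff s \<phi>)"
    using frac_op_abs[OF assms(1) \<phi>(3) fin rep_abs_L2[OF \<phi>(3)]] by auto
  show "sq_integrable (frac_diff s \<phi>)" using fin assms \<phi>(1) by (simp add: sq_integrable_frac_diff_iff)
qed

text \<open>The squared differences converge to 0 in \<open>L1\<close>, which provides the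
  subsequence.\<close>

lemma L2_convergent_AE_subseq:
  fixes X :: "nat \<Rightarrow> 'a::euclidean_space L2"
  assumes "X \<longlonglongrightarrow> x"
  obtains r where "strict_mono r" "AE p in lborel. (\<lambda>k. rep_L2 (X (r k)) p) \<longlonglongrightarrow> rep_L2 x p"
proof -
  have eq: "(LINT p|lborel. norm ((rep_L2 (X n) p - rep_L2 x p)\<^sup>2)) = (norm (X n - x))\<^sup>2" for n
    using dist_abs_L2[OF sq_integrable_rep_L2[of "X n"] sq_integrable_rep_L2[of x]] by (simp add: abs_rep_L2 dist_norm)
  have "(\<lambda>n. norm (X n - x)) \<longlonglongrightarrow> 0" using assms by (simp add: tendsto_norm_zero_iff LIM_zero_iff)
  from tendsto_power[OF this, of 2] have "(\<lambda>n. LINT p|lborel. norm ((rep_L2 (X n) p - rep_L2 x p)\<^sup>2)) \<longlonglongrightarrow> 0"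
    unfolding eq by simp
  moreover have "integrable lborel (\<lambda>p. (rep_L2 (X n) p - rep_L2 x p)\<^sup>2)" for n
    using sq_integrable_diff[OF sq_integrable_rep_L2[of "X n"] sq_integrable_rep_L2[of x]] by (simp add: sq_integrable_def)
  ultimately obtain r where r: "strict_mono r" "AE p in lborel. (\<lambda>n. (rep_L2 (X (r n)) p - rep_L2 x p)\<^sup>2) \<longlonglongrightarrow> 0"
    using tendsto_L1_AE_subseq[of lborel "\<lambda>n p. (rep_L2 (X n) p - rep_L2 x p)\<^sup>2"] by auto
  have "AE p in lborel. (\<lambda>k. rep_L2 (X (r k)) p) \<longlonglongrightarrow> rep_L2 x p"
    using r(2)
  proof eventually_elim
    case (elim p)
    from tendsto_real_sqrt[OF this] have "(\<lambda>n. \<bar>rep_L2 (X (r n)) p - rep_L2 x p\<bar>) \<longlonglongrightarrow> 0" by simp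
    then show ?case by (simp add: tendsto_rabs_zero_iff LIM_zero_iff)
  qed
  with r(1) show thesis by (rule that)
qed

text \<open>By Fubini the cylinders over a null set in either coordinate are null in the product, so
  statements on representatives can be used at both points of a difference.\<close>

lemma AE_lborel_prod_both:
  assumes "AE x in (lborel :: 'a::euclidean_space measure). P x"
  shows "AE p in (lborel :: ('a \<times> 'a) measure). P (fst p) \<and> P (snd p)"
proof -
  obtain N where N': "\<And>x. x \<in> space lborel - N \<Longrightarrow> P x" and N: "N \<in> null_sets lborel"
    using AE_E3[OF assms] by blast
  have [measurable]: "N \<in> sets borel" using null_setsD2[OF N] by simp
  have "AE x in (lborel :: 'a measure). AE y in (lborel :: 'a measure). fst (x, y) \<notin> N \<and> snd (x, y) \<notin> N"
    using AE_not_in[OF N]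
  proof eventually_elim
    case (elim x)
    show ?case using AE_not_in[OF N] by eventually_elim (use elim in simp)
  qed
  then have "AE p in (lborel :: 'a measure) \<Otimes>\<^sub>M (lborel :: 'a measure). fst p \<notin> N \<and> snd p \<notin> N"
    by (intro lborel_pair.AE_pair_measure) measurable
  then have "AE p in (lborel :: ('a \<times> 'a) measure). fst p \<notin> N \<and> snd p \<notin> N" unfolding lborel_prod .
  then show ?thesis by eventually_elim (use N' in auto)
qed

text \<open>Along a common subsequence both the functions and their images converge almost
  everywhere. The image formula is continuous in the two values it involves, so the image of the
  limit agrees with \<open>z\<close> almost everywhere.\<close>

lemma frac_op_closed:
  fixes X :: "nat \<Rightarrow> 'a::euclidean_space L2"
  assumes s: "0 < s" and X: "\<And>k. X k \<in> frac_dom s" "X \<longlonglongrightarrow> x" and T: "(\<lambda>k. frac_op s (X k)) \<longlonglongrightarrow> z"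
  shows "x \<in> frac_dom s" "frac_op s x = z"
proof -
  obtain r where r: "strict_mono r" "AE p in lborel. (\<lambda>k. rep_L2 (X (r k)) p) \<longlonglongrightarrow> rep_L2 x p"
    by (rule L2_convergent_AE_subseq[OF X(2)])
  have "(\<lambda>k. frac_op s (X (r k))) \<longlonglongrightarrow> z" using LIMSEQ_subseq_LIMSEQ[OF T r(1)] by (simp add: o_def)
  then obtain q where q: "strict_mono q"
      "AE p in lborel. (\<lambda>k. rep_L2 (frac_op s (X (r (q k)))) p) \<longlonglongrightarrow> rep_L2 z p"
    by (rule L2_convergent_AE_subseq)
  have "AE p in lborel. rep_L2 (frac_op s (X (r (q k)))) p = frac_diff s (rep_L2 (X (r (q k)))) p" for k
    unfolding frac_op_def by (rule rep_abs_L2[OF frac_dom_sq_integrable[OF s X(1)]])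
  then have "AE p in lborel. \<forall>k. rep_L2 (frac_op s (X (r (q k)))) p = frac_diff s (rep_L2 (X (r (q k)))) p"
    by (simp add: AE_all_countable)
  with q(2) AE_lborel_prod_both[OF r(2)]
  have ae: "AE p in lborel. frac_diff s (rep_L2 x) p = rep_L2 z p"
  proof eventually_elim
    case (elim p)
    obtain a b where p: "p = (a, b)" by (cases p)
    have ab: "(\<lambda>k. rep_L2 (X (r (q k))) a) \<longlonglongrightarrow> rep_L2 x a" "(\<lambda>k. rep_L2 (X (r (q k))) b) \<longlonglongrightarrow> rep_L2 x b"
      using elim(2) LIMSEQ_subseq_LIMSEQ[OF _ q(1)] by (auto simp: p o_def)
    have "(\<lambda>k. frac_diff s (rep_L2 (X (r (q k)))) p) \<longlonglongrightarrow> frac_diff s (rep_L2 x) p"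
      unfolding p frac_diff_def prod.case divide_inverse
      by (rule tendsto_mult[OF tendsto_mult[OF tendsto_const tendsto_diff[OF ab]] tendsto_const])
    moreover have "(\<lambda>k. frac_diff s (rep_L2 (X (r (q k)))) p) \<longlonglongrightarrow> rep_L2 z p" using elim(1,3) by simp
    ultimately show ?case by (rule LIMSEQ_unique)
  qed
  have "integrable lborel (\<lambda>p. (frac_diff s (rep_L2 x) p)\<^sup>2)"
  proof (rule integrable_cong_AE_imp)
    show "integrable lborel (\<lambda>p. (rep_L2 z p)\<^sup>2)" using sq_integrable_rep_L2[of z] by (simp add: sq_integrable_def)
    show "(\<lambda>p. (frac_diff s (rep_L2 x) p)\<^sup>2) \<in> borel_measurable lborel"
      using frac_diff_measurable[OF rep_L2_measurable, of s x] by measurable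
    show "AE p in lborel. (rep_L2 z p)\<^sup>2 = (frac_diff s (rep_L2 x) p)\<^sup>2" using ae by eventually_elim simp
  qed
  then have i: "sq_integrable (frac_diff s (rep_L2 x))"
    using frac_diff_measurable[OF rep_L2_measurable, of s x] by (simp add: sq_integrable_def)
  then show "x \<in> frac_dom s" using s by (simp add: frac_dom_def sq_integrable_frac_diff_iff)
  have "frac_op s x = abs_L2 (rep_L2 z)"
    unfolding frac_op_def by (rule abs_L2_eqI[OF i sq_integrable_rep_L2 ae])
  then show "frac_op s x = z" by (simp add: abs_rep_L2)
qed

section \<open>Functions supported in the domain and the completion of test functions\<close>

lemma L2_on_diff:
  assumes "u \<in> L2_on \<Omega>" "v \<in> L2_on \<Omega>"
  shows "u - v \<in> L2_on \<Omega>"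
  using assms rep_L2_diff[of u v] unfolding L2_on_def mem_Collect_eq by eventually_elim auto

lemma L2_on_add:
  assumes "u \<in> L2_on \<Omega>" "v \<in> L2_on \<Omega>"
  shows "u + v \<in> L2_on \<Omega>"
  using assms rep_L2_add[of u v] unfolding L2_on_def mem_Collect_eq by eventually_elim auto

lemma L2_on_scale:
  assumes "u \<in> L2_on \<Omega>"
  shows "c *\<^sub>R u \<in> L2_on \<Omega>"
  using assms rep_L2_scale[of c u] unfolding L2_on_def mem_Collect_eq by eventually_elim auto

lemma L2_on_zero: "0 \<in> L2_on \<Omega>"
  using rep_L2_zero unfolding L2_on_def mem_Collect_eq by eventually_elim auto

lemma L2_on_closed:
  assumes X: "\<And>k::nat. X k \<in> L2_on \<Omega>" "X \<longlonglongrightarrow> x"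
  shows "x \<in> L2_on \<Omega>"
proof -
  obtain r where r: "strict_mono r" "AE p in lborel. (\<lambda>k. rep_L2 (X (r k)) p) \<longlonglongrightarrow> rep_L2 x p"
    by (rule L2_convergent_AE_subseq[OF X(2)])
  have "AE p in lborel. \<forall>k. p \<notin> \<Omega> \<longrightarrow> rep_L2 (X (r k)) p = 0"
    by (subst AE_all_countable) (use X(1) in \<open>simp add: L2_on_def\<close>)
  with r(2) show ?thesis
    unfolding L2_on_def mem_Collect_eq by eventually_elim (auto simp: LIMSEQ_const_iff)
qed

lemma test_in_L2_on:
  assumes "\<phi> \<in> Cc_infty \<Omega>"
  shows "abs_L2 \<phi> \<in> L2_on \<Omega>"
proof -
  obtain K where K: "K \<subseteq> \<Omega>" "\<And>x. x \<notin> K \<Longrightarrow> \<phi> x = 0" using Cc_inftyD[OF assms] by metis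
  have "AE x in lborel. rep_L2 (abs_L2 \<phi>) x = \<phi> x" by (rule rep_abs_L2[OF Cc_infty_integrable(3)[OF assms]])
  then show ?thesis unfolding L2_on_def mem_Collect_eq by eventually_elim (use K in auto)
qed

lemma gagliardo_sq_test_diff:
  assumes s: "0 < s" "s < 1" and \<phi>: "\<phi> \<in> Cc_infty \<Omega>"
  shows "gagliardo_sq s (\<lambda>x. \<phi> x - rep_L2 u x) = gagliardo_sq s (rep_L2 (abs_L2 \<phi> - u))"
proof (rule gagliardo_sq_cong_AE)
  show "AE x in lborel. \<phi> x - rep_L2 u x = rep_L2 (abs_L2 \<phi> - u) x"
    using rep_L2_diff[of "abs_L2 \<phi>" u] rep_abs_L2[OF Cc_infty_integrable(3)[OF \<phi>]] by eventually_elim simp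
qed

text \<open>Convergence of an extended-real seminorm is translated into norm convergence of images
  under \<open>frac_op\<close>. That \<open>u\<close> itself has finite seminorm follows because
  some test function is at finite distance from it.\<close>

lemma H0s_iff:
  assumes s: "0 < s" "s < 1"
  shows "u \<in> H0s s \<Omega> \<longleftrightarrow> u \<in> L2_on \<Omega> \<and> u \<in> frac_dom s \<and>
    (\<exists>\<phi>. (\<forall>k::nat. \<phi> k \<in> Cc_infty \<Omega>) \<and> (\<lambda>k. frac_op s (abs_L2 (\<phi> k))) \<longlonglongrightarrow> frac_op s u)"
proof -
  have ev: "(\<lambda>k. gagliardo_sq s (\<lambda>x. \<phi> k x - rep_L2 u x)) \<longlonglongrightarrow> 0
      \<longleftrightarrow> (\<lambda>k. frac_op s (abs_L2 (\<phi> k))) \<longlonglongrightarrow> frac_op s u"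
    if \<phi>: "\<And>k::nat. \<phi> k \<in> Cc_infty \<Omega>" and u: "u \<in> frac_dom s" for \<phi>
  proof -
    have W: "abs_L2 (\<phi> k) \<in> frac_dom s" for k by (rule frac_op_test(1)[OF s \<phi>])
    have "(\<lambda>k. frac_op s (abs_L2 (\<phi> k))) \<longlonglongrightarrow> frac_op s u
        \<longleftrightarrow> (\<lambda>k. (norm (frac_op s (abs_L2 (\<phi> k) - u)))\<^sup>2) \<longlonglongrightarrow> 0"
      by (simp add: frac_op_linear(6)[OF s(1) W u] LIM_zero_iff tendsto_norm_zero_iff)
    also have "\<dots> \<longleftrightarrow> (\<lambda>k. ennreal ((norm (frac_op s (abs_L2 (\<phi> k) - u)))\<^sup>2)) \<longlonglongrightarrow> ennreal 0"
      by (rule tendsto_ennreal_iff[symmetric]) auto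
    also have "\<dots> \<longleftrightarrow> (\<lambda>k. ennreal s * gagliardo_sq s (\<lambda>x. \<phi> k x - rep_L2 u x)) \<longlonglongrightarrow> 0"
      by (simp add: norm_frac_op[OF s(1) frac_op_linear(5)[OF s(1) W u]] gagliardo_sq_test_diff[OF s \<phi>])
    also have "\<dots> \<longleftrightarrow> (\<lambda>k. gagliardo_sq s (\<lambda>x. \<phi> k x - rep_L2 u x)) \<longlonglongrightarrow> 0"
    proof
      assume "(\<lambda>k. ennreal s * gagliardo_sq s (\<lambda>x. \<phi> k x - rep_L2 u x)) \<longlonglongrightarrow> 0"
      then have "(\<lambda>k. ennreal (1 / s) * (ennreal s * gagliardo_sq s (\<lambda>x. \<phi> k x - rep_L2 u x))) \<longlonglongrightarrow> ennreal (1 / s) * 0"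
        by (intro ennreal_tendsto_cmult) auto
      then show "(\<lambda>k. gagliardo_sq s (\<lambda>x. \<phi> k x - rep_L2 u x)) \<longlonglongrightarrow> 0"
        using s by (simp flip: mult.assoc ennreal_mult)
    next
      assume "(\<lambda>k. gagliardo_sq s (\<lambda>x. \<phi> k x - rep_L2 u x)) \<longlonglongrightarrow> 0"
      then have "(\<lambda>k. ennreal s * gagliardo_sq s (\<lambda>x. \<phi> k x - rep_L2 u x)) \<longlonglongrightarrow> ennreal s * 0"
        by (intro ennreal_tendsto_cmult) auto
      then show "(\<lambda>k. ennreal s * gagliardo_sq s (\<lambda>x. \<phi> k x - rep_L2 u x)) \<longlonglongrightarrow> 0" by simp
    qed
    finally show ?thesis ..
  qed
  have dom: "u \<in> frac_dom s" if \<phi>: "\<And>k::nat. \<phi> k \<in> Cc_infty \<Omega>"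
      and lim: "(\<lambda>k. gagliardo_sq s (\<lambda>x. \<phi> k x - rep_L2 u x)) \<longlonglongrightarrow> 0" for \<phi>
  proof -
    have "\<forall>\<^sub>F k in sequentially. gagliardo_sq s (\<lambda>x. \<phi> k x - rep_L2 u x) < \<infinity>"
      by (rule order_tendstoD(2)[OF lim]) simp
    then obtain k where "gagliardo_sq s (\<lambda>x. \<phi> k x - rep_L2 u x) < \<infinity>"
      by (auto simp: eventually_sequentially)
    then have "abs_L2 (\<phi> k) - u \<in> frac_dom s" by (simp add: frac_dom_def gagliardo_sq_test_diff[OF s \<phi>])
    from frac_op_linear(5)[OF s(1) frac_op_test(1)[OF s \<phi>] this, of k] show ?thesis by simp
  qed
  show ?thesis
    unfolding H0s_def using ev dom by blast
qed

text \<open>Sums and multiples of approximating sequences approximate sums and multiples. For the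
  closed graph, each \<open>X k\<close> is replaced by a test function whose image is within
  \<open>1 / (k + 1)\<close>, a diagonal choice that keeps the limit in the completion.\<close>

lemma H0s_closed_operator:
  assumes s: "0 < s" "s < 1"
  shows "closed_operator (H0s s \<Omega>) (frac_op s)"
proof
  note I = H0s_iff[OF s, of _ \<Omega>]
  have dom: "x \<in> frac_dom s" if "x \<in> H0s s \<Omega>" for x using that I by blast
  note lin = frac_op_linear[OF s(1)]
  have add_test: "frac_op s (abs_L2 (\<lambda>x. \<phi> x + \<psi> x)) = frac_op s (abs_L2 \<phi>) + frac_op s (abs_L2 \<psi>)"
    if "\<phi> \<in> Cc_infty \<Omega>" "\<psi> \<in> Cc_infty \<Omega>" for \<phi> \<psi>
    using lin(2)[OF frac_op_test(1)[OF s that(1)] frac_op_test(1)[OF s that(2)]]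
    by (simp add: abs_L2_add Cc_infty_integrable(3)[OF that(1)] Cc_infty_integrable(3)[OF that(2)])
  have scale_test: "frac_op s (abs_L2 (\<lambda>x. c * \<phi> x)) = c *\<^sub>R frac_op s (abs_L2 \<phi>)" if "\<phi> \<in> Cc_infty \<Omega>" for c \<phi>
    using lin(4)[OF frac_op_test(1)[OF s that] frac_op_test(1)[OF s that]]
    by (simp add: abs_L2_scale Cc_infty_integrable(3)[OF that])
  have zd: "(0 :: 'a L2) \<in> frac_dom s" using gagliardo_sq_cong_AE[OF rep_L2_zero, of s, where 'a = 'a] by (simp add: frac_dom_def gagliardo_sq_zero)
  have "(\<lambda>_::'a. 0) \<in> Cc_infty \<Omega>"
  proof -
    have "Ck k (\<lambda>_::'a. 0 :: real)" for k
    proof (induction k)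
      case (Suc k)
      then show ?case by (intro Ck_SucI[of _ "\<lambda>_ _. 0"]) auto
    qed simp
    then show ?thesis by (simp add: Cc_infty_def)
  qed
  then show "0 \<in> H0s s \<Omega>"
    using zd L2_on_zero by (auto simp: I intro!: exI[of _ "\<lambda>_ _. 0"] simp flip: abs_L2_zero)
  fix x y assume x: "x \<in> H0s s \<Omega>"
  obtain \<phi> where \<phi>: "\<And>k::nat. \<phi> k \<in> Cc_infty \<Omega>" "(\<lambda>k. frac_op s (abs_L2 (\<phi> k))) \<longlonglongrightarrow> frac_op s x"
    using x by (auto simp: I)
  show "c *\<^sub>R x \<in> H0s s \<Omega>" for c
    unfolding I
  proof (intro conjI exI allI)
    show "(\<lambda>x. c * \<phi> k x) \<in> Cc_infty \<Omega>" for k by (rule Cc_infty_scale[OF \<phi>(1)])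
    show "(\<lambda>k. frac_op s (abs_L2 (\<lambda>x. c * \<phi> k x))) \<longlonglongrightarrow> frac_op s (c *\<^sub>R x)"
      unfolding scale_test[OF \<phi>(1)] lin(4)[OF dom[OF x] dom[OF x]] by (intro tendsto_intros \<phi>(2))
  qed (use x I L2_on_scale lin(3)[OF dom[OF x] dom[OF x]] in auto)
  show "frac_op s (c *\<^sub>R x) = c *\<^sub>R frac_op s x" for c by (rule lin(4)[OF dom[OF x] dom[OF x]])
  assume y: "y \<in> H0s s \<Omega>"
  obtain \<psi> where \<psi>: "\<And>k::nat. \<psi> k \<in> Cc_infty \<Omega>" "(\<lambda>k. frac_op s (abs_L2 (\<psi> k))) \<longlonglongrightarrow> frac_op s y"
    using y by (auto simp: I)
  show "frac_op s (x + y) = frac_op s x + frac_op s y" by (rule lin(2)[OF dom[OF x] dom[OF y]])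
  show "x + y \<in> H0s s \<Omega>"
    unfolding I
  proof (intro conjI exI allI)
    show "(\<lambda>x. \<phi> k x + \<psi> k x) \<in> Cc_infty \<Omega>" for k by (rule Cc_infty_add[OF \<phi>(1) \<psi>(1)])
    show "(\<lambda>k. frac_op s (abs_L2 (\<lambda>x. \<phi> k x + \<psi> k x))) \<longlonglongrightarrow> frac_op s (x + y)"
      unfolding add_test[OF \<phi>(1) \<psi>(1)] lin(2)[OF dom[OF x] dom[OF y]] by (intro tendsto_intros \<phi>(2) \<psi>(2))
  qed (use x y I L2_on_add lin(1)[OF dom[OF x] dom[OF y]] in auto)
next
  note I = H0s_iff[OF s, of _ \<Omega>]
  fix X :: "nat \<Rightarrow> 'a L2" and x z
  assume X: "\<And>k. X k \<in> H0s s \<Omega>" "X \<longlonglongrightarrow> x" "(\<lambda>k. frac_op s (X k)) \<longlonglongrightarrow> z"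
  have xz: "x \<in> frac_dom s" "frac_op s x = z"
    using frac_op_closed[OF s(1) _ X(2,3)] X(1) I by blast+
  have "\<exists>\<phi>\<in>Cc_infty \<Omega>. dist (frac_op s (abs_L2 \<phi>)) (frac_op s (X k)) < 1 / real (Suc k)" for k
  proof -
    obtain \<phi> where \<phi>: "\<And>k::nat. \<phi> k \<in> Cc_infty \<Omega>" "(\<lambda>j. frac_op s (abs_L2 (\<phi> j))) \<longlonglongrightarrow> frac_op s (X k)"
      using X(1)[of k] by (auto simp: I)
    from metric_LIMSEQ_D[OF \<phi>(2), of "1 / real (Suc k)"] \<phi>(1) show ?thesis by auto
  qed
  then obtain \<phi> where \<phi>: "\<And>k. \<phi> k \<in> Cc_infty \<Omega>" "\<And>k. dist (frac_op s (abs_L2 (\<phi> k))) (frac_op s (X k)) < 1 / real (Suc k)"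
    by metis
  have "(\<lambda>k. dist (frac_op s (abs_L2 (\<phi> k))) (frac_op s (X k))) \<longlonglongrightarrow> 0"
    by (rule tendsto_sandwich[OF _ _ tendsto_const LIMSEQ_Suc[OF lim_1_over_n]])
      (use \<phi>(2) in \<open>auto intro!: always_eventually less_imp_le simp del: of_nat_Suc\<close>)
  then have "(\<lambda>k. frac_op s (abs_L2 (\<phi> k)) - frac_op s (X k)) \<longlonglongrightarrow> 0"
    by (simp add: dist_norm tendsto_norm_zero_iff)
  from tendsto_add[OF this X(3)] have "(\<lambda>k. frac_op s (abs_L2 (\<phi> k))) \<longlonglongrightarrow> frac_op s x" by (simp add: xz)
  moreover have "x \<in> L2_on \<Omega>" by (rule L2_on_closed[OF _ X(2)]) (use X(1) I in blast)
  ultimately show "x \<in> H0s s \<Omega> \<and> frac_op s x = z" using xz \<phi>(1) by (auto simp: I)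
qed

text \<open>If \<open>\<Omega>\<close> lies in the ball of radius \<open>R\<close> and
  \<open>x\<close> is in \<open>\<Omega>\<close>, then \<open>x + z\<close> with
  \<open>norm z \<ge> 3 * R\<close> lies outside, where \<open>u\<close> vanishes. Hence the inner
  integral of the seminorm dominates the square of \<open>u\<close> at \<open>x\<close> times the
  tail mass of the kernel.\<close>

lemma poincare:
  fixes \<Omega> :: "'a::euclidean_space set"
  assumes "bounded \<Omega>" and s: "0 < s"
  obtains c where "0 < c" "\<And>u. u \<in> L2_on \<Omega> \<Longrightarrow> u \<in> frac_dom s \<Longrightarrow> c * (norm u)\<^sup>2 \<le> (norm (frac_op s u))\<^sup>2"
proof -
  obtain R where R: "0 < R" "\<And>x. x \<in> \<Omega> \<Longrightarrow> norm x \<le> R"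
    using assms(1) by (metis bounded_pos)
  define c where "c = dim_omega TYPE('a) / (2 * s * (3 * R) powr (2 * s))"
  have c: "0 < c" using R s dim_omega_pos[where 'a = 'a] by (simp add: c_def)
  have "s * c * (norm u)\<^sup>2 \<le> (norm (frac_op s u))\<^sup>2" if u: "u \<in> L2_on \<Omega>" "u \<in> frac_dom s" for u
  proof -
    define f where "f = rep_L2 u"
    have fm [measurable]: "f \<in> borel_measurable borel" by (simp add: f_def)
    have f0: "AE x in lborel. x \<notin> \<Omega> \<longrightarrow> f x = 0" using u by (simp add: L2_on_def f_def)
    have "ennreal ((norm u)\<^sup>2) * ennreal c = (\<integral>\<^sup>+x. ennreal ((f x)\<^sup>2) * ennreal c \<partial>lborel)"
      using nn_integral_sq_L2[OF sq_integrable_rep_L2[of u]] by (simp add: f_def nn_integral_multc abs_rep_L2)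
    also have "\<dots> \<le> (\<integral>\<^sup>+x. \<integral>\<^sup>+z. ennreal ((f x - f (x + z))\<^sup>2 * frac_kernel s z) \<partial>lborel \<partial>lborel)"
    proof (rule nn_integral_mono_AE, use f0 in eventually_elim)
      case (elim x)
      show ?case
      proof (cases "x \<in> \<Omega>")
        case True
        have "ennreal ((f x)\<^sup>2) * ennreal c = (\<integral>\<^sup>+(z::'a). ennreal ((f x)\<^sup>2) * (indicator {z. 3 * R \<le> norm z} z * ennreal (frac_kernel s z)) \<partial>lborel)"
          using kernel_outer[of "3 * R" s, where 'a = 'a] R s
          by (subst nn_integral_cmult) (auto simp: frac_kernel_def c_def)
        also have "\<dots> \<le> (\<integral>\<^sup>+z. ennreal ((f x - f (x + z))\<^sup>2 * frac_kernel s z) \<partial>lborel)"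
        proof (rule nn_integral_mono_AE)
          \<comment> \<open>Translation invariance carries the exceptional null set over to the
            shifted variable.\<close>
          have "AE z in lborel. x + z \<notin> \<Omega> \<longrightarrow> f (x + z) = 0"
          proof -
            obtain N where N': "\<And>x. x \<in> space lborel - N \<Longrightarrow> x \<notin> \<Omega> \<longrightarrow> f x = 0" and N: "N \<in> null_sets lborel"
              using AE_E3[OF f0] by blast
            have [measurable]: "N \<in> sets borel" using null_setsD2[OF N] by simp
            have "(\<integral>\<^sup>+z. indicator N (x + z) \<partial>lborel) = emeasure lborel N"
              by (subst nn_integral_lborel_plus) auto
            then have "(\<integral>\<^sup>+z. indicator N (x + z) \<partial>lborel) = (0::ennreal)" using null_setsD1[OF N] by simp
            then have "AE z in lborel. indicator N (x + z) = (0::ennreal)"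
              by (subst (asm) nn_integral_0_iff_AE) auto
            then show ?thesis by eventually_elim (use N' in \<open>auto simp: indicator_def split: if_splits\<close>)
          qed
          then show "AE z in lborel. ennreal ((f x)\<^sup>2) * (indicator {z. 3 * R \<le> norm z} z * ennreal (frac_kernel s z))
              \<le> ennreal ((f x - f (x + z))\<^sup>2 * frac_kernel s z)"
          proof eventually_elim
            case (elim z)
            show ?case
            proof (cases "3 * R \<le> norm z")
              case far: True
              have "norm z \<le> norm (x + z) + norm x" using norm_triangle_ineq4[of "x + z" x] by simp
              then have "x + z \<notin> \<Omega>" using R(2)[of "x + z"] R(2)[OF True] R(1) far by auto
              then show ?thesis using elim far by (simp add: ennreal_mult)
            qed simp
          qed
        qed
        finally show ?thesis .
      qed (use elim in simp)
    qed
    also have "\<dots> = gagliardo_sq s f" by (rule gagliardo_sq_eq[symmetric]) simp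
    finally have "ennreal s * (ennreal ((norm u)\<^sup>2) * ennreal c) \<le> ennreal s * gagliardo_sq s f"
      by (rule mult_left_mono) simp
    also have "\<dots> = ennreal ((norm (frac_op s u))\<^sup>2)" using norm_frac_op[OF s u(2)] by (simp add: f_def)
    finally have "ennreal (s * c * (norm u)\<^sup>2) \<le> ennreal ((norm (frac_op s u))\<^sup>2)"
      using s c by (simp add: ennreal_mult mult_ac)
    then show ?thesis by (simp add: ennreal_le_iff)
  qed
  then show thesis using that[of "s * c"] s c by simp
qed

section \<open>The scaled fractional Laplacian as \<open>s \<rightarrow> 0\<close>\<close>

abbreviation second_diff :: "('a::euclidean_space \<Rightarrow> real) \<Rightarrow> 'a \<Rightarrow> 'a \<Rightarrow> real" where
  "second_diff \<phi> x z \<equiv> 2 * \<phi> x - \<phi> (x + z) - \<phi> (x - z)"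

lemma integral_bound_of_nn_integral:
  fixes f :: "'a \<Rightarrow> real"
  assumes m: "f \<in> borel_measurable M" and b: "(\<integral>\<^sup>+x. ennreal \<bar>f x\<bar> \<partial>M) \<le> ennreal c" and c: "0 \<le> c"
  shows "integrable M f" "\<bar>integral\<^sup>L M f\<bar> \<le> c"
proof -
  show i: "integrable M f"
    using m b by (auto simp: integrable_iff_bounded intro: le_less_trans)
  have "\<bar>integral\<^sup>L M f\<bar> \<le> (\<integral>x. \<bar>f x\<bar> \<partial>M)" by (rule integral_abs_bound)
  also have "\<dots> \<le> c"
  proof -
    have "ennreal (\<integral>x. \<bar>f x\<bar> \<partial>M) = (\<integral>\<^sup>+x. ennreal \<bar>f x\<bar> \<partial>M)"
      using i by (intro nn_integral_eq_integral[symmetric]) auto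
    with b have "ennreal (\<integral>x. \<bar>f x\<bar> \<partial>M) \<le> ennreal c" by simp
    then show ?thesis using c by (simp add: ennreal_le_iff)
  qed
  finally show "\<bar>integral\<^sup>L M f\<bar> \<le> c" .
qed

lemma frac_laplacian_eq:
  "frac_laplacian s \<phi> x = (LINT z|lborel. second_diff \<phi> x z * frac_kernel s z)"
  by (simp add: frac_laplacian_def frac_kernel_def)

lemma frac_laplacian_measurable:
  fixes \<phi> :: "'a::euclidean_space \<Rightarrow> real"
  assumes [measurable]: "\<phi> \<in> borel_measurable borel"
  shows "frac_laplacian s \<phi> \<in> borel_measurable borel"
proof -
  have "(\<lambda>x. LINT z|lborel. second_diff \<phi> x z * frac_kernel s z) \<in> borel_measurable (borel :: 'a measure)"
    by (rule lborel.borel_measurable_lebesgue_integral) measurable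
  then show ?thesis by (simp add: frac_laplacian_eq[abs_def])
qed

text \<open>Uniformity in \<open>x\<close> is the point: it bounds the fractional Laplacian and also
  supplies the absolute integrability for the exchange of integrals in the duality formula.\<close>

lemma second_diff_kernel_bound:
  fixes \<phi> :: "'a::euclidean_space \<Rightarrow> real"
  assumes \<phi>: "\<phi> \<in> Cc_infty \<Omega>" and s: "0 < s" "s < 1"
  obtains B where "0 \<le> B" "\<And>x. (\<integral>\<^sup>+z. ennreal \<bar>second_diff \<phi> x z * frac_kernel s z\<bar> \<partial>lborel) \<le> ennreal B"
proof -
  obtain M C where M: "0 \<le> M" "\<And>x. \<bar>\<phi> x\<bar> \<le> M"
    and C: "0 \<le> C" "\<And>x z. \<bar>second_diff \<phi> x z\<bar> \<le> C * (norm z)\<^sup>2" using Cc_inftyD[OF \<phi>] by metis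
  have [measurable]: "\<phi> \<in> borel_measurable borel" by (rule Cc_infty_integrable(1)[OF \<phi>])
  define B where "B = C * (dim_omega TYPE('a) / DIM('a) * ((real DIM('a) + 2 * s) / (2 - 2 * s) + 1)) + 4 * M * (dim_omega TYPE('a) / (2 * s))"
  have "0 \<le> B" using C M s dim_omega_pos[where 'a = 'a] by (simp add: B_def)
  moreover have "(\<integral>\<^sup>+z. ennreal \<bar>second_diff \<phi> x z * frac_kernel s z\<bar> \<partial>lborel) \<le> ennreal B" for x
  proof -
    have "\<bar>second_diff \<phi> x z\<bar> \<le> 4 * M" for z using M(2)[of x] M(2)[of "x + z"] M(2)[of "x - z"] by linarith
    moreover have "(\<lambda>z. \<bar>second_diff \<phi> x z\<bar>) \<in> borel_measurable borel" by measurable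
    ultimately show ?thesis
      using frac_kernel_integral_bound[of "\<lambda>z. \<bar>second_diff \<phi> x z\<bar>" s C "4 * M"] s C by (simp add: abs_mult B_def)
  qed
  ultimately show thesis by (rule that)
qed

lemma frac_laplacian_bounded:
  fixes \<phi> :: "'a::euclidean_space \<Rightarrow> real"
  assumes \<phi>: "\<phi> \<in> Cc_infty \<Omega>" and s: "0 < s" "s < 1"
  obtains B where "0 \<le> B" "\<And>x. \<bar>frac_laplacian s \<phi> x\<bar> \<le> B"
proof -
  obtain B where B: "0 \<le> B" "\<And>x. (\<integral>\<^sup>+z. ennreal \<bar>second_diff \<phi> x z * frac_kernel s z\<bar> \<partial>lborel) \<le> ennreal B"
    by (rule second_diff_kernel_bound[OF assms]) blast
  have [measurable]: "\<phi> \<in> borel_measurable borel" by (rule Cc_infty_integrable(1)[OF \<phi>])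
  show thesis
  proof (rule that[OF B(1)])
    show "\<bar>frac_laplacian s \<phi> x\<bar> \<le> B" for x
      unfolding frac_laplacian_eq by (rule integral_bound_of_nn_integral(2)[OF _ B(2,1)]) measurable
  qed
qed

lemma kernel_outer_has_integral:
  fixes s :: real
  assumes s: "0 < s"
  shows "has_bochner_integral lborel (\<lambda>z::'a::euclidean_space. indicator {z. 1 \<le> norm z} z * frac_kernel s z) (dim_omega TYPE('a) / (2 * s))"
proof (rule has_bochner_integral_nn_integral)
  show "(\<integral>\<^sup>+(z::'a). ennreal (indicator {z. 1 \<le> norm z} z * frac_kernel s z) \<partial>lborel) = ennreal (dim_omega TYPE('a) / (2 * s))"
    using kernel_outer[of 1 s, where 'a = 'a] s
    by (subst ennreal_mult) (simp_all add: frac_kernel_def ennreal_indicator)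
qed (use s dim_omega_pos[where 'a = 'a] in auto)

text \<open>Near the origin the kernel is harmless as \<open>s \<rightarrow> 0\<close>; outside the unit ball it has total mass
  \<open>dim_omega / (2 s)\<close>, which is where the factor of the limit equation comes from.\<close>

lemma scaled_frac_laplacian_converges:
  fixes \<phi> :: "'a::euclidean_space \<Rightarrow> real"
  assumes \<phi>: "\<phi> \<in> Cc_infty \<Omega>"
  obtains B where "0 \<le> B" "\<And>s x. 0 < s \<Longrightarrow> s \<le> 1 / 2 \<Longrightarrow> \<bar>s * frac_laplacian s \<phi> x - dim_omega TYPE('a) * \<phi> x\<bar> \<le> s * B"
proof -
  obtain K M C where K: "compact K" "\<And>x. x \<notin> K \<Longrightarrow> \<phi> x = 0" and M: "0 \<le> M" "\<And>x. \<bar>\<phi> x\<bar> \<le> M"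
    and C: "0 \<le> C" "\<And>x z. \<bar>second_diff \<phi> x z\<bar> \<le> C * (norm z)\<^sup>2" using Cc_inftyD[OF \<phi>] by metis
  have [measurable]: "\<phi> \<in> borel_measurable borel" by (rule Cc_infty_integrable(1)[OF \<phi>])
  obtain R where R: "0 \<le> R" "\<And>x. x \<in> K \<Longrightarrow> norm x \<le> R"
    using compact_imp_bounded[OF K(1)] by (metis bounded_pos less_imp_le)
  note dp = dim_omega_pos[where 'a = 'a]
  define V where "V = unit_ball_vol DIM('a) * R ^ DIM('a)"
  have V0: "0 \<le> V" using R by (simp add: V_def)
  have V: "emeasure lborel (cball c R) = ennreal V" for c :: 'a using R by (simp add: V_def emeasure_cball)
  define D where "D = dim_omega TYPE('a) / DIM('a) * (DIM('a) + 2)"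
  have D0: "0 \<le> D" using dp by (simp add: D_def)
  define B where "B = C * D + (M * V + M * V)"
  have B0: "0 \<le> B" using C D0 M V0 by (simp add: B_def)
  have "\<bar>s * frac_laplacian s \<phi> x - dim_omega TYPE('a) * \<phi> x\<bar> \<le> s * B" if s: "0 < s" "s \<le> 1 / 2" for s x
  proof -
    \<comment> \<open>The removed term is the far part of \<open>2 * \<phi> x\<close>. Its integral,
      multiplied by \<open>s\<close>, is exactly \<open>dim_omega\<close> times
      \<open>\<phi> x\<close>, while the integral of \<open>q\<close> is bounded uniformly in
      \<open>x\<close> and in \<open>s \<le> 1 / 2\<close>.\<close>
    define q where "q z = second_diff \<phi> x z * frac_kernel s z - 2 * \<phi> x * (indicator {z. 1 \<le> norm z} z * frac_kernel s z)" for z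
    have qm: "q \<in> borel_measurable lborel" unfolding q_def by measurable
    \<comment> \<open>The shifted values live on balls of radius \<open>R\<close> around
      \<open>- x\<close> and \<open>x\<close>, whose volume does not depend on
      \<open>x\<close>.\<close>
    have ind: "\<bar>\<phi> (x + z)\<bar> \<le> M * indicator (cball (- x) R) z" "\<bar>\<phi> (x - z)\<bar> \<le> M * indicator (cball x R) z" for z
    proof -
      show "\<bar>\<phi> (x + z)\<bar> \<le> M * indicator (cball (- x) R) z"
        using R(2)[of "x + z"] M(2)[of "x + z"] K(2)[of "x + z"] M(1) norm_minus_commute[of "- x" z]
        by (cases "x + z \<in> K") (auto simp: indicator_def dist_norm algebra_simps)
      show "\<bar>\<phi> (x - z)\<bar> \<le> M * indicator (cball x R) z"
        using R(2)[of "x - z"] M(2)[of "x - z"] K(2)[of "x - z"] M(1)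
        by (cases "x - z \<in> K") (auto simp: indicator_def dist_norm)
    qed
    have q: "ennreal \<bar>q z\<bar> \<le> ennreal C * ((ennreal ((norm z)\<^sup>2) * indicator {z. norm z < 1} z) * ennreal (frac_kernel s z))
        + (ennreal M * indicator (cball (- x) R) z + ennreal M * indicator (cball x R) z)" for z
    proof (cases "norm z < 1")
      case True
      then have "\<bar>q z\<bar> \<le> C * (norm z)\<^sup>2 * frac_kernel s z"
        using C(2)[of x z] by (simp add: q_def abs_mult mult_right_mono)
      then have "ennreal \<bar>q z\<bar> \<le> ennreal C * ((ennreal ((norm z)\<^sup>2) * indicator {z. norm z < 1} z) * ennreal (frac_kernel s z))"
        using True C(1) by (simp add: ennreal_mult[symmetric] mult.assoc ennreal_leI)
      then show ?thesis by (simp add: add_increasing2)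
    next
      case False
      then have "q z = - ((\<phi> (x + z) + \<phi> (x - z)) * frac_kernel s z)" by (simp add: q_def algebra_simps)
      then have "\<bar>q z\<bar> = \<bar>\<phi> (x + z) + \<phi> (x - z)\<bar> * frac_kernel s z" by (simp only: abs_minus_cancel abs_mult) simp
      also have "\<dots> \<le> (\<bar>\<phi> (x + z)\<bar> + \<bar>\<phi> (x - z)\<bar>) * 1"
        using False s by (intro mult_mono frac_kernel_le_1) auto
      also have "\<dots> \<le> M * indicator (cball (- x) R) z + M * indicator (cball x R) z"
        using ind[of z] by simp
      finally have "ennreal \<bar>q z\<bar> \<le> ennreal (M * indicator (cball (- x) R) z + M * indicator (cball x R) z)" by (rule ennreal_leI)
      also have "\<dots> = ennreal M * indicator (cball (- x) R) z + ennreal M * indicator (cball x R) z"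
        using M(1) by (simp add: ennreal_plus ennreal_mult ennreal_indicator)
      finally show ?thesis by (simp add: add_increasing)
    qed
    have "(\<integral>\<^sup>+z. ennreal \<bar>q z\<bar> \<partial>lborel) \<le> (\<integral>\<^sup>+z. ennreal C * ((ennreal ((norm z)\<^sup>2) * indicator {z. norm z < 1} z) * ennreal (frac_kernel s z))
        + (ennreal M * indicator (cball (- x) R) z + ennreal M * indicator (cball x R) z) \<partial>lborel)"
      by (intro nn_integral_mono q)
    also have "\<dots> = ennreal C * (\<integral>\<^sup>+(z::'a). (ennreal ((norm z)\<^sup>2) * indicator {z. norm z < 1} z) * ennreal (frac_kernel s z) \<partial>lborel)
        + (ennreal M * emeasure lborel (cball (- x) R) + ennreal M * emeasure lborel (cball x R))"
    proof -
      have "(\<lambda>z::'a. ennreal M * indicator (cball c R) z) \<in> borel_measurable lborel" for c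
        by (intro borel_measurable_times_ennreal borel_measurable_const borel_measurable_indicator) simp
      then show ?thesis
        by (subst nn_integral_add; (subst nn_integral_add)?; (subst nn_integral_cmult)?) (auto simp: nn_integral_cmult_indicator)
    qed
    also have "\<dots> \<le> ennreal C * ennreal D + (ennreal M * ennreal V + ennreal M * ennreal V)"
      unfolding V
    proof (intro add_mono mult_left_mono order_refl)
      have "(\<integral>\<^sup>+(z::'a). (ennreal ((norm z)\<^sup>2) * indicator {z. norm z < 1} z) * ennreal (frac_kernel s z) \<partial>lborel)
        \<le> ennreal (dim_omega TYPE('a) / DIM('a) * ((DIM('a) + 2 * s) / (2 - 2 * s) + 1))"
        using kernel_inner[of s, where 'a = 'a] s by (simp add: frac_kernel_def)
      also have "\<dots> \<le> ennreal D"
      proof (rule ennreal_leI)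
        \<comment> \<open>The restriction \<open>s \<le> 1 / 2\<close> keeps
          \<open>2 - 2 * s\<close> at least 1 and \<open>2 * s\<close> at most 1.\<close>
        have "(DIM('a) + 2 * s) / (2 - 2 * s) \<le> (real DIM('a) + 1) / 1"
          using s by (intro frac_le) auto
        then show "dim_omega TYPE('a) / DIM('a) * ((DIM('a) + 2 * s) / (2 - 2 * s) + 1) \<le> D"
          unfolding D_def using dp by (intro mult_left_mono) auto
      qed
      finally show "(\<integral>\<^sup>+(z::'a). (ennreal ((norm z)\<^sup>2) * indicator {z. norm z < 1} z) * ennreal (frac_kernel s z) \<partial>lborel) \<le> ennreal D" .
    qed auto
    also have "\<dots> = ennreal B"
      unfolding B_def using C(1) D0 M(1) V0 by (simp only: ennreal_mult[symmetric] ennreal_plus[symmetric] mult_nonneg_nonneg add_nonneg_nonneg)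
    finally have bound: "(\<integral>\<^sup>+z. ennreal \<bar>q z\<bar> \<partial>lborel) \<le> ennreal B" .
    note qi = integral_bound_of_nn_integral[OF qm bound B0]
    note out = kernel_outer_has_integral[OF s(1), where 'a = 'a]
    have "frac_laplacian s \<phi> x = (LINT z|lborel. q z + 2 * \<phi> x * (indicator {z. 1 \<le> norm z} z * frac_kernel s z))"
      unfolding frac_laplacian_eq by (rule Bochner_Integration.integral_cong) (auto simp: q_def)
    also have "\<dots> = (LINT z|lborel. q z) + 2 * \<phi> x * (dim_omega TYPE('a) / (2 * s))"
      using qi(1) out by (subst Bochner_Integration.integral_add) (auto simp: has_bochner_integral_iff)
    finally have "s * frac_laplacian s \<phi> x - dim_omega TYPE('a) * \<phi> x = s * (LINT z|lborel. q z)"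
      using s by (simp add: algebra_simps)
    then show ?thesis using qi(2) s by (simp add: abs_mult)
  qed
  with B0 show thesis by (rule that)
qed

section \<open>Duality between the form and the fractional Laplacian\<close>

lemma sq_integrable_plus:
  fixes f :: "'a::euclidean_space \<Rightarrow> real"
  assumes "sq_integrable f"
  shows "sq_integrable (\<lambda>x. f (c + x))"
proof -
  have [measurable]: "f \<in> borel_measurable borel" and i: "integrable lborel (\<lambda>x. (f x)\<^sup>2)"
    using assms by (auto simp: sq_integrable_def)
  have "integrable lborel (\<lambda>x. (f (c + x))\<^sup>2)" using i lborel_integral_plus(2)[of "\<lambda>x. (f x)\<^sup>2" c] by simp
  then show ?thesis by (simp add: sq_integrable_def)
qed

text \<open>Summation by parts: in the half that contains \<open>f (x + z)\<close> the variable is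
  shifted by \<open>z\<close>, which turns the first difference of \<open>g\<close> into a second
  difference.\<close>

lemma integral_difference_product:
  fixes f g :: "'a::euclidean_space \<Rightarrow> real"
  assumes f: "sq_integrable f" and g: "sq_integrable g"
  shows "(LINT x|lborel. (f x - f (x + z)) * (g x - g (x + z))) = (LINT x|lborel. f x * second_diff g x z)"
proof -
  have [measurable]: "f \<in> borel_measurable borel" "g \<in> borel_measurable borel" using f g by (auto simp: sq_integrable_def)
  define h where "h x = f x * (g (x - z) - g x)" for x
  have gp: "sq_integrable (\<lambda>x. g (x + z))" "sq_integrable (\<lambda>x. g (x - z))"
    using sq_integrable_plus[OF g, of z] sq_integrable_plus[OF g, of "- z"] by (simp_all add: add.commute)
  have hi: "integrable lborel h" unfolding h_def by (intro sq_integrable_mult f sq_integrable_diff gp g)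
  have hm: "h \<in> borel_measurable borel" unfolding h_def by measurable
  have i1: "integrable lborel (\<lambda>x. f x * (g x - g (x + z)))" by (intro sq_integrable_mult f sq_integrable_diff gp g)
  have i2: "integrable lborel (\<lambda>x. h (z + x))" using hi lborel_integral_plus(2)[OF hm] by simp
  have "(LINT x|lborel. (f x - f (x + z)) * (g x - g (x + z))) = (LINT x|lborel. f x * (g x - g (x + z)) - h (z + x))"
    by (rule Bochner_Integration.integral_cong) (auto simp: h_def algebra_simps)
  also have "\<dots> = (LINT x|lborel. f x * (g x - g (x + z))) - (LINT x|lborel. h x)"
    using i1 i2 lborel_integral_plus(1)[OF hm] by simp
  also have "\<dots> = (LINT x|lborel. f x * (g x - g (x + z)) - h x)" using i1 hi by simp
  also have "\<dots> = (LINT x|lborel. f x * second_diff g x z)"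
    by (rule Bochner_Integration.integral_cong) (auto simp: h_def algebra_simps)
  finally show ?thesis .
qed

lemma L2_on_integrable:
  fixes \<Omega> :: "'a::euclidean_space set"
  assumes \<Omega>: "open \<Omega>" "bounded \<Omega>" and u: "u \<in> L2_on \<Omega>"
  shows "integrable lborel (rep_L2 u)"
proof (rule Bochner_Integration.integrable_bound)
  have "emeasure lborel \<Omega> < \<infinity>" using \<Omega>(2) emeasure_bounded_finite by blast
  then show "integrable lborel (\<lambda>x. indicator \<Omega> x + (rep_L2 u x)\<^sup>2)"
    using \<Omega> sq_integrable_rep_L2[of u] by (intro Bochner_Integration.integrable_add) (auto simp: sq_integrable_def)
  have "AE x in lborel. x \<notin> \<Omega> \<longrightarrow> rep_L2 u x = 0" using u by (simp add: L2_on_def)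
  then show "AE x in lborel. norm (rep_L2 u x) \<le> norm (indicator \<Omega> x + (rep_L2 u x)\<^sup>2)"
  proof eventually_elim
    case (elim x)
    have "0 \<le> (\<bar>rep_L2 u x\<bar> - 1/2)\<^sup>2" by simp
    then have "\<bar>rep_L2 u x\<bar> \<le> 1 + (rep_L2 u x)\<^sup>2" unfolding power2_diff by (simp add: power_one_over)
    then show ?case using elim by (auto simp: indicator_def)
  qed
qed simp

text \<open>In the variables \<open>x\<close> and \<open>z = y - x\<close> the integration over
  \<open>x\<close> comes first, so that for fixed \<open>z\<close> the difference can be moved from
  \<open>u\<close> to \<open>\<phi>\<close>. Absolute integrability is checked twice: before the
  shift it comes from a product of two square-integrable functions, after it from the second
  difference of \<open>\<phi>\<close> and the integrability of \<open>u\<close>. The conventions for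
  the form and for the Laplacian match without an extra factor.\<close>

lemma frac_op_inner_test:
  fixes \<Omega> :: "'a::euclidean_space set"
  assumes \<Omega>: "open \<Omega>" "bounded \<Omega>" and s: "0 < s" "s < 1" and u: "u \<in> L2_on \<Omega>" "u \<in> frac_dom s" and \<phi>: "\<phi> \<in> Cc_infty \<Omega>"
  shows "frac_op s u \<bullet> frac_op s (abs_L2 \<phi>) = s * frac_laplacian_dual \<Omega> s u \<phi>"
proof -
  define f where "f = rep_L2 u"
  have fm [measurable]: "f \<in> borel_measurable borel" by (simp add: f_def)
  have \<phi>m [measurable]: "\<phi> \<in> borel_measurable borel" by (rule Cc_infty_integrable(1)[OF \<phi>])
  have fs: "sq_integrable f" by (simp add: f_def sq_integrable_rep_L2)
  have \<phi>s: "sq_integrable \<phi>" by (rule Cc_infty_integrable(3)[OF \<phi>])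
  have fd: "sq_integrable (frac_diff s f)" unfolding f_def by (rule frac_dom_sq_integrable[OF s(1) u(2)])
  have \<phi>d: "sq_integrable (frac_diff s \<phi>)" by (rule frac_op_test(3)[OF s \<phi>])
  define F where "F x y = (f x - f y) * (\<phi> x - \<phi> y) * frac_kernel s (x - y)" for x y
  have FF: "frac_diff s f (x, y) * frac_diff s \<phi> (x, y) = s * F x y" for x y
  proof -
    define r where "r = norm (x - y) powr ((real DIM('a) + 2 * s) / 2)"
    have "r * r = norm (x - y) powr (real DIM('a) + 2 * s)" unfolding r_def by (simp flip: powr_add)
    moreover have "frac_diff s f (x, y) * frac_diff s \<phi> (x, y) = (sqrt s * sqrt s) * ((f x - f y) * (\<phi> x - \<phi> y)) / (r * r)"
      by (simp add: frac_diff_def r_def)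
    ultimately show ?thesis using s by (simp add: F_def frac_kernel_def)
  qed
  define G where "G x z = (f x - f (x + z)) * (\<phi> x - \<phi> (x + z)) * frac_kernel s z" for x z
  have FG: "F x (x + z) = G x z" for x z using frac_kernel_minus[of s z] by (simp add: F_def G_def)
  have int: "integrable lborel (\<lambda>p. s * F (fst p) (snd p))"
    using sq_integrable_mult[OF fd \<phi>d] by (simp add: FF[symmetric])
  then have int': "integrable (lborel \<Otimes>\<^sub>M lborel) (\<lambda>(x, y). F x y)"
    using s unfolding lborel_prod by (simp add: case_prod_beta')
  have Gm: "(\<lambda>(x, z). G x z) \<in> borel_measurable (lborel \<Otimes>\<^sub>M lborel)" unfolding G_def by measurable
  have Gint: "integrable (lborel \<Otimes>\<^sub>M lborel) (\<lambda>(x, z). G x z)"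
  proof (subst integrable_iff_bounded, intro conjI Gm)
    have "(\<integral>\<^sup>+p. ennreal (norm (case p of (x, z) \<Rightarrow> G x z)) \<partial>(lborel \<Otimes>\<^sub>M lborel))
      = (\<integral>\<^sup>+x. \<integral>\<^sup>+z. ennreal \<bar>G x z\<bar> \<partial>lborel \<partial>lborel)"
      using Gm by (subst lborel.nn_integral_fst[symmetric]) auto
    also have "\<dots> = (\<integral>\<^sup>+x. \<integral>\<^sup>+y. ennreal \<bar>F x y\<bar> \<partial>lborel \<partial>lborel)"
    proof (rule nn_integral_cong)
      fix x
      have [measurable]: "F x \<in> borel_measurable borel" unfolding F_def by measurable
      show "(\<integral>\<^sup>+z. ennreal \<bar>G x z\<bar> \<partial>lborel) = (\<integral>\<^sup>+y. ennreal \<bar>F x y\<bar> \<partial>lborel)"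
        using nn_integral_lborel_plus[of "\<lambda>y. ennreal \<bar>F x y\<bar>" x] by (simp add: FG)
    qed
    also have "\<dots> = (\<integral>\<^sup>+p. ennreal (norm (case p of (x, z) \<Rightarrow> F x z)) \<partial>(lborel \<Otimes>\<^sub>M lborel))"
      using borel_measurable_integrable[OF int'] by (subst lborel.nn_integral_fst[symmetric]) auto
    also have "\<dots> < \<infinity>" using int' by (simp add: integrable_iff_bounded)
    finally show "(\<integral>\<^sup>+p. ennreal (norm (case p of (x, z) \<Rightarrow> G x z)) \<partial>(lborel \<Otimes>\<^sub>M lborel)) < \<infinity>" .
  qed
  obtain B where B: "0 \<le> B" "\<And>x. (\<integral>\<^sup>+z. ennreal \<bar>second_diff \<phi> x z * frac_kernel s z\<bar> \<partial>lborel) \<le> ennreal B"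
    by (rule second_diff_kernel_bound[OF \<phi> s]) blast
  define H where "H x z = f x * (second_diff \<phi> x z * frac_kernel s z)" for x z
  have Hm: "(\<lambda>(x, z). H x z) \<in> borel_measurable (lborel \<Otimes>\<^sub>M lborel)" unfolding H_def by measurable
  have Hint: "integrable (lborel \<Otimes>\<^sub>M lborel) (\<lambda>(x, z). H x z)"
  proof (subst integrable_iff_bounded, intro conjI Hm)
    have "(\<integral>\<^sup>+p. ennreal (norm (case p of (x, z) \<Rightarrow> H x z)) \<partial>(lborel \<Otimes>\<^sub>M lborel))
      = (\<integral>\<^sup>+x. \<integral>\<^sup>+z. ennreal \<bar>H x z\<bar> \<partial>lborel \<partial>lborel)"
      using Hm by (subst lborel.nn_integral_fst[symmetric]) auto
    also have "\<dots> = (\<integral>\<^sup>+x. ennreal \<bar>f x\<bar> * (\<integral>\<^sup>+z. ennreal \<bar>second_diff \<phi> x z * frac_kernel s z\<bar> \<partial>lborel) \<partial>lborel)"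
      by (rule nn_integral_cong, subst nn_integral_cmult[symmetric]) (auto simp: H_def abs_mult ennreal_mult)
    also have "\<dots> \<le> (\<integral>\<^sup>+x. ennreal \<bar>f x\<bar> * ennreal B \<partial>lborel)"
      by (intro nn_integral_mono mult_left_mono B) auto
    also have "\<dots> = (\<integral>\<^sup>+x. ennreal \<bar>f x\<bar> \<partial>lborel) * ennreal B" by (rule nn_integral_multc) measurable
    also have "\<dots> < \<infinity>"
      using L2_on_integrable[OF \<Omega> u(1)] by (auto simp: integrable_iff_bounded f_def ennreal_mult_less_top)
    finally show "(\<integral>\<^sup>+p. ennreal (norm (case p of (x, z) \<Rightarrow> H x z)) \<partial>(lborel \<Otimes>\<^sub>M lborel)) < \<infinity>" .
  qed
  have "frac_op s u \<bullet> frac_op s (abs_L2 \<phi>) = (LINT p|lborel. frac_diff s f p * frac_diff s \<phi> p)"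
    unfolding frac_op_test(2)[OF s \<phi>] unfolding frac_op_def f_def[symmetric] by (rule inner_abs_L2[OF fd \<phi>d])
  also have "\<dots> = (LINT p|lborel. s * (case p of (x, y) \<Rightarrow> F x y))"
    by (rule Bochner_Integration.integral_cong) (auto simp: FF)
  also have "\<dots> = s * (LINT p|(lborel \<Otimes>\<^sub>M lborel). (case p of (x, y) \<Rightarrow> F x y))"
    unfolding lborel_prod by simp
  also have "(LINT p|(lborel \<Otimes>\<^sub>M lborel). (case p of (x, y) \<Rightarrow> F x y)) = (LINT x|lborel. LINT y|lborel. F x y)"
    using lborel_pair.integral_fst'[OF int'] by simp
  also have "\<dots> = (LINT x|lborel. LINT z|lborel. G x z)"
  proof (rule Bochner_Integration.integral_cong[OF refl])
    fix x
    have [measurable]: "F x \<in> borel_measurable borel" unfolding F_def by measurable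
    show "(LINT y|lborel. F x y) = (LINT z|lborel. G x z)"
      using lborel_integral_plus(1)[of "F x" x] by (simp add: FG)
  qed
  also have "\<dots> = (LINT z|lborel. LINT x|lborel. G x z)" by (rule lborel_pair.Fubini_integral[OF Gint, symmetric])
  also have "\<dots> = (LINT z|lborel. LINT x|lborel. H x z)"
  proof (rule Bochner_Integration.integral_cong[OF refl])
    fix z
    have "(LINT x|lborel. G x z) = (LINT x|lborel. (f x - f (x + z)) * (\<phi> x - \<phi> (x + z))) * frac_kernel s z"
      unfolding G_def by simp
    also have "\<dots> = (LINT x|lborel. H x z)"
      unfolding integral_difference_product[OF fs \<phi>s] H_def by (simp flip: mult.assoc)
    finally show "(LINT x|lborel. G x z) = (LINT x|lborel. H x z)" .
  qed
  also have "\<dots> = (LINT x|lborel. LINT z|lborel. H x z)" by (rule lborel_pair.Fubini_integral[OF Hint])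
  also have "\<dots> = (LINT x|lborel. f x * frac_laplacian s \<phi> x)"
    by (simp add: H_def frac_laplacian_eq)
  also have "\<dots> = (LINT x|lborel. indicator \<Omega> x *\<^sub>R (f x * frac_laplacian s \<phi> x))"
  proof (rule integral_cong_AE)
    have "AE x in lborel. x \<notin> \<Omega> \<longrightarrow> f x = 0" using u by (simp add: L2_on_def f_def)
    then show "AE x in lborel. f x * frac_laplacian s \<phi> x = indicator \<Omega> x *\<^sub>R (f x * frac_laplacian s \<phi> x)"
      by eventually_elim (auto simp: indicator_def)
    have [measurable]: "frac_laplacian s \<phi> \<in> borel_measurable borel" by (rule frac_laplacian_measurable) simp
    have [measurable]: "\<Omega> \<in> sets borel" using \<Omega> by simp
    show "(\<lambda>x. f x * frac_laplacian s \<phi> x) \<in> borel_measurable lborel" by measurable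
    show "(\<lambda>x. indicator \<Omega> x *\<^sub>R (f x * frac_laplacian s \<phi> x)) \<in> borel_measurable lborel" by measurable
  qed
  finally show ?thesis
    by (simp add: frac_laplacian_dual_def L2_pairing_def set_lebesgue_integral_def f_def)
qed

lemma L2_pairing_test:
  assumes \<phi>: "\<phi> \<in> Cc_infty \<Omega>"
  shows "L2_pairing \<Omega> u \<phi> = u \<bullet> abs_L2 \<phi>"
proof -
  obtain K where K: "K \<subseteq> \<Omega>" "\<And>x. x \<notin> K \<Longrightarrow> \<phi> x = 0" using Cc_inftyD[OF \<phi>] by metis
  have "u \<bullet> abs_L2 \<phi> = (LINT x|lborel. rep_L2 u x * \<phi> x)"
    using inner_abs_L2[OF sq_integrable_rep_L2[of u] Cc_infty_integrable(3)[OF \<phi>]] by (simp add: abs_rep_L2)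
  also have "(\<lambda>x. rep_L2 u x * \<phi> x) = (\<lambda>x. indicator \<Omega> x *\<^sub>R (rep_L2 u x * \<phi> x))"
    using K by (auto simp: indicator_def fun_eq_iff)
  finally show ?thesis by (simp add: L2_pairing_def set_lebesgue_integral_def)
qed

text \<open>The pairing sees only \<open>\<Omega>\<close>, so the scaled Laplacian may be cut off
  there. The finite measure of \<open>\<Omega>\<close> turns the uniform estimate into an
  \<open>L2\<close> estimate of order \<open>s\<close>, with \<open>g s\<close> independent of
  \<open>u\<close>.\<close>

lemma scaled_frac_laplacian_L2:
  fixes \<Omega> :: "'a::euclidean_space set"
  assumes \<Omega>: "open \<Omega>" "bounded \<Omega>" and \<phi>: "\<phi> \<in> Cc_infty \<Omega>"
  obtains g B where "\<And>s u. 0 < s \<Longrightarrow> s < 1 \<Longrightarrow> s * frac_laplacian_dual \<Omega> s u \<phi> = u \<bullet> g s"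
    "0 \<le> B" "\<And>s. 0 < s \<Longrightarrow> s \<le> 1 / 2 \<Longrightarrow> norm (g s - dim_omega TYPE('a) *\<^sub>R abs_L2 \<phi>) \<le> s * B"
proof -
  have [measurable]: "\<phi> \<in> borel_measurable borel" by (rule Cc_infty_integrable(1)[OF \<phi>])
  have [measurable]: "frac_laplacian s \<phi> \<in> borel_measurable borel" for s by (rule frac_laplacian_measurable) simp
  have [measurable]: "\<Omega> \<in> sets borel" using \<Omega> by simp
  have fin: "emeasure lborel \<Omega> < \<infinity>" using \<Omega>(2) emeasure_bounded_finite by blast
  define h where "h s x = indicator \<Omega> x * (s * frac_laplacian s \<phi> x)" for s x
  have sqi: "sq_integrable k" if [measurable]: "k \<in> borel_measurable borel" and k: "\<And>x. \<bar>k x\<bar> \<le> c * indicator \<Omega> x" for k :: "'a \<Rightarrow> real" and c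
  proof -
    have "integrable lborel (\<lambda>x. (k x)\<^sup>2)"
    proof (rule Bochner_Integration.integrable_bound)
      show "integrable lborel (\<lambda>x. c\<^sup>2 * indicator \<Omega> x)" using fin by simp
      show "AE x in lborel. norm ((k x)\<^sup>2) \<le> norm (c\<^sup>2 * indicator \<Omega> x)"
      proof (rule AE_I2)
        fix x show "norm ((k x)\<^sup>2) \<le> norm (c\<^sup>2 * indicator \<Omega> x)"
          using power_mono[OF k[of x] abs_ge_zero, of 2] by (cases "x \<in> \<Omega>") simp_all
      qed
    qed simp
    then show ?thesis by (simp add: sq_integrable_def)
  qed
  have hs: "sq_integrable (h s)" if s: "0 < s" "s < 1" for s
  proof -
    obtain B where B: "0 \<le> B" "\<And>x. \<bar>frac_laplacian s \<phi> x\<bar> \<le> B" by (rule frac_laplacian_bounded[OF \<phi> s]) blast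
    show ?thesis
    proof (rule sqi)
      show "h s \<in> borel_measurable borel" unfolding h_def by measurable
      show "\<bar>h s x\<bar> \<le> (s * B) * indicator \<Omega> x" for x
        using B s by (auto simp: h_def indicator_def abs_mult intro!: mult_left_mono)
    qed
  qed
  obtain B where B: "0 \<le> B" "\<And>s x. 0 < s \<Longrightarrow> s \<le> 1 / 2 \<Longrightarrow> \<bar>s * frac_laplacian s \<phi> x - dim_omega TYPE('a) * \<phi> x\<bar> \<le> s * B"
    by (rule scaled_frac_laplacian_converges[OF \<phi>]) blast
  show thesis
  proof (rule that[of "\<lambda>s. abs_L2 (h s)" "B * sqrt (measure lborel \<Omega>)"])
    show "s * frac_laplacian_dual \<Omega> s u \<phi> = u \<bullet> abs_L2 (h s)" if s: "0 < s" "s < 1" for s u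
    proof -
      have "u \<bullet> abs_L2 (h s) = (LINT x|lborel. rep_L2 u x * h s x)"
        using inner_abs_L2[OF sq_integrable_rep_L2[of u] hs[OF s]] by (simp add: abs_rep_L2)
      also have "\<dots> = (LINT x|lborel. s * (indicator \<Omega> x *\<^sub>R (rep_L2 u x * frac_laplacian s \<phi> x)))"
        by (rule Bochner_Integration.integral_cong) (auto simp: h_def)
      finally show ?thesis
        by (simp add: frac_laplacian_dual_def L2_pairing_def set_lebesgue_integral_def)
    qed
    show "norm (abs_L2 (h s) - dim_omega TYPE('a) *\<^sub>R abs_L2 \<phi>) \<le> s * (B * sqrt (measure lborel \<Omega>))" if s: "0 < s" "s \<le> 1 / 2" for s
    proof -
      obtain K where K: "K \<subseteq> \<Omega>" "\<And>x. x \<notin> K \<Longrightarrow> \<phi> x = 0" using Cc_inftyD[OF \<phi>] by metis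
      have s1: "s < 1" using s by simp
      note \<phi>s = Cc_infty_integrable(3)[OF \<phi>]
      define k where "k x = h s x - dim_omega TYPE('a) * \<phi> x" for x
      have kb: "\<bar>k x\<bar> \<le> (s * B) * indicator \<Omega> x" for x
        using B(2)[OF s, of x] K by (auto simp: k_def h_def indicator_def)
      have "(norm (abs_L2 (h s) - dim_omega TYPE('a) *\<^sub>R abs_L2 \<phi>))\<^sup>2 = (LINT x|lborel. (k x)\<^sup>2)"
        unfolding k_def abs_L2_scale[OF \<phi>s] abs_L2_diff[OF hs[OF s(1) s1] sq_integrable_scale[OF \<phi>s]]
        by (rule norm_abs_L2[OF sq_integrable_diff[OF hs[OF s(1) s1] sq_integrable_scale[OF \<phi>s]]])
      also have "\<dots> \<le> (LINT x|lborel. (s * B)\<^sup>2 * indicator \<Omega> x)"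
      proof (rule integral_mono)
        show "integrable lborel (\<lambda>x. (k x)\<^sup>2)"
          using sq_integrable_diff[OF hs[OF s(1) s1] sq_integrable_scale[OF \<phi>s]] by (simp add: sq_integrable_def k_def)
        show "integrable lborel (\<lambda>x. (s * B)\<^sup>2 * indicator \<Omega> x)" using fin by simp
        show "(k x)\<^sup>2 \<le> (s * B)\<^sup>2 * indicator \<Omega> x" for x
          using power_mono[OF kb[of x] abs_ge_zero, of 2] by (cases "x \<in> \<Omega>") simp_all
      qed
      also have "\<dots> = (s * (B * sqrt (measure lborel \<Omega>)))\<^sup>2" using fin by (simp add: power_mult_distrib)
      finally show ?thesis using s B(1) by (auto intro: power2_le_imp_le)
    qed
  qed (use B in auto)
qed

section \<open>Regularity and uniqueness of the flow\<close>

text \<open>The expansion from \<open>t\<close> to \<open>t + h\<close> and the one from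
  \<open>t + h\<close> back to \<open>t\<close> add up to
  \<open>h *\<^sub>R (v (t + h) - v t)\<close>. For \<open>\<bar>h\<bar> < t / 4\<close> both are
  admissible and start at times at least \<open>t / 2\<close>, where the constant is
  bounded.\<close>

lemma taylor_velocity_continuous:
  fixes u v :: "real \<Rightarrow> 'b::real_normed_vector"
  assumes taylor: "\<And>t h. 0 < t \<Longrightarrow> \<bar>h\<bar> \<le> t / 2 \<Longrightarrow> norm (u (t + h) - u t - h *\<^sub>R v t) \<le> h\<^sup>2 * sqrt (27 * E / t ^ 3)"
    and E: "0 \<le> E"
  shows "continuous_on {0<..} v"
proof (rule continuous_at_imp_continuous_on, rule ballI)
  fix t :: real assume "t \<in> {0<..}"
  then have t: "0 < t" by simp
  define M where "M = 2 * sqrt (27 * E / (t / 2) ^ 3)"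
  have bound: "norm (v (t + h) - v t) \<le> \<bar>h\<bar> * M" if h: "\<bar>h\<bar> < t / 4" for h
  proof (cases "h = 0")
    case False
    have r: "t / 2 \<le> t + h" "0 < t + h" using h t by auto
    have a: "norm (u (t + h) - u t - h *\<^sub>R v t) \<le> h\<^sup>2 * (M / 2)"
    proof -
      have "sqrt (27 * E / t ^ 3) \<le> M / 2"
        unfolding M_def using t E by (auto intro!: real_sqrt_le_mono divide_left_mono power_mono)
      then have "h\<^sup>2 * sqrt (27 * E / t ^ 3) \<le> h\<^sup>2 * (M / 2)" by (intro mult_left_mono) auto
      moreover have "norm (u (t + h) - u t - h *\<^sub>R v t) \<le> h\<^sup>2 * sqrt (27 * E / t ^ 3)"
        by (rule taylor) (use h t in auto)
      ultimately show ?thesis by simp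
    qed
    have b: "norm (u t - u (t + h) - (- h) *\<^sub>R v (t + h)) \<le> h\<^sup>2 * (M / 2)"
    proof -
      have "sqrt (27 * E / (t + h) ^ 3) \<le> M / 2"
        unfolding M_def using t E r by (auto intro!: real_sqrt_le_mono divide_left_mono power_mono)
      then have "h\<^sup>2 * sqrt (27 * E / (t + h) ^ 3) \<le> h\<^sup>2 * (M / 2)" by (intro mult_left_mono) auto
      moreover have "norm (u (t + h + (- h)) - u (t + h) - (- h) *\<^sub>R v (t + h)) \<le> (- h)\<^sup>2 * sqrt (27 * E / (t + h) ^ 3)"
        by (rule taylor) (use r h in auto)
      ultimately show ?thesis by simp
    qed
    have "h *\<^sub>R (v (t + h) - v t) = (u (t + h) - u t - h *\<^sub>R v t) + (u t - u (t + h) - (- h) *\<^sub>R v (t + h))"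
      by (simp add: algebra_simps)
    then have "\<bar>h\<bar> * norm (v (t + h) - v t) \<le> h\<^sup>2 * (M / 2) + h\<^sup>2 * (M / 2)"
      using norm_triangle_mono[OF a b] by (metis norm_scaleR)
    also have "\<dots> = \<bar>h\<bar> * (\<bar>h\<bar> * M)" by (simp add: power2_eq_square flip: abs_mult)
    finally show ?thesis using False by simp
  qed simp
  have "((\<lambda>h. v (t + h) - v t) \<longlongrightarrow> 0) (at 0)"
  proof (rule Lim_null_comparison)
    show "\<forall>\<^sub>F h in at 0. norm (v (t + h) - v t) \<le> \<bar>h\<bar> * M"
      unfolding eventually_at using bound t by (intro exI[of _ "t / 4"]) (auto simp: dist_real_def)
    have "((\<lambda>h::real. \<bar>h\<bar> * M) \<longlongrightarrow> \<bar>0\<bar> * M) (at 0)" by (intro tendsto_intros)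
    then show "((\<lambda>h::real. \<bar>h\<bar> * M) \<longlongrightarrow> 0) (at 0)" by simp
  qed
  then have "((\<lambda>h. v (t + h)) \<longlongrightarrow> v t) (at 0)" by (simp add: LIM_zero_iff)
  then show "isCont v t" unfolding isCont_def by (rule LIM_offset_zero_cancel)
qed

text \<open>The velocity is controlled at positive times only. Interior points of \<open>I\<close>
  are positive and time 0 is a null set, so this is enough for a weak derivative.\<close>

lemma regular_path_H1:
  fixes u v :: "real \<Rightarrow> 'b::{real_inner, banach, second_countable_topology}"
  assumes I: "I \<subseteq> {0..}" "I \<in> sets borel"
    and u: "continuous_on {0..} u" "\<And>t. 0 \<le> t \<Longrightarrow> u t \<in> X" "set_integrable lborel I (\<lambda>t. (norm (u t))\<^sup>2)"
    and v: "continuous_on {0<..} v" "\<And>t. 0 < t \<Longrightarrow> v t \<in> X" "set_integrable lborel I (\<lambda>t. (norm (v t))\<^sup>2)"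
    and der: "\<And>t. 0 < t \<Longrightarrow> (u has_vector_derivative v t) (at t)"
  shows "u \<in> H1_time I X" "v \<in> L2_time I X" "u \<in> L2_time I X" "weak_deriv I u v"
proof -
  have int: "interior I \<subseteq> {0<..}"
    using interior_mono[OF I(1)] by simp
  have um: "(\<lambda>t. indicator I t *\<^sub>R u t) \<in> borel_measurable borel"
  proof -
    have "(\<lambda>t. indicator {0..} t *\<^sub>R u t) \<in> borel_measurable borel"
      by (rule borel_measurable_continuous_on_indicator[OF _ u(1)]) simp
    then have "(\<lambda>t. (indicator I t :: real) *\<^sub>R (indicator {0..} t *\<^sub>R u t)) \<in> borel_measurable borel" using I(2) by measurable
    also have "(\<lambda>t. (indicator I t :: real) *\<^sub>R (indicator {0..} t *\<^sub>R u t)) = (\<lambda>t. indicator I t *\<^sub>R u t)"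
      using I(1) by (auto simp: indicator_def fun_eq_iff)
    finally show ?thesis .
  qed
  have vm: "(\<lambda>t. indicator I t *\<^sub>R v t) \<in> borel_measurable borel"
  proof -
    have "(\<lambda>t. indicator {0<..} t *\<^sub>R v t) \<in> borel_measurable borel"
      by (rule borel_measurable_continuous_on_indicator[OF _ v(1)]) simp
    \<comment> \<open>The extra summand restores the value at time 0, which is arbitrary and which
      \<open>I\<close> may contain.\<close>
    then have "(\<lambda>t. (indicator I t :: real) *\<^sub>R (indicator {0<..} t *\<^sub>R v t) + (if t = 0 then indicator I 0 *\<^sub>R v 0 else 0)) \<in> borel_measurable borel"
      using I(2) by measurable
    also have "(\<lambda>t. (indicator I t :: real) *\<^sub>R (indicator {0<..} t *\<^sub>R v t) + (if t = 0 then indicator I 0 *\<^sub>R v 0 else 0)) = (\<lambda>t. indicator I t *\<^sub>R v t)"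
      using I(1) by (auto simp: indicator_def fun_eq_iff)
    finally show ?thesis .
  qed
  show uL: "u \<in> L2_time I X"
    using um u(2,3) I(1) by (auto simp: L2_time_def set_borel_measurable_def)
  have "AE t in lborel. t \<in> I \<longrightarrow> v t \<in> X"
    using AE_lborel_singleton[of 0] by eventually_elim (use I(1) v(2) in \<open>auto simp: less_le\<close>)
  then show vL: "v \<in> L2_time I X"
    using vm v(3) by (auto simp: L2_time_def set_borel_measurable_def)
  show w: "weak_deriv I u v"
    by (rule deriv_imp_weak_deriv) (use der int v(1) continuous_on_subset in auto)
  show "u \<in> H1_time I X"
    using uL vL w u(1,2) I(1) by (auto simp: H1_time_def intro: continuous_on_subset)
qed

lemma set_integrable_norm_sq_bounded:
  fixes u :: "real \<Rightarrow> 'b::real_normed_vector"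
  assumes u: "continuous_on {0..} u" and b: "\<And>t. 0 \<le> t \<Longrightarrow> (norm (u t))\<^sup>2 \<le> K * exp (- a * t)" and a: "0 < a"
  shows "set_integrable lborel {0..} (\<lambda>t. (norm (u t))\<^sup>2)"
  unfolding set_integrable_def
proof (rule integrableI_bounded)
  show "(\<lambda>t. indicator {0..} t *\<^sub>R (norm (u t))\<^sup>2) \<in> borel_measurable lborel"
    using borel_measurable_continuous_on_indicator[of "{0..}" "\<lambda>t. (norm (u t))\<^sup>2"] u by (simp add: continuous_intros)
  have K: "0 \<le> K" using order_trans[OF zero_le_power2 b[of 0]] by simp
  have "(\<integral>\<^sup>+t. ennreal (norm (indicator {0..} t *\<^sub>R (norm (u t))\<^sup>2)) \<partial>lborel)
    \<le> (\<integral>\<^sup>+t. ennreal (K * exp (- a * t)) * indicator {0..} t \<partial>lborel)"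
    by (rule nn_integral_mono) (use b in \<open>auto simp: indicator_def intro!: ennreal_leI\<close>)
  also have "\<dots> = ennreal (K * (exp (- a * 0) / a))"
    by (rule nn_integral_has_integral_lebesgue')
      (use K has_integral_mult_right[OF has_integral_exp_minus_to_infinity[OF a], of K 0] in auto)
  finally show "(\<integral>\<^sup>+t. ennreal (norm (indicator {0..} t *\<^sub>R (norm (u t))\<^sup>2)) \<partial>lborel) < \<infinity>"
    by (auto intro: le_less_trans)
qed

lemma norm_sq_deriv:
  fixes u :: "real \<Rightarrow> 'b::real_inner"
  assumes "(u has_vector_derivative v) (at t)"
  shows "((\<lambda>t. (norm (u t))\<^sup>2) has_real_derivative 2 * (v \<bullet> u t)) (at t)"
proof -
  have d: "(u has_derivative (\<lambda>h. h *\<^sub>R v)) (at t)" using assms by (simp add: has_vector_derivative_def)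
  have "((\<lambda>t. u t \<bullet> u t) has_derivative (\<lambda>h. u t \<bullet> (h *\<^sub>R v) + (h *\<^sub>R v) \<bullet> u t)) (at t)"
    by (rule has_derivative_inner[OF d d])
  moreover have "(\<lambda>h. u t \<bullet> (h *\<^sub>R v) + (h *\<^sub>R v) \<bullet> u t) = (*) (2 * (v \<bullet> u t))"
    by (auto simp: inner_commute)
  ultimately show ?thesis by (simp add: has_field_derivative_def power2_norm_eq_inner)
qed

text \<open>The assumptions on \<open>u\<close> and \<open>v\<close> are the conclusions of \<open>gradient_flow_exists\<close>.\<close>

locale regular_flow = closed_operator V T for V :: "'b::{real_inner, banach, second_countable_topology} set"
    and T :: "'b \<Rightarrow> 'c::{real_inner, banach}" +
  fixes X :: "'b set" and c :: real and x :: 'b and u v :: "real \<Rightarrow> 'b"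
  assumes V_sub: "V \<subseteq> X"
    and X_diff: "\<And>a b. a \<in> X \<Longrightarrow> b \<in> X \<Longrightarrow> a - b \<in> X"
    and X_scale: "\<And>r a. a \<in> X \<Longrightarrow> r *\<^sub>R a \<in> X"
    and X_closed: "\<And>(S :: nat \<Rightarrow> 'b) l. (\<And>k. S k \<in> X) \<Longrightarrow> S \<longlonglongrightarrow> l \<Longrightarrow> l \<in> X"
    and c_pos: "0 < c" and coercive: "\<And>y. y \<in> V \<Longrightarrow> c * (norm y)\<^sup>2 \<le> (norm (T y))\<^sup>2"
    and initial: "u 0 = x" and continuous: "continuous_on {0..} u" and in_V: "\<And>t. 0 \<le> t \<Longrightarrow> u t \<in> V"
    and equation: "\<And>t y. 0 < t \<Longrightarrow> y \<in> V \<Longrightarrow> v t \<bullet> y = - (T (u t) \<bullet> T y)"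
    and taylor: "\<And>t h. 0 < t \<Longrightarrow> \<bar>h\<bar> \<le> t / 2 \<Longrightarrow>
      norm (u (t + h) - u t - h *\<^sub>R v t) \<le> h\<^sup>2 * sqrt (27 * (norm (T x))\<^sup>2 / t ^ 3)"
    and speed: "\<And>t. 0 < t \<Longrightarrow> (norm (v t))\<^sup>2 \<le> (norm (T x))\<^sup>2 / (2 * t)"
    and energy: "\<And>t. 0 < t \<Longrightarrow> (\<integral>\<^sup>+r. ennreal ((norm (v r))\<^sup>2) * indicator {0<..t} r \<partial>lborel)
      + ennreal ((norm (T (u t)))\<^sup>2 / 2) \<le> ennreal ((norm (T x))\<^sup>2 / 2)"
begin

lemma velocity_continuous: "continuous_on {0<..} v"
  by (rule taylor_velocity_continuous[OF taylor]) auto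

lemma deriv: "0 < t \<Longrightarrow> (u has_vector_derivative v t) (at t)"
  by (rule taylor_has_vector_derivative[OF _ taylor])

text \<open>The difference quotients belong to \<open>X\<close>, and \<open>X\<close> is closed
  under limits.\<close>

lemma velocity_in:
  assumes t: "0 < t"
  shows "v t \<in> X"
proof (rule X_closed)
  define h where "h k = t / (2 * real (Suc k))" for k
  have h: "0 < h k" "\<bar>h k\<bar> \<le> t / 2" for k
    using t by (auto simp: h_def field_simps)
  show "(1 / h k) *\<^sub>R (u (t + h k) - u t) \<in> X" for k
    using in_V[of "t + h k"] in_V[of t] t h(1)[of k] V_sub by (intro X_scale X_diff) auto
  define M where "M = sqrt (27 * (norm (T x))\<^sup>2 / t ^ 3)"
  have nb: "norm ((1 / h k) *\<^sub>R (u (t + h k) - u t) - v t) \<le> h k * M" for k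
  proof -
    have "(1 / h k) *\<^sub>R (u (t + h k) - u t) - v t = (1 / h k) *\<^sub>R (u (t + h k) - u t - h k *\<^sub>R v t)"
      using h(1)[of k] by (simp add: scaleR_right_diff_distrib)
    then have "norm ((1 / h k) *\<^sub>R (u (t + h k) - u t) - v t) = (1 / h k) * norm (u (t + h k) - u t - h k *\<^sub>R v t)"
      using h(1)[of k] by simp
    also have "\<dots> \<le> (1 / h k) * ((h k)\<^sup>2 * M)"
      unfolding M_def using taylor[OF t h(2)[of k]] h(1)[of k] by (intro mult_left_mono) auto
    also have "\<dots> = h k * M" using h(1)[of k] by (simp add: power2_eq_square)
    finally show ?thesis .
  qed
  have hl: "(\<lambda>k. h k * M) \<longlonglongrightarrow> 0"
  proof -
    have "(\<lambda>k. t / 2 * (1 / real (Suc k)) * M) \<longlonglongrightarrow> t / 2 * 0 * M"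
      by (intro tendsto_intros LIMSEQ_Suc[OF lim_1_over_n])
    then show ?thesis by (simp add: h_def field_simps)
  qed
  have "(\<lambda>k. (1 / h k) *\<^sub>R (u (t + h k) - u t) - v t) \<longlonglongrightarrow> 0"
    by (rule Lim_null_comparison[OF always_eventually hl]) (rule allI, rule nb)
  then show "(\<lambda>k. (1 / h k) *\<^sub>R (u (t + h k) - u t)) \<longlonglongrightarrow> v t" by (simp add: LIM_zero_iff)
qed

text \<open>Coercivity gives \<open>exp (2 * c * t) * (norm (u t))^2\<close> a nonpositive
  derivative. The exponential decay is what puts the path into \<open>L2\<close> over the unbounded
  half-line.\<close>

lemma decay:
  assumes t: "0 \<le> t"
  shows "(norm (u t))\<^sup>2 \<le> (norm x)\<^sup>2 * exp (- (2 * c) * t)"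
proof (cases "t = 0")
  case False
  define f where "f t = exp (2 * c * t) * (norm (u t))\<^sup>2" for t
  have "f t \<le> f 0"
  proof (rule DERIV_nonpos_imp_decreasing_open[of 0 t])
    show "continuous_on {0..t} f" unfolding f_def
      by (intro continuous_intros continuous_on_subset[OF continuous]) auto
    fix r assume r: "0 < r" "r < t"
    have "(f has_real_derivative exp (2 * c * r) * (2 * (v r \<bullet> u r)) + (exp (2 * c * r) * (2 * c)) * (norm (u r))\<^sup>2) (at r)"
      unfolding f_def by (rule DERIV_mult'[OF _ norm_sq_deriv[OF deriv[OF r(1)]]]) (auto intro!: derivative_eq_intros)
    moreover have "exp (2 * c * r) * (2 * (v r \<bullet> u r)) + (exp (2 * c * r) * (2 * c)) * (norm (u r))\<^sup>2
        = 2 * exp (2 * c * r) * (c * (norm (u r))\<^sup>2 - (norm (T (u r)))\<^sup>2)"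
      using equation[OF r(1), of "u r"] in_V[of r] r by (simp add: power2_norm_eq_inner algebra_simps)
    moreover have "\<dots> \<le> 0"
      using coercive[of "u r"] in_V[of r] r by (intro mult_nonneg_nonpos) auto
    ultimately show "\<exists>y. (f has_real_derivative y) (at r) \<and> y \<le> 0" by auto
  qed (use t False in auto)
  then have "exp (2 * c * t) * (norm (u t))\<^sup>2 \<le> (norm x)\<^sup>2" by (simp add: f_def initial)
  then have "exp (- (2 * c) * t) * (exp (2 * c * t) * (norm (u t))\<^sup>2) \<le> exp (- (2 * c) * t) * (norm x)\<^sup>2"
    by (intro mult_left_mono) auto
  also have "exp (- (2 * c) * t) * (exp (2 * c * t) * (norm (u t))\<^sup>2) = (norm (u t))\<^sup>2"
    by (simp only: mult.assoc[symmetric] exp_add[symmetric]) simp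
  finally show ?thesis by (simp only: mult.commute)
qed (simp add: initial)

lemma norm_le_initial: "0 \<le> t \<Longrightarrow> norm (u t) \<le> norm x"
proof -
  assume t: "0 \<le> t"
  have "(norm (u t))\<^sup>2 \<le> (norm x)\<^sup>2 * exp (- (2 * c) * t)" by (rule decay[OF t])
  also have "\<dots> \<le> (norm x)\<^sup>2 * 1" using c_pos t by (intro mult_left_mono) auto
  finally show ?thesis by (auto intro: power2_le_imp_le)
qed

lemma velocity_measurable: "(\<lambda>t. indicator {0<..} t *\<^sub>R v t) \<in> borel_measurable borel"
  by (rule borel_measurable_continuous_on_indicator[OF _ velocity_continuous]) simp

text \<open>The energy inequality covers bounded intervals; monotone convergence exhausts the
  half-line.\<close>

lemma velocity_nn_integral_le:
  "(\<integral>\<^sup>+r. ennreal ((norm (v r))\<^sup>2) * indicator {0<..} r \<partial>lborel) \<le> ennreal ((norm (T x))\<^sup>2 / 2)"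
proof -
  define f where "f n r = ennreal ((norm (indicator {0<..} r *\<^sub>R v r))\<^sup>2) * indicator {0<..real (Suc n)} r" for n r
  have fm: "f n \<in> borel_measurable lborel" for n
    unfolding f_def using velocity_measurable by measurable
  have "(\<integral>\<^sup>+r. ennreal ((norm (v r))\<^sup>2) * indicator {0<..} r \<partial>lborel) \<le> (\<integral>\<^sup>+r. (SUP n. f n r) \<partial>lborel)"
  proof (rule nn_integral_mono)
    fix r :: real
    show "ennreal ((norm (v r))\<^sup>2) * indicator {0<..} r \<le> (SUP n. f n r)"
    proof (cases "0 < r")
      case True
      obtain n where n: "r < real n" using reals_Archimedean2 by blast
      then have "ennreal ((norm (v r))\<^sup>2) * indicator {0<..} r = f n r" using True by (simp add: f_def)
      then show ?thesis using SUP_upper[of n UNIV "\<lambda>n. f n r"] by simp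
    qed simp
  qed
  also have "\<dots> = (SUP n. \<integral>\<^sup>+r. f n r \<partial>lborel)"
    by (rule nn_integral_monotone_convergence_SUP[OF _ fm])
      (auto simp: incseq_def le_fun_def f_def indicator_def)
  also have "\<dots> \<le> ennreal ((norm (T x))\<^sup>2 / 2)"
  proof (rule SUP_least)
    fix n
    have "(\<integral>\<^sup>+r. f n r \<partial>lborel) = (\<integral>\<^sup>+r. ennreal ((norm (v r))\<^sup>2) * indicator {0<..real (Suc n)} r \<partial>lborel)"
      by (rule nn_integral_cong) (auto simp: f_def indicator_def)
    also have "\<dots> \<le> \<dots> + ennreal ((norm (T (u (real (Suc n)))))\<^sup>2 / 2)" by simp
    also have "\<dots> \<le> ennreal ((norm (T x))\<^sup>2 / 2)" by (rule energy) simp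
    finally show "(\<integral>\<^sup>+r. f n r \<partial>lborel) \<le> ennreal ((norm (T x))\<^sup>2 / 2)" .
  qed
  finally show ?thesis .
qed

lemma velocity_integrable: "set_integrable lborel {0..} (\<lambda>t. (norm (v t))\<^sup>2)"
proof -
  have "integrable lborel (\<lambda>t. indicator {0<..} t *\<^sub>R (norm (v t))\<^sup>2)"
  proof (rule integrableI_bounded)
    have "(\<lambda>t. (norm (indicator {0<..} t *\<^sub>R v t))\<^sup>2) \<in> borel_measurable lborel"
      using velocity_measurable by measurable
    also have "(\<lambda>t. (norm (indicator {0<..} t *\<^sub>R v t))\<^sup>2) = (\<lambda>t. indicator {0<..} t *\<^sub>R (norm (v t))\<^sup>2)"
      by (auto simp: indicator_def)
    finally show "(\<lambda>t. indicator {0<..} t *\<^sub>R (norm (v t))\<^sup>2) \<in> borel_measurable lborel" .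
    have "(\<integral>\<^sup>+t. ennreal (norm (indicator {0<..} t *\<^sub>R (norm (v t))\<^sup>2)) \<partial>lborel)
      = (\<integral>\<^sup>+r. ennreal ((norm (v r))\<^sup>2) * indicator {0<..} r \<partial>lborel)"
      by (rule nn_integral_cong) (auto simp: indicator_def)
    also have "\<dots> < \<infinity>" using velocity_nn_integral_le by (auto intro: le_less_trans)
    finally show "(\<integral>\<^sup>+t. ennreal (norm (indicator {0<..} t *\<^sub>R (norm (v t))\<^sup>2)) \<partial>lborel) < \<infinity>" .
  qed
  then have "integrable lborel (\<lambda>t. indicator {0<..} t *\<^sub>R (norm (v t))\<^sup>2 + indicator {0} t *\<^sub>R (norm (v 0))\<^sup>2)"
    by (rule Bochner_Integration.integrable_add) (simp add: emeasure_lborel_singleton)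
  also have "(\<lambda>t. indicator {0<..} t *\<^sub>R (norm (v t))\<^sup>2 + indicator {0} t *\<^sub>R (norm (v 0))\<^sup>2) = (\<lambda>t. indicator {0..} t *\<^sub>R (norm (v t))\<^sup>2)"
    by (auto simp: indicator_def fun_eq_iff)
  finally show ?thesis by (simp add: set_integrable_def)
qed

text \<open>A general \<open>I\<close> is kept because the fractional problem is posed on the
  half-line while convergence is stated on bounded intervals.\<close>

lemma H1:
  assumes I: "I \<subseteq> {0..}" "I \<in> sets borel"
  shows "u \<in> H1_time I X" "v \<in> L2_time I X" "u \<in> L2_time I X" "weak_deriv I u v"
proof -
  have "set_integrable lborel {0..} (\<lambda>t. (norm (u t))\<^sup>2)"
    by (rule set_integrable_norm_sq_bounded[OF continuous decay]) (use c_pos in auto)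
  then have iu: "set_integrable lborel I (\<lambda>t. (norm (u t))\<^sup>2)" by (rule set_integrable_subset) (use I in auto)
  have iv: "set_integrable lborel I (\<lambda>t. (norm (v t))\<^sup>2)"
    by (rule set_integrable_subset[OF velocity_integrable]) (use I in auto)
  have inX: "u t \<in> X" if "0 \<le> t" for t using in_V[OF that] V_sub by blast
  note H1 = regular_path_H1[OF I continuous inX iu velocity_continuous velocity_in iv deriv]
  show "u \<in> H1_time I X" by (rule H1(1))
  show "v \<in> L2_time I X" by (rule H1(2))
  show "u \<in> L2_time I X" by (rule H1(3))
  show "weak_deriv I u v" by (rule H1(4))
qed

lemma velocity_integral_Ioc:
  assumes t: "0 < t"
  shows "(LINT r:{0<..t}|lborel. (norm (v r))\<^sup>2) \<le> ((norm (T x))\<^sup>2 - (norm (T (u t)))\<^sup>2) / 2"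
proof -
  have i: "integrable lborel (\<lambda>r. indicator {0<..t} r *\<^sub>R (norm (v r))\<^sup>2)"
    unfolding set_integrable_def[symmetric] by (rule set_integrable_subset[OF velocity_integrable]) auto
  define A where "A = (LINT r:{0<..t}|lborel. (norm (v r))\<^sup>2)"
  have A0: "0 \<le> A" unfolding A_def set_lebesgue_integral_def by (rule integral_nonneg_AE) auto
  have "ennreal A = (\<integral>\<^sup>+r. ennreal (indicator {0<..t} r *\<^sub>R (norm (v r))\<^sup>2) \<partial>lborel)"
    unfolding A_def set_lebesgue_integral_def by (rule nn_integral_eq_integral[OF i, symmetric]) auto
  also have "\<dots> = (\<integral>\<^sup>+r. ennreal ((norm (v r))\<^sup>2) * indicator {0<..t} r \<partial>lborel)"
    by (rule nn_integral_cong) (auto simp: indicator_def)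
  finally have "ennreal A + ennreal ((norm (T (u t)))\<^sup>2 / 2) \<le> ennreal ((norm (T x))\<^sup>2 / 2)"
    using energy[OF t] by simp
  then have "A + (norm (T (u t)))\<^sup>2 / 2 \<le> (norm (T x))\<^sup>2 / 2"
    using A0 by (simp add: ennreal_plus[symmetric] ennreal_le_iff del: ennreal_plus)
  then show ?thesis by (simp add: A_def diff_divide_distrib)
qed

end

section \<open>The fractional flow: equation, uniqueness and comparison\<close>

lemma H0s_subset:
  assumes "0 < s" "s < 1"
  shows "H0s s \<Omega> \<subseteq> L2_on \<Omega>" "H0s s \<Omega> \<subseteq> frac_dom s"
  using H0s_iff[OF assms] by blast+

lemma test_in_H0s:
  assumes s: "0 < s" "s < 1" and \<phi>: "\<phi> \<in> Cc_infty \<Omega>"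
  shows "abs_L2 \<phi> \<in> H0s s \<Omega>"
  unfolding H0s_iff[OF s]
  using test_in_L2_on[OF \<phi>] frac_op_test(1)[OF s \<phi>] \<phi> by (auto intro!: exI[of _ "\<lambda>_. \<phi>"])

text \<open>Membership in the completion yields convergence of images under \<open>frac_op\<close>;
  convergence in \<open>L2\<close> is recovered from the Poincare inequality.\<close>

lemma H0s_density:
  fixes \<Omega> :: "'a::euclidean_space set"
  assumes \<Omega>: "bounded \<Omega>" and s: "0 < s" "s < 1" and y: "y \<in> H0s s \<Omega>"
  obtains \<phi> where "\<And>k::nat. \<phi> k \<in> Cc_infty \<Omega>" "(\<lambda>k. abs_L2 (\<phi> k)) \<longlonglongrightarrow> y"
    "(\<lambda>k. frac_op s (abs_L2 (\<phi> k))) \<longlonglongrightarrow> frac_op s y"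
proof -
  obtain c where c: "0 < c" "\<And>u. u \<in> L2_on \<Omega> \<Longrightarrow> u \<in> frac_dom s \<Longrightarrow> c * (norm u)\<^sup>2 \<le> (norm (frac_op s u))\<^sup>2"
    by (rule poincare[OF \<Omega> s(1)]) blast
  obtain \<phi> where \<phi>: "\<And>k::nat. \<phi> k \<in> Cc_infty \<Omega>" "(\<lambda>k. frac_op s (abs_L2 (\<phi> k))) \<longlonglongrightarrow> frac_op s y"
    and yL: "y \<in> L2_on \<Omega>" "y \<in> frac_dom s" using y by (auto simp: H0s_iff[OF s])
  have "(\<lambda>k. abs_L2 (\<phi> k) - y) \<longlonglongrightarrow> 0"
  proof (rule Lim_null_comparison[OF always_eventually], rule allI)
    fix k
    have "c * (norm (abs_L2 (\<phi> k) - y))\<^sup>2 \<le> (norm (frac_op s (abs_L2 (\<phi> k) - y)))\<^sup>2"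
      by (intro c L2_on_diff test_in_L2_on \<phi> yL frac_op_linear(5)[OF s(1) frac_op_test(1)[OF s \<phi>(1)] yL(2)])
    then have "(norm (abs_L2 (\<phi> k) - y))\<^sup>2 \<le> (norm (frac_op s (abs_L2 (\<phi> k)) - frac_op s y))\<^sup>2 / c"
      using c(1) by (simp add: frac_op_linear(6)[OF s(1) frac_op_test(1)[OF s \<phi>(1)] yL(2)] field_simps)
    then have "norm (abs_L2 (\<phi> k) - y) \<le> sqrt ((norm (frac_op s (abs_L2 (\<phi> k)) - frac_op s y))\<^sup>2 / c)"
      by (rule real_le_rsqrt)
    then show "norm (abs_L2 (\<phi> k) - y) \<le> norm (frac_op s (abs_L2 (\<phi> k)) - frac_op s y) / sqrt c"
      by (simp add: real_sqrt_divide)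
  next
    have "(\<lambda>k. norm (frac_op s (abs_L2 (\<phi> k)) - frac_op s y)) \<longlonglongrightarrow> 0"
      using \<phi>(2) by (simp add: tendsto_norm_zero_iff LIM_zero_iff)
    from tendsto_divide[OF this tendsto_const[of "sqrt c"]]
    show "(\<lambda>k. norm (frac_op s (abs_L2 (\<phi> k)) - frac_op s y) / sqrt c) \<longlonglongrightarrow> 0" using c(1) by simp
  qed
  then have "(\<lambda>k. abs_L2 (\<phi> k)) \<longlonglongrightarrow> y" by (simp add: LIM_zero_iff)
  with \<phi> show thesis by (intro that)
qed

locale frac_flow =
  fixes \<Omega> :: "'a::euclidean_space set" and s c :: real and x :: "'a L2" and u v :: "real \<Rightarrow> 'a L2"
  assumes open_domain: "open \<Omega>" and bounded_domain: "bounded \<Omega>" and s: "0 < s" "s < 1"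
    and regular: "regular_flow (H0s s \<Omega>) (frac_op s) (L2_on \<Omega>) c x u v"
begin

sublocale regular_flow "H0s s \<Omega>" "frac_op s" "L2_on \<Omega>" c x u v
  by (rule regular)

lemma inner_test:
  assumes "y \<in> H0s s \<Omega>" "\<phi> \<in> Cc_infty \<Omega>"
  shows "frac_op s y \<bullet> frac_op s (abs_L2 \<phi>) = s * frac_laplacian_dual \<Omega> s y \<phi>"
  by (rule frac_op_inner_test[OF open_domain bounded_domain s])
    (use assms H0s_subset[OF s] in blast)+

lemma velocity_pairing:
  assumes "0 < t" "\<phi> \<in> Cc_infty \<Omega>"
  shows "L2_pairing \<Omega> (v t) \<phi> = - s * frac_laplacian_dual \<Omega> s (u t) \<phi>"
  using equation[OF assms(1) test_in_H0s[OF s assms(2)]] inner_test[OF in_V assms(2), of t] assms(1)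
  by (simp add: L2_pairing_test[OF assms(2)])

lemma time_deriv_eq: "AE t in lborel. t \<in> {0..} \<longrightarrow> time_deriv {0..} (L2_on \<Omega>) u t = v t"
  by (rule time_deriv_AE[OF H1(1) H1(2) H1(4) AE_atLeast_interior]) auto

lemma solves: "solves_frac_cauchy \<Omega> s x u"
  unfolding solves_frac_cauchy_def
proof (intro conjI)
  show "u \<in> H1_time {0..} (L2_on \<Omega>)" by (rule H1(1)) auto
  show "AE t in lborel. t \<in> {0..} \<longrightarrow> u t \<in> H0s s \<Omega> \<and> (\<forall>\<phi>\<in>Cc_infty \<Omega>.
      L2_pairing \<Omega> (time_deriv {0..} (L2_on \<Omega>) u t) \<phi> = - s * frac_laplacian_dual \<Omega> s (u t) \<phi>)"
    using time_deriv_eq AE_lborel_singleton[of 0]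
  proof eventually_elim
    case (elim t)
    then show ?case using velocity_pairing[of t] in_V[of t] by (auto simp: less_le)
  qed
qed (rule initial)

text \<open>The equation itself identifies the representing function as
  \<open>- v t / s\<close>.\<close>

lemma laplacian_in_L2:
  assumes "0 < t"
  shows "frac_laplacian_in_L2 \<Omega> s (u t)"
  unfolding frac_laplacian_in_L2_def
proof (intro conjI bexI ballI)
  show "u t \<in> H0s s \<Omega>" using assms by (intro in_V) simp
  show "(- 1 / s) *\<^sub>R v t \<in> L2_on \<Omega>" by (intro L2_on_scale velocity_in assms)
  fix \<phi> assume \<phi>: "\<phi> \<in> Cc_infty \<Omega>"
  have "L2_pairing \<Omega> ((- 1 / s) *\<^sub>R v t) \<phi> = (- 1 / s) * L2_pairing \<Omega> (v t) \<phi>"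
    by (simp add: L2_pairing_test[OF \<phi>])
  then show "frac_laplacian_dual \<Omega> s (u t) \<phi> = L2_pairing \<Omega> ((- 1 / s) *\<^sub>R v t) \<phi>"
    using velocity_pairing[OF assms \<phi>] s by simp
qed

text \<open>A competitor satisfies its equation against test functions. Density extends it to the
  whole form domain, after which the difference of the two solutions is an admissible test and
  proves dissipative.\<close>

lemma unique:
  assumes w: "solves_frac_cauchy \<Omega> s x w" and t: "0 \<le> t"
  shows "w t = u t"
proof -
  define w' where "w' = time_deriv {0..} (L2_on \<Omega>) w"
  have wH: "w \<in> H1_time {0..} (L2_on \<Omega>)" and w0: "w 0 = x"
    and wae: "AE t in lborel. t \<in> {0..} \<longrightarrow> w t \<in> H0s s \<Omega> \<and>
      (\<forall>\<phi>\<in>Cc_infty \<Omega>. L2_pairing \<Omega> (w' t) \<phi> = - s * frac_laplacian_dual \<Omega> s (w t) \<phi>)"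
    using w by (auto simp: solves_frac_cauchy_def w'_def)
  note w' = time_derivD[OF wH, folded w'_def]
  have wL: "w \<in> L2_time {0..} (L2_on \<Omega>)" "continuous_on {0..} w" using wH by (auto simp: H1_time_def)
  have I: "{0::real..} \<subseteq> {0..}" "{0::real..} \<in> sets borel" by auto
  have "norm (w t - u t) \<le> norm (w 0 - u 0)"
  proof (rule weak_dissipative[where I = "{0..}" and T = t])
    show "weak_deriv {0..} (\<lambda>t. w t - u t) (\<lambda>t. w' t - v t)"
      by (rule weak_deriv_diff[OF w'(2) H1(4)[OF I] wL(1) w'(1) H1(3)[OF I] H1(2)[OF I]])
    show "(\<lambda>t. w t - u t) \<in> L2_time {0..} (L2_on \<Omega>)"
      by (rule L2_time_diff[OF wL(1) H1(3)[OF I] L2_on_diff])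
    show "(\<lambda>t. w' t - v t) \<in> L2_time {0..} (L2_on \<Omega>)"
      by (rule L2_time_diff[OF w'(1) H1(2)[OF I] L2_on_diff])
    show "continuous_on {0..} (\<lambda>t. w t - u t)" by (intro continuous_intros wL(2) continuous)
    show "AE t in lborel. t \<in> {0..} \<longrightarrow> (w' t - v t) \<bullet> (w t - u t) \<le> 0"
      using wae AE_lborel_singleton[of 0]
    proof eventually_elim
      case (elim t)
      show ?case
      proof
        assume "t \<in> {0..}"
        with elim have t: "0 < t" and wt: "w t \<in> H0s s \<Omega>"
          and eq: "\<And>\<phi>. \<phi> \<in> Cc_infty \<Omega> \<Longrightarrow> L2_pairing \<Omega> (w' t) \<phi> = - s * frac_laplacian_dual \<Omega> s (w t) \<phi>" by auto
        have wy: "w' t \<bullet> y = - (frac_op s (w t) \<bullet> frac_op s y)" if y: "y \<in> H0s s \<Omega>" for y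
        proof -
          obtain \<phi> where \<phi>: "\<And>k::nat. \<phi> k \<in> Cc_infty \<Omega>" "(\<lambda>k. abs_L2 (\<phi> k)) \<longlonglongrightarrow> y"
            "(\<lambda>k. frac_op s (abs_L2 (\<phi> k))) \<longlonglongrightarrow> frac_op s y"
            using H0s_density[OF bounded_domain s y] by blast
          have "w' t \<bullet> abs_L2 (\<phi> k) = - (frac_op s (w t) \<bullet> frac_op s (abs_L2 (\<phi> k)))" for k
            using eq[OF \<phi>(1)[of k]] inner_test[OF wt \<phi>(1)[of k]] by (simp add: L2_pairing_test[OF \<phi>(1)])
          moreover have "(\<lambda>k. w' t \<bullet> abs_L2 (\<phi> k)) \<longlonglongrightarrow> w' t \<bullet> y" by (intro tendsto_intros \<phi>(2))
          moreover have "(\<lambda>k. - (frac_op s (w t) \<bullet> frac_op s (abs_L2 (\<phi> k)))) \<longlonglongrightarrow> - (frac_op s (w t) \<bullet> frac_op s y)"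
            by (intro tendsto_intros \<phi>(3))
          ultimately show ?thesis by (simp add: LIMSEQ_unique)
        qed
        have ut: "u t \<in> H0s s \<Omega>" using t by (intro in_V) simp
        have "(w' t - v t) \<bullet> (w t - u t) = - ((frac_op s (w t) - frac_op s (u t)) \<bullet> frac_op s (w t - u t))"
          using wy[OF diff_in[OF wt ut]] equation[OF t diff_in[OF wt ut]] by (simp add: inner_diff_left)
        also have "\<dots> = - (norm (frac_op s (w t - u t)))\<^sup>2"
          by (simp add: T_diff[OF wt ut] power2_norm_eq_inner)
        finally show "(w' t - v t) \<bullet> (w t - u t) \<le> 0" by simp
      qed
    qed
  qed (use t in auto)
  then show ?thesis by (simp add: w0 initial)
qed

lemma scaled_energy:
  assumes "0 \<le> t"
  shows "ennreal s * frac_energy s (u t) = ennreal ((norm (frac_op s (u t)))\<^sup>2 / 2)"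
  using frac_energy_eq[OF s(1)] in_V[OF assms] H0s_subset(2)[OF s] by blast

text \<open>Compares the flow with \<open>exp (- \<kappa> t) \<phi>\<close>, where \<open>g\<close> represents \<open>s (-\<Delta>)\<^sup>s \<phi>\<close>.\<close>

lemma compare_with_decay:
  assumes \<phi>: "\<phi> \<in> Cc_infty \<Omega>" and \<kappa>: "0 \<le> \<kappa>"
    and g: "\<And>y. s * frac_laplacian_dual \<Omega> s y \<phi> = y \<bullet> g" and t: "0 \<le> t"
  shows "(norm (u t - exp (- \<kappa> * t) *\<^sub>R abs_L2 \<phi>))\<^sup>2
    \<le> exp t * ((norm (x - abs_L2 \<phi>))\<^sup>2 + (norm (g - \<kappa> *\<^sub>R abs_L2 \<phi>))\<^sup>2 * t)"
proof (cases "t = 0")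
  case False
  define p where "p = abs_L2 \<phi>"
  define z where "z t = u t - exp (- \<kappa> * t) *\<^sub>R p" for t
  define e where "e = norm (g - \<kappa> *\<^sub>R p)"
  \<comment> \<open>The factor \<open>exp (- t)\<close> absorbs the square of \<open>z\<close> that
    Young's inequality produces from the residual, and \<open>e^2 * t\<close> pays for the square of
    the residual.\<close>
  define f where "f t = exp (- t) * (norm (z t))\<^sup>2 - e\<^sup>2 * t" for t
  have pV: "p \<in> H0s s \<Omega>" unfolding p_def by (rule test_in_H0s[OF s \<phi>])
  have "f t \<le> f 0"
  proof (rule DERIV_nonpos_imp_decreasing_open[of 0 t])
    show "continuous_on {0..t} f" unfolding f_def z_def
      by (intro continuous_intros continuous_on_subset[OF continuous]) auto
    fix r assume r: "0 < r" "r < t"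
    have ur: "u r \<in> H0s s \<Omega>" using r by (intro in_V) simp
    have zr: "z r \<in> H0s s \<Omega>" unfolding z_def by (intro diff_in ur scale_in pV)
    have ed: "((\<lambda>t. exp (- \<kappa> * t)) has_real_derivative - \<kappa> * exp (- \<kappa> * r)) (at r)"
      by (auto intro!: derivative_eq_intros)
    have "((\<lambda>t. exp (- \<kappa> * t) *\<^sub>R p) has_vector_derivative (- \<kappa> * exp (- \<kappa> * r)) *\<^sub>R p) (at r)"
      using has_vector_derivative_scaleR[OF ed has_vector_derivative_const[of p]] by simp
    from has_vector_derivative_diff[OF deriv[OF r(1)] this]
    have zd: "(z has_vector_derivative v r - (- \<kappa> * exp (- \<kappa> * r)) *\<^sub>R p) (at r)" by (simp add: z_def[abs_def])
    define q where "q = v r - (- \<kappa> * exp (- \<kappa> * r)) *\<^sub>R p"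
    have fd: "(f has_real_derivative (exp (- r) * (2 * (q \<bullet> z r)) + (- exp (- r)) * (norm (z r))\<^sup>2) - e\<^sup>2) (at r)"
      unfolding f_def q_def
      by (intro DERIV_diff DERIV_mult'[OF _ norm_sq_deriv[OF zd]]) (auto intro!: derivative_eq_intros)
    have "v r \<bullet> z r = - (frac_op s (u r) \<bullet> frac_op s (z r))" by (rule equation[OF r(1) zr])
    moreover have "frac_op s (z r) = frac_op s (u r) - exp (- \<kappa> * r) *\<^sub>R frac_op s p"
      unfolding z_def by (simp only: T_diff[OF ur scale_in[OF pV]] T_scale[OF pV])
    then have "frac_op s (u r) = frac_op s (z r) + exp (- \<kappa> * r) *\<^sub>R frac_op s p" by simp
    moreover have "frac_op s (z r) \<bullet> frac_op s p = z r \<bullet> g"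
      unfolding p_def using inner_test[OF zr \<phi>] g[of "z r"] by simp
    \<comment> \<open>The form contributes a negative square, so the only source is the residual
      \<open>g - \<kappa> *\<^sub>R p\<close>, damped by the exponential.\<close>
    ultimately have "q \<bullet> z r = - (norm (frac_op s (z r)))\<^sup>2 - exp (- \<kappa> * r) * ((g - \<kappa> *\<^sub>R p) \<bullet> z r)"
      by (simp add: q_def inner_diff_left inner_add_left power2_norm_eq_inner inner_commute algebra_simps)
    also have "\<dots> \<le> exp (- \<kappa> * r) * \<bar>(g - \<kappa> *\<^sub>R p) \<bullet> z r\<bar>"
    proof -
      have "exp (- \<kappa> * r) * - ((g - \<kappa> *\<^sub>R p) \<bullet> z r) \<le> exp (- \<kappa> * r) * \<bar>(g - \<kappa> *\<^sub>R p) \<bullet> z r\<bar>"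
        by (intro mult_left_mono) auto
      moreover have "0 \<le> (norm (frac_op s (z r)))\<^sup>2" by simp
      ultimately show ?thesis unfolding mult_minus_right by linarith
    qed
    also have "\<dots> \<le> 1 * \<bar>(g - \<kappa> *\<^sub>R p) \<bullet> z r\<bar>"
      using \<kappa> r by (intro mult_right_mono) auto
    also have "\<dots> \<le> e * norm (z r)"
      using Cauchy_Schwarz_ineq2[of "g - \<kappa> *\<^sub>R p" "z r"] by (simp add: e_def)
    finally have "2 * (q \<bullet> z r) \<le> e\<^sup>2 + (norm (z r))\<^sup>2"
      using sum_squares_bound[of e "norm (z r)"] by simp
    then have "exp (- r) * (2 * (q \<bullet> z r)) \<le> exp (- r) * (e\<^sup>2 + (norm (z r))\<^sup>2)" by (intro mult_left_mono) auto
    moreover have "exp (- r) * e\<^sup>2 \<le> 1 * e\<^sup>2" using r by (intro mult_right_mono) auto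
    ultimately have "(exp (- r) * (2 * (q \<bullet> z r)) + (- exp (- r)) * (norm (z r))\<^sup>2) - e\<^sup>2 \<le> 0"
      by (simp add: distrib_left)
    with fd show "\<exists>y. (f has_real_derivative y) (at r) \<and> y \<le> 0" by blast
  qed (use t False in auto)
  then have "exp (- t) * (norm (z t))\<^sup>2 \<le> (norm (x - p))\<^sup>2 + e\<^sup>2 * t" by (simp add: f_def z_def initial)
  then have "exp t * (exp (- t) * (norm (z t))\<^sup>2) \<le> exp t * ((norm (x - p))\<^sup>2 + e\<^sup>2 * t)"
    by (intro mult_left_mono) auto
  also have "exp t * (exp (- t) * (norm (z t))\<^sup>2) = (norm (z t))\<^sup>2"
    by (simp only: mult.assoc[symmetric] exp_add[symmetric]) simp
  finally show ?thesis by (simp add: z_def p_def e_def)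
qed (simp add: initial)

end

lemma frac_flow_exists:
  fixes \<Omega> :: "'a::euclidean_space set"
  assumes \<Omega>: "open \<Omega>" "bounded \<Omega>" and s: "0 < s" "s < 1" and x: "x \<in> H0s s \<Omega>"
  obtains c u v where "frac_flow \<Omega> s c x u v"
proof -
  obtain c where c: "0 < c" "\<And>u. u \<in> L2_on \<Omega> \<Longrightarrow> u \<in> frac_dom s \<Longrightarrow> c * (norm u)\<^sup>2 \<le> (norm (frac_op s u))\<^sup>2"
    by (rule poincare[OF \<Omega>(2) s(1)]) blast
  interpret closed_operator "H0s s \<Omega>" "frac_op s" by (rule H0s_closed_operator[OF s])
  obtain u v where uv: "u 0 = x" "continuous_on {0..} u" "\<And>t. 0 \<le> t \<Longrightarrow> u t \<in> H0s s \<Omega>"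
    "\<And>t y. 0 < t \<Longrightarrow> y \<in> H0s s \<Omega> \<Longrightarrow> v t \<bullet> y = - (frac_op s (u t) \<bullet> frac_op s y)"
    "\<And>t h. 0 < t \<Longrightarrow> \<bar>h\<bar> \<le> t / 2 \<Longrightarrow>
      norm (u (t + h) - u t - h *\<^sub>R v t) \<le> h\<^sup>2 * sqrt (27 * (norm (frac_op s x))\<^sup>2 / t ^ 3)"
    "\<And>t. 0 < t \<Longrightarrow> (norm (v t))\<^sup>2 \<le> (norm (frac_op s x))\<^sup>2 / (2 * t)"
    "\<And>t. 0 < t \<Longrightarrow> (\<integral>\<^sup>+r. ennreal ((norm (v r))\<^sup>2) * indicator {0<..t} r \<partial>lborel)
      + ennreal ((norm (frac_op s (u t)))\<^sup>2 / 2) \<le> ennreal ((norm (frac_op s x))\<^sup>2 / 2)"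
    using gradient_flow_exists[OF x] by blast
  have "regular_flow (H0s s \<Omega>) (frac_op s) (L2_on \<Omega>) c x u v"
  proof unfold_locales
    show "H0s s \<Omega> \<subseteq> L2_on \<Omega>" by (rule H0s_subset(1)[OF s])
    show "c * (norm y)\<^sup>2 \<le> (norm (frac_op s y))\<^sup>2" if "y \<in> H0s s \<Omega>" for y
      using that H0s_subset[OF s] by (intro c) blast+
  qed (fact L2_on_diff L2_on_scale L2_on_closed c(1) uv)+
  then have "frac_flow \<Omega> s c x u v" using \<Omega> s by (simp add: frac_flow_def)
  then show thesis by (rule that)
qed

section \<open>The limit \<open>s \<rightarrow> 0\<close>\<close>

lemma set_integral_Icc_eq_Ioc:
  fixes f :: "real \<Rightarrow> real"
  assumes f: "set_integrable lborel {a..b} f"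
  shows "(LINT t:{a..b}|lborel. f t) = (LINT t:{a<..b}|lborel. f t)"
proof -
  have "set_integrable lborel {a<..b} f" by (rule set_integrable_subset[OF f]) auto
  then have m: "(\<lambda>t. indicator {a<..b} t *\<^sub>R f t) \<in> borel_measurable lborel"
    "(\<lambda>t. indicator {a..b} t *\<^sub>R f t) \<in> borel_measurable lborel"
    using f by (auto simp: set_integrable_def)
  show ?thesis
    unfolding set_lebesgue_integral_def
  proof (rule integral_cong_AE[OF m(2,1)])
    show "AE t in lborel. indicator {a..b} t *\<^sub>R f t = indicator {a<..b} t *\<^sub>R f t"
      using AE_lborel_singleton[of a] by eventually_elim (auto simp: indicator_def)
  qed
qed

text \<open>Bounds of order \<open>1 / t\<close> are not integrable at 0, so dominated convergence
  works on \<open>(d, T]\<close> only. Near 0 it is replaced by a separate smallness hypothesis,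
  which has to hold merely for large \<open>n\<close>.\<close>

lemma integral_tendsto_0_split:
  fixes k :: "nat \<Rightarrow> real \<Rightarrow> real"
  assumes T: "0 < T" and nonneg: "\<And>n t. 0 \<le> k n t"
    and int: "\<And>n. set_integrable lborel {0..T} (k n)"
    and lim: "\<And>t. 0 < t \<Longrightarrow> t \<le> T \<Longrightarrow> (\<lambda>n. k n t) \<longlonglongrightarrow> 0"
    and dom: "\<And>d. 0 < d \<Longrightarrow> d < T \<Longrightarrow> \<exists>w. set_integrable lborel {d<..T} w \<and> (\<forall>n. \<forall>t\<in>{d<..T}. k n t \<le> w t)"
    and small: "\<And>e. 0 < e \<Longrightarrow> \<exists>d. 0 < d \<and> d < T \<and> (\<forall>\<^sub>F n in sequentially. (LINT t:{0<..d}|lborel. k n t) \<le> e)"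
  shows "(\<lambda>n. LINT t:{0..T}|lborel. k n t) \<longlonglongrightarrow> 0"
proof -
  have nn: "0 \<le> (LINT t:A|lborel. k n t)" for A n
    unfolding set_lebesgue_integral_def using nonneg by (intro integral_nonneg_AE) auto
  have "\<forall>\<^sub>F n in sequentially. norm (LINT t:{0..T}|lborel. k n t) < e" if e: "0 < e" for e
  proof -
    obtain d where d: "0 < d" "d < T" "\<forall>\<^sub>F n in sequentially. (LINT t:{0<..d}|lborel. k n t) \<le> e / 2"
      using small[of "e / 2"] e by auto
    obtain w where w: "set_integrable lborel {d<..T} w" "\<And>n t. t \<in> {d<..T} \<Longrightarrow> k n t \<le> w t"
      using dom[OF d(1,2)] by blast
    have sub: "set_integrable lborel A (k n)" if "A \<subseteq> {0..T}" "A \<in> sets borel" for A n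
      by (rule set_integrable_subset[OF int]) (use that in auto)
    have subs: "{0<..T} \<subseteq> {0..T}" "{0<..d} \<subseteq> {0..T}" "{d<..T} \<subseteq> {0..T}" using d by auto
    note sub = sub[OF order_refl] sub[OF subs(1)] sub[OF subs(2)] sub[OF subs(3)]
    have "(\<lambda>n. LINT t|lborel. indicator {d<..T} t *\<^sub>R k n t) \<longlonglongrightarrow> (LINT t|(lborel :: real measure). 0)"
    proof (rule integral_dominated_convergence)
      show "integrable lborel (\<lambda>t. indicator {d<..T} t *\<^sub>R w t)" using w(1) by (simp add: set_integrable_def)
      show "(\<lambda>t. indicator {d<..T} t *\<^sub>R k n t) \<in> borel_measurable lborel" for n
        using sub(4)[of n] by (auto simp: set_integrable_def)
      show "AE t in lborel. (\<lambda>n. indicator {d<..T} t *\<^sub>R k n t) \<longlonglongrightarrow> 0"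
      proof (rule AE_I2)
        fix t show "(\<lambda>n. indicator {d<..T} t *\<^sub>R k n t) \<longlonglongrightarrow> 0"
          using lim[of t] d by (cases "t \<in> {d<..T}") auto
      qed
      show "AE t in lborel. norm (indicator {d<..T} t *\<^sub>R k n t) \<le> indicator {d<..T} t *\<^sub>R w t" for n
        using w(2) nonneg by (intro AE_I2) (auto simp: indicator_def)
    qed auto
    then have "(\<lambda>n. LINT t:{d<..T}|lborel. k n t) \<longlonglongrightarrow> 0" by (simp add: set_lebesgue_integral_def)
    from order_tendstoD(2)[OF this, of "e / 2"] e
    have "\<forall>\<^sub>F n in sequentially. (LINT t:{d<..T}|lborel. k n t) < e / 2" by simp
    with d(3) show ?thesis
    proof eventually_elim
      case (elim n)
      have "(LINT t:{0..T}|lborel. k n t) = (LINT t:{0<..T}|lborel. k n t)"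
        by (rule set_integral_Icc_eq_Ioc[OF int])
      also have "{0<..T} = {0<..d} \<union> {d<..T}" using d by auto
      also have "(LINT t:({0<..d} \<union> {d<..T})|lborel. k n t) = (LINT t:{0<..d}|lborel. k n t) + (LINT t:{d<..T}|lborel. k n t)"
        by (rule set_integral_Un) (use sub(3,4)[of n] d in auto)
      finally show ?case using elim nn[of "{0..T}" n] by simp
    qed
  qed
  then show ?thesis by (simp add: tendsto_iff dist_norm)
qed

text \<open>Absolute continuity of the integral at the left endpoint, uniformly over all shorter
  intervals.\<close>

lemma set_integral_Ioc_tendsto_0:
  fixes w :: "real \<Rightarrow> real"
  assumes T: "0 < T" and w: "set_integrable lborel {0..T} w" and e: "0 < e"
  obtains d where "0 < d" "d < T" "\<And>r. 0 < r \<Longrightarrow> r \<le> d \<Longrightarrow> (LINT t:{0<..r}|lborel. \<bar>w t\<bar>) < e"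
proof -
  have sub: "set_integrable lborel A (\<lambda>t. \<bar>w t\<bar>)" if "A \<subseteq> {0..T}" "A \<in> sets borel" for A
    by (rule set_integrable_abs[OF set_integrable_subset[OF w]]) (use that in auto)
  have "(\<lambda>n. LINT t|lborel. indicator {0<..T / real (n + 2)} t *\<^sub>R \<bar>w t\<bar>) \<longlonglongrightarrow> (LINT t|(lborel :: real measure). 0)"
  proof (rule integral_dominated_convergence)
    show "integrable lborel (\<lambda>t. indicator {0..T} t *\<^sub>R \<bar>w t\<bar>)" using sub[of "{0..T}"] by (simp add: set_integrable_def)
    have le: "T / real (n + 2) \<le> T" for n using T by (simp add: divide_le_eq)
    have "set_integrable lborel {0<..T / real (n + 2)} (\<lambda>t. \<bar>w t\<bar>)" for n
      by (rule sub) (use le[of n] in auto)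
    then show "(\<lambda>t. indicator {0<..T / real (n + 2)} t *\<^sub>R \<bar>w t\<bar>) \<in> borel_measurable lborel" for n
      unfolding set_integrable_def by (rule borel_measurable_integrable)
    show "AE t in lborel. (\<lambda>n. indicator {0<..T / real (n + 2)} t *\<^sub>R \<bar>w t\<bar>) \<longlonglongrightarrow> 0"
    proof (rule AE_I2)
      fix t :: real
      show "(\<lambda>n. indicator {0<..T / real (n + 2)} t *\<^sub>R \<bar>w t\<bar>) \<longlonglongrightarrow> 0"
      proof (cases "0 < t")
        case True
        have "(\<lambda>n. T / real (n + 2)) \<longlonglongrightarrow> 0" by (rule LIMSEQ_ignore_initial_segment[OF lim_const_over_n])
        from order_tendstoD(2)[OF this True]
        have "\<forall>\<^sub>F n in sequentially. indicator {0<..T / real (n + 2)} t *\<^sub>R \<bar>w t\<bar> = 0"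
          by eventually_elim (simp add: indicator_def)
        then show ?thesis by (rule tendsto_eventually)
      qed (simp add: indicator_def)
    qed
    show "AE t in lborel. norm (indicator {0<..T / real (n + 2)} t *\<^sub>R \<bar>w t\<bar>) \<le> indicator {0..T} t *\<^sub>R \<bar>w t\<bar>" for n
      using le[of n] by (intro AE_I2) (auto simp: indicator_def)
  qed auto
  from order_tendstoD(2)[OF this, of e] e
  obtain n where n: "(LINT t:{0<..T / real (n + 2)}|lborel. \<bar>w t\<bar>) < e"
    by (auto simp: set_lebesgue_integral_def eventually_sequentially)
  show thesis
  proof (rule that[of "T / real (n + 2)"])
    show "0 < T / real (n + 2)" using T by simp
    show d: "T / real (n + 2) < T" using T by (simp add: divide_less_eq)
    fix r assume r: "0 < r" "r \<le> T / real (n + 2)"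
    have "(LINT t:{0<..r}|lborel. \<bar>w t\<bar>) \<le> (LINT t:{0<..T / real (n + 2)}|lborel. \<bar>w t\<bar>)"
      unfolding set_lebesgue_integral_def
    proof (rule integral_mono)
      show "integrable lborel (\<lambda>t. indicator {0<..r} t *\<^sub>R \<bar>w t\<bar>)"
        "integrable lborel (\<lambda>t. indicator {0<..T / real (n + 2)} t *\<^sub>R \<bar>w t\<bar>)"
        using sub[of "{0<..r}"] sub[of "{0<..T / real (n + 2)}"] r d by (auto simp: set_integrable_def subset_iff)
      show "indicator {0<..r} t *\<^sub>R \<bar>w t\<bar> \<le> indicator {0<..T / real (n + 2)} t *\<^sub>R \<bar>w t\<bar>" for t
        using r by (auto simp: indicator_def)
    qed
    with n show "(LINT t:{0<..r}|lborel. \<bar>w t\<bar>) < e" by simp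
  qed
qed

lemma L2_time_inner_integrable:
  fixes f g :: "real \<Rightarrow> 'b::{real_inner, banach, second_countable_topology}"
  assumes f: "f \<in> L2_time I X" and g: "g \<in> L2_time I X"
  shows "set_integrable lborel I (\<lambda>t. f t \<bullet> g t)"
  unfolding set_integrable_def
proof (rule Bochner_Integration.integrable_bound)
  show "integrable lborel (\<lambda>t. indicator I t *\<^sub>R (norm (f t))\<^sup>2 + indicator I t *\<^sub>R (norm (g t))\<^sup>2)"
    using L2_timeD(2)[OF f] L2_timeD(2)[OF g] by (auto simp: set_integrable_def)
  have "(\<lambda>t. (indicator I t *\<^sub>R f t) \<bullet> (indicator I t *\<^sub>R g t)) \<in> borel_measurable lborel"
    using L2_timeD(1)[OF f] L2_timeD(1)[OF g] by measurable
  also have "(\<lambda>t. (indicator I t *\<^sub>R f t) \<bullet> (indicator I t *\<^sub>R g t)) = (\<lambda>t. indicator I t *\<^sub>R (f t \<bullet> g t))"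
    by (auto simp: indicator_def fun_eq_iff)
  finally show "(\<lambda>t. indicator I t *\<^sub>R (f t \<bullet> g t)) \<in> borel_measurable lborel" .
  show "AE t in lborel. norm (indicator I t *\<^sub>R (f t \<bullet> g t)) \<le> norm (indicator I t *\<^sub>R (norm (f t))\<^sup>2 + indicator I t *\<^sub>R (norm (g t))\<^sup>2)"
  proof (rule AE_I2)
    fix t
    have "\<bar>f t \<bullet> g t\<bar> \<le> norm (f t) * norm (g t)" by (rule Cauchy_Schwarz_ineq2)
    moreover have "2 * norm (f t) * norm (g t) \<le> (norm (f t))\<^sup>2 + (norm (g t))\<^sup>2" by (rule sum_squares_bound)
    moreover have "0 \<le> norm (f t) * norm (g t)" by simp
    ultimately have "\<bar>f t \<bullet> g t\<bar> \<le> (norm (f t))\<^sup>2 + (norm (g t))\<^sup>2" by linarith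
    then show "norm (indicator I t *\<^sub>R (f t \<bullet> g t)) \<le> norm (indicator I t *\<^sub>R (norm (f t))\<^sup>2 + indicator I t *\<^sub>R (norm (g t))\<^sup>2)"
      by (auto simp: indicator_def)
  qed
qed

text \<open>Near 0 the functions \<open>h n\<close> are only bounded in \<open>L2\<close>, but the
  fixed \<open>g\<close> has little mass there. Young's inequality with weight \<open>a\<close>
  balances the two.\<close>

lemma L2_time_inner_tendsto:
  fixes h :: "nat \<Rightarrow> real \<Rightarrow> 'b::{real_inner, banach, second_countable_topology}"
  assumes T: "0 < T" and h: "\<And>n. h n \<in> L2_time {0..T} X" and g: "g \<in> L2_time {0..T} X"
    and lim: "\<And>t. 0 < t \<Longrightarrow> t \<le> T \<Longrightarrow> (\<lambda>n. h n t) \<longlonglongrightarrow> 0"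
    and bound: "\<And>n t. 0 < t \<Longrightarrow> t \<le> T \<Longrightarrow> (norm (h n t))\<^sup>2 \<le> C / t"
    and total: "\<And>n. (LINT t:{0..T}|lborel. (norm (h n t))\<^sup>2) \<le> D"
  shows "(\<lambda>n. LINT t:{0..T}|lborel. h n t \<bullet> g t) \<longlonglongrightarrow> 0"
proof -
  have C: "0 \<le> C" using order_trans[OF zero_le_power2 bound[of T 0]] T by (simp add: zero_le_divide_iff)
  have D: "0 \<le> D" using total[of 0] by (intro order_trans[OF _ total[of 0]]) (auto simp: set_lebesgue_integral_def intro!: integral_nonneg_AE)
  have hg: "set_integrable lborel {0..T} (\<lambda>t. \<bar>h n t \<bullet> g t\<bar>)" for n
    by (intro set_integrable_abs L2_time_inner_integrable[OF h g])
  have gi: "set_integrable lborel {0..T} (\<lambda>t. (norm (g t))\<^sup>2)" by (rule L2_timeD(2)[OF g])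
  have hi: "set_integrable lborel {0..T} (\<lambda>t. (norm (h n t))\<^sup>2)" for n by (rule L2_timeD(2)[OF h])
  have "(\<lambda>n. LINT t:{0..T}|lborel. \<bar>h n t \<bullet> g t\<bar>) \<longlonglongrightarrow> 0"
  proof (rule integral_tendsto_0_split[OF T _ hg])
    fix t :: real assume t: "0 < t" "t \<le> T"
    have "(\<lambda>n. \<bar>h n t \<bullet> g t\<bar>) \<longlonglongrightarrow> \<bar>0 \<bullet> g t\<bar>" by (intro tendsto_intros lim t)
    then show "(\<lambda>n. \<bar>h n t \<bullet> g t\<bar>) \<longlonglongrightarrow> 0" by simp
  next
    fix d :: real assume d: "0 < d" "d < T"
    show "\<exists>w. set_integrable lborel {d<..T} w \<and> (\<forall>n. \<forall>t\<in>{d<..T}. \<bar>h n t \<bullet> g t\<bar> \<le> w t)"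
    proof (intro exI conjI allI ballI)
      show "set_integrable lborel {d<..T} (\<lambda>t. C / d + (norm (g t))\<^sup>2)"
      proof (rule set_integral_add)
        show "set_integrable lborel {d<..T} (\<lambda>t. C / d)"
          unfolding set_integrable_def by (rule integrable_scaleR_left) (use d in simp)
        show "set_integrable lborel {d<..T} (\<lambda>t. (norm (g t))\<^sup>2)" by (rule set_integrable_subset[OF gi]) (use d in auto)
      qed
      fix n t assume t: "t \<in> {d<..T}"
      have "(norm (h n t))\<^sup>2 \<le> C / t" using t d by (intro bound) auto
      also have "\<dots> \<le> C / d" using t d C by (intro divide_left_mono) auto
      finally have "(norm (h n t))\<^sup>2 \<le> C / d" .
      moreover have "\<bar>h n t \<bullet> g t\<bar> \<le> norm (h n t) * norm (g t)" by (rule Cauchy_Schwarz_ineq2)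
      moreover have "2 * norm (h n t) * norm (g t) \<le> (norm (h n t))\<^sup>2 + (norm (g t))\<^sup>2" by (rule sum_squares_bound)
      moreover have "0 \<le> norm (h n t) * norm (g t)" by simp
      ultimately show "\<bar>h n t \<bullet> g t\<bar> \<le> C / d + (norm (g t))\<^sup>2" by linarith
    qed
  next
    fix e :: real assume e: "0 < e"
    \<comment> \<open>With this weight \<open>a / 2 * D\<close> is at most \<open>e / 2\<close>, and
      \<open>1 / (2 * a) * (a * e)\<close> equals \<open>e / 2\<close>.\<close>
    define a where "a = e / (D + 1)"
    have a: "0 < a" "a * D \<le> e" using e D by (auto simp: a_def divide_le_eq)
    obtain d where d: "0 < d" "d < T" "\<And>r. 0 < r \<Longrightarrow> r \<le> d \<Longrightarrow> (LINT t:{0<..r}|lborel. \<bar>(norm (g t))\<^sup>2\<bar>) < a * e"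
      using set_integral_Ioc_tendsto_0[OF T gi, of "a * e"] a e by auto
    have "(LINT t:{0<..d}|lborel. \<bar>h n t \<bullet> g t\<bar>) \<le> e" for n
    proof -
      have i: "set_integrable lborel {0<..d} (\<lambda>t. (norm (g t))\<^sup>2)" "set_integrable lborel {0<..d} (\<lambda>t. (norm (h n t))\<^sup>2)"
        "set_integrable lborel {0<..d} (\<lambda>t. \<bar>h n t \<bullet> g t\<bar>)"
        using d by (auto intro!: set_integrable_subset[OF gi] set_integrable_subset[OF hi] set_integrable_subset[OF hg])
      have "(LINT t:{0<..d}|lborel. \<bar>h n t \<bullet> g t\<bar>)
        \<le> (LINT t:{0<..d}|lborel. a / 2 * (norm (h n t))\<^sup>2 + 1 / (2 * a) * (norm (g t))\<^sup>2)"
      proof (rule set_integral_mono)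
        show "set_integrable lborel {0<..d} (\<lambda>t. a / 2 * (norm (h n t))\<^sup>2 + 1 / (2 * a) * (norm (g t))\<^sup>2)"
          by (intro set_integral_add set_integrable_mult_right i)
        fix t
        have "\<bar>h n t \<bullet> g t\<bar> \<le> norm (h n t) * norm (g t)" by (rule Cauchy_Schwarz_ineq2)
        also have "2 * (sqrt a * norm (h n t)) * (norm (g t) / sqrt a) \<le> (sqrt a * norm (h n t))\<^sup>2 + (norm (g t) / sqrt a)\<^sup>2"
          by (rule sum_squares_bound)
        then have "norm (h n t) * norm (g t) \<le> a / 2 * (norm (h n t))\<^sup>2 + 1 / (2 * a) * (norm (g t))\<^sup>2"
          using a by (simp add: power_mult_distrib power_divide field_simps)
        finally show "\<bar>h n t \<bullet> g t\<bar> \<le> a / 2 * (norm (h n t))\<^sup>2 + 1 / (2 * a) * (norm (g t))\<^sup>2" .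
      qed (rule i)
      also have "\<dots> = a / 2 * (LINT t:{0<..d}|lborel. (norm (h n t))\<^sup>2) + 1 / (2 * a) * (LINT t:{0<..d}|lborel. (norm (g t))\<^sup>2)"
        by (subst set_integral_add(2)) (auto intro!: set_integrable_mult_right i)
      also have "\<dots> \<le> a / 2 * D + 1 / (2 * a) * (a * e)"
      proof (intro add_mono mult_left_mono)
        have "(LINT t:{0<..d}|lborel. (norm (h n t))\<^sup>2) \<le> (LINT t:{0..T}|lborel. (norm (h n t))\<^sup>2)"
          unfolding set_lebesgue_integral_def
          by (rule integral_mono) (use i(2) hi[of n] d in \<open>auto simp: set_integrable_def indicator_def\<close>)
        then show "(LINT t:{0<..d}|lborel. (norm (h n t))\<^sup>2) \<le> D" using total[of n] by simp
        show "(LINT t:{0<..d}|lborel. (norm (g t))\<^sup>2) \<le> a * e" using d(3)[of d] d(1) by simp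
      qed (use a in auto)
      also have "\<dots> \<le> e" using a by simp
      finally show ?thesis .
    qed
    then show "\<exists>d. 0 < d \<and> d < T \<and> (\<forall>\<^sub>F n in sequentially. (LINT t:{0<..d}|lborel. \<bar>h n t \<bullet> g t\<bar>) \<le> e)"
      using d by (intro exI[of _ d]) auto
  qed simp
  then show ?thesis
  proof (rule Lim_null_comparison[OF always_eventually, rotated], intro allI)
    fix n
    show "norm (LINT t:{0..T}|lborel. h n t \<bullet> g t) \<le> (LINT t:{0..T}|lborel. \<bar>h n t \<bullet> g t\<bar>)"
      using integral_norm_bound[of lborel "\<lambda>t. indicator {0..T} t *\<^sub>R (h n t \<bullet> g t)"]
      by (simp add: set_lebesgue_integral_def abs_mult)
  qed
qed

lemma H1_inner_eq:
  assumes u: "u \<in> H1_time {0..T} X" "u' \<in> L2_time {0..T} X" "weak_deriv {0..T} u u'"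
    and w: "w \<in> H1_time {0..T} X" "w' \<in> L2_time {0..T} X" "weak_deriv {0..T} w w'"
  shows "H1_inner {0..T} X u w = (LINT t:{0..T}|lborel. u t \<bullet> w t) + (LINT t:{0..T}|lborel. u' t \<bullet> w' t)"
proof -
  note au = time_deriv_AE[OF u AE_Icc_interior] and aw = time_deriv_AE[OF w AE_Icc_interior]
  have m: "(\<lambda>t. indicator {0..T} t *\<^sub>R (f t \<bullet> g t)) \<in> borel_measurable lborel"
    if "f \<in> L2_time {0..T} X" "g \<in> L2_time {0..T} X" for f g
    using L2_time_inner_integrable[OF that] by (auto simp: set_integrable_def)
  have "(LINT t:{0..T}|lborel. time_deriv {0..T} X u t \<bullet> time_deriv {0..T} X w t) = (LINT t:{0..T}|lborel. u' t \<bullet> w' t)"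
    unfolding set_lebesgue_integral_def
  proof (rule integral_cong_AE[OF m[OF time_derivD(1)[OF u(1)] time_derivD(1)[OF w(1)]] m[OF u(2) w(2)]])
    show "AE t in lborel. indicator {0..T} t *\<^sub>R (time_deriv {0..T} X u t \<bullet> time_deriv {0..T} X w t) = indicator {0..T} t *\<^sub>R (u' t \<bullet> w' t)"
      using au aw by eventually_elim (auto simp: indicator_def)
  qed
  then show ?thesis by (simp add: H1_inner_def)
qed

section \<open>The limit equation\<close>

lemma decay_path_deriv:
  "((\<lambda>t. exp (- \<kappa> * t) *\<^sub>R p) has_vector_derivative - \<kappa> *\<^sub>R (exp (- \<kappa> * t) *\<^sub>R p)) (at t)"
proof -
  have "((\<lambda>t. exp (- \<kappa> * t)) has_real_derivative - \<kappa> * exp (- \<kappa> * t)) (at t)"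
    by (auto intro!: derivative_eq_intros)
  from has_vector_derivative_scaleR[OF this has_vector_derivative_const[of p]] show ?thesis by simp
qed

lemma decay_path_H1:
  fixes p :: "'a::euclidean_space L2" and \<kappa> :: real
  assumes p: "p \<in> L2_on \<Omega>"
  defines "w \<equiv> \<lambda>t. exp (- \<kappa> * t) *\<^sub>R p"
  shows "w \<in> H1_time {0..T} (L2_on \<Omega>)" "(\<lambda>t. - \<kappa> *\<^sub>R w t) \<in> L2_time {0..T} (L2_on \<Omega>)"
    "w \<in> L2_time {0..T} (L2_on \<Omega>)" "weak_deriv {0..T} w (\<lambda>t. - \<kappa> *\<^sub>R w t)"
proof -
  have c: "continuous_on S w" "continuous_on S (\<lambda>t. - \<kappa> *\<^sub>R w t)" for S
    unfolding w_def by (intro continuous_intros)+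
  have si: "set_integrable lborel {0..T} f" if "continuous_on {0..T} f" for f :: "real \<Rightarrow> real"
    unfolding set_integrable_def by (rule borel_integrable_compact[OF _ that]) simp
  have m: "w t \<in> L2_on \<Omega>" "- \<kappa> *\<^sub>R w t \<in> L2_on \<Omega>" for t unfolding w_def by (intro L2_on_scale p)+
  have i: "set_integrable lborel {0..T} (\<lambda>t. (norm (w t))\<^sup>2)" "set_integrable lborel {0..T} (\<lambda>t. (norm (- \<kappa> *\<^sub>R w t))\<^sup>2)"
    by (intro si continuous_on_power continuous_on_norm c)+
  have d: "(w has_vector_derivative - \<kappa> *\<^sub>R w t) (at t)" for t unfolding w_def by (rule decay_path_deriv)
  note H = regular_path_H1[OF _ _ c(1) m(1) i(1) c(2) m(2) i(2) d]
  show "w \<in> H1_time {0..T} (L2_on \<Omega>)" by (rule H(1)) auto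
  show "(\<lambda>t. - \<kappa> *\<^sub>R w t) \<in> L2_time {0..T} (L2_on \<Omega>)" by (rule H(2)) auto
  show "w \<in> L2_time {0..T} (L2_on \<Omega>)" by (rule H(3)) auto
  show "weak_deriv {0..T} w (\<lambda>t. - \<kappa> *\<^sub>R w t)" by (rule H(4)) auto
qed

lemma decay_path_solves:
  fixes p :: "'a::euclidean_space L2"
  assumes p: "p \<in> L2_on \<Omega>"
  shows "solves_limit_cauchy \<Omega> T p (\<lambda>t. exp (- dim_omega TYPE('a) * t) *\<^sub>R p)"
  unfolding solves_limit_cauchy_def
proof (intro conjI)
  note H = decay_path_H1[OF p, where \<kappa> = "dim_omega TYPE('a)" and T = T]
  show "(\<lambda>t. exp (- dim_omega TYPE('a) * t) *\<^sub>R p) \<in> H1_time {0..T} (L2_on \<Omega>)" by (rule H(1))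
  show "AE t in lborel. t \<in> {0<..<T} \<longrightarrow>
      time_deriv {0..T} (L2_on \<Omega>) (\<lambda>t. exp (- dim_omega TYPE('a) * t) *\<^sub>R p) t
      = - dim_omega TYPE('a) *\<^sub>R (exp (- dim_omega TYPE('a) * t) *\<^sub>R p)"
    using time_deriv_AE[OF H(1,2,4) AE_Icc_interior] by eventually_elim auto
qed simp

text \<open>The difference between a weak solution and the explicit exponential starts at 0 and has
  velocity \<open>- \<kappa>\<close> times itself, so the contraction estimate applies.\<close>

lemma limit_cauchy_unique:
  fixes p :: "'a::euclidean_space L2"
  assumes w: "solves_limit_cauchy \<Omega> T p w" and p: "p \<in> L2_on \<Omega>" and t: "t \<in> {0..T}"
  shows "w t = exp (- dim_omega TYPE('a) * t) *\<^sub>R p"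
proof -
  define \<kappa> where "\<kappa> = dim_omega TYPE('a)"
  have \<kappa>: "0 < \<kappa>" by (simp add: \<kappa>_def dim_omega_pos)
  define q where "q = (\<lambda>t. exp (- \<kappa> * t) *\<^sub>R p)"
  have q: "q \<in> H1_time {0..T} (L2_on \<Omega>)" "(\<lambda>t. - \<kappa> *\<^sub>R q t) \<in> L2_time {0..T} (L2_on \<Omega>)"
    "q \<in> L2_time {0..T} (L2_on \<Omega>)" "weak_deriv {0..T} q (\<lambda>t. - \<kappa> *\<^sub>R q t)"
    unfolding q_def by (rule decay_path_H1[OF p])+
  define w' where "w' = time_deriv {0..T} (L2_on \<Omega>) w"
  have wH: "w \<in> H1_time {0..T} (L2_on \<Omega>)" and w0: "w 0 = p"
    and wae: "AE t in lborel. t \<in> {0<..<T} \<longrightarrow> w' t = - \<kappa> *\<^sub>R w t"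
    using w by (auto simp: solves_limit_cauchy_def w'_def \<kappa>_def)
  note w' = time_derivD[OF wH, folded w'_def]
  have wL: "w \<in> L2_time {0..T} (L2_on \<Omega>)" "continuous_on {0..T} w" using wH by (auto simp: H1_time_def)
  have "norm (w t - q t) \<le> norm (w 0 - q 0)"
  proof (rule weak_dissipative[where I = "{0..T}" and T = T])
    show "weak_deriv {0..T} (\<lambda>t. w t - q t) (\<lambda>t. w' t - (- \<kappa> *\<^sub>R q t))"
      by (rule weak_deriv_diff[OF w'(2) q(4) wL(1) w'(1) q(3) q(2)])
    show "(\<lambda>t. w t - q t) \<in> L2_time {0..T} (L2_on \<Omega>)" by (rule L2_time_diff[OF wL(1) q(3) L2_on_diff])
    show "(\<lambda>t. w' t - (- \<kappa> *\<^sub>R q t)) \<in> L2_time {0..T} (L2_on \<Omega>)" by (rule L2_time_diff[OF w'(1) q(2) L2_on_diff])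
    show "continuous_on {0..T} (\<lambda>t. w t - q t)" unfolding q_def by (intro continuous_intros wL(2))
    show "AE t in lborel. t \<in> {0..T} \<longrightarrow> (w' t - (- \<kappa> *\<^sub>R q t)) \<bullet> (w t - q t) \<le> 0"
      using wae AE_lborel_singleton[of 0] AE_lborel_singleton[of T]
    proof eventually_elim
      case (elim t)
      show ?case
      proof
        assume "t \<in> {0..T}"
        with elim have "w' t = - \<kappa> *\<^sub>R w t" by auto
        then have "w' t - (- \<kappa> *\<^sub>R q t) = - \<kappa> *\<^sub>R (w t - q t)" by (simp add: algebra_simps)
        then show "(w' t - (- \<kappa> *\<^sub>R q t)) \<bullet> (w t - q t) \<le> 0" using \<kappa> by (simp only: inner_scaleR_left) simp
      qed
    qed
  qed (use t in auto)
  then show ?thesis by (simp add: w0 q_def \<kappa>_def)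
qed

section \<open>Convergence of the sequence of flows\<close>

locale flow_sequence =
  fixes \<Omega> :: "'a::euclidean_space set" and s c :: "nat \<Rightarrow> real" and u0 :: "nat \<Rightarrow> 'a L2" and u00 :: "'a L2"
    and u v :: "nat \<Rightarrow> real \<Rightarrow> 'a L2" and E :: real
  assumes flow: "\<And>n. frac_flow \<Omega> (s n) (c n) (u0 n) (u n) (v n)"
    and s_lim: "s \<longlonglongrightarrow> 0" and u0_lim: "u0 \<longlonglongrightarrow> u00" and u00_in: "u00 \<in> L2_on \<Omega>"
    and initial_energy: "\<And>n. (norm (frac_op (s n) (u0 n)))\<^sup>2 \<le> E"
begin

definition \<kappa> :: real where "\<kappa> = dim_omega TYPE('a)"

text \<open>The formula does not involve \<open>T\<close>, so one limit path serves every
  interval.\<close>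

definition w :: "real \<Rightarrow> 'a L2" where "w t = exp (- \<kappa> * t) *\<^sub>R u00"

definition dw :: "real \<Rightarrow> 'a L2" where "dw t = - \<kappa> *\<^sub>R w t"

lemma \<kappa>_pos: "0 < \<kappa>"
  by (simp add: \<kappa>_def dim_omega_pos)

lemma E_nonneg: "0 \<le> E"
  using order_trans[OF zero_le_power2 initial_energy[of 0]] .

lemma regular: "regular_flow (H0s (s n) \<Omega>) (frac_op (s n)) (L2_on \<Omega>) (c n) (u0 n) (u n) (v n)"
  by (rule frac_flow.regular[OF flow])

lemma w_deriv: "(w has_vector_derivative dw t) (at t)"
  unfolding dw_def w_def by (rule decay_path_deriv)

lemma w_H1:
  "w \<in> H1_time {0..T} (L2_on \<Omega>)" "dw \<in> L2_time {0..T} (L2_on \<Omega>)"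
  "w \<in> L2_time {0..T} (L2_on \<Omega>)" "weak_deriv {0..T} w dw"
  unfolding dw_def[abs_def] w_def[abs_def] by (rule decay_path_H1[OF u00_in])+

lemma flow_H1:
  "u n \<in> H1_time {0..T} (L2_on \<Omega>)" "v n \<in> L2_time {0..T} (L2_on \<Omega>)"
  "u n \<in> L2_time {0..T} (L2_on \<Omega>)" "weak_deriv {0..T} (u n) (v n)"
proof -
  have I: "{0..T} \<subseteq> {0..}" "{0..T} \<in> sets borel" by auto
  show "u n \<in> H1_time {0..T} (L2_on \<Omega>)" by (rule regular_flow.H1(1)[OF regular I])
  show "v n \<in> L2_time {0..T} (L2_on \<Omega>)" by (rule regular_flow.H1(2)[OF regular I])
  show "u n \<in> L2_time {0..T} (L2_on \<Omega>)" by (rule regular_flow.H1(3)[OF regular I])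
  show "weak_deriv {0..T} (u n) (v n)" by (rule regular_flow.H1(4)[OF regular I])
qed

text \<open>The data \<open>u0 n\<close> approach \<open>u00\<close>, and each of them lies in a
  completion of the test functions that embeds into \<open>L2\<close>. Approximability of
  \<open>u00\<close> is thus read off from the data.\<close>

lemma test_near_u00:
  assumes e: "0 < e"
  obtains \<phi> where "\<phi> \<in> Cc_infty \<Omega>" "norm (abs_L2 \<phi> - u00) < e"
proof -
  obtain n where n: "dist (u0 n) u00 < e / 2"
    using metric_LIMSEQ_D[OF u0_lim, of "e / 2"] e by auto
  have x: "u0 n \<in> H0s (s n) \<Omega>"
    using regular_flow.in_V[OF regular, of 0 n] regular_flow.initial[OF regular, of n] by simp
  obtain \<phi> where \<phi>: "\<And>k::nat. \<phi> k \<in> Cc_infty \<Omega>" "(\<lambda>k. abs_L2 (\<phi> k)) \<longlonglongrightarrow> u0 n"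
    using H0s_density[OF frac_flow.bounded_domain[OF flow] frac_flow.s[OF flow] x] by blast
  obtain k where k: "dist (abs_L2 (\<phi> k)) (u0 n) < e / 2"
    using metric_LIMSEQ_D[OF \<phi>(2), of "e / 2"] e by auto
  have "norm (abs_L2 (\<phi> k) - u00) < e"
    using n k dist_triangle[of "abs_L2 (\<phi> k)" u00 "u0 n"] by (simp add: dist_norm)
  with \<phi>(1) show thesis by (rule that)
qed

lemma flow_tendsto:
  assumes t: "0 \<le> t"
  shows "(\<lambda>n. u n t) \<longlonglongrightarrow> w t"
proof (rule metric_LIMSEQ_I)
  fix e :: real assume e: "0 < e"
  define K where "K = sqrt (exp t)"
  have K: "0 < K" by (simp add: K_def)
  \<comment> \<open>As \<open>n\<close> grows the comparison bound tends to
    \<open>(K + 1) * norm (p - u00)\<close>: \<open>K\<close> comes from the growth factor in the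
    estimate, 1 from replacing \<open>p\<close> by \<open>u00\<close> in the exponential
    path.\<close>
  obtain \<phi> where \<phi>: "\<phi> \<in> Cc_infty \<Omega>" "norm (abs_L2 \<phi> - u00) < e / (K + 1)"
    using test_near_u00[of "e / (K + 1)"] e K by auto
  define p where "p = abs_L2 \<phi>"
  obtain g B where g: "\<And>s u. 0 < s \<Longrightarrow> s < 1 \<Longrightarrow> s * frac_laplacian_dual \<Omega> s u \<phi> = u \<bullet> g s"
    "0 \<le> B" "\<And>s. 0 < s \<Longrightarrow> s \<le> 1 / 2 \<Longrightarrow> norm (g s - dim_omega TYPE('a) *\<^sub>R abs_L2 \<phi>) \<le> s * B"
    using scaled_frac_laplacian_L2[OF frac_flow.open_domain[OF flow] frac_flow.bounded_domain[OF flow] \<phi>(1)] by blast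
  define b where "b n = sqrt (exp t * ((norm (u0 n - p))\<^sup>2 + (s n * B)\<^sup>2 * t)) + norm (p - u00)" for n
  have "b \<longlonglongrightarrow> sqrt (exp t * ((norm (u00 - p))\<^sup>2 + (0 * B)\<^sup>2 * t)) + norm (p - u00)"
    unfolding b_def by (intro tendsto_intros u0_lim s_lim)
  moreover have "sqrt (exp t * ((norm (u00 - p))\<^sup>2 + (0 * B)\<^sup>2 * t)) + norm (p - u00) = (K + 1) * norm (p - u00)"
    by (simp add: K_def real_sqrt_mult norm_minus_commute algebra_simps)
  moreover have "(K + 1) * norm (p - u00) < e" using \<phi>(2) K by (simp add: p_def field_simps)
  ultimately have "\<forall>\<^sub>F n in sequentially. b n < e" by (metis order_tendstoD(2))
  moreover have "\<forall>\<^sub>F n in sequentially. s n < 1 / 2" by (rule order_tendstoD(2)[OF s_lim]) simp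
  ultimately have "\<forall>\<^sub>F n in sequentially. dist (u n t) (w t) < e"
  proof eventually_elim
    case (elim n)
    have sn: "0 < s n" "s n < 1" using frac_flow.s[OF flow] by auto
    have "(norm (u n t - exp (- \<kappa> * t) *\<^sub>R p))\<^sup>2 \<le> exp t * ((norm (u0 n - p))\<^sup>2 + (norm (g (s n) - \<kappa> *\<^sub>R p))\<^sup>2 * t)"
      unfolding p_def by (rule frac_flow.compare_with_decay[OF flow \<phi>(1) _ g(1)[OF sn] t]) (use \<kappa>_pos in simp)
    also have "\<dots> \<le> exp t * ((norm (u0 n - p))\<^sup>2 + (s n * B)\<^sup>2 * t)"
      using g(3)[of "s n"] elim(2) sn t
      by (intro mult_left_mono add_left_mono mult_right_mono power_mono) (auto simp: \<kappa>_def p_def)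
    finally have "norm (u n t - exp (- \<kappa> * t) *\<^sub>R p) \<le> sqrt (exp t * ((norm (u0 n - p))\<^sup>2 + (s n * B)\<^sup>2 * t))"
      by (rule real_le_rsqrt)
    moreover have "norm (exp (- \<kappa> * t) *\<^sub>R p - w t) \<le> 1 * norm (p - u00)"
    proof -
      have "exp (- \<kappa> * t) *\<^sub>R p - w t = exp (- \<kappa> * t) *\<^sub>R (p - u00)" by (simp add: w_def scaleR_right_diff_distrib)
      then have "norm (exp (- \<kappa> * t) *\<^sub>R p - w t) = exp (- \<kappa> * t) * norm (p - u00)" by simp
      also have "\<dots> \<le> 1 * norm (p - u00)" using \<kappa>_pos t by (intro mult_right_mono) auto
      finally show ?thesis .
    qed
    moreover have "norm (u n t - w t) \<le> norm (u n t - exp (- \<kappa> * t) *\<^sub>R p) + norm (exp (- \<kappa> * t) *\<^sub>R p - w t)"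
      using norm_triangle_ineq[of "u n t - exp (- \<kappa> * t) *\<^sub>R p" "exp (- \<kappa> * t) *\<^sub>R p - w t"] by simp
    ultimately show ?case using elim(1) by (simp add: b_def dist_norm)
  qed
  then show "\<exists>N. \<forall>n\<ge>N. dist (u n t) (w t) < e" by (simp add: eventually_sequentially)
qed

lemma velocity_tendsto:
  assumes t: "0 < t"
  shows "(\<lambda>n. v n t) \<longlonglongrightarrow> dw t"
proof -
  define M where "M = sqrt (27 * E / t ^ 3)"
  have taylor: "norm (u n (t + h) - u n t - h *\<^sub>R v n t) \<le> h\<^sup>2 * M" if h: "\<bar>h\<bar> \<le> t / 2" for n h
  proof -
    have "norm (u n (t + h) - u n t - h *\<^sub>R v n t) \<le> h\<^sup>2 * sqrt (27 * (norm (frac_op (s n) (u0 n)))\<^sup>2 / t ^ 3)"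
      by (rule regular_flow.taylor[OF regular t h])
    also have "\<dots> \<le> h\<^sup>2 * M"
      unfolding M_def using t initial_energy[of n]
      by (intro mult_left_mono real_sqrt_le_mono divide_right_mono) auto
    finally show ?thesis .
  qed
  have lim: "(\<lambda>n. u n r) \<longlonglongrightarrow> w r" if "0 < r" for r using that by (intro flow_tendsto) simp
  obtain q where q: "(\<lambda>n. v n t) \<longlonglongrightarrow> q"
    using taylor_velocity_convergent[of u w t, OF lim t taylor] by (auto simp: convergent_def)
  \<comment> \<open>The remainder bound passes to the limit, so the limit \<open>q\<close> of the
    velocities must be the derivative of the limit path.\<close>
  have "norm (w (t + h) - w t - h *\<^sub>R q) \<le> h\<^sup>2 * M" if h: "\<bar>h\<bar> \<le> t / 2" for h
  proof (rule LIMSEQ_le_const2)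
    show "(\<lambda>n. norm (u n (t + h) - u n t - h *\<^sub>R v n t)) \<longlonglongrightarrow> norm (w (t + h) - w t - h *\<^sub>R q)"
      using h t by (intro tendsto_intros lim q) auto
  qed (use taylor[OF h] in auto)
  then have "(w has_vector_derivative q) (at t)" by (rule taylor_has_vector_derivative[OF t])
  then have "q = dw t" by (rule vector_derivative_unique_at[OF _ w_deriv])
  with q show ?thesis by simp
qed

lemma energy_tendsto:
  assumes t: "0 < t"
  shows "(\<lambda>n. (norm (frac_op (s n) (u n t)))\<^sup>2) \<longlonglongrightarrow> \<kappa> * (norm (w t))\<^sup>2"
proof -
  have "(norm (frac_op (s n) (u n t)))\<^sup>2 = - (v n t \<bullet> u n t)" for n
    using regular_flow.equation[OF regular t regular_flow.in_V[OF regular], of t n] t by (simp add: power2_norm_eq_inner)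
  moreover have "(\<lambda>n. - (v n t \<bullet> u n t)) \<longlonglongrightarrow> - (dw t \<bullet> w t)"
    using t by (intro tendsto_intros velocity_tendsto flow_tendsto) auto
  ultimately show ?thesis by (simp add: dw_def power2_norm_eq_inner)
qed

lemma scaled_energy_tendsto:
  assumes t: "0 < t"
  shows "(\<lambda>n. ennreal (s n) * frac_energy (s n) (u n t)) \<longlonglongrightarrow> ennreal (zero_energy (w t))"
proof -
  have "(\<lambda>n. ennreal ((norm (frac_op (s n) (u n t)))\<^sup>2 / 2)) \<longlonglongrightarrow> ennreal (\<kappa> * (norm (w t))\<^sup>2 / 2)"
    by (intro tendsto_ennrealI tendsto_divide energy_tendsto t tendsto_const) simp
  then show ?thesis
    using frac_flow.scaled_energy[OF flow, of t] t by (simp add: zero_energy_def \<kappa>_def)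
qed

lemma uniform_bound:
  obtains C where "0 \<le> C" "\<And>n t. 0 \<le> t \<Longrightarrow> norm (u n t) \<le> C" "\<And>t. 0 \<le> t \<Longrightarrow> norm (w t) \<le> C"
proof -
  obtain C where C: "\<And>n. norm (u0 n) \<le> C"
    using Bseq_def convergentI[OF u0_lim] convergent_imp_Bseq by metis
  have C0: "0 \<le> C" using order_trans[OF norm_ge_zero C] .
  show thesis
  proof (rule that[OF C0])
    show un: "norm (u n t) \<le> C" if "0 \<le> t" for n t
      using regular_flow.norm_le_initial[OF regular that, of n] C[of n] by simp
    show "norm (w t) \<le> C" if "0 \<le> t" for t
      by (rule LIMSEQ_le_const2[OF tendsto_norm[OF flow_tendsto[OF that]]]) (use un[OF that] in auto)
  qed
qed

text \<open>The constant bound is also recorded in the forms \<open>C * T / t\<close> and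
  \<open>C * T\<close>, the shape in which \<open>L2_time_inner_tendsto\<close> takes its
  hypotheses.\<close>

lemma path_diff_bound:
  assumes T: "0 < T"
  obtains C where "0 \<le> C" "\<And>n t. 0 \<le> t \<Longrightarrow> (norm (u n t - w t))\<^sup>2 \<le> C"
    "\<And>n t. 0 < t \<Longrightarrow> t \<le> T \<Longrightarrow> (norm (u n t - w t))\<^sup>2 \<le> C * T / t"
    "\<And>n. (LINT t:{0..T}|lborel. (norm (u n t - w t))\<^sup>2) \<le> C * T"
proof -
  obtain C where C: "0 \<le> C" "\<And>n t. 0 \<le> t \<Longrightarrow> norm (u n t) \<le> C" "\<And>t. 0 \<le> t \<Longrightarrow> norm (w t) \<le> C"
    by (rule uniform_bound) blast
  have b: "(norm (u n t - w t))\<^sup>2 \<le> 4 * C\<^sup>2" if "0 \<le> t" for n t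
    using norm_diff_sq_le[of "u n t" "w t"] power_mono[OF C(2)[OF that, of n] norm_ge_zero, of 2]
      power_mono[OF C(3)[OF that] norm_ge_zero, of 2] by simp
  show thesis
  proof (rule that[of "4 * C\<^sup>2"])
    show "(norm (u n t - w t))\<^sup>2 \<le> 4 * C\<^sup>2 * T / t" if "0 < t" "t \<le> T" for n t
    proof -
      have "4 * C\<^sup>2 * 1 \<le> 4 * C\<^sup>2 * (T / t)" using that by (intro mult_left_mono) auto
      then show ?thesis using b[of t n] that by simp
    qed
    show "(LINT t:{0..T}|lborel. (norm (u n t - w t))\<^sup>2) \<le> 4 * C\<^sup>2 * T" for n
    proof -
      have "(LINT t:{0..T}|lborel. (norm (u n t - w t))\<^sup>2) \<le> (LINT t:{0..T}|lborel. 4 * C\<^sup>2)"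
        unfolding set_lebesgue_integral_def
      proof (rule integral_mono)
        show "integrable lborel (\<lambda>t. indicator {0..T} t *\<^sub>R (norm (u n t - w t))\<^sup>2)"
          using L2_timeD(2)[OF L2_time_diff[OF flow_H1(3) w_H1(3) L2_on_diff]] by (simp add: set_integrable_def)
        show "integrable lborel (\<lambda>t. indicator {0..T} t *\<^sub>R (4 * C\<^sup>2))"
          by (rule integrable_scaleR_left) (use T in simp)
      qed (use b in \<open>auto simp: indicator_def\<close>)
      also have "\<dots> = 4 * C\<^sup>2 * T" using T by (simp add: set_lebesgue_integral_def)
      finally show ?thesis .
    qed
  qed (use b in auto)
qed

text \<open>The pointwise bound inherits the singularity \<open>1 / t\<close> of the speed estimate,
  whereas the integrated bound comes from the energy inequality. Both are uniform in
  \<open>n\<close>.\<close>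

lemma velocity_diff_bound:
  assumes T: "0 < T"
  obtains C where "0 \<le> C" "\<And>n t. 0 < t \<Longrightarrow> t \<le> T \<Longrightarrow> (norm (v n t - dw t))\<^sup>2 \<le> C / t"
    "\<And>n. (LINT t:{0..T}|lborel. (norm (v n t - dw t))\<^sup>2) \<le> C"
proof -
  obtain C where C: "0 \<le> C" "\<And>n t. 0 \<le> t \<Longrightarrow> norm (u n t) \<le> C" "\<And>t. 0 \<le> t \<Longrightarrow> norm (w t) \<le> C"
    by (rule uniform_bound) blast
  \<comment> \<open>\<open>E\<close> accounts for the fractional velocities and the second summand
    for \<open>dw\<close>; the factor \<open>T\<close> lets the constant bound on \<open>dw\<close>
    be written as a multiple of \<open>1 / t\<close>.\<close>
  define D where "D = E + 2 * (\<kappa>\<^sup>2 * C\<^sup>2) * T"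
  have wb: "(norm (dw t))\<^sup>2 \<le> \<kappa>\<^sup>2 * C\<^sup>2" if "0 \<le> t" for t
    using C(3)[OF that] by (simp add: dw_def power_mult_distrib mult_left_mono power_mono)
  show thesis
  proof (rule that[of D])
    show "0 \<le> D" using E_nonneg T by (simp add: D_def)
    show "(norm (v n t - dw t))\<^sup>2 \<le> D / t" if t: "0 < t" "t \<le> T" for n t
    proof -
      have "(norm (v n t))\<^sup>2 \<le> (norm (frac_op (s n) (u0 n)))\<^sup>2 / (2 * t)" by (rule regular_flow.speed[OF regular t(1)])
      also have "\<dots> \<le> E / (2 * t)" using t by (intro divide_right_mono initial_energy) auto
      finally have "2 * (norm (v n t))\<^sup>2 \<le> E / t" by simp
      moreover have "2 * (\<kappa>\<^sup>2 * C\<^sup>2) * 1 \<le> 2 * (\<kappa>\<^sup>2 * C\<^sup>2) * (T / t)" using t by (intro mult_left_mono) auto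
      ultimately show ?thesis
        using norm_diff_sq_le[of "v n t" "dw t"] wb[of t] t by (simp add: D_def add_divide_distrib)
    qed
    show "(LINT t:{0..T}|lborel. (norm (v n t - dw t))\<^sup>2) \<le> D" for n
    proof -
      have i: "set_integrable lborel {0..T} (\<lambda>t. (norm (v n t))\<^sup>2)" by (rule L2_timeD(2)[OF flow_H1(2)])
      have ic: "set_integrable lborel {0..T} (\<lambda>t. 2 * (\<kappa>\<^sup>2 * C\<^sup>2))"
        unfolding set_integrable_def by (rule integrable_scaleR_left) (use T in simp)
      have "(LINT t:{0..T}|lborel. (norm (v n t - dw t))\<^sup>2)
        \<le> (LINT t:{0..T}|lborel. 2 * (norm (v n t))\<^sup>2 + 2 * (\<kappa>\<^sup>2 * C\<^sup>2))"
      proof (rule set_integral_mono)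
        show "set_integrable lborel {0..T} (\<lambda>t. (norm (v n t - dw t))\<^sup>2)"
          by (rule L2_timeD(2)[OF L2_time_diff[OF flow_H1(2) w_H1(2) L2_on_diff]])
        show "set_integrable lborel {0..T} (\<lambda>t. 2 * (norm (v n t))\<^sup>2 + 2 * (\<kappa>\<^sup>2 * C\<^sup>2))"
          by (intro set_integral_add set_integrable_mult_right i ic)
        fix t assume "t \<in> {0..T}"
        then show "(norm (v n t - dw t))\<^sup>2 \<le> 2 * (norm (v n t))\<^sup>2 + 2 * (\<kappa>\<^sup>2 * C\<^sup>2)"
          using norm_diff_sq_le[of "v n t" "dw t"] wb[of t] by simp
      qed
      also have "\<dots> = 2 * (LINT t:{0..T}|lborel. (norm (v n t))\<^sup>2) + 2 * (\<kappa>\<^sup>2 * C\<^sup>2) * T"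
        by (subst set_integral_add(2)[OF set_integrable_mult_right[OF i] ic]) (use T in \<open>simp add: set_lebesgue_integral_def\<close>)
      finally have "(LINT t:{0..T}|lborel. (norm (v n t - dw t))\<^sup>2)
        \<le> 2 * (LINT t:{0..T}|lborel. (norm (v n t))\<^sup>2) + 2 * (\<kappa>\<^sup>2 * C\<^sup>2) * T" .
      moreover have "(LINT t:{0..T}|lborel. (norm (v n t))\<^sup>2)
        \<le> ((norm (frac_op (s n) (u0 n)))\<^sup>2 - (norm (frac_op (s n) (u n T)))\<^sup>2) / 2"
        unfolding set_integral_Icc_eq_Ioc[OF i] by (rule regular_flow.velocity_integral_Ioc[OF regular T])
      moreover have "(norm (frac_op (s n) (u0 n)))\<^sup>2 - (norm (frac_op (s n) (u n T)))\<^sup>2 \<le> E"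
        using order_trans[OF diff_left_mono[OF zero_le_power2] eq_refl] initial_energy[of n] by (smt (verit) zero_le_power2)
      ultimately show ?thesis unfolding D_def by argo
    qed
  qed
qed

text \<open>No subsequence is extracted: the scalar products of the differences with a fixed test
  path tend to 0 directly, separately for the paths and for their velocities.\<close>

lemma H1_weak_convergence:
  assumes T: "0 < T"
  shows "H1_weak_lim {0..T} (L2_on \<Omega>) u w"
  unfolding H1_weak_lim_def
proof (intro conjI allI ballI)
  show "u n \<in> H1_time {0..T} (L2_on \<Omega>)" for n by (rule flow_H1(1))
  show "w \<in> H1_time {0..T} (L2_on \<Omega>)" by (rule w_H1(1))
  fix g assume g: "g \<in> H1_time {0..T} (L2_on \<Omega>)"
  define g' where "g' = time_deriv {0..T} (L2_on \<Omega>) g"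
  note g' = time_derivD[OF g, folded g'_def]
  have gL: "g \<in> L2_time {0..T} (L2_on \<Omega>)" using g by (simp add: H1_time_def)
  have inner_diff: "(LINT t:{0..T}|lborel. (f t - h t) \<bullet> k t) = (LINT t:{0..T}|lborel. f t \<bullet> k t) - (LINT t:{0..T}|lborel. h t \<bullet> k t)"
    if "f \<in> L2_time {0..T} (L2_on \<Omega>)" "h \<in> L2_time {0..T} (L2_on \<Omega>)" "k \<in> L2_time {0..T} (L2_on \<Omega>)"
    for f h k :: "real \<Rightarrow> 'a L2"
    unfolding inner_diff_left by (intro set_integral_diff(2) L2_time_inner_integrable[OF that(1,3)] L2_time_inner_integrable[OF that(2,3)])
  obtain C where C: "\<And>n t. 0 < t \<Longrightarrow> t \<le> T \<Longrightarrow> (norm (u n t - w t))\<^sup>2 \<le> C * T / t"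
    "\<And>n. (LINT t:{0..T}|lborel. (norm (u n t - w t))\<^sup>2) \<le> C * T"
    by (rule path_diff_bound[OF T]) blast
  obtain D where D: "\<And>n t. 0 < t \<Longrightarrow> t \<le> T \<Longrightarrow> (norm (v n t - dw t))\<^sup>2 \<le> D / t"
    "\<And>n. (LINT t:{0..T}|lborel. (norm (v n t - dw t))\<^sup>2) \<le> D"
    by (rule velocity_diff_bound[OF T]) blast
  have "(\<lambda>n. LINT t:{0..T}|lborel. (u n t - w t) \<bullet> g t) \<longlonglongrightarrow> 0"
  proof (rule L2_time_inner_tendsto[OF T L2_time_diff[OF flow_H1(3) w_H1(3) L2_on_diff] gL _ C])
    fix t :: real assume t: "0 < t"
    show "(\<lambda>n. u n t - w t) \<longlonglongrightarrow> 0"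
      by (rule LIM_zero[OF flow_tendsto]) (use t in simp)
  qed
  moreover have "(\<lambda>n. LINT t:{0..T}|lborel. (v n t - dw t) \<bullet> g' t) \<longlonglongrightarrow> 0"
  proof (rule L2_time_inner_tendsto[OF T L2_time_diff[OF flow_H1(2) w_H1(2) L2_on_diff] g'(1) _ D])
    show "(\<lambda>n. v n t - dw t) \<longlonglongrightarrow> 0" if "0 < t" for t
      by (rule LIM_zero[OF velocity_tendsto[OF that]])
  qed
  ultimately have "(\<lambda>n. (LINT t:{0..T}|lborel. (u n t - w t) \<bullet> g t) + (LINT t:{0..T}|lborel. (v n t - dw t) \<bullet> g' t)) \<longlonglongrightarrow> 0 + 0"
    by (rule tendsto_add)
  moreover have "(LINT t:{0..T}|lborel. (u n t - w t) \<bullet> g t) + (LINT t:{0..T}|lborel. (v n t - dw t) \<bullet> g' t)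
      = H1_inner {0..T} (L2_on \<Omega>) (u n) g - H1_inner {0..T} (L2_on \<Omega>) w g" for n
    unfolding inner_diff[OF flow_H1(3) w_H1(3) gL] inner_diff[OF flow_H1(2) w_H1(2) g'(1)]
      H1_inner_eq[OF flow_H1(1,2,4) g g'] H1_inner_eq[OF w_H1(1,2,4) g g'] by simp
  ultimately show "(\<lambda>n. H1_inner {0..T} (L2_on \<Omega>) (u n) g) \<longlonglongrightarrow> H1_inner {0..T} (L2_on \<Omega>) w g"
    by (simp add: LIM_zero_iff)
qed

text \<open>Well-preparedness of the initial data prevents the velocities from concentrating at \<open>t = 0\<close>:
  \<open>\<integral>\<^sub>0\<^sup>d \<parallel>v\<^sub>n\<parallel>\<^sup>2\<close> is at most the energy lost on \<open>[0, d]\<close>, and this converges.\<close>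

lemma velocity_L2_convergence:
  assumes T: "0 < T" and prepared: "(\<lambda>n. (norm (frac_op (s n) (u0 n)))\<^sup>2) \<longlonglongrightarrow> \<kappa> * (norm u00)\<^sup>2"
  shows "(\<lambda>n. LINT t:{0..T}|lborel. (norm (v n t - dw t))\<^sup>2) \<longlonglongrightarrow> 0"
proof (rule integral_tendsto_0_split[OF T])
  have wi: "set_integrable lborel {0..T} (\<lambda>t. (norm (dw t))\<^sup>2)" by (rule L2_timeD(2)[OF w_H1(2)])
  have vi: "set_integrable lborel {0..T} (\<lambda>t. (norm (v n t))\<^sup>2)" for n by (rule L2_timeD(2)[OF flow_H1(2)])
  show di: "set_integrable lborel {0..T} (\<lambda>t. (norm (v n t - dw t))\<^sup>2)" for n
    by (rule L2_timeD(2)[OF L2_time_diff[OF flow_H1(2) w_H1(2) L2_on_diff]])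
  show "(\<lambda>n. (norm (v n t - dw t))\<^sup>2) \<longlonglongrightarrow> 0" if "0 < t" for t
  proof -
    have "(\<lambda>n. (norm (v n t - dw t))\<^sup>2) \<longlonglongrightarrow> (norm (dw t - dw t))\<^sup>2"
      by (intro tendsto_power tendsto_norm tendsto_diff velocity_tendsto that tendsto_const)
    then show ?thesis by simp
  qed
  show "\<exists>f. set_integrable lborel {d<..T} f \<and> (\<forall>n. \<forall>t\<in>{d<..T}. (norm (v n t - dw t))\<^sup>2 \<le> f t)"
    if d: "0 < d" "d < T" for d
  proof -
    obtain D where D: "0 \<le> D" "\<And>n t. 0 < t \<Longrightarrow> t \<le> T \<Longrightarrow> (norm (v n t - dw t))\<^sup>2 \<le> D / t"
      by (rule velocity_diff_bound[OF T]) blast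
    have "(norm (v n t - dw t))\<^sup>2 \<le> D / d" if "t \<in> {d<..T}" for n t
    proof -
      have "(norm (v n t - dw t))\<^sup>2 \<le> D / t" using that d by (intro D) auto
      also have "\<dots> \<le> D / d" using that d D(1) by (intro divide_left_mono) auto
      finally show ?thesis .
    qed
    moreover have "set_integrable lborel {d<..T} (\<lambda>t. D / d)"
      unfolding set_integrable_def by (rule integrable_scaleR_left) (use d in simp)
    ultimately show ?thesis by blast
  qed
  fix e :: real assume e: "0 < e"
  obtain d1 where d1: "0 < d1" "d1 < T" "\<And>r. 0 < r \<Longrightarrow> r \<le> d1 \<Longrightarrow> (LINT t:{0<..r}|lborel. \<bar>(norm (dw t))\<^sup>2\<bar>) < e / 8"
    using set_integral_Ioc_tendsto_0[OF T wi, of "e / 8"] e by auto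
  have "isCont w 0" by (rule has_vector_derivative_continuous[OF w_deriv])
  then have "isCont (\<lambda>t. \<kappa> * (norm (w t))\<^sup>2) 0" by (intro continuous_intros)
  then obtain d2 where d2: "0 < d2" "\<And>t. dist t 0 < d2 \<Longrightarrow> dist (\<kappa> * (norm (w t))\<^sup>2) (\<kappa> * (norm (w 0))\<^sup>2) < e / 4"
    unfolding continuous_at_eps_delta dist_norm using e by (metis zero_less_divide_iff zero_less_numeral)
  \<comment> \<open>On \<open>(0, d]\<close> the squared limit velocity has integral below
    \<open>e / 8\<close>, and \<open>\<kappa> * (norm (w t))^2\<close> has dropped by less than
    \<open>e / 4\<close> at \<open>d\<close>. Half of that drop bounds the integral for
    \<open>v n\<close> once \<open>n\<close> is large, so the doubled sum stays below
    \<open>e / 2\<close>.\<close>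
  define d where "d = min d1 (d2 / 2)"
  have d: "0 < d" "d \<le> d1" "d < d2" "d < T" using d1 d2 by (auto simp: d_def)
  have "\<kappa> * (norm u00)\<^sup>2 - \<kappa> * (norm (w d))\<^sup>2 < e / 4"
    using d2(2)[of d] d by (simp add: dist_real_def w_def abs_if split: if_splits)
  then have "\<forall>\<^sub>F n in sequentially. (norm (frac_op (s n) (u0 n)))\<^sup>2 - (norm (frac_op (s n) (u n d)))\<^sup>2 < e / 4"
    by (rule order_tendstoD(2)[OF tendsto_diff[OF prepared energy_tendsto[OF d(1)]]])
  then have "\<forall>\<^sub>F n in sequentially. (LINT t:{0<..d}|lborel. (norm (v n t - dw t))\<^sup>2) \<le> e"
  proof eventually_elim
    case (elim n)
    have sub: "{0<..d} \<subseteq> {0..T}" "{0<..d} \<in> sets lborel" using d by auto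
    note i = set_integrable_subset[OF wi sub(2,1)] set_integrable_subset[OF vi sub(2,1)] set_integrable_subset[OF di sub(2,1)]
    have "(LINT t:{0<..d}|lborel. (norm (v n t - dw t))\<^sup>2)
      \<le> (LINT t:{0<..d}|lborel. 2 * (norm (v n t))\<^sup>2 + 2 * (norm (dw t))\<^sup>2)"
      by (rule set_integral_mono[OF i(3) set_integral_add(1)[OF set_integrable_mult_right[OF i(2)] set_integrable_mult_right[OF i(1)]]])
        (rule norm_diff_sq_le)
    also have "\<dots> = 2 * (LINT t:{0<..d}|lborel. (norm (v n t))\<^sup>2) + 2 * (LINT t:{0<..d}|lborel. (norm (dw t))\<^sup>2)"
      by (subst set_integral_add(2)[OF set_integrable_mult_right[OF i(2)] set_integrable_mult_right[OF i(1)]])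
        (simp only: set_integral_mult_right)
    also have "\<dots> \<le> e"
      using regular_flow.velocity_integral_Ioc[OF regular d(1), of n] elim d1(3)[OF d(1,2)] e by simp
    finally show ?case .
  qed
  then show "\<exists>d. 0 < d \<and> d < T \<and> (\<forall>\<^sub>F n in sequentially. (LINT t:{0<..d}|lborel. (norm (v n t - dw t))\<^sup>2) \<le> e)"
    using d by blast
qed simp

lemma path_L2_convergence:
  assumes T: "0 < T"
  shows "(\<lambda>n. LINT t:{0..T}|lborel. (norm (u n t - w t))\<^sup>2) \<longlonglongrightarrow> 0"
proof -
  obtain C where C: "\<And>n t. 0 \<le> t \<Longrightarrow> (norm (u n t - w t))\<^sup>2 \<le> C" by (rule path_diff_bound[OF T]) blast
  have "(\<lambda>n. LINT t|lborel. indicator {0..T} t *\<^sub>R (norm (u n t - w t))\<^sup>2) \<longlonglongrightarrow> (LINT t|(lborel :: real measure). 0)"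
  proof (rule integral_dominated_convergence)
    show "integrable lborel (\<lambda>t. indicator {0..T} t *\<^sub>R C)" by (rule integrable_scaleR_left) (use T in simp)
    show "(\<lambda>t. indicator {0..T} t *\<^sub>R (norm (u n t - w t))\<^sup>2) \<in> borel_measurable lborel" for n
      using L2_timeD(2)[OF L2_time_diff[OF flow_H1(3) w_H1(3) L2_on_diff], of T n] by (auto simp: set_integrable_def)
    show "AE t in lborel. (\<lambda>n. indicator {0..T} t *\<^sub>R (norm (u n t - w t))\<^sup>2) \<longlonglongrightarrow> 0"
    proof (rule AE_I2)
      fix t
      show "(\<lambda>n. indicator {0..T} t *\<^sub>R (norm (u n t - w t))\<^sup>2) \<longlonglongrightarrow> 0"
      proof (cases "t \<in> {0..T}")
        case True
        have "(\<lambda>n. (norm (u n t - w t))\<^sup>2) \<longlonglongrightarrow> (norm (w t - w t))\<^sup>2"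
          using True by (intro tendsto_intros flow_tendsto) auto
        then show ?thesis using True by simp
      qed simp
    qed
    show "AE t in lborel. norm (indicator {0..T} t *\<^sub>R (norm (u n t - w t))\<^sup>2) \<le> indicator {0..T} t *\<^sub>R C" for n
      using C by (intro AE_I2) (auto simp: indicator_def)
  qed auto
  then show ?thesis by (simp add: set_lebesgue_integral_def)
qed

lemma H1_strong_convergence:
  assumes T: "0 < T" and prepared: "(\<lambda>n. (norm (frac_op (s n) (u0 n)))\<^sup>2) \<longlonglongrightarrow> \<kappa> * (norm u00)\<^sup>2"
  shows "H1_strong_lim {0..T} (L2_on \<Omega>) u w"
  unfolding H1_strong_lim_def
proof (intro conjI allI)
  show "u n \<in> H1_time {0..T} (L2_on \<Omega>)" for n by (rule flow_H1(1))
  show "w \<in> H1_time {0..T} (L2_on \<Omega>)" by (rule w_H1(1))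
  have L: "(\<lambda>t. u n t - w t) \<in> L2_time {0..T} (L2_on \<Omega>)" "(\<lambda>t. v n t - dw t) \<in> L2_time {0..T} (L2_on \<Omega>)"
    "weak_deriv {0..T} (\<lambda>t. u n t - w t) (\<lambda>t. v n t - dw t)" for n
    by (rule L2_time_diff[OF flow_H1(3) w_H1(3) L2_on_diff] L2_time_diff[OF flow_H1(2) w_H1(2) L2_on_diff]
        weak_deriv_diff[OF flow_H1(4) w_H1(4) flow_H1(3) flow_H1(2) w_H1(3) w_H1(2)]; assumption)+
  have H: "(\<lambda>t. u n t - w t) \<in> H1_time {0..T} (L2_on \<Omega>)" for n
    using flow_H1(1)[of n T] w_H1(1)[of T] L[of n]
    by (auto simp: H1_time_def intro!: continuous_on_diff L2_on_diff)
  have "H1_norm {0..T} (L2_on \<Omega>) (\<lambda>t. u n t - w t) = sqrt ((LINT t:{0..T}|lborel. (norm (u n t - w t))\<^sup>2)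
      + (LINT t:{0..T}|lborel. (norm (v n t - dw t))\<^sup>2))" for n
    unfolding H1_norm_def H1_inner_eq[OF H L(2,3) H L(2,3)] power2_norm_eq_inner ..
  moreover have "(\<lambda>n. sqrt ((LINT t:{0..T}|lborel. (norm (u n t - w t))\<^sup>2)
      + (LINT t:{0..T}|lborel. (norm (v n t - dw t))\<^sup>2))) \<longlonglongrightarrow> sqrt (0 + 0)"
    by (intro tendsto_real_sqrt tendsto_add path_L2_convergence velocity_L2_convergence T prepared)
  ultimately show "(\<lambda>n. H1_norm {0..T} (L2_on \<Omega>) (\<lambda>t. u n t - w t)) \<longlonglongrightarrow> 0" by simp
qed

end

theorem theorem4p4:
  fixes \<Omega> :: "'a::euclidean_space set"
    and s :: "nat \<Rightarrow> real"
    and u0 :: "nat \<Rightarrow> 'a L2"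
    and u00 :: "'a L2"
  assumes "open \<Omega>" and "bounded \<Omega>" and "lipschitz_boundary \<Omega>"
    and "\<And>n. 0 < s n \<and> s n < 1" and "s \<longlonglongrightarrow> 0"
    and "u00 \<in> L2_on \<Omega>"
    and "\<And>n. u0 n \<in> H0s (s n) \<Omega>"
    and "(SUP n. ennreal (s n) * frac_energy (s n) (u0 n)) < \<infinity>"
    and "u0 \<longlonglongrightarrow> u00"
  shows "\<exists>(u :: nat \<Rightarrow> real \<Rightarrow> 'a L2) (u_lim :: real \<Rightarrow> 'a L2).
    (\<forall>n. solves_frac_cauchy \<Omega> (s n) (u0 n) (u n) \<and>
         (\<forall>w. solves_frac_cauchy \<Omega> (s n) (u0 n) w \<longrightarrow> (\<forall>t\<ge>0. w t = u n t)) \<and>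
         (AE t in lborel. t \<ge> 0 \<longrightarrow> frac_laplacian_in_L2 \<Omega> (s n) (u n t))) \<and>
    (\<forall>T>0. solves_limit_cauchy \<Omega> T u00 u_lim \<and>
         (\<forall>w. solves_limit_cauchy \<Omega> T u00 w \<longrightarrow> (\<forall>t\<in>{0..T}. w t = u_lim t)) \<and>
         H1_weak_lim {0..T} (L2_on \<Omega>) u u_lim) \<and>
    ((\<lambda>n. ennreal (s n) * frac_energy (s n) (u0 n)) \<longlonglongrightarrow> ennreal (zero_energy u00) \<longrightarrow>
       (\<forall>T>0. H1_strong_lim {0..T} (L2_on \<Omega>) u u_lim) \<and>
       (\<forall>t\<ge>0. (\<lambda>n. norm (u n t - u_lim t)) \<longlonglongrightarrow> 0 \<and>
         (\<lambda>n. ennreal (s n) * frac_energy (s n) (u n t)) \<longlonglongrightarrow> ennreal (zero_energy (u_lim t))))"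
proof -
  have s: "0 < s n" "s n < 1" for n using assms(4)[of n] by auto
  have energy: "ennreal (s n) * frac_energy (s n) (u0 n) = ennreal ((norm (frac_op (s n) (u0 n)))\<^sup>2 / 2)" for n
    using frac_energy_eq[OF s(1)] assms(7) H0s_subset(2)[OF s] by blast
  have "\<exists>c u v. frac_flow \<Omega> (s n) c (u0 n) u v" for n
    using frac_flow_exists[OF assms(1,2) s assms(7)] by metis
  then obtain c u v where flow: "\<And>n. frac_flow \<Omega> (s n) (c n) (u0 n) (u n) (v n)" by metis
  \<comment> \<open>The scaled energies are half squared norms, hence the bound \<open>2 * S\<close>
    on the squared norms below.\<close>
  define S where "S = enn2real (SUP n. ennreal (s n) * frac_energy (s n) (u0 n))"
  have "(norm (frac_op (s n) (u0 n)))\<^sup>2 \<le> 2 * S" for n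
  proof -
    have "ennreal ((norm (frac_op (s n) (u0 n)))\<^sup>2 / 2) \<le> (SUP n. ennreal (s n) * frac_energy (s n) (u0 n))"
      unfolding energy[symmetric] by (rule SUP_upper) simp
    also have "\<dots> = ennreal S" using assms(8) by (simp add: S_def less_top)
    finally show ?thesis by (simp add: S_def ennreal_le_iff)
  qed
  with flow assms(5,6,9) interpret flow_sequence \<Omega> s c u0 u00 u v "2 * S"
    by (intro flow_sequence.intro)
  interpret F: frac_flow \<Omega> "s n" "c n" "u0 n" "u n" "v n" for n by (rule flow)
  have w0: "w 0 = u00" by (simp add: w_def)
  show ?thesis
  proof (intro exI[of _ u] exI[of _ w] conjI allI impI)
    fix n
    show "solves_frac_cauchy \<Omega> (s n) (u0 n) (u n)" by (rule F.solves)
    show "w' t = u n t" if "solves_frac_cauchy \<Omega> (s n) (u0 n) w'" "0 \<le> t" for w' t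
      by (rule F.unique[OF that])
    show "AE t in lborel. 0 \<le> t \<longrightarrow> frac_laplacian_in_L2 \<Omega> (s n) (u n t)"
      using AE_lborel_singleton[of 0] by eventually_elim (auto intro: F.laplacian_in_L2)
  next
    fix T :: real assume T: "0 < T"
    show "solves_limit_cauchy \<Omega> T u00 w"
      using decay_path_solves[OF u00_in, of T] by (simp add: w_def[abs_def] \<kappa>_def)
    show "\<forall>t\<in>{0..T}. w' t = w t" if "solves_limit_cauchy \<Omega> T u00 w'" for w'
      using limit_cauchy_unique[OF that u00_in] by (simp add: w_def \<kappa>_def)
    show "H1_weak_lim {0..T} (L2_on \<Omega>) u w" by (rule H1_weak_convergence[OF T])
  next
    assume prep: "(\<lambda>n. ennreal (s n) * frac_energy (s n) (u0 n)) \<longlonglongrightarrow> ennreal (zero_energy u00)"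
    then have "(\<lambda>n. (norm (frac_op (s n) (u0 n)))\<^sup>2 / 2) \<longlonglongrightarrow> \<kappa> / 2 * (norm u00)\<^sup>2"
      unfolding energy using \<kappa>_pos by (subst (asm) tendsto_ennreal_iff) (auto simp: zero_energy_def \<kappa>_def)
    from tendsto_mult_left[OF this, of 2]
    have prepared: "(\<lambda>n. (norm (frac_op (s n) (u0 n)))\<^sup>2) \<longlonglongrightarrow> \<kappa> * (norm u00)\<^sup>2" by simp
    show "H1_strong_lim {0..T} (L2_on \<Omega>) u w" if "0 < T" for T
      by (rule H1_strong_convergence[OF that prepared])
    fix t :: real assume t: "0 \<le> t"
    show "(\<lambda>n. norm (u n t - w t)) \<longlonglongrightarrow> 0"
      using flow_tendsto[OF t] by (simp add: tendsto_norm_zero_iff LIM_zero_iff)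
    show "(\<lambda>n. ennreal (s n) * frac_energy (s n) (u n t)) \<longlonglongrightarrow> ennreal (zero_energy (w t))"
    \<comment> \<open>At \<open>t = 0\<close> the claim is the assumed convergence of the initial
      energies; at positive times it comes from the convergence of the velocities.\<close>
    proof (cases "t = 0")
      case True
      then show ?thesis using prep F.initial w0 by simp
    next
      case False
      then show ?thesis using t by (intro scaled_energy_tendsto) simp
    qed
  qed
qed

end
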